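(* Let $n=2$, $\mu=1$, let $0<r_i<r_e<R$, and let $\mathcal{L}_1$ be the self-adjoint operator in $L^2(B_R)$ defined in the context for $\Omega=B_R=\{x\in\mathbb{R}^2:|x|<R\}$ and $\Omega_-=B_{r_i,r_e}=\{x\in\mathbb{R}^2:r_i<|x|<r_e\}$. Then $\mathcal{L}_1$ is injective, and a function $g\in L^2(B_R)$ of the form $$g(r\cos\theta,r\sin\theta)=1_{(a,b)}(r)\,h(\theta),\qquad h\in L^2(0,2\pi),\qquad r_e\le a<b\le R,$$ belongs to $\operatorname{ran}\mathcal{L}_1$ if and only if $$\sum_{m\in\mathbb{Z}\setminus\{0\}}\frac{|h_m|^2}{|m|^5}\Big(\frac{r_e^2}{r_i a}\Big)^{2|m|}<\infty,\qquad\text{where } h_m:=\frac{1}{2\pi}\int_0^{2\pi}h(\theta)e^{-\mathrm{i}m\theta}\,d\theta.$$ In particular, this summability condition is satisfied for any $h$ if $a\ge r_e^2/r_i$, but fails generically for $a<r_e^2/r_i$.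
   Context: Let $\Omega\subset\mathbb{R}^2$ be an open bounded set with smooth boundary $\partial\Omega$, let $\Omega_-$ be an open subset of $\Omega$ with smooth boundary $\Sigma$ such that $\overline{\Omega_-}\subset\Omega$, and put $\Omega_+:=\Omega\setminus\overline{\Omega_-}$. (In the situation of the claim, the interface is $\Sigma=\{|x|=r_i\}\cup\{|x|=r_e\}$, and $\Omega_+=B_{r_i}\cup\{r_e<|x|<R\}$ with $B_{r_i}=\{|x|<r_i\}$.) Let $N_\pm$ be the unit normal on $\Sigma$ exterior with respect to $\Omega_\pm$ (so $N_+=-N_-$). Identify $L^2(\Omega)\simeq L^2(\Omega_-)\oplus L^2(\Omega_+)$, $u\simeq(u_-,u_+)$. Let $\mathcal{D}^2_1(\Omega\setminus\Sigma)$ be the set of all $u=(u_-,u_+)\in H^2(\Omega_-)\oplus H^2(\Omega_+)$ such that, in the sense of Sobolev traces, $u_-=u_+$ and $N_-\cdot\nabla u_-=N_+\cdot\nabla u_+$ on $\Sigma$, and $u_+=0$ on $\partial\Omega$. The operator $L_1(u_-,u_+)=(-\Delta u_-,\Delta u_+)$ with domain $\mathcal{D}^2_1(\Omega\setminus\Sigma)$ (the case $\mu=1$ of $L_\mu(u_-,u_+)=(-\Delta u_-,\mu\Delta u_+)$) is essentially self-adjoint in $L^2(\Omega)$, and $\mathcal{L}_1:=\overline{L_1}$ denotes its closure (its unique self-adjoint extension). $\operatorname{ran}$ denotes the range and $1_{(a,b)}$ the indicator function of $(a,b)$. *)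

theory Defs
  imports "HOL-Analysis.Analysis"
begin

section \<open>Square-integrable functions\<close>

text \<open>
  \<open>L2 S\<close> consists of functions rather than of classes modulo equality almost everywhere; the values
  outside \<open>S\<close> are irrelevant.  Identification almost everywhere is made explicit where it matters.
\<close>

definition L2 :: "'a::euclidean_space set \<Rightarrow> ('a \<Rightarrow> complex) set" where
  "L2 S = {f \<in> borel_measurable (lebesgue_on S). integrable (lebesgue_on S) (\<lambda>x. (cmod (f x))\<^sup>2)}"

text \<open>Meaningful only for \<open>f \<in> L2 S\<close>: the Bochner integral of a non-integrable function is \<open>0\<close>.\<close>

definition L2_norm :: "'a::euclidean_space set \<Rightarrow> ('a \<Rightarrow> complex) \<Rightarrow> real" where
  "L2_norm S f = sqrt (integral\<^sup>L (lebesgue_on S) (\<lambda>x. (cmod (f x))\<^sup>2))"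

definition L2_tendsto ::
    "'a::euclidean_space set \<Rightarrow> (nat \<Rightarrow> 'a \<Rightarrow> complex) \<Rightarrow> ('a \<Rightarrow> complex) \<Rightarrow> bool" where
  "L2_tendsto S F f \<longleftrightarrow> f \<in> L2 S \<and> (\<forall>k. F k \<in> L2 S) \<and> (\<lambda>k. L2_norm S (\<lambda>x. F k x - f x)) \<longlonglongrightarrow> 0"

text \<open>
  The topology of the \<open>L2\<close> seminorm; its Kolmogorov quotient is the usual Hilbert space, so that
  Baire category in both spaces is the same.
\<close>

definition L2_topology :: "'a::euclidean_space set \<Rightarrow> ('a \<Rightarrow> complex) topology" where
  "L2_topology S = topology (\<lambda>U. U \<subseteq> L2 S \<and>
     (\<forall>f\<in>U. \<exists>e>0. \<forall>g\<in>L2 S. L2_norm S (\<lambda>x. g x - f x) < e \<longrightarrow> g \<in> U))"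

lemma openin_L2_topology:
  "openin (L2_topology S) U \<longleftrightarrow> U \<subseteq> L2 S \<and>
     (\<forall>f\<in>U. \<exists>e>0. \<forall>g\<in>L2 S. L2_norm S (\<lambda>x. g x - f x) < e \<longrightarrow> g \<in> U)"
proof -
  let ?P = "\<lambda>U. U \<subseteq> L2 S \<and>
     (\<forall>f\<in>U. \<exists>e>0. \<forall>g\<in>L2 S. L2_norm S (\<lambda>x. g x - f x) < e \<longrightarrow> g \<in> U)"
  have "istopology ?P"
    unfolding istopology_def
  proof (intro conjI allI impI)
    fix U V assume U: "?P U" and V: "?P V"
    show "U \<inter> V \<subseteq> L2 S" using U by blast
    show "\<forall>f\<in>U \<inter> V. \<exists>e>0. \<forall>g\<in>L2 S. L2_norm S (\<lambda>x. g x - f x) < e \<longrightarrow> g \<in> U \<inter> V"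
    proof
      fix f assume f: "f \<in> U \<inter> V"
      obtain d where d: "d > 0" "\<forall>g\<in>L2 S. L2_norm S (\<lambda>x. g x - f x) < d \<longrightarrow> g \<in> U"
        using U f by blast
      obtain e where e: "e > 0" "\<forall>g\<in>L2 S. L2_norm S (\<lambda>x. g x - f x) < e \<longrightarrow> g \<in> V"
        using V f by blast
      have "\<forall>g\<in>L2 S. L2_norm S (\<lambda>x. g x - f x) < min d e \<longrightarrow> g \<in> U \<inter> V"
        using d e by auto
      moreover have "min d e > 0" using d e by simp
      ultimately show "\<exists>e>0. \<forall>g\<in>L2 S. L2_norm S (\<lambda>x. g x - f x) < e \<longrightarrow> g \<in> U \<inter> V"
        by blast
    qed
  next
    fix K assume K: "Ball K ?P"
    show "\<Union>K \<subseteq> L2 S" using K by blast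
    show "\<forall>f\<in>\<Union>K. \<exists>e>0. \<forall>g\<in>L2 S. L2_norm S (\<lambda>x. g x - f x) < e \<longrightarrow> g \<in> \<Union>K"
    proof
      fix f assume "f \<in> \<Union>K"
      then obtain U where U: "U \<in> K" "f \<in> U" by blast
      then obtain e where "e > 0" "\<forall>g\<in>L2 S. L2_norm S (\<lambda>x. g x - f x) < e \<longrightarrow> g \<in> U"
        using K by blast
      then show "\<exists>e>0. \<forall>g\<in>L2 S. L2_norm S (\<lambda>x. g x - f x) < e \<longrightarrow> g \<in> \<Union>K"
        using U by blast
    qed
  qed
  then show ?thesis unfolding L2_topology_def by (simp add: topology_inverse')
qed

lemma topspace_L2_topology [simp]: "topspace (L2_topology S) = L2 S"
proof -
  have "openin (L2_topology S) (L2 S)"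
    unfolding openin_L2_topology by (auto intro: exI[of _ 1])
  moreover have "openin (L2_topology S) (topspace (L2_topology S))" by simp
  ultimately show ?thesis
    unfolding openin_L2_topology[of S "topspace (L2_topology S)"] by (meson openin_subset subset_antisym)
qed

definition meager_in :: "'a topology \<Rightarrow> 'a set \<Rightarrow> bool" where
  "meager_in X A \<longleftrightarrow> A \<subseteq> topspace X \<and>
     (\<exists>N :: nat \<Rightarrow> 'a set. (\<forall>k. N k \<subseteq> topspace X \<and> X interior_of (X closure_of N k) = {}) \<and> A \<subseteq> (\<Union>k. N k))"

definition holds_generically :: "'a topology \<Rightarrow> ('a \<Rightarrow> bool) \<Rightarrow> bool" where
  "holds_generically X P \<longleftrightarrow> meager_in X {x \<in> topspace X. \<not> P x}"


section \<open>Weak derivatives and Sobolev spaces on open subsets of the plane\<close>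

definition pderiv_at :: "2 \<Rightarrow> (real^2 \<Rightarrow> complex) \<Rightarrow> real^2 \<Rightarrow> complex" where
  "pderiv_at i f x = frechet_derivative f (at x) (axis i 1)"

fun Ck :: "nat \<Rightarrow> (real^2 \<Rightarrow> complex) \<Rightarrow> bool" where
  "Ck 0 f \<longleftrightarrow> continuous_on UNIV f"
| "Ck (Suc k) f \<longleftrightarrow> (\<forall>x. f differentiable (at x)) \<and> (\<forall>i. Ck k (pderiv_at i f))"

definition smooth :: "(real^2 \<Rightarrow> complex) \<Rightarrow> bool" where
  "smooth f \<longleftrightarrow> (\<forall>k. Ck k f)"

definition test_functions :: "(real^2) set \<Rightarrow> (real^2 \<Rightarrow> complex) set" where
  "test_functions U = {\<phi>. smooth \<phi> \<and> compact (closure {x. \<phi> x \<noteq> 0}) \<and> closure {x. \<phi> x \<noteq> 0} \<subseteq> U}"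

definition is_weak_pderiv ::
    "(real^2) set \<Rightarrow> 2 \<Rightarrow> (real^2 \<Rightarrow> complex) \<Rightarrow> (real^2 \<Rightarrow> complex) \<Rightarrow> bool" where
  "is_weak_pderiv U i u v \<longleftrightarrow> (\<forall>\<phi>\<in>test_functions U.
     integral\<^sup>L (lebesgue_on U) (\<lambda>x. u x * pderiv_at i \<phi> x) =
     - integral\<^sup>L (lebesgue_on U) (\<lambda>x. v x * \<phi> x))"

definition H1 :: "(real^2) set \<Rightarrow> (real^2 \<Rightarrow> complex) set" where
  "H1 U = {u \<in> L2 U. \<forall>i. \<exists>v\<in>L2 U. is_weak_pderiv U i u v}"

text \<open>A representative of the weak derivative, which is unique almost everywhere.\<close>

definition wpderiv :: "(real^2) set \<Rightarrow> 2 \<Rightarrow> (real^2 \<Rightarrow> complex) \<Rightarrow> real^2 \<Rightarrow> complex" where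
  "wpderiv U i u = (SOME v. v \<in> L2 U \<and> is_weak_pderiv U i u v)"

definition H2 :: "(real^2) set \<Rightarrow> (real^2 \<Rightarrow> complex) set" where
  "H2 U = {u \<in> H1 U. \<forall>i. wpderiv U i u \<in> H1 U}"

definition weak_laplacian :: "(real^2) set \<Rightarrow> (real^2 \<Rightarrow> complex) \<Rightarrow> real^2 \<Rightarrow> complex" where
  "weak_laplacian U u x = (\<Sum>i\<in>UNIV. wpderiv U i (wpderiv U i u) x)"


section \<open>Traces on circles\<close>

definition polar :: "real \<Rightarrow> real \<Rightarrow> real^2" where
  "polar r \<theta> = vector [r * cos \<theta>, r * sin \<theta>]"

text \<open>
  The trace on a boundary circle of radius \<open>\<rho>\<close> of a bounded domain \<open>U\<close> is the extension by
  continuity, from the \<open>H1\<close> norm on \<open>U\<close> to the \<open>L2\<close> norm on the circle, of the restriction of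
  functions smooth up to the boundary.  The circle is parametrized by the angle; the constant
  density \<open>\<rho>\<close> of arc length is irrelevant for convergence and for null sets.
\<close>

definition has_trace ::
    "(real^2) set \<Rightarrow> real \<Rightarrow> (real^2 \<Rightarrow> complex) \<Rightarrow> (real^2 \<Rightarrow> complex) \<Rightarrow> bool" where
  "has_trace U \<rho> u t \<longleftrightarrow> u \<in> H1 U \<and>
     (\<exists>\<phi> :: nat \<Rightarrow> real^2 \<Rightarrow> complex. (\<forall>k. smooth (\<phi> k)) \<and>
        L2_tendsto U \<phi> u \<and>
        (\<forall>i. L2_tendsto U (\<lambda>k. pderiv_at i (\<phi> k)) (wpderiv U i u)) \<and>
        L2_tendsto {0<..<2*pi} (\<lambda>k \<theta>. \<phi> k (polar \<rho> \<theta>)) (\<lambda>\<theta>. t (polar \<rho> \<theta>)))"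

definition has_normal_trace ::
    "(real^2) set \<Rightarrow> real \<Rightarrow> (real^2 \<Rightarrow> real^2) \<Rightarrow> (real^2 \<Rightarrow> complex) \<Rightarrow> (real^2 \<Rightarrow> complex) \<Rightarrow> bool" where
  "has_normal_trace U \<rho> N u s \<longleftrightarrow>
     (\<exists>T :: 2 \<Rightarrow> real^2 \<Rightarrow> complex. (\<forall>i. has_trace U \<rho> (wpderiv U i u) (T i)) \<and>
        s = (\<lambda>x. \<Sum>i\<in>UNIV. of_real (N x $ i) * T i x))"


section \<open>The indefinite Laplacian\<close>

definition Omega_minus :: "real \<Rightarrow> real \<Rightarrow> (real^2) set" where
  "Omega_minus ri re = {x. ri < norm x \<and> norm x < re}"

definition Omega_plus :: "real \<Rightarrow> real \<Rightarrow> real \<Rightarrow> (real^2) set" where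
  "Omega_plus ri re R = ball 0 R - closure (Omega_minus ri re)"

text \<open>
  Unit normals on the interface, the union of the circles of radii \<open>ri\<close> and \<open>re\<close>, exterior with
  respect to \<open>Omega_minus\<close> and \<open>Omega_plus\<close>.
\<close>

definition N_minus :: "real \<Rightarrow> real^2 \<Rightarrow> real^2" where
  "N_minus re x = (if norm x = re then sgn x else - sgn x)"

definition N_plus :: "real \<Rightarrow> real^2 \<Rightarrow> real^2" where
  "N_plus re x = - N_minus re x"

text \<open>
  A pair \<open>(u_minus, u_plus)\<close> is represented by a single function on the disc; the interface is a
  null set.
\<close>

definition D1 :: "real \<Rightarrow> real \<Rightarrow> real \<Rightarrow> (real^2 \<Rightarrow> complex) set" where
  "D1 ri re R = {u \<in> L2 (ball 0 R).
     u \<in> H2 (Omega_minus ri re) \<and> u \<in> H2 (Omega_plus ri re R) \<and>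
     (\<forall>\<rho>\<in>{ri, re}.
        (\<exists>t. has_trace (Omega_minus ri re) \<rho> u t \<and> has_trace (Omega_plus ri re R) \<rho> u t) \<and>
        (\<exists>s. has_normal_trace (Omega_minus ri re) \<rho> (N_minus re) u s \<and>
             has_normal_trace (Omega_plus ri re R) \<rho> (N_plus re) u s)) \<and>
     has_trace (Omega_plus ri re R) R u (\<lambda>_. 0)}"

definition L1 :: "real \<Rightarrow> real \<Rightarrow> real \<Rightarrow> (real^2 \<Rightarrow> complex) \<Rightarrow> real^2 \<Rightarrow> complex" where
  "L1 ri re R u x =
     (if x \<in> Omega_minus ri re then - weak_laplacian (Omega_minus ri re) u x
      else if x \<in> Omega_plus ri re R then weak_laplacian (Omega_plus ri re R) u x
      else 0)"

text \<open>The graph of the closure of \<open>L1\<close>, with domain \<open>D1\<close>, as an operator in \<open>L2 (ball 0 R)\<close>.\<close>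

definition L1_closure ::
    "real \<Rightarrow> real \<Rightarrow> real \<Rightarrow> ((real^2 \<Rightarrow> complex) \<times> (real^2 \<Rightarrow> complex)) set" where
  "L1_closure ri re R = {(u, f). \<exists>v :: nat \<Rightarrow> real^2 \<Rightarrow> complex. (\<forall>k. v k \<in> D1 ri re R) \<and>
     L2_tendsto (ball 0 R) v u \<and> L2_tendsto (ball 0 R) (\<lambda>k. L1 ri re R (v k)) f}"


section \<open>The summability condition\<close>

definition fourier_coeff :: "(real \<Rightarrow> complex) \<Rightarrow> int \<Rightarrow> complex" where
  "fourier_coeff h m = of_real (1 / (2 * pi)) *
     integral\<^sup>L (lebesgue_on {0<..<2*pi}) (\<lambda>\<theta>. h \<theta> * exp (- \<i> * of_int m * of_real \<theta>))"

definition summability_condition :: "real \<Rightarrow> real \<Rightarrow> real \<Rightarrow> (real \<Rightarrow> complex) \<Rightarrow> bool" where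
  "summability_condition ri re a h \<longleftrightarrow>
     (\<lambda>m::int. (cmod (fourier_coeff h m))\<^sup>2 / \<bar>real_of_int m\<bar> ^ 5 * (re\<^sup>2 / (ri * a)) ^ (2 * nat \<bar>m\<bar>))
       summable_on (UNIV - {0})"

end

theory Submission
  imports Defs
begin

text \<open>
  In the variable \<open>s = r\<^sup>2\<close> the equation \<open>L\<^sub>1 u = \<sigma>(s) z\<^sup>m\<close> is solved explicitly by \<open>u = Sol(s) z\<^sup>m\<close>, with the
  two solutions \<open>phi\<close>, \<open>psi\<close> of the homogeneous transmission problem (regular at \<open>0\<close>, zero at \<open>R\<close>).  Green's
  formula makes the operator symmetric against these smooth solutions, so an element \<open>(u, f)\<close> of the closure
  satisfies \<open>\<integral> u \<sigma> z\<^sup>m = \<integral> f Sol z\<^sup>m\<close>; as the modes \<open>\<sigma> z\<^sup>m\<close> are total, \<open>f\<close> determines \<open>u\<close>.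

  With \<open>M = \<bar>m\<bar>\<close> and \<open>q = re\<^sup>2 / (ri a)\<close>, the sign change makes \<open>phi\<close> equal to \<open>(re\<^sup>2 / s)\<^sup>M\<close> in the annulus, so the
  mode \<open>m\<close> of \<open>u\<close> there is \<open>h\<^sub>m\<close> times a function of squared norm comparable to \<open>q\<^bsup>2M\<^esup> / M\<^sup>5\<close>.  By Bessel's
  inequality the condition is necessary; conversely the solutions \<open>V m\<close> of the individual modes are
  orthogonal with squared norm \<open>O(1 + q\<^bsup>2M\<^esup> / M\<^sup>5)\<close>, so under the condition their series converges, and the
  closedness of the graph gives a preimage of \<open>g\<close>.  If \<open>q > 1\<close>, the functions \<open>h\<close> all of whose terms are bounded by
  \<open>k\<close> form a closed set without interior, since the weight of a single coefficient is arbitrarily large.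
\<close>

section \<open>Square-integrable functions\<close>

text \<open>Regularity of elements of the closure is never studied. An arbitrary element enters only
  through its pairing with smooth mode solutions, and preimages are limits of glued functions whose
  pieces are smooth on the whole plane, so that weak derivatives and traces are classical. The
  variable \<open>s = r^2\<close> is used because \<open>|x|^2\<close> is smooth at the origin and
  area becomes \<open>ds dtheta / 2\<close>, with constant density. Every mode is solvable because
  of the Wronskian of \<open>phi\<close> and \<open>psi\<close>: crossing a circle keeps values and
  reverses fluxes, so the Wronskian only changes sign, exactly as the operator does. The weight in
  the condition is a product of two integrals. The source meets \<open>psi\<close>, which is about
  \<open>s^(-M) / M\<close>, in an integral of size \<open>a^(-M) / M^2\<close>, and its square
  gives \<open>M^(-4)\<close>. The squared norm of \<open>(re^2 / s)^M z^m\<close> over the annulus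
  has size \<open>re^(4M) ri^(-2M) / M\<close>. Together this is \<open>q^(2M) / M^5\<close>. Only
  the growth in \<open>M\<close> matters, so all estimates are up to constants independent of
  \<open>M\<close>.\<close>

abbreviation lebint :: "'a::euclidean_space set \<Rightarrow> ('a \<Rightarrow> 'b::{banach, second_countable_topology}) \<Rightarrow> 'b" where
  "lebint S \<equiv> integral\<^sup>L (lebesgue_on S)"

abbreviation lborint :: "('a::euclidean_space \<Rightarrow> 'b::{banach, second_countable_topology}) \<Rightarrow> 'b" where
  "lborint \<equiv> integral\<^sup>L lborel"



lemma L2_measurable: "f \<in> L2 S \<Longrightarrow> f \<in> borel_measurable (lebesgue_on S)"
  by (simp add: L2_def)

lemma L2_integrable_sq: "f \<in> L2 S \<Longrightarrow> integrable (lebesgue_on S) (\<lambda>x. (cmod (f x))\<^sup>2)"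
  by (simp add: L2_def)

lemma L2_norm_nonneg: "L2_norm S f \<ge> 0"
  by (simp add: L2_norm_def integral_nonneg_AE)

lemma L2_norm_sq: "(L2_norm S f)\<^sup>2 = lebint S (\<lambda>x. (cmod (f x))\<^sup>2)"
  by (simp add: L2_norm_def integral_nonneg_AE)

lemma cmod_add_sq_le: "(cmod (a + b))\<^sup>2 \<le> 2 * (cmod a)\<^sup>2 + 2 * (cmod b)\<^sup>2"
proof -
  have "(cmod (a + b))\<^sup>2 \<le> (cmod a + cmod b)\<^sup>2"
    by (intro power_mono norm_triangle_ineq norm_ge_zero)
  also have "\<dots> \<le> 2 * (cmod a)\<^sup>2 + 2 * (cmod b)\<^sup>2"
    using sum_squares_bound[of "cmod a" "cmod b"] by (simp add: power2_eq_square algebra_simps)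
  finally show ?thesis .
qed

lemma L2_add:
  assumes "f \<in> L2 S" "g \<in> L2 S"
  shows "(\<lambda>x. f x + g x) \<in> L2 S"
proof -
  note [measurable] = L2_measurable[OF assms(1)] L2_measurable[OF assms(2)]
  have "integrable (lebesgue_on S) (\<lambda>x. (cmod (f x + g x))\<^sup>2)"
  proof (rule Bochner_Integration.integrable_bound)
    show "integrable (lebesgue_on S) (\<lambda>x. 2 * (cmod (f x))\<^sup>2 + 2 * (cmod (g x))\<^sup>2)"
      using assms by (simp add: L2_integrable_sq)
    show "AE x in lebesgue_on S. norm ((cmod (f x + g x))\<^sup>2) \<le> norm (2 * (cmod (f x))\<^sup>2 + 2 * (cmod (g x))\<^sup>2)"
    proof (rule AE_I2)
      fix x
      show "norm ((cmod (f x + g x))\<^sup>2) \<le> norm (2 * (cmod (f x))\<^sup>2 + 2 * (cmod (g x))\<^sup>2)"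
        using cmod_add_sq_le[of "f x" "g x"] by simp
    qed
  qed simp
  then show ?thesis by (simp add: L2_def)
qed

lemma L2_cmult: "f \<in> L2 S \<Longrightarrow> (\<lambda>x. c * f x) \<in> L2 S"
  by (auto simp: L2_def norm_mult power_mult_distrib)

lemma L2_diff: "f \<in> L2 S \<Longrightarrow> g \<in> L2 S \<Longrightarrow> (\<lambda>x. f x - g x) \<in> L2 S"
  using L2_add[OF _ L2_cmult[of g S "-1"], of f] by simp

lemma L2_zero: "(\<lambda>x. 0) \<in> L2 S"
  by (simp add: L2_def)

lemma L2_sum:
  assumes "\<And>i. i \<in> I \<Longrightarrow> f i \<in> L2 S"
  shows "(\<lambda>x. \<Sum>i\<in>I. f i x) \<in> L2 S"
  using assms
proof (induction I rule: infinite_finite_induct)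
  case (insert i I)
  then show ?case using L2_add[of "f i" S "\<lambda>x. \<Sum>i\<in>I. f i x"] by simp
qed (simp_all add: L2_zero)

lemma L2_cnj:
  assumes "f \<in> L2 S" shows "(\<lambda>x. cnj (f x)) \<in> L2 S"
proof -
  have "cnj \<in> borel_measurable borel"
    by (intro borel_measurable_continuous_onI continuous_intros)
  then have "(\<lambda>x. cnj (f x)) \<in> borel_measurable (lebesgue_on S)"
    by (rule measurable_compose[OF L2_measurable[OF assms]])
  then show ?thesis using assms by (simp add: L2_def)
qed

lemma L2_bounded:
  assumes "S \<in> lmeasurable" "f \<in> borel_measurable (lebesgue_on S)" "\<And>x. x \<in> S \<Longrightarrow> cmod (f x) \<le> B"
  shows "f \<in> L2 S"
proof -
  note [measurable] = assms(2)
  have "integrable (lebesgue_on S) (\<lambda>x. (cmod (f x))\<^sup>2)"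
  proof (rule Bochner_Integration.integrable_bound)
    show "integrable (lebesgue_on S) (\<lambda>x. B\<^sup>2)"
      by (rule finite_measure.integrable_const[OF finite_measure_lebesgue_on[OF assms(1)]])
    show "AE x in lebesgue_on S. norm ((cmod (f x))\<^sup>2) \<le> norm (B\<^sup>2)"
      using assms(3) by (auto intro!: AE_I2 power_mono)
  qed auto
  then show ?thesis using assms(2) by (simp add: L2_def)
qed

lemma L2_bounded_mult:
  assumes "f \<in> L2 S" "g \<in> borel_measurable (lebesgue_on S)" "\<And>x. x \<in> S \<Longrightarrow> cmod (g x) \<le> B"
  shows "(\<lambda>x. f x * g x) \<in> L2 S"
proof -
  note [measurable] = assms(2) L2_measurable[OF assms(1)]
  have "integrable (lebesgue_on S) (\<lambda>x. (cmod (f x * g x))\<^sup>2)"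
  proof (rule Bochner_Integration.integrable_bound)
    show "integrable (lebesgue_on S) (\<lambda>x. B\<^sup>2 * (cmod (f x))\<^sup>2)"
      using assms by (simp add: L2_integrable_sq)
    show "AE x in lebesgue_on S. norm ((cmod (f x * g x))\<^sup>2) \<le> norm (B\<^sup>2 * (cmod (f x))\<^sup>2)"
    proof (rule AE_I2)
      fix x assume "x \<in> space (lebesgue_on S)"
      then have "(cmod (g x))\<^sup>2 \<le> B\<^sup>2" using assms(3) by (intro power_mono) auto
      then show "norm ((cmod (f x * g x))\<^sup>2) \<le> norm (B\<^sup>2 * (cmod (f x))\<^sup>2)"
        by (simp add: norm_mult power_mult_distrib mult.commute[of "B\<^sup>2"] mult_left_mono)
    qed
  qed auto
  then show ?thesis by (simp add: L2_def)
qed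

lemma continuous_imp_lebesgue_on_measurable:
  fixes f :: "'a::euclidean_space \<Rightarrow> 'b::euclidean_space"
  assumes "continuous_on UNIV f"
  shows "f \<in> borel_measurable (lebesgue_on S)"
proof -
  have "f \<in> borel_measurable borel" using assms by (rule borel_measurable_continuous_onI)
  then have "f \<in> borel_measurable lebesgue"
    by (metis measurable_completion measurable_lborel2)
  then show ?thesis by (rule measurable_restrict_space1)
qed

lemma L2_continuous:
  assumes "S \<in> lmeasurable" "bounded S" "continuous_on UNIV f"
  shows "f \<in> L2 S"
proof -
  have "compact (f ` closure S)"
    using assms by (intro compact_continuous_image) (auto intro: continuous_on_subset simp: compact_closure)
  then obtain B where "\<forall>y\<in>f ` closure S. norm y \<le> B"
    using compact_imp_bounded bounded_iff by meson
  then have "\<And>x. x \<in> S \<Longrightarrow> cmod (f x) \<le> B" using closure_subset by blast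
  then show ?thesis
    using L2_bounded assms continuous_imp_lebesgue_on_measurable by blast
qed

lemma L2_mult_integrable:
  assumes "f \<in> L2 S" "g \<in> L2 S"
  shows "integrable (lebesgue_on S) (\<lambda>x. f x * g x)"
proof (rule Bochner_Integration.integrable_bound)
  note [measurable] = L2_measurable[OF assms(1)] L2_measurable[OF assms(2)]
  show "integrable (lebesgue_on S) (\<lambda>x. (cmod (f x))\<^sup>2 + (cmod (g x))\<^sup>2)"
    using assms by (simp add: L2_integrable_sq)
  show "(\<lambda>x. f x * g x) \<in> borel_measurable (lebesgue_on S)" by measurable
  have "cmod (f x) * cmod (g x) \<le> (cmod (f x))\<^sup>2 + (cmod (g x))\<^sup>2" for x
    using sum_squares_bound[of "cmod (f x)" "cmod (g x)"]
      mult_nonneg_nonneg[OF norm_ge_zero[of "f x"] norm_ge_zero[of "g x"]] by linarith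
  then show "AE x in lebesgue_on S. norm (f x * g x) \<le> norm ((cmod (f x))\<^sup>2 + (cmod (g x))\<^sup>2)"
    by (auto simp: norm_mult)
qed

lemma L2_integrable:
  assumes "S \<in> lmeasurable" "f \<in> L2 S"
  shows "integrable (lebesgue_on S) f"
  using L2_mult_integrable[OF assms(2) L2_bounded[OF assms(1), of "\<lambda>_. 1" 1]] by simp

text \<open>A quadratic in \<open>t\<close> without negative values has nonpositive discriminant.
  The degenerate case \<open>A = 0\<close> is included, so that Cauchy-Schwarz covers functions
  vanishing almost everywhere.\<close>

lemma discriminant_bound:
  fixes A B I :: real
  assumes q: "\<And>t. 0 \<le> t\<^sup>2 * A - 2 * t * I + B" and "0 \<le> A" and I: "0 \<le> I"
  shows "I\<^sup>2 \<le> A * B"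
proof (cases "A = 0")
  case True
  have "I = 0"
  proof (rule ccontr)
    assume "I \<noteq> 0"
    \<comment> \<open>For \<open>A = 0\<close> this \<open>t\<close> gives the quadratic the value
      \<open>-1\<close>.\<close>
    then show False using q[of "(B + 1) / (2 * I)"] True by (simp add: field_simps)
  qed
  then show ?thesis using True by simp
next
  case False
  then have p: "A > 0" using assms(2) by simp
  have "(I / A)\<^sup>2 * A - 2 * (I / A) * I = - (I\<^sup>2 / A)"
    using p by (simp add: field_simps power2_eq_square)
  then have "I\<^sup>2 / A \<le> B" using q[of "I / A"] by simp
  then show ?thesis using p by (simp add: field_simps)
qed

text \<open>Cauchy-Schwarz for the moduli: as the factors are real and nonnegative, a real parameter
  \<open>t\<close> in the quadratic is enough and no phase has to be chosen.\<close>

lemma L2_norm_mult_le: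
  assumes "f \<in> L2 S" "g \<in> L2 S"
  shows "lebint S (\<lambda>x. cmod (f x) * cmod (g x)) \<le> L2_norm S f * L2_norm S g"
proof -
  let ?I = "lebint S (\<lambda>x. cmod (f x) * cmod (g x))"
  let ?A = "(L2_norm S f)\<^sup>2" let ?B = "(L2_norm S g)\<^sup>2"
  have i1: "integrable (lebesgue_on S) (\<lambda>x. cmod (f x) * cmod (g x))"
    using integrable_norm[OF L2_mult_integrable[OF assms]] by (simp add: norm_mult)
  have q: "0 \<le> t\<^sup>2 * ?A - 2 * t * ?I + ?B" for t :: real
  proof -
    have "0 \<le> lebint S (\<lambda>x. (t * cmod (f x) - cmod (g x))\<^sup>2)"
      by (intro integral_nonneg_AE) auto
    also have "(\<lambda>x. (t * cmod (f x) - cmod (g x))\<^sup>2) =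
        (\<lambda>x. t\<^sup>2 * (cmod (f x))\<^sup>2 - 2 * t * (cmod (f x) * cmod (g x)) + (cmod (g x))\<^sup>2)"
      by (auto simp: power2_eq_square algebra_simps)
    also have "lebint S \<dots> = t\<^sup>2 * ?A - 2 * t * ?I + ?B"
      using i1 assms by (simp add: L2_norm_sq L2_integrable_sq)
    finally show ?thesis .
  qed
  have "?I\<^sup>2 \<le> ?A * ?B"
    by (rule discriminant_bound[OF q]) (auto intro: integral_nonneg_AE)
  then have "?I\<^sup>2 \<le> (L2_norm S f * L2_norm S g)\<^sup>2" by (simp add: power_mult_distrib)
  then show ?thesis
    by (rule power2_le_imp_le) (simp add: L2_norm_nonneg)
qed

lemma L2_cauchy_schwarz:
  assumes "f \<in> L2 S" "g \<in> L2 S"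
  shows "cmod (lebint S (\<lambda>x. f x * g x)) \<le> L2_norm S f * L2_norm S g"
proof -
  have "cmod (lebint S (\<lambda>x. f x * g x)) \<le> lebint S (\<lambda>x. cmod (f x * g x))"
    by (rule integral_norm_bound)
  then show ?thesis using L2_norm_mult_le[OF assms] by (simp add: norm_mult)
qed

lemma L2_norm_triangle:
  assumes "f \<in> L2 S" "g \<in> L2 S"
  shows "L2_norm S (\<lambda>x. f x + g x) \<le> L2_norm S f + L2_norm S g"
proof (rule power2_le_imp_le)
  have i1: "integrable (lebesgue_on S) (\<lambda>x. cmod (f x) * cmod (g x))"
    using integrable_norm[OF L2_mult_integrable[OF assms]] by (simp add: norm_mult)
  have i2: "integrable (lebesgue_on S) (\<lambda>x. (cmod (f x))\<^sup>2 + 2 * (cmod (f x) * cmod (g x)) + (cmod (g x))\<^sup>2)"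
    using i1 assms by (simp add: L2_integrable_sq)
  have "(L2_norm S (\<lambda>x. f x + g x))\<^sup>2 \<le>
      lebint S (\<lambda>x. (cmod (f x))\<^sup>2 + 2 * (cmod (f x) * cmod (g x)) + (cmod (g x))\<^sup>2)"
    unfolding L2_norm_sq
  proof (rule integral_mono[OF L2_integrable_sq[OF L2_add[OF assms]] i2])
    fix x
    have "(cmod (f x + g x))\<^sup>2 \<le> (cmod (f x) + cmod (g x))\<^sup>2"
      by (intro power_mono norm_triangle_ineq norm_ge_zero)
    then show "(cmod (f x + g x))\<^sup>2 \<le> (cmod (f x))\<^sup>2 + 2 * (cmod (f x) * cmod (g x)) + (cmod (g x))\<^sup>2"
      by (simp add: power2_eq_square algebra_simps)
  qed
  also have "\<dots> = (L2_norm S f)\<^sup>2 + 2 * lebint S (\<lambda>x. cmod (f x) * cmod (g x)) + (L2_norm S g)\<^sup>2"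
    using i1 assms by (simp add: L2_norm_sq L2_integrable_sq)
  also have "\<dots> \<le> (L2_norm S f + L2_norm S g)\<^sup>2"
    using L2_norm_mult_le[OF assms] by (simp add: power2_eq_square algebra_simps)
  finally show "(L2_norm S (\<lambda>x. f x + g x))\<^sup>2 \<le> (L2_norm S f + L2_norm S g)\<^sup>2" .
qed (simp add: L2_norm_nonneg)

lemma L2_norm_cmult: "L2_norm S (\<lambda>x. c * f x) = cmod c * L2_norm S f"
  by (simp add: L2_norm_def norm_mult power_mult_distrib real_sqrt_mult)

lemma L2_norm_minus_commute: "L2_norm S (\<lambda>x. f x - g x) = L2_norm S (\<lambda>x. g x - f x)"
  by (simp add: L2_norm_def norm_minus_commute)

lemma L2_norm_triangle3:
  assumes "f \<in> L2 S" "g \<in> L2 S" "h \<in> L2 S"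
  shows "L2_norm S (\<lambda>x. f x - h x) \<le> L2_norm S (\<lambda>x. f x - g x) + L2_norm S (\<lambda>x. g x - h x)"
  using L2_norm_triangle[OF L2_diff[OF assms(1,2)] L2_diff[OF assms(2,3)]] by simp

section \<open>Modification on null sets and convergence in \<open>L2\<close>\<close>

lemma complete_measure_lebesgue_on:
  assumes "S \<in> sets lebesgue" shows "complete_measure (lebesgue_on S)"
proof
  fix A B assume B: "B \<subseteq> A" and A: "A \<in> null_sets (lebesgue_on S)"
  have A': "A \<subseteq> S" "A \<in> null_sets lebesgue"
    using A null_sets_restrict_space[of S lebesgue A] assms by auto
  have "B \<in> null_sets lebesgue" using null_sets_completion_subset[OF B A'(2)] .
  then have "B \<in> null_sets (lebesgue_on S)"
    using null_sets_restrict_space[of S lebesgue B] assms A'(1) B by auto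
  then show "B \<in> sets (lebesgue_on S)" by (rule null_setsD2)
qed

text \<open>Completeness of the measure carries measurability over null sets. Since
  \<open>L2\<close> consists of functions and \<open>wpderiv\<close> is some representative,
  identifications made almost everywhere later rely on this fact.\<close>

lemma lebesgue_on_measurable_AE_cong:
  fixes f g :: "'a::euclidean_space \<Rightarrow> 'b::topological_space"
  assumes "S \<in> sets lebesgue" "f \<in> borel_measurable (lebesgue_on S)" "AE x in lebesgue_on S. f x = g x"
  shows "g \<in> borel_measurable (lebesgue_on S)"
proof (rule measurableI)
  interpret complete_measure "lebesgue_on S" by (rule complete_measure_lebesgue_on[OF assms(1)])
  fix A :: "'b set" assume A: "A \<in> sets borel"
  have "f -` A \<inter> space (lebesgue_on S) \<in> sets (lebesgue_on S)"
    using assms(2) A by (rule measurable_sets)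
  then show "g -` A \<inter> space (lebesgue_on S) \<in> sets (lebesgue_on S)"
    by (rule in_sets_AE[rotated]) (use assms(3) in auto)
qed auto

lemma L2_AE_cong:
  assumes "S \<in> sets lebesgue" "f \<in> L2 S" "AE x in lebesgue_on S. f x = g x"
  shows "g \<in> L2 S"
proof -
  have g: "g \<in> borel_measurable (lebesgue_on S)"
    using lebesgue_on_measurable_AE_cong assms L2_measurable by blast
  have "integrable (lebesgue_on S) (\<lambda>x. (cmod (g x))\<^sup>2)"
    by (rule integrable_cong_AE_imp[OF L2_integrable_sq[OF assms(2)]]) (use g assms(3) in auto)
  then show ?thesis using g by (simp add: L2_def)
qed

lemma L2_norm_AE_cong:
  assumes "f \<in> L2 S" "g \<in> L2 S" "AE x in lebesgue_on S. f x = g x"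
  shows "L2_norm S f = L2_norm S g"
proof -
  note [measurable] = L2_measurable[OF assms(1)] L2_measurable[OF assms(2)]
  show ?thesis unfolding L2_norm_def
    by (intro arg_cong[where f=sqrt] integral_cong_AE) (use assms(3) in auto)
qed

lemma L2_tendsto_AE_cong:
  assumes "S \<in> sets lebesgue" "L2_tendsto S F f"
    "\<And>k. AE x in lebesgue_on S. F k x = G k x" "AE x in lebesgue_on S. f x = g x"
  shows "L2_tendsto S G g"
proof -
  have F: "\<And>k. F k \<in> L2 S" "f \<in> L2 S" and lim: "(\<lambda>k. L2_norm S (\<lambda>x. F k x - f x)) \<longlonglongrightarrow> 0"
    using assms(2) by (auto simp: L2_tendsto_def)
  have G: "\<And>k. G k \<in> L2 S" "g \<in> L2 S"
    using L2_AE_cong assms F by blast+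
  have "L2_norm S (\<lambda>x. F k x - f x) = L2_norm S (\<lambda>x. G k x - g x)" for k
  proof (rule L2_norm_AE_cong)
    show "AE x in lebesgue_on S. F k x - f x = G k x - g x"
      using assms(3)[of k] assms(4) by eventually_elim simp
  qed (use F G L2_diff in blast)+
  then show ?thesis using lim G by (simp add: L2_tendsto_def)
qed

lemma L2_tendsto_const: "f \<in> L2 S \<Longrightarrow> L2_tendsto S (\<lambda>_. f) f"
  by (simp add: L2_tendsto_def L2_norm_def)

text \<open>The pairing is bilinear, without conjugation. Its continuity carries Green's formula
  from smooth functions to traces, and from \<open>L1\<close> to its closure.\<close>

lemma L2_tendsto_pairing:
  assumes "L2_tendsto S F f" "g \<in> L2 S"
  shows "(\<lambda>k. lebint S (\<lambda>x. F k x * g x)) \<longlonglongrightarrow> lebint S (\<lambda>x. f x * g x)"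
proof -
  have F: "\<And>k. F k \<in> L2 S" "f \<in> L2 S" and lim: "(\<lambda>k. L2_norm S (\<lambda>x. F k x - f x)) \<longlonglongrightarrow> 0"
    using assms(1) by (auto simp: L2_tendsto_def)
  let ?I = "\<lambda>u. lebint S (\<lambda>x. u x * g x)"
  have bound: "norm (?I (F k) - ?I f) \<le> L2_norm S (\<lambda>x. F k x - f x) * L2_norm S g" for k
  proof -
    have "?I (F k) - ?I f = lebint S (\<lambda>x. F k x * g x - f x * g x)"
      by (rule Bochner_Integration.integral_diff[symmetric, OF L2_mult_integrable[OF F(1)[of k] assms(2)] L2_mult_integrable[OF F(2) assms(2)]])
    also have "(\<lambda>x. F k x * g x - f x * g x) = (\<lambda>x. (F k x - f x) * g x)"
      by (rule ext) (rule left_diff_distrib[symmetric])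
    finally have e: "?I (F k) - ?I f = lebint S (\<lambda>x. (F k x - f x) * g x)" .
    show ?thesis unfolding e by (rule L2_cauchy_schwarz[OF L2_diff[OF F(1)[of k] F(2)] assms(2)])
  qed
  have "(\<lambda>k. L2_norm S (\<lambda>x. F k x - f x) * L2_norm S g) \<longlonglongrightarrow> 0"
    by (rule tendsto_mult_left_zero[OF lim])
  then have "(\<lambda>k. ?I (F k) - ?I f) \<longlonglongrightarrow> 0"
    by (rule Lim_null_comparison[rotated]) (rule always_eventually, rule allI, rule bound)
  then show ?thesis by (rule LIM_zero_cancel)
qed

text \<open>Dominated convergence with a constant majorant, possible because \<open>S\<close> has
  finite measure. It is applied where smooth cutoffs approximate a sharp weight.\<close>

lemma L2_tendsto_dominated:
  assumes S: "S \<in> lmeasurable" and m: "\<And>k. F k \<in> borel_measurable (lebesgue_on S)"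
    and f: "f \<in> borel_measurable (lebesgue_on S)"
    and b: "\<And>k x. x \<in> S \<Longrightarrow> cmod (F k x) \<le> B"
    and lim: "\<And>x. x \<in> S \<Longrightarrow> (\<lambda>k. F k x) \<longlonglongrightarrow> f x"
  shows "L2_tendsto S F f"
proof -
  note [measurable] = m f
  have bf: "cmod (f x) \<le> B" if "x \<in> S" for x
    using b[OF that] lim[OF that] by (intro Lim_bounded[OF tendsto_norm]) auto
  have "(\<lambda>k. lebint S (\<lambda>x. (cmod (F k x - f x))\<^sup>2)) \<longlonglongrightarrow> lebint S (\<lambda>x. 0)"
  proof (rule integral_dominated_convergence[where w="\<lambda>x. (2*B)\<^sup>2"])
    show "integrable (lebesgue_on S) (\<lambda>x. (2*B)\<^sup>2)"
      by (rule finite_measure.integrable_const[OF finite_measure_lebesgue_on[OF S]])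
    show "AE x in lebesgue_on S. (\<lambda>k. (cmod (F k x - f x))\<^sup>2) \<longlonglongrightarrow> 0"
    proof (rule AE_I2)
      fix x assume "x \<in> space (lebesgue_on S)"
      then have "(\<lambda>k. F k x - f x) \<longlonglongrightarrow> f x - f x" by (intro tendsto_diff lim tendsto_const) simp
      then show "(\<lambda>k. (cmod (F k x - f x))\<^sup>2) \<longlonglongrightarrow> 0"
        using tendsto_power[OF tendsto_norm, of "\<lambda>k. F k x - f x" _ _ 2] by fastforce
    qed
    show "AE x in lebesgue_on S. norm ((cmod (F k x - f x))\<^sup>2) \<le> (2*B)\<^sup>2" for k
    proof (rule AE_I2)
      fix x assume "x \<in> space (lebesgue_on S)"
      then have "cmod (F k x - f x) \<le> 2 * B"
        using b[of x k] bf[of x] norm_triangle_ineq4[of "F k x" "f x"] by simp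
      then show "norm ((cmod (F k x - f x))\<^sup>2) \<le> (2*B)\<^sup>2" using power_mono[of _ "2 * B" 2] by simp
    qed
  qed simp_all
  then have "(\<lambda>k. L2_norm S (\<lambda>x. F k x - f x)) \<longlonglongrightarrow> sqrt 0"
    unfolding L2_norm_def by (intro tendsto_real_sqrt) simp
  then show ?thesis using L2_bounded[OF S m b] L2_bounded[OF S f bf] by (simp add: L2_tendsto_def)
qed

section \<open>Completeness and orthogonality\<close>


text \<open>Riesz-Fischer. A subsequence with steps below \<open>2^(-j)\<close> converges almost
  everywhere, and Fatou's lemma shows that its pointwise limit is the limit in norm of the whole
  sequence.\<close>

lemma L2_complete:
  fixes F :: "nat \<Rightarrow> 'a::euclidean_space \<Rightarrow> complex"
  assumes S: "S \<in> lmeasurable" and F: "\<And>k. F k \<in> L2 S"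
    and cauchy: "\<And>e. e > 0 \<Longrightarrow> \<exists>N. \<forall>k\<ge>N. \<forall>l\<ge>N. L2_norm S (\<lambda>x. F k x - F l x) < e"
  shows "\<exists>f. L2_tendsto S F f"
proof -
  have meas[measurable]: "F k \<in> borel_measurable (lebesgue_on S)" for k
    using F by (rule L2_measurable)
  have "\<forall>j::nat. \<exists>N. \<forall>k\<ge>N. \<forall>l\<ge>N. L2_norm S (\<lambda>x. F k x - F l x) < (1/2)^j"
    using cauchy by simp
  then obtain N where N: "\<And>j k l. k \<ge> N j \<Longrightarrow> l \<ge> N j \<Longrightarrow> L2_norm S (\<lambda>x. F k x - F l x) < (1/2)^j"
    by metis
  \<comment> \<open>The sum makes \<open>r\<close> monotone with \<open>r j\<close> at least
    \<open>N j\<close>; the summand \<open>j\<close> makes \<open>r j\<close> exceed any given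
    \<open>N i\<close> as soon as \<open>j\<close> does.\<close>
  define r where "r j = (\<Sum>i\<le>j. N i) + j" for j
  have rN: "N j \<le> r j" for j
    unfolding r_def by (rule trans_le_add1) (rule member_le_sum, auto)
  have rS: "r j \<le> r (Suc j)" for j by (simp add: r_def)
  have step: "L2_norm S (\<lambda>x. F (r (Suc j)) x - F (r j) x) < (1/2)^j" for j
    using N rN rS order_trans by blast
  define G where "G j x = cmod (F (r (Suc j)) x - F (r j) x)" for j x
  have [measurable]: "G j \<in> borel_measurable (lebesgue_on S)" for j
    unfolding G_def by measurable
  define C where "C = L2_norm S (\<lambda>_. 1 :: complex)"
  have one: "(\<lambda>_. 1 :: complex) \<in> L2 S" by (rule L2_bounded[OF S, of _ 1]) simp_all
  have Gint: "integrable (lebesgue_on S) (G j)" for j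
    unfolding G_def by (intro integrable_norm L2_integrable[OF S] L2_diff F)
  \<comment> \<open>On a set of finite measure, Cauchy-Schwarz against the constant \<open>1\<close>
    bounds the \<open>L1\<close> norms of the steps. So the sum of the steps is integrable and hence
    finite almost everywhere.\<close>
  have GI: "lebint S (G j) \<le> C * (1/2)^j" for j
  proof -
    have "lebint S (G j) \<le> L2_norm S (\<lambda>x. F (r (Suc j)) x - F (r j) x) * C"
      using L2_norm_mult_le[OF L2_diff[OF F F] one] unfolding G_def C_def by simp
    also have "\<dots> \<le> (1/2)^j * C"
      using step[of j] L2_norm_nonneg[of S "\<lambda>_. 1"] unfolding C_def by (intro mult_right_mono) simp_all
    finally show ?thesis by (simp add: mult.commute)
  qed
  have "(\<integral>\<^sup>+x. (\<Sum>j. ennreal (G j x)) \<partial>lebesgue_on S) = (\<Sum>j. \<integral>\<^sup>+x. ennreal (G j x) \<partial>lebesgue_on S)"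
    by (rule nn_integral_suminf) measurable
  also have "\<dots> \<le> (\<Sum>j. ennreal (C * (1/2)^j))"
  proof (intro suminf_le allI)
    fix j
    have "(\<integral>\<^sup>+x. ennreal (G j x) \<partial>lebesgue_on S) = ennreal (lebint S (G j))"
      by (rule nn_integral_eq_integral[OF Gint]) (simp add: G_def)
    also have "\<dots> \<le> ennreal (C * (1/2)^j)" by (rule ennreal_leI[OF GI])
    finally show "(\<integral>\<^sup>+x. ennreal (G j x) \<partial>lebesgue_on S) \<le> ennreal (C * (1/2)^j)" .
  qed simp_all
  also have "\<dots> = ennreal (\<Sum>j. C * (1/2)^j)"
    by (rule suminf_ennreal2) (auto intro!: summable_mult summable_geometric simp: C_def L2_norm_nonneg)
  also have "\<dots> < \<infinity>" by simp
  finally have fin: "(\<integral>\<^sup>+x. (\<Sum>j. ennreal (G j x)) \<partial>lebesgue_on S) \<noteq> \<infinity>" by simp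
  have ae: "AE x in lebesgue_on S. convergent (\<lambda>j. F (r j) x)"
  proof -
    have "AE x in lebesgue_on S. (\<Sum>j. ennreal (G j x)) \<noteq> \<infinity>"
      by (rule nn_integral_PInf_AE[OF _ fin]) measurable
    then show ?thesis
    proof eventually_elim
      case (elim x)
      have "summable (\<lambda>j. G j x)"
        by (rule summable_suminf_not_top) (use elim in \<open>auto simp: G_def\<close>)
      then have "summable (\<lambda>j. F (r (Suc j)) x - F (r j) x)"
        unfolding G_def by (rule summable_norm_cancel)
      then have "convergent (\<lambda>n. \<Sum>j<n. F (r (Suc j)) x - F (r j) x)"
        by (simp add: summable_iff_convergent)
      then have "convergent (\<lambda>n. F (r n) x - F (r 0) x)"
        by (simp add: sum_lessThan_telescope[of "\<lambda>j. F (r j) x"])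
      then have "convergent (\<lambda>n. F (r n) x - F (r 0) x + F (r 0) x)"
        by (intro convergent_add convergent_const)
      then show ?case by simp
    qed
  qed
  define f where "f x = lim (\<lambda>j. F (r j) x)" for x
  have fm[measurable]: "f \<in> borel_measurable (lebesgue_on S)"
    unfolding f_def by (rule borel_measurable_lim_metric) (rule meas)
  have ae': "AE x in lebesgue_on S. (\<lambda>j. F (r j) x) \<longlonglongrightarrow> f x"
    using ae unfolding f_def by eventually_elim (simp add: convergent_LIMSEQ_iff)
  \<comment> \<open>Fatou's lemma for fixed \<open>k\<close>, with the index of the subsequence
    tending to infinity.\<close>
  have key: "(\<lambda>x. F k x - f x) \<in> L2 S \<and> L2_norm S (\<lambda>x. F k x - f x) \<le> (1/2)^i" if k: "k \<ge> N i" for i k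
  proof -
    have "(\<integral>\<^sup>+x. ennreal ((cmod (F k x - f x))\<^sup>2) \<partial>lebesgue_on S)
        \<le> (\<integral>\<^sup>+x. liminf (\<lambda>j. ennreal ((cmod (F k x - F (r j) x))\<^sup>2)) \<partial>lebesgue_on S)"
    proof (rule nn_integral_mono_AE)
      show "AE x in lebesgue_on S. ennreal ((cmod (F k x - f x))\<^sup>2) \<le> liminf (\<lambda>j. ennreal ((cmod (F k x - F (r j) x))\<^sup>2))"
        using ae'
      proof eventually_elim
        case (elim x)
        have "(\<lambda>j. ennreal ((cmod (F k x - F (r j) x))\<^sup>2)) \<longlonglongrightarrow> ennreal ((cmod (F k x - f x))\<^sup>2)"
          by (intro tendsto_ennrealI tendsto_power tendsto_norm tendsto_diff tendsto_const elim)
        then have "liminf (\<lambda>j. ennreal ((cmod (F k x - F (r j) x))\<^sup>2)) = ennreal ((cmod (F k x - f x))\<^sup>2)"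
          by (rule lim_imp_Liminf[rotated]) simp
        then show ?case by simp
      qed
    qed
    also have "\<dots> \<le> liminf (\<lambda>j. (\<integral>\<^sup>+x. ennreal ((cmod (F k x - F (r j) x))\<^sup>2) \<partial>lebesgue_on S))"
      by (rule nn_integral_liminf) measurable
    also have "\<dots> \<le> liminf (\<lambda>j::nat. ennreal (((1/2)^i)\<^sup>2))"
    proof (rule Liminf_mono)
      show "\<forall>\<^sub>F j in sequentially. (\<integral>\<^sup>+x. ennreal ((cmod (F k x - F (r j) x))\<^sup>2) \<partial>lebesgue_on S) \<le> ennreal (((1/2)^i)\<^sup>2)"
        using eventually_ge_at_top[of "N i"]
      proof eventually_elim
        case (elim j)
        have "r j \<ge> N i" using elim unfolding r_def by simp
        then have "L2_norm S (\<lambda>x. F k x - F (r j) x) < (1/2)^i" using N k by blast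
        then have "(L2_norm S (\<lambda>x. F k x - F (r j) x))\<^sup>2 \<le> ((1/2)^i)\<^sup>2"
          by (intro power_mono L2_norm_nonneg) simp
        moreover have "(\<integral>\<^sup>+x. ennreal ((cmod (F k x - F (r j) x))\<^sup>2) \<partial>lebesgue_on S)
            = ennreal ((L2_norm S (\<lambda>x. F k x - F (r j) x))\<^sup>2)"
          unfolding L2_norm_sq
          by (rule nn_integral_eq_integral[OF L2_integrable_sq[OF L2_diff[OF F F]]]) simp
        ultimately show ?case by (simp add: ennreal_leI)
      qed
    qed
    also have "\<dots> = ennreal (((1/2)^i)\<^sup>2)" by (rule Liminf_const) simp
    finally have le: "(\<integral>\<^sup>+x. ennreal ((cmod (F k x - f x))\<^sup>2) \<partial>lebesgue_on S) \<le> ennreal (((1/2)^i)\<^sup>2)" .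
    have int: "integrable (lebesgue_on S) (\<lambda>x. (cmod (F k x - f x))\<^sup>2)"
    proof (rule integrableI_nonneg)
      show "(\<integral>\<^sup>+x. ennreal ((cmod (F k x - f x))\<^sup>2) \<partial>lebesgue_on S) < \<infinity>"
        using le by (rule le_less_trans) simp
    qed simp_all
    then have L: "(\<lambda>x. F k x - f x) \<in> L2 S" by (simp add: L2_def)
    have "ennreal ((L2_norm S (\<lambda>x. F k x - f x))\<^sup>2) \<le> ennreal (((1/2)^i)\<^sup>2)"
      using le nn_integral_eq_integral[OF int] unfolding L2_norm_sq by simp
    then have "(L2_norm S (\<lambda>x. F k x - f x))\<^sup>2 \<le> ((1/2)^i)\<^sup>2" by (subst (asm) ennreal_le_iff) simp_all
    then have "L2_norm S (\<lambda>x. F k x - f x) \<le> (1/2)^i" by (rule power2_le_imp_le) simp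
    with L show ?thesis by simp
  qed
  have fL: "f \<in> L2 S"
    using L2_diff[OF F[of "N 0"] conjunct1[OF key[of 0 "N 0"]]] by simp
  have "(\<lambda>k. L2_norm S (\<lambda>x. F k x - f x)) \<longlonglongrightarrow> 0"
  proof (rule LIMSEQ_I)
    fix e :: real assume "e > 0"
    then obtain i where i: "(1/2)^i < e" using real_arch_pow_inv[of e "1/2"] by auto
    show "\<exists>no. \<forall>n\<ge>no. norm (L2_norm S (\<lambda>x. F n x - f x) - 0) < e"
    proof (intro exI[of _ "N i"] allI impI)
      fix n assume "N i \<le> n"
      then have "L2_norm S (\<lambda>x. F n x - f x) < e" using key[of i n] i by simp
      then show "norm (L2_norm S (\<lambda>x. F n x - f x) - 0) < e" using L2_norm_nonneg[of S] by simp
    qed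
  qed
  then show ?thesis using F fL unfolding L2_tendsto_def by blast
qed

section \<open>Orthogonality for unnormalised families\<close>

definition L2_inner :: "'a::euclidean_space set \<Rightarrow> ('a \<Rightarrow> complex) \<Rightarrow> ('a \<Rightarrow> complex) \<Rightarrow> complex" where
  "L2_inner S f g = lebint S (\<lambda>x. f x * cnj (g x))"

lemma L2_inner_integrable:
  "f \<in> L2 S \<Longrightarrow> g \<in> L2 S \<Longrightarrow> integrable (lebesgue_on S) (\<lambda>x. f x * cnj (g x))"
  by (rule L2_mult_integrable[OF _ L2_cnj])

lemma L2_inner_sum_left:
  assumes "\<And>i. i \<in> I \<Longrightarrow> f i \<in> L2 S" "g \<in> L2 S"
  shows "L2_inner S (\<lambda>x. \<Sum>i\<in>I. a i * f i x) g = (\<Sum>i\<in>I. a i * L2_inner S (f i) g)"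
proof -
  have "L2_inner S (\<lambda>x. \<Sum>i\<in>I. a i * f i x) g = lebint S (\<lambda>x. \<Sum>i\<in>I. a i * (f i x * cnj (g x)))"
    unfolding L2_inner_def by (simp only: sum_distrib_right mult.assoc)
  also have "\<dots> = (\<Sum>i\<in>I. lebint S (\<lambda>x. a i * (f i x * cnj (g x))))"
    by (rule Bochner_Integration.integral_sum) (intro integrable_mult_right L2_inner_integrable assms, assumption)
  finally show ?thesis by (simp add: L2_inner_def)
qed

lemma L2_inner_commute: "L2_inner S f g = cnj (L2_inner S g f)"
proof -
  have "cnj (L2_inner S g f) = lebint S (\<lambda>x. cnj (g x * cnj (f x)))"
    unfolding L2_inner_def using Bochner_Integration.integral_cnj[of "lebesgue_on S" "\<lambda>x. g x * cnj (f x)"] by (simp only:)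
  then show ?thesis by (simp add: L2_inner_def mult.commute)
qed

lemma L2_pythagoras:
  assumes f: "f \<in> L2 S" and g: "g \<in> L2 S" and o: "L2_inner S f g = 0"
  shows "(L2_norm S (\<lambda>x. f x + g x))\<^sup>2 = (L2_norm S f)\<^sup>2 + (L2_norm S g)\<^sup>2"
proof -
  have e: "(cmod (a + b))\<^sup>2 = (cmod a)\<^sup>2 + (cmod b)\<^sup>2 + 2 * Re (a * cnj b)" for a b :: complex
    unfolding cmod_power2 by (simp add: power2_eq_square algebra_simps)
  have i: "integrable (lebesgue_on S) (\<lambda>x. Re (f x * cnj (g x)))"
    by (rule integrable_Re[OF L2_inner_integrable[OF f g]])
  have "lebint S (\<lambda>x. Re (f x * cnj (g x))) = Re (L2_inner S f g)"
    unfolding L2_inner_def by (rule integral_Re[OF L2_inner_integrable[OF f g]])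
  then have z: "lebint S (\<lambda>x. Re (f x * cnj (g x))) = 0" using o by simp
  show ?thesis
    unfolding L2_norm_sq e
    using L2_integrable_sq[OF f] L2_integrable_sq[OF g] i z
    by (simp only: Bochner_Integration.integral_add Bochner_Integration.integrable_add integrable_mult_right integral_mult_right_zero)
qed

lemma L2_pythagoras_sum:
  assumes "finite I" and e: "\<And>i. i \<in> I \<Longrightarrow> e i \<in> L2 S"
    and o: "\<And>i j. i \<in> I \<Longrightarrow> j \<in> I \<Longrightarrow> i \<noteq> j \<Longrightarrow> L2_inner S (e i) (e j) = 0"
  shows "(L2_norm S (\<lambda>x. \<Sum>i\<in>I. a i * e i x))\<^sup>2 = (\<Sum>i\<in>I. (cmod (a i))\<^sup>2 * (L2_norm S (e i))\<^sup>2)"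
  using assms
proof (induction I rule: finite_induct)
  case empty
  then show ?case by (simp add: L2_norm_def)
next
  case (insert i I)
  have "L2_inner S (\<lambda>x. \<Sum>j\<in>I. a j * e j x) (\<lambda>x. a i * e i x) = (\<Sum>j\<in>I. a j * L2_inner S (e j) (\<lambda>x. a i * e i x))"
    by (rule L2_inner_sum_left) (use insert.prems(1) L2_cmult in auto)
  also have "\<dots> = 0"
  proof (rule sum.neutral, rule ballI)
    fix j assume j: "j \<in> I"
    have "L2_inner S (e j) (\<lambda>x. a i * e i x) = cnj (a i) * L2_inner S (e j) (e i)"
      by (simp add: L2_inner_def mult.left_commute)
    then show "a j * L2_inner S (e j) (\<lambda>x. a i * e i x) = 0"
      using insert.prems(2)[of j i] insert.hyps j by auto
  qed
  finally have z: "L2_inner S (\<lambda>x. \<Sum>j\<in>I. a j * e j x) (\<lambda>x. a i * e i x) = 0" .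
  have m: "(\<lambda>x. \<Sum>j\<in>I. a j * e j x) \<in> L2 S" "(\<lambda>x. a i * e i x) \<in> L2 S"
    using insert.prems(1) by (auto intro!: L2_sum L2_cmult)
  show ?case
    using L2_pythagoras[OF m z] insert
    by (simp add: L2_norm_cmult power_mult_distrib add.commute)
qed

text \<open>The sum \<open>w\<close> is the orthogonal projection of \<open>u\<close> on the span:
  \<open>u - w\<close> is orthogonal to every \<open>e i\<close>, hence to \<open>w\<close>, and
  Pythagoras applies. The vectors stay unnormalised because the norms of the modes are themselves
  part of the later estimates.\<close>

lemma L2_bessel:
  assumes fin: "finite I" and e: "\<And>i. i \<in> I \<Longrightarrow> e i \<in> L2 S" and u: "u \<in> L2 S"
    and o: "\<And>i j. i \<in> I \<Longrightarrow> j \<in> I \<Longrightarrow> i \<noteq> j \<Longrightarrow> L2_inner S (e i) (e j) = 0"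
    and n: "\<And>i. i \<in> I \<Longrightarrow> L2_norm S (e i) \<noteq> 0"
  shows "(\<Sum>i\<in>I. (cmod (L2_inner S u (e i)))\<^sup>2 / (L2_norm S (e i))\<^sup>2) \<le> (L2_norm S u)\<^sup>2"
proof -
  define a where "a i = L2_inner S u (e i) / of_real ((L2_norm S (e i))\<^sup>2)" for i
  define w where "w x = (\<Sum>i\<in>I. a i * e i x)" for x
  have wL: "w \<in> L2 S" unfolding w_def using e by (auto intro!: L2_sum L2_cmult)
  have ee: "L2_inner S (e i) (e i) = of_real ((L2_norm S (e i))\<^sup>2)" for i
    unfolding L2_inner_def L2_norm_sq
    by (simp only: complex_norm_square[symmetric] of_real_power[symmetric] integral_complex_of_real)
  have we: "L2_inner S w (e j) = L2_inner S u (e j)" if j: "j \<in> I" for j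
  proof -
    have "L2_inner S w (e j) = (\<Sum>i\<in>I. a i * L2_inner S (e i) (e j))"
      unfolding w_def by (rule L2_inner_sum_left) (use e j in auto)
    also have "\<dots> = (\<Sum>i\<in>I. if i = j then a j * L2_inner S (e j) (e j) else 0)"
      by (rule sum.cong) (use o j in auto)
    also have "\<dots> = a j * L2_inner S (e j) (e j)" using fin j by simp
    also have "\<dots> = L2_inner S u (e j)" using n[OF j] by (simp add: ee a_def)
    finally show ?thesis .
  qed
  define v where "v x = u x - w x" for x
  have vL: "v \<in> L2 S" unfolding v_def by (rule L2_diff[OF u wL])
  have ve: "L2_inner S v (e j) = 0" if j: "j \<in> I" for j
  proof -
    have "L2_inner S v (e j) = lebint S (\<lambda>x. u x * cnj (e j x) - w x * cnj (e j x))"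
      unfolding L2_inner_def v_def by (simp only: left_diff_distrib)
    also have "\<dots> = L2_inner S u (e j) - L2_inner S w (e j)"
      unfolding L2_inner_def
      by (rule Bochner_Integration.integral_diff[OF L2_inner_integrable[OF u e[OF j]] L2_inner_integrable[OF wL e[OF j]]])
    finally show ?thesis using we[OF j] by simp
  qed
  have "L2_inner S w v = (\<Sum>i\<in>I. a i * L2_inner S (e i) v)"
    unfolding w_def by (rule L2_inner_sum_left) (use e vL in auto)
  also have "\<dots> = 0"
  proof (rule sum.neutral, rule ballI)
    fix i assume "i \<in> I"
    then show "a i * L2_inner S (e i) v = 0" using ve L2_inner_commute[of S "e i" v] by simp
  qed
  finally have wv: "L2_inner S w v = 0" .
  have "(L2_norm S u)\<^sup>2 = (L2_norm S w)\<^sup>2 + (L2_norm S v)\<^sup>2"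
    using L2_pythagoras[OF wL vL wv] by (simp add: v_def)
  moreover have "(L2_norm S w)\<^sup>2 = (\<Sum>i\<in>I. (cmod (a i))\<^sup>2 * (L2_norm S (e i))\<^sup>2)"
    unfolding w_def by (rule L2_pythagoras_sum[OF fin e o])
  moreover have "(cmod (a i))\<^sup>2 * (L2_norm S (e i))\<^sup>2 = (cmod (L2_inner S u (e i)))\<^sup>2 / (L2_norm S (e i))\<^sup>2" if "i \<in> I" for i
    using n[OF that] by (simp add: a_def norm_divide power_divide norm_mult power2_eq_square)
  ultimately show ?thesis by simp
qed

section \<open>Smooth functions on the plane\<close>


lemma pderiv_at_eq: "(f has_derivative D) (at x) \<Longrightarrow> pderiv_at i f x = D (axis i 1)"
  unfolding pderiv_at_def by (drule frechet_derivative_at) simp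

lemma pderiv_at_add:
  assumes "f differentiable (at x)" "g differentiable (at x)"
  shows "pderiv_at i (\<lambda>y. f y + g y) x = pderiv_at i f x + pderiv_at i g x"
  using pderiv_at_eq[OF has_derivative_add[OF iffD1[OF frechet_derivative_works, OF assms(1)] iffD1[OF frechet_derivative_works, OF assms(2)]]]
  by (simp add: pderiv_at_def)

lemma pderiv_at_mult:
  assumes "f differentiable (at x)" "g differentiable (at x)"
  shows "pderiv_at i (\<lambda>y. f y * g y) x = f x * pderiv_at i g x + pderiv_at i f x * g x"
  using pderiv_at_eq[OF has_derivative_mult[OF iffD1[OF frechet_derivative_works, OF assms(1)] iffD1[OF frechet_derivative_works, OF assms(2)]]]
  by (simp add: pderiv_at_def)

lemma pderiv_at_const: "pderiv_at i (\<lambda>_. c) x = 0"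
  using pderiv_at_eq[OF has_derivative_const] by simp

lemma pderiv_at_cong_open:
  assumes "open S" "x \<in> S" "\<And>y. y \<in> S \<Longrightarrow> f y = g y" "f differentiable (at x)"
  shows "pderiv_at i g x = pderiv_at i f x"
  using pderiv_at_eq[OF has_derivative_transform_within_open[OF iffD1[OF frechet_derivative_works, OF assms(4)] assms(1,2,3)]]
  by (simp add: pderiv_at_def)

text \<open>The recursion for \<open>Ck\<close> demands nothing of lower orders explicitly; they are
  recovered because differentiability at the last level yields continuity.\<close>

lemma Ck_SucD: "Ck (Suc k) f \<Longrightarrow> Ck k f"
proof (induction k arbitrary: f)
  case 0
  then show ?case
    by (simp add: continuous_at_imp_continuous_on differentiable_imp_continuous_within)
next
  case (Suc k)
  then show ?case by simp
qed

lemma Ck_continuous: "Ck k f \<Longrightarrow> continuous_on UNIV f"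
  by (induction k) (use Ck_SucD in auto)

lemma Ck_const: "Ck k (\<lambda>_. c)"
proof (induction k arbitrary: c)
  case (Suc k)
  have "pderiv_at i (\<lambda>_. c) = (\<lambda>_. 0)" for i by (rule ext) (rule pderiv_at_const)
  then show ?case using Suc by simp
qed simp

lemma Ck_add: "Ck k f \<Longrightarrow> Ck k g \<Longrightarrow> Ck k (\<lambda>x. f x + g x)"
proof (induction k arbitrary: f g)
  case 0
  then show ?case by (simp add: continuous_on_add)
next
  case (Suc k)
  have "pderiv_at i (\<lambda>x. f x + g x) = (\<lambda>x. pderiv_at i f x + pderiv_at i g x)" for i
    using Suc.prems by (intro ext pderiv_at_add) auto
  then show ?case using Suc by auto
qed

text \<open>Leibniz' rule pairs derivatives, which are of order \<open>k\<close>, with the factors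
  themselves, which are of order \<open>k\<close> by \<open>Ck_SucD\<close>; so the induction
  closes.\<close>

lemma Ck_mult: "Ck k f \<Longrightarrow> Ck k g \<Longrightarrow> Ck k (\<lambda>x. f x * g x)"
proof (induction k arbitrary: f g)
  case 0
  then show ?case by (simp add: continuous_on_mult)
next
  case (Suc k)
  have "pderiv_at i (\<lambda>x. f x * g x) = (\<lambda>x. f x * pderiv_at i g x + pderiv_at i f x * g x)" for i
    using Suc.prems by (intro ext pderiv_at_mult) auto
  moreover have "Ck k f" "Ck k g" using Suc.prems Ck_SucD by auto
  ultimately show ?case using Suc Ck_add by auto
qed

lemma smooth_const: "smooth (\<lambda>_. c)"
  by (simp add: smooth_def Ck_const)

lemma smooth_add: "smooth f \<Longrightarrow> smooth g \<Longrightarrow> smooth (\<lambda>x. f x + g x)"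
  by (simp add: smooth_def Ck_add)

lemma smooth_mult: "smooth f \<Longrightarrow> smooth g \<Longrightarrow> smooth (\<lambda>x. f x * g x)"
  by (simp add: smooth_def Ck_mult)

lemma smooth_uminus: "smooth f \<Longrightarrow> smooth (\<lambda>x. - f x)"
  using smooth_mult[OF smooth_const[of "-1"]] by simp

lemma smooth_diff: "smooth f \<Longrightarrow> smooth g \<Longrightarrow> smooth (\<lambda>x. f x - g x)"
  using smooth_add[OF _ smooth_uminus] by fastforce

lemma smooth_sum: "(\<And>i. i \<in> I \<Longrightarrow> smooth (f i)) \<Longrightarrow> smooth (\<lambda>x. \<Sum>i\<in>I. f i x)"
proof (induction I rule: infinite_finite_induct)
  case (insert i I)
  then show ?case using smooth_add[of "f i" "\<lambda>x. \<Sum>i\<in>I. f i x"] by simp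
qed (simp_all add: smooth_const)

lemma smooth_prod: "(\<And>i. i \<in> I \<Longrightarrow> smooth (f i)) \<Longrightarrow> smooth (\<lambda>x. \<Prod>i\<in>I. f i x)"
proof (induction I rule: infinite_finite_induct)
  case (insert i I)
  then show ?case using smooth_mult[of "f i" "\<lambda>x. \<Prod>i\<in>I. f i x"] by simp
qed (simp_all add: smooth_const)

lemma smooth_power: "smooth f \<Longrightarrow> smooth (\<lambda>x. f x ^ n)"
proof (induction n)
  case (Suc n)
  then show ?case using smooth_mult[of f "\<lambda>x. f x ^ n"] by simp
qed (simp add: smooth_const)

lemma smooth_differentiable: "smooth f \<Longrightarrow> f differentiable (at x)"
  unfolding smooth_def by (metis Ck.simps(2))

lemma smooth_pderiv: "smooth f \<Longrightarrow> smooth (pderiv_at i f)"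
  unfolding smooth_def by (metis Ck.simps(2))

lemma smooth_continuous: "smooth f \<Longrightarrow> continuous_on UNIV f"
  unfolding smooth_def using Ck_continuous by blast

lemma pderiv_at_sum:
  assumes "\<And>i. i \<in> I \<Longrightarrow> smooth (f i)"
  shows "pderiv_at j (\<lambda>y. \<Sum>i\<in>I. f i y) x = (\<Sum>i\<in>I. pderiv_at j (f i) x)"
  using assms
proof (induction I rule: infinite_finite_induct)
  case (insert i I)
  have "pderiv_at j (\<lambda>y. f i y + (\<Sum>i\<in>I. f i y)) x = pderiv_at j (f i) x + pderiv_at j (\<lambda>y. \<Sum>i\<in>I. f i y) x"
    by (rule pderiv_at_add) (use insert.prems in \<open>auto intro!: smooth_differentiable smooth_sum\<close>)
  then show ?case using insert by simp
qed (simp_all add: pderiv_at_const)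

lemma has_derivative_coord: "((\<lambda>x::real^2. complex_of_real (x $ i)) has_derivative (\<lambda>h. complex_of_real (h $ i))) (at x)"
  by (intro bounded_linear_imp_has_derivative bounded_linear_compose[OF bounded_linear_of_real] bounded_linear_vec_nth)

lemma pderiv_at_coord: "pderiv_at j (\<lambda>x. complex_of_real (x $ i)) x = (if i = j then 1 else 0)"
  using pderiv_at_eq[OF has_derivative_coord[of i x], of j] by (simp add: axis_def)

lemma smooth_coord: "smooth (\<lambda>x. complex_of_real (x $ i))"
  unfolding smooth_def
proof
  fix k show "Ck k (\<lambda>x. complex_of_real (x $ i))"
  proof (cases k)
    case 0
    then show ?thesis by (auto intro!: continuous_intros)
  next
    case (Suc m)
    have "pderiv_at j (\<lambda>x. complex_of_real (x $ i)) = (\<lambda>x. if i = j then 1 else 0)" for j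
      by (rule ext) (rule pderiv_at_coord)
    moreover have "(\<lambda>x. complex_of_real (x $ i)) differentiable (at x)" for x
      using has_derivative_coord unfolding differentiable_def by blast
    ultimately show ?thesis using Suc by (auto intro: Ck_const)
  qed
qed

section \<open>Smooth functions of one real variable\<close>

text \<open>The set matters because radial profiles can be singular at \<open>0\<close>. As
  \<open>deriv\<close> looks at a whole neighbourhood, most rules below take open sets.\<close>

fun CkR :: "nat \<Rightarrow> real set \<Rightarrow> (real \<Rightarrow> real) \<Rightarrow> bool" where
  "CkR 0 S f \<longleftrightarrow> continuous_on S f"
| "CkR (Suc k) S f \<longleftrightarrow> (\<forall>x\<in>S. f differentiable (at x)) \<and> CkR k S (deriv f)"

definition smoothR :: "real set \<Rightarrow> (real \<Rightarrow> real) \<Rightarrow> bool" where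
  "smoothR S f \<longleftrightarrow> (\<forall>k. CkR k S f)"

lemma CkR_SucD: "CkR (Suc k) S f \<Longrightarrow> CkR k S f"
proof (induction k arbitrary: f)
  case 0
  then show ?case
    by (auto intro!: continuous_at_imp_continuous_on differentiable_imp_continuous_within)
next
  case (Suc k)
  then show ?case by simp
qed

lemma deriv_cong_open:
  fixes f g :: "real \<Rightarrow> real"
  assumes "open S" "x \<in> S" "\<And>y. y \<in> S \<Longrightarrow> f y = g y"
  shows "deriv f x = deriv g x"
proof (rule deriv_cong_ev)
  show "\<forall>\<^sub>F x in nhds x. f x = g x"
    using eventually_nhds_in_open[OF assms(1,2)] by eventually_elim (rule assms(3))
qed simp

lemma CkR_cong:
  assumes "open S" "\<And>x. x \<in> S \<Longrightarrow> f x = g x" "CkR k S f"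
  shows "CkR k S g"
  using assms(2,3)
proof (induction k arbitrary: f g)
  case 0
  then show ?case using continuous_on_cong[of S S f g] by simp
next
  case (Suc k)
  have "g differentiable (at x)" if "x \<in> S" for x
  proof -
    have "f differentiable (at x)" using Suc.prems that by simp
    then obtain D where "(f has_derivative D) (at x)" unfolding differentiable_def by blast
    then have "(g has_derivative D) (at x)"
      by (rule has_derivative_transform_within_open[OF _ assms(1) that]) (rule Suc.prems(1))
    then show ?thesis unfolding differentiable_def by blast
  qed
  moreover have "CkR k S (deriv g)"
  proof (rule Suc.IH)
    show "deriv f x = deriv g x" if "x \<in> S" for x
      by (rule deriv_cong_open[OF assms(1) that Suc.prems(1)])
    show "CkR k S (deriv f)" using Suc.prems(2) by simp
  qed
  ultimately show ?case by simp
qed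

text \<open>Any candidate for the derivative may be supplied, since \<open>deriv f\<close> and
  \<open>f'\<close> coincide on the open set and so are equally smooth. Most concrete smoothness
  proofs use this rule.\<close>

lemma CkR_SucI:
  assumes "open S" "\<And>x. x \<in> S \<Longrightarrow> (f has_real_derivative f' x) (at x)" "CkR k S f'"
  shows "CkR (Suc k) S f"
proof -
  have "CkR k S (deriv f)"
    by (rule CkR_cong[OF assms(1) _ assms(3)]) (use assms(2) DERIV_imp_deriv in metis)
  moreover have "f differentiable (at x)" if "x \<in> S" for x
    using assms(2)[OF that] real_differentiable_def by blast
  ultimately show ?thesis by simp
qed

lemma CkR_const: "open S \<Longrightarrow> CkR k S (\<lambda>_. c)"
proof (induction k arbitrary: c)
  case (Suc k)
  show ?case by (rule CkR_SucI[OF Suc.prems DERIV_const Suc.IH[OF Suc.prems]])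
qed simp

lemma CkR_DERIV: "CkR (Suc k) S f \<Longrightarrow> x \<in> S \<Longrightarrow> (f has_real_derivative deriv f x) (at x)"
  using DERIV_deriv_iff_real_differentiable by auto

lemma CkR_add: "open S \<Longrightarrow> CkR k S f \<Longrightarrow> CkR k S g \<Longrightarrow> CkR k S (\<lambda>x. f x + g x)"
proof (induction k arbitrary: f g)
  case 0
  then show ?case by (simp add: continuous_on_add)
next
  case (Suc k)
  show ?case
  proof (rule CkR_SucI[OF Suc.prems(1)])
    fix x assume "x \<in> S"
    then show "((\<lambda>x. f x + g x) has_real_derivative deriv f x + deriv g x) (at x)"
      by (intro DERIV_add CkR_DERIV[OF Suc.prems(2)] CkR_DERIV[OF Suc.prems(3)])
  next
    show "CkR k S (\<lambda>x. deriv f x + deriv g x)" using Suc by simp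
  qed
qed

lemma CkR_mult: "open S \<Longrightarrow> CkR k S f \<Longrightarrow> CkR k S g \<Longrightarrow> CkR k S (\<lambda>x. f x * g x)"
proof (induction k arbitrary: f g)
  case 0
  then show ?case by (simp add: continuous_on_mult)
next
  case (Suc k)
  show ?case
  proof (rule CkR_SucI[OF Suc.prems(1)])
    fix x assume x: "x \<in> S"
    show "((\<lambda>x. f x * g x) has_real_derivative deriv f x * g x + deriv g x * f x) (at x)"
      by (rule DERIV_mult[OF CkR_DERIV[OF Suc.prems(2) x] CkR_DERIV[OF Suc.prems(3) x]])
  next
    show "CkR k S (\<lambda>x. deriv f x * g x + deriv g x * f x)"
      using Suc CkR_SucD by (intro CkR_add Suc.IH) auto
  qed
qed

lemma CkR_inverse: "open S \<Longrightarrow> (\<And>x. x \<in> S \<Longrightarrow> f x \<noteq> 0) \<Longrightarrow> CkR k S f \<Longrightarrow> CkR k S (\<lambda>x. inverse (f x))"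
proof (induction k arbitrary: f)
  case 0
  then show ?case by (simp add: continuous_on_inverse)
next
  case (Suc k)
  show ?case
  proof (rule CkR_SucI[OF Suc.prems(1)])
    fix x assume x: "x \<in> S"
    show "((\<lambda>x. inverse (f x)) has_real_derivative - 1 * (deriv f x * (inverse (f x) * inverse (f x)))) (at x)"
      using DERIV_inverse_fun[OF CkR_DERIV[OF Suc.prems(3) x] Suc.prems(2)[OF x]]
      by (simp add: power2_eq_square mult.commute numeral_2_eq_2)
  next
    have "CkR k S (\<lambda>x. inverse (f x))" by (rule Suc.IH) (use Suc.prems CkR_SucD in auto)
    then show "CkR k S (\<lambda>x. - 1 * (deriv f x * (inverse (f x) * inverse (f x))))"
      using Suc.prems by (intro CkR_mult CkR_const) auto
  qed
qed

lemma CkR_id: "open S \<Longrightarrow> CkR k S (\<lambda>x. x)"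
proof (cases k)
  case (Suc m)
  assume S: "open S"
  show ?thesis unfolding Suc by (rule CkR_SucI[OF S DERIV_ident CkR_const[OF S]])
qed simp

text \<open>Differentiation only shifts the exponent, so the induction closes for arbitrary
  \<open>p\<close>.\<close>

lemma CkR_powr: "CkR k {0<..} (\<lambda>x. x powr p)"
proof (induction k arbitrary: p)
  case 0
  then show ?case by (auto intro!: continuous_intros)
next
  case (Suc k)
  show ?case
  proof (rule CkR_SucI)
    fix x :: real assume "x \<in> {0<..}"
    then show "((\<lambda>x. x powr p) has_real_derivative p * x powr (p - 1)) (at x)"
      by (auto intro!: derivative_eq_intros)
  next
    show "CkR k {0<..} (\<lambda>x. p * x powr (p - 1))" by (intro CkR_mult CkR_const Suc.IH) auto
  qed simp
qed

lemma CkR_subset: "CkR k S f \<Longrightarrow> T \<subseteq> S \<Longrightarrow> CkR k T f"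
  by (induction k arbitrary: f) (auto intro: continuous_on_subset)

lemma CkR_Un: "open S \<Longrightarrow> open T \<Longrightarrow> CkR k S f \<Longrightarrow> CkR k T f \<Longrightarrow> CkR k (S \<union> T) f"
  by (induction k arbitrary: f) (auto intro: continuous_on_open_Un)

lemma CkR_affine: "CkR k UNIV f \<Longrightarrow> CkR k UNIV (\<lambda>x. f (a * x + b))"
proof (induction k arbitrary: f)
  case 0
  then show ?case by (auto intro!: continuous_intros continuous_on_compose2[of UNIV f])
next
  case (Suc k)
  show ?case
  proof (rule CkR_SucI[OF open_UNIV])
    fix x
    have "((\<lambda>x. a * x + b) has_real_derivative a) (at x)" by (auto intro!: derivative_eq_intros)
    from DERIV_chain'[OF this CkR_DERIV[OF Suc.prems]]
    show "((\<lambda>x. f (a * x + b)) has_real_derivative a * deriv f (a * x + b)) (at x)"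
      by (simp add: mult.commute)
  next
    show "CkR k UNIV (\<lambda>x. a * deriv f (a * x + b))"
      using Suc by (intro CkR_mult CkR_const) auto
  qed
qed

lemma smoothR_const: "open S \<Longrightarrow> smoothR S (\<lambda>_. c)"
  by (simp add: smoothR_def CkR_const)
lemma smoothR_id: "open S \<Longrightarrow> smoothR S (\<lambda>x. x)"
  by (simp add: smoothR_def CkR_id)
lemma smoothR_add: "open S \<Longrightarrow> smoothR S f \<Longrightarrow> smoothR S g \<Longrightarrow> smoothR S (\<lambda>x. f x + g x)"
  by (simp add: smoothR_def CkR_add)
lemma smoothR_mult: "open S \<Longrightarrow> smoothR S f \<Longrightarrow> smoothR S g \<Longrightarrow> smoothR S (\<lambda>x. f x * g x)"
  by (simp add: smoothR_def CkR_mult)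
lemma smoothR_diff: "open S \<Longrightarrow> smoothR S f \<Longrightarrow> smoothR S g \<Longrightarrow> smoothR S (\<lambda>x. f x - g x)"
  using smoothR_add[of S f "\<lambda>x. -1 * g x"] smoothR_mult[of S "\<lambda>x. -1" g] smoothR_const[of S "-1"] by simp
lemma smoothR_cong: "open S \<Longrightarrow> (\<And>x. x \<in> S \<Longrightarrow> f x = g x) \<Longrightarrow> smoothR S f \<Longrightarrow> smoothR S g"
  unfolding smoothR_def using CkR_cong by blast
lemma smoothR_subset: "smoothR S f \<Longrightarrow> T \<subseteq> S \<Longrightarrow> smoothR T f"
  unfolding smoothR_def using CkR_subset by blast
lemma smoothR_Un: "open S \<Longrightarrow> open T \<Longrightarrow> smoothR S f \<Longrightarrow> smoothR T f \<Longrightarrow> smoothR (S \<union> T) f"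
  unfolding smoothR_def using CkR_Un by blast
lemma smoothR_powr: "smoothR {0<..} (\<lambda>x. x powr p)"
  by (simp add: smoothR_def CkR_powr)
lemma smoothR_antiderivative:
  assumes "open S" "\<And>x. x \<in> S \<Longrightarrow> (f has_real_derivative f' x) (at x)" "smoothR S f'"
  shows "smoothR S f"
  unfolding smoothR_def
proof
  fix k show "CkR k S f"
    using CkR_SucD[OF CkR_SucI[OF assms(1,2)]] assms(3) unfolding smoothR_def by blast
qed

section \<open>Cutoff functions\<close>

text \<open>The powers of \<open>inverse x\<close> are included because the derivatives of
  \<open>exp (- 1 / x)\<close> are combinations of such terms: the span of the family is closed
  under differentiation.\<close>

definition flat_exp :: "nat \<Rightarrow> real \<Rightarrow> real" where
  "flat_exp n x = (if x > 0 then inverse x ^ n * exp (- inverse x) else 0)"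

lemma flat_exp_lim0: "((\<lambda>x. flat_exp n x) \<longlongrightarrow> 0) (at 0)"
proof -
  have r: "((\<lambda>x. flat_exp n x) \<longlongrightarrow> 0) (at_right 0)"
  proof (rule Lim_transform_eventually)
    have "((\<lambda>y::real. y ^ n / exp y) \<longlongrightarrow> 0) at_top" by (rule tendsto_power_div_exp_0)
    from filterlim_compose[OF this filterlim_inverse_at_top_right]
    show "((\<lambda>x::real. inverse x ^ n / exp (inverse x)) \<longlongrightarrow> 0) (at_right 0)" .
    show "\<forall>\<^sub>F x in at_right 0. inverse x ^ n / exp (inverse x) = flat_exp n x"
      by (rule eventually_at_right_less[THEN eventually_mono]) (simp add: flat_exp_def exp_minus divide_inverse)
  qed
  have l: "((\<lambda>x. flat_exp n x) \<longlongrightarrow> 0) (at_left 0)"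
    by (rule tendsto_eventually, rule eventually_at_leftI[of "-1"]) (auto simp: flat_exp_def)
  show ?thesis using filterlim_split_at[OF l r] by simp
qed

lemma flat_exp_DERIV: "(flat_exp n has_real_derivative flat_exp (n + 2) x - real n * flat_exp (n + 1) x) (at x)"
proof -
  consider "x > 0" | "x < 0" | "x = 0" by linarith
  then show ?thesis
  proof cases
    case 1
    have "((\<lambda>x. inverse x ^ n * exp (- inverse x)) has_real_derivative
        inverse x ^ (n + 2) * exp (- inverse x) - real n * (inverse x ^ (n + 1) * exp (- inverse x))) (at x)"
    proof -
      have d: "(inverse has_real_derivative - (inverse x * inverse x)) (at x)"
        using DERIV_inverse[of x] 1 by (simp add: power2_eq_square numeral_2_eq_2)
      have p: "((\<lambda>x. inverse x ^ n) has_real_derivative - (real n * inverse x ^ (n + 1))) (at x)"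
        using DERIV_power[OF d, of n] by (cases n) (simp_all add: algebra_simps)
      have e: "((\<lambda>x. exp (- inverse x)) has_real_derivative exp (- inverse x) * (inverse x * inverse x)) (at x)"
        using DERIV_fun_exp[OF DERIV_minus[OF d]] by simp
      show ?thesis
        using DERIV_mult[OF p e] by (simp add: algebra_simps)
    qed
    then have "((\<lambda>x. inverse x ^ n * exp (- inverse x)) has_real_derivative flat_exp (n + 2) x - real n * flat_exp (n + 1) x) (at x)"
      using 1 by (simp add: flat_exp_def)
    then show ?thesis
      by (rule has_field_derivative_transform_within_open[where S="{0<..}"]) (use 1 in \<open>auto simp: flat_exp_def\<close>)
  next
    case 2
    have "((\<lambda>x. 0) has_real_derivative flat_exp (n + 2) x - real n * flat_exp (n + 1) x) (at x)"
      using 2 by (simp add: flat_exp_def)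
    then show ?thesis
      by (rule has_field_derivative_transform_within_open[where S="{..<0}"]) (use 2 in \<open>auto simp: flat_exp_def\<close>)
  next
    case 3
    \<comment> \<open>At the origin the difference quotient of the \<open>n\<close>-th function is
      the \<open>(n+1)\<close>-st, which tends to \<open>0\<close> like every member of the
      family.\<close>
    have e: "(flat_exp n (0 + h) - flat_exp n 0) / h = flat_exp (n + 1) h" for h
      by (simp add: flat_exp_def divide_inverse)
    have "(flat_exp n has_real_derivative 0) (at 0)"
      unfolding DERIV_def e by (rule flat_exp_lim0)
    then show ?thesis using 3 by (simp add: flat_exp_def)
  qed
qed

lemma CkR_flat_exp: "CkR k UNIV (flat_exp n)"
proof (induction k arbitrary: n)
  case 0
  have "isCont (flat_exp n) x" for x using flat_exp_DERIV DERIV_isCont by blast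
  then show ?case by (simp add: continuous_at_imp_continuous_on)
next
  case (Suc k)
  have "CkR k UNIV (\<lambda>x. flat_exp (n + 2) x + (- real n) * flat_exp (n + 1) x)"
    by (intro CkR_add CkR_mult CkR_const Suc.IH open_UNIV)
  then have "CkR k UNIV (\<lambda>x. flat_exp (n + 2) x - real n * flat_exp (n + 1) x)" by simp
  from CkR_SucI[OF open_UNIV flat_exp_DERIV this] show ?case .
qed

definition smooth_step :: "real \<Rightarrow> real" where
  "smooth_step x = flat_exp 0 x * inverse (flat_exp 0 x + flat_exp 0 (-1 * x + 1))"

text \<open>\<open>x\<close> and \<open>1 - x\<close> are never both nonpositive.\<close>

lemma smooth_step_denom: "flat_exp 0 x + flat_exp 0 (-1 * x + 1) > 0"
proof -
  consider "x > 0" | "-1 * x + 1 > 0" by linarith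
  then show ?thesis by cases (auto simp: flat_exp_def intro: add_pos_nonneg add_nonneg_pos)
qed

lemma smoothR_smooth_step: "smoothR UNIV smooth_step"
proof -
  have "CkR k UNIV (\<lambda>x. flat_exp 0 x * inverse (flat_exp 0 x + flat_exp 0 (-1 * x + 1)))" for k
    by (intro CkR_mult CkR_inverse CkR_add CkR_flat_exp open_UNIV CkR_affine[where a="-1" and b=1])
      (use smooth_step_denom in \<open>simp add: less_imp_neq[symmetric]\<close>)
  then show ?thesis unfolding smoothR_def smooth_step_def[abs_def] by blast
qed

lemma smooth_step_0: "x \<le> 0 \<Longrightarrow> smooth_step x = 0"
  by (simp add: smooth_step_def flat_exp_def)

lemma smooth_step_1: "x \<ge> 1 \<Longrightarrow> smooth_step x = 1"
  by (simp add: smooth_step_def flat_exp_def)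

lemma smooth_step_bounds: "0 \<le> smooth_step x" "smooth_step x \<le> 1"
proof -
  have n: "flat_exp 0 y \<ge> 0" for y by (simp add: flat_exp_def)
  show "0 \<le> smooth_step x" unfolding smooth_step_def
    using n smooth_step_denom[of x] by (intro mult_nonneg_nonneg) (simp_all add: less_imp_le)
  show "smooth_step x \<le> 1" unfolding smooth_step_def
    using n[of "-1 * x + 1"] smooth_step_denom[of x] by (simp add: divide_inverse[symmetric] pos_divide_le_eq)
qed

text \<open>With \<open>k = n + 1\<close> the function vanishes within \<open>1/k\<close> of the
  ends of \<open>(c, d)\<close> and equals \<open>1\<close> at points of the interval at distance at
  least \<open>2/k\<close> from both. The shift by \<open>1\<close> produces the margin that makes
  cutoffs admissible as sources.\<close>

definition cutoff :: "real \<Rightarrow> real \<Rightarrow> nat \<Rightarrow> real \<Rightarrow> real" where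
  "cutoff c d n x = smooth_step (real (Suc n) * x + (- real (Suc n) * c - 1))
    * smooth_step (- real (Suc n) * x + (real (Suc n) * d - 1))"

lemma smoothR_cutoff: "smoothR UNIV (cutoff c d n)"
proof -
  have "CkR k UNIV (\<lambda>x. smooth_step (real (Suc n) * x + (- real (Suc n) * c - 1))
    * smooth_step (- real (Suc n) * x + (real (Suc n) * d - 1)))" for k
    using smoothR_smooth_step unfolding smoothR_def by (intro CkR_mult open_UNIV CkR_affine) blast+
  then show ?thesis unfolding smoothR_def cutoff_def[abs_def] by blast
qed

lemma cutoff_bounds: "0 \<le> cutoff c d n x" "cutoff c d n x \<le> 1"
  unfolding cutoff_def
  by (intro mult_nonneg_nonneg smooth_step_bounds) (intro mult_le_one smooth_step_bounds)

lemma cutoff_eq_0: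
  assumes "x \<le> c + 1 / real (Suc n) \<or> x \<ge> d - 1 / real (Suc n)"
  shows "cutoff c d n x = 0"
proof -
  let ?k = "real (Suc n)"
  have k: "?k > 0" by simp
  from assms have "?k * x + (- ?k * c - 1) \<le> 0 \<or> - ?k * x + (?k * d - 1) \<le> 0"
    using k by (simp add: field_simps del: of_nat_Suc)
  then show ?thesis unfolding cutoff_def using smooth_step_0 by auto
qed

lemma cutoff_outside: "x \<notin> {c<..<d} \<Longrightarrow> cutoff c d n x = 0"
proof (rule cutoff_eq_0)
  assume "x \<notin> {c<..<d}"
  moreover have "1 / real (Suc n) > 0" by simp
  ultimately show "x \<le> c + 1 / real (Suc n) \<or> x \<ge> d - 1 / real (Suc n)"
    unfolding greaterThanLessThan_iff by linarith
qed

lemma cutoff_tendsto: "(\<lambda>n. cutoff c d n x) \<longlonglongrightarrow> indicator {c<..<d} x"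
proof (cases "x \<in> {c<..<d}")
  case False
  then show ?thesis by (simp add: cutoff_outside)
next
  case True
  have ev: "\<forall>\<^sub>F n in sequentially. real (Suc n) * e \<ge> 2" if "e > 0" for e :: real
  proof -
    obtain N where N: "real N * e > 2" using reals_Archimedean3[OF \<open>e > 0\<close>] by blast
    show ?thesis
    proof (rule eventually_sequentiallyI[of N])
      fix n assume "N \<le> n"
      then have "real N * e \<le> real (Suc n) * e" using that by (intro mult_right_mono) auto
      then show "real (Suc n) * e \<ge> 2" using N by linarith
    qed
  qed
  have "\<forall>\<^sub>F n in sequentially. cutoff c d n x = 1"
    using ev[of "x - c"] ev[of "d - x"] True
  proof -
    assume "0 < x - c \<Longrightarrow> \<forall>\<^sub>F n in sequentially. 2 \<le> real (Suc n) * (x - c)"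
      "0 < d - x \<Longrightarrow> \<forall>\<^sub>F n in sequentially. 2 \<le> real (Suc n) * (d - x)"
    with True have "\<forall>\<^sub>F n in sequentially. 2 \<le> real (Suc n) * (x - c)" "\<forall>\<^sub>F n in sequentially. 2 \<le> real (Suc n) * (d - x)"
      by auto
    then show ?thesis
    proof eventually_elim
      case (elim n)
      have "real (Suc n) * x + (- real (Suc n) * c - 1) \<ge> 1" "- real (Suc n) * x + (real (Suc n) * d - 1) \<ge> 1"
        using elim by (simp_all add: algebra_simps)
      then show ?case unfolding cutoff_def by (simp add: smooth_step_1 del: of_nat_Suc)
    qed
  qed
  then have "(\<lambda>n. cutoff c d n x) \<longlonglongrightarrow> 1" by (rule tendsto_eventually)
  then show ?thesis using True by simp
qed

section \<open>Profiles of one variable as smooth functions on the plane\<close>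

lemma Ck_compose_real:
  assumes q: "smooth (\<lambda>x. complex_of_real (q x))" and S: "\<And>x. q x \<in> S"
  shows "CkR k S g \<Longrightarrow> Ck k (\<lambda>x. complex_of_real (g (q x)))"
proof (induction k arbitrary: g)
  case 0
  have "continuous_on UNIV (\<lambda>x. Re (complex_of_real (q x)))"
    by (intro continuous_on_Re smooth_continuous[OF q])
  then have "continuous_on UNIV q" by simp
  then show ?case
    using 0 S by (auto intro!: continuous_intros continuous_on_compose2[of S g])
next
  case (Suc k)
  have D: "((\<lambda>x. complex_of_real (g (q x))) has_derivative
      (\<lambda>h. complex_of_real (deriv g (q x)) * frechet_derivative (\<lambda>x. complex_of_real (q x)) (at x) h)) (at x)" for x
  proof -
    let ?Q = "frechet_derivative (\<lambda>x. complex_of_real (q x)) (at x)"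
    have Q: "((\<lambda>x. complex_of_real (q x)) has_derivative ?Q) (at x)"
      by (rule iffD1[OF frechet_derivative_works, OF smooth_differentiable[OF q]])
    have dq: "(q has_derivative (\<lambda>h. Re (?Q h))) (at x)"
      using has_derivative_Re[OF Q] by simp
    \<comment> \<open>By uniqueness of the derivative \<open>?Q\<close> takes real values only, so
      the real chain rule for \<open>g\<close> can be read in the complex numbers.\<close>
    have "((\<lambda>x. complex_of_real (q x)) has_derivative (\<lambda>h. complex_of_real (Re (?Q h)))) (at x)"
      by (rule has_derivative_of_real[OF dq])
    from has_derivative_unique[OF this Q] have e: "complex_of_real (Re (?Q h)) = ?Q h" for h
      by (metis (no_types))
    have "(g has_derivative (\<lambda>h. deriv g (q x) * h)) (at (q x))"
      using CkR_DERIV[OF Suc.prems S] unfolding has_field_derivative_def .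
    from has_derivative_of_real[OF has_derivative_compose[OF dq this]]
    have "((\<lambda>x. complex_of_real (g (q x))) has_derivative (\<lambda>h. complex_of_real (deriv g (q x)) * complex_of_real (Re (?Q h)))) (at x)"
      by simp
    then show ?thesis unfolding e .
  qed
  have "pderiv_at i (\<lambda>x. complex_of_real (g (q x))) =
      (\<lambda>x. complex_of_real (deriv g (q x)) * pderiv_at i (\<lambda>x. complex_of_real (q x)) x)" for i
    using pderiv_at_eq[OF D] by (intro ext) (simp add: pderiv_at_def)
  moreover have "Ck k (\<lambda>x. complex_of_real (deriv g (q x)))" using Suc by simp
  moreover have "Ck k (pderiv_at i (\<lambda>x. complex_of_real (q x)))" for i
    using smooth_pderiv[OF q] unfolding smooth_def by blast
  ultimately have "\<forall>i. Ck k (pderiv_at i (\<lambda>x. complex_of_real (g (q x))))" by (simp add: Ck_mult)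
  moreover have "(\<lambda>x. complex_of_real (g (q x))) differentiable (at x)" for x
    using D differentiable_def by blast
  ultimately show ?case by simp
qed

lemma smooth_compose_real:
  assumes "smooth (\<lambda>x. complex_of_real (q x))" "\<And>x. q x \<in> S" "smoothR S g"
  shows "smooth (\<lambda>x. complex_of_real (g (q x)))"
  using Ck_compose_real[OF assms(1,2)] assms(3) unfolding smooth_def smoothR_def by blast

lemma norm_sq_coords: "(norm (x::real^2))\<^sup>2 = (x $ 1)\<^sup>2 + (x $ 2)\<^sup>2"
  unfolding norm_vec_def L2_set_def by (simp add: sum_2)

lemma smooth_norm_sq: "smooth (\<lambda>x. complex_of_real ((norm x)\<^sup>2))"
proof -
  have "smooth (\<lambda>x. complex_of_real (x $ 1) ^ 2 + complex_of_real (x $ 2) ^ 2)"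
    by (intro smooth_add smooth_power smooth_coord)
  then show ?thesis unfolding norm_sq_coords by simp
qed

text \<open>Profiles are functions of \<open>|x|^2\<close>, which unlike \<open>|x|\<close> is
  smooth at the origin. The half-line from \<open>-1\<close> stands for an open neighbourhood of the
  values of \<open>|x|^2\<close>; later profiles on the plane follow this convention.\<close>

lemma smooth_radial: "smoothR {-1<..} g \<Longrightarrow> smooth (\<lambda>x. complex_of_real (g ((norm x)\<^sup>2)))"
  by (rule smooth_compose_real[OF smooth_norm_sq]) (auto intro: less_le_trans[of _ 0])

lemma smooth_of_coord: "smoothR UNIV g \<Longrightarrow> smooth (\<lambda>x. complex_of_real (g (x $ i)))"
  by (rule smooth_compose_real[OF smooth_coord]) auto

section \<open>Uniqueness of weak derivatives\<close>


text \<open>The positive and the negative part, taken as densities, define measures that agree on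
  boxes, an intersection-stable generator of the Borel sets. So the two parts agree almost
  everywhere, while at each point at most one of them is nonzero.\<close>

lemma AE_zero_of_box_integrals_real:
  fixes f :: "'a::euclidean_space \<Rightarrow> real"
  assumes f: "integrable lborel f" and z: "\<And>c d. lborint (\<lambda>x. f x * indicator (box c d) x) = 0"
  shows "AE x in lborel. f x = 0"
proof -
  have fm[measurable]: "f \<in> borel_measurable borel" using f by auto
  define p where "p x = max 0 (f x)" for x
  define q where "q x = max 0 (- f x)" for x
  have [measurable]: "p \<in> borel_measurable borel" "q \<in> borel_measurable borel"
    unfolding p_def[abs_def] q_def[abs_def] by measurable
  have ip: "integrable lborel p" unfolding p_def by (rule integrable_max[OF integrable_zero f])
  have iq: "integrable lborel q" unfolding q_def by (rule integrable_max) (use f in auto)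
  have em: "emeasure (density lborel (\<lambda>x. ennreal (g x))) (box c d) = ennreal (lborint (\<lambda>x. g x * indicator (box c d) x))"
    if g: "integrable lborel g" and [measurable]: "g \<in> borel_measurable borel" and n: "\<And>x. g x \<ge> 0" for g c d
  proof -
    have "emeasure (density lborel (\<lambda>x. ennreal (g x))) (box c d) = (\<integral>\<^sup>+x. ennreal (g x) * indicator (box c d) x \<partial>lborel)"
      by (rule emeasure_density) auto
    also have "\<dots> = (\<integral>\<^sup>+x. ennreal (g x * indicator (box c d) x) \<partial>lborel)"
      by (rule nn_integral_cong) (auto simp: indicator_def)
    also have "\<dots> = ennreal (lborint (\<lambda>x. g x * indicator (box c d) x))"
      by (rule nn_integral_eq_integral) (use n in \<open>auto intro!: integrable_real_mult_indicator g\<close>)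
    finally show ?thesis .
  qed
  have "density lborel (\<lambda>x. ennreal (p x)) = density lborel (\<lambda>x. ennreal (q x))"
  proof (rule measure_eqI_generator_eq)
    let ?E = "range (\<lambda>(a, b). box a b :: 'a set)"
    show "Int_stable ?E" by (auto simp: Int_stable_def box_Int_box)
    show "?E \<subseteq> Pow UNIV" by simp
    show "sets (density lborel (\<lambda>x. ennreal (p x))) = sigma_sets UNIV ?E" "sets (density lborel (\<lambda>x. ennreal (q x))) = sigma_sets UNIV ?E"
      by (simp_all add: borel_eq_box)
    let ?A = "\<lambda>n::nat. box (- (real n *\<^sub>R One)) (real n *\<^sub>R One) :: 'a set"
    show "range ?A \<subseteq> ?E" "(\<Union>i. ?A i) = UNIV" unfolding UN_box_eq_UNIV by auto
    show "emeasure (density lborel (\<lambda>x. ennreal (p x))) (?A i) \<noteq> \<infinity>" for i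
      by (subst em[OF ip]) (auto simp: p_def)
    fix X assume "X \<in> ?E"
    then obtain c d where X: "X = box c d" by auto
    have "lborint (\<lambda>x. p x * indicator (box c d) x) - lborint (\<lambda>x. q x * indicator (box c d) x)
      = lborint (\<lambda>x. p x * indicator (box c d) x - q x * indicator (box c d) x)"
      by (rule Bochner_Integration.integral_diff[symmetric]) (auto intro!: integrable_real_mult_indicator ip iq)
    also have "(\<lambda>x. p x * indicator (box c d) x - q x * indicator (box c d) x) = (\<lambda>x. f x * indicator (box c d) x)"
      by (rule ext) (simp add: p_def q_def max_def algebra_simps)
    finally have "lborint (\<lambda>x. p x * indicator (box c d) x) = lborint (\<lambda>x. q x * indicator (box c d) x)"
      using z[of c d] by simp
    then show "emeasure (density lborel (\<lambda>x. ennreal (p x))) X = emeasure (density lborel (\<lambda>x. ennreal (q x))) X"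
      unfolding X by (subst em[OF ip], simp, simp add: p_def, subst em[OF iq]) (auto simp: q_def)
  qed
  then have "AE x in lborel. ennreal (p x) = ennreal (q x)"
    by (subst (asm) sigma_finite_measure.density_unique_iff[OF sigma_finite_lborel]) auto
  then show ?thesis
    by eventually_elim (auto simp: p_def q_def max_def split: if_splits)
qed

lemma AE_zero_of_box_integrals:
  fixes v :: "'a::euclidean_space \<Rightarrow> complex"
  assumes U: "U \<in> sets lebesgue" and v: "integrable (lebesgue_on U) v"
    and z: "\<And>c d. lebint U (\<lambda>x. v x * indicator (box c d) x) = 0"
  shows "AE x in lebesgue_on U. v x = 0"
proof -
  \<comment> \<open>A Borel representative brings the Lebesgue-measurable case back to
    \<open>lborel\<close>. This is applied to the real and the imaginary part of \<open>v\<close>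
    extended by zero.\<close>
  have real: "AE x in lborel. g x = 0"
    if g: "integrable lebesgue g" and gz: "\<And>c d. integral\<^sup>L lebesgue (\<lambda>x. g x * indicator (box c d) x) = 0"
    for g :: "'a \<Rightarrow> real"
  proof -
    obtain g' where g'[measurable]: "g' \<in> borel_measurable lborel" and ae: "AE x in lborel. g x = g' x"
      using completion_ex_borel_measurable_real[of g lborel] g by auto
    have ae': "AE x in lebesgue. g x = g' x" using ae by (rule AE_completion)
    have gm: "g' \<in> borel_measurable lebesgue" using g' by (rule measurable_completion)
    have "integrable lebesgue g'" by (rule integrable_cong_AE_imp[OF g gm]) (use ae' in auto)
    then have gi: "integrable lborel g'" by (subst (asm) integrable_completion) auto
    have "AE x in lborel. g' x = 0"
    proof (rule AE_zero_of_box_integrals_real[OF gi])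
      fix c d :: 'a
      have m: "(\<lambda>x. g' x * indicator (box c d) x) \<in> borel_measurable lborel" by measurable
      have gmm[measurable]: "g \<in> borel_measurable lebesgue" using g by auto
      have "lborint (\<lambda>x. g' x * indicator (box c d) x) = integral\<^sup>L lebesgue (\<lambda>x. g' x * indicator (box c d) x)"
        by (rule integral_completion[symmetric, OF m])
      also have "\<dots> = integral\<^sup>L lebesgue (\<lambda>x. g x * indicator (box c d) x)"
      proof (rule integral_cong_AE)
        have [measurable]: "(indicator (box c d) :: 'a \<Rightarrow> real) \<in> borel_measurable lebesgue"
          by (rule borel_measurable_indicator) simp
        note [measurable] = gm
        show "(\<lambda>x. g' x * indicat_real (box c d) x) \<in> borel_measurable lebesgue"
          "(\<lambda>x. g x * indicat_real (box c d) x) \<in> borel_measurable lebesgue" by measurable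
        show "AE x in lebesgue. g' x * indicat_real (box c d) x = g x * indicat_real (box c d) x"
          using ae' by eventually_elim simp
      qed
      finally show "lborint (\<lambda>x. g' x * indicator (box c d) x) = 0" using gz by simp
    qed
    with ae show ?thesis by eventually_elim simp
  qed
  define w where "w x = indicator U x *\<^sub>R v x" for x
  have w: "integrable lebesgue w"
    using v U unfolding w_def by (subst (asm) integrable_restrict_space) (auto simp: )
  have wz: "integral\<^sup>L lebesgue (\<lambda>x. w x * indicator (box c d) x) = 0" for c d
  proof -
    have "lebint U (\<lambda>x. v x * indicator (box c d) x) = integral\<^sup>L lebesgue (\<lambda>x. indicator U x *\<^sub>R (v x * indicator (box c d) x))"
      by (rule integral_restrict_space) (use U in auto)
    then show ?thesis using z[of c d] unfolding w_def by simp
  qed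
  have wi: "integrable lebesgue (\<lambda>x. w x * indicator (box c d) x)" for c d
  proof -
    have "integrable lebesgue (\<lambda>x. indicator (box c d) x *\<^sub>R w x)"
      by (rule integrable_mult_indicator[OF _ w]) simp
    then show ?thesis by (rule Bochner_Integration.integrable_cong[THEN iffD1, rotated -1]) (auto simp: indicator_def)
  qed
  have "AE x in lborel. Re (w x) = 0"
  proof (rule real[OF integrable_Re[OF w]])
    fix c d
    have e: "(\<lambda>x. Re (w x) * indicator (box c d) x) = (\<lambda>x. Re (w x * indicator (box c d) x))"
      by (rule ext) (simp add: indicator_def)
    show "integral\<^sup>L lebesgue (\<lambda>x. Re (w x) * indicator (box c d) x) = 0"
      unfolding e integral_Re[OF wi] wz by simp
  qed
  moreover have "AE x in lborel. Im (w x) = 0"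
  proof (rule real[OF integrable_Im[OF w]])
    fix c d
    have e: "(\<lambda>x. Im (w x) * indicator (box c d) x) = (\<lambda>x. Im (w x * indicator (box c d) x))"
      by (rule ext) (simp add: indicator_def)
    show "integral\<^sup>L lebesgue (\<lambda>x. Im (w x) * indicator (box c d) x) = 0"
      unfolding e integral_Im[OF wi] wz by simp
  qed
  ultimately have "AE x in lborel. w x = 0" by eventually_elim (simp add: complex_eq_iff)
  then have "AE x in lebesgue. w x = 0" by (rule AE_completion)
  then have "AE x in lebesgue. x \<in> U \<longrightarrow> v x = 0" by eventually_elim (auto simp: w_def)
  then show ?thesis using U by (subst AE_restrict_space_iff) auto
qed

lemma lebesgue_on_integrable_mult_indicator:
  fixes v :: "'a::euclidean_space \<Rightarrow> complex"
  assumes "integrable (lebesgue_on U) v" "A \<in> sets lebesgue" "U \<in> sets lebesgue"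
  shows "integrable (lebesgue_on U) (\<lambda>x. v x * indicator A x)"
proof (rule Bochner_Integration.integrable_bound[OF assms(1)])
  have [measurable]: "v \<in> borel_measurable (lebesgue_on U)" using assms(1) by auto
  have "indicator A \<in> borel_measurable (lebesgue :: 'a measure)" using assms(2) by (rule borel_measurable_indicator)
  then have [measurable]: "(indicator A :: 'a \<Rightarrow> complex) \<in> borel_measurable (lebesgue_on U)" by (rule measurable_restrict_space1)
  show "(\<lambda>x. v x * indicator A x) \<in> borel_measurable (lebesgue_on U)" by measurable
qed (auto simp: indicator_def)

text \<open>Test functions supported in \<open>U\<close> give access only to boxes whose closure
  lies in \<open>U\<close>. Countably many closed boxes exhaust \<open>U\<close>, and for
  \<open>v\<close> truncated to one of them every box integral is again of this kind.\<close>

lemma AE_zero_of_interior_box_integrals: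
  fixes v :: "'a::euclidean_space \<Rightarrow> complex"
  assumes U: "open U" and v: "integrable (lebesgue_on U) v"
    and z: "\<And>c d. cbox c d \<subseteq> U \<Longrightarrow> lebint U (\<lambda>x. v x * indicator (box c d) x) = 0"
  shows "AE x in lebesgue_on U. v x = 0"
proof -
  have Ul: "U \<in> sets lebesgue" using U by simp
  obtain D where D: "countable D" "D \<subseteq> Pow U" "\<And>X. X \<in> D \<Longrightarrow> \<exists>a b. X = cbox a b" "\<Union>D = U"
    using open_countable_Union_open_cbox[OF U] by metis
  have "AE x in lebesgue_on U. x \<in> K \<longrightarrow> v x = 0" if K: "K \<in> D" for K
  proof -
    obtain a b where ab: "K = cbox a b" using D(3) K by blast
    have KU: "cbox a b \<subseteq> U" using D(2) K ab by blast
    let ?w = "\<lambda>x. v x * indicator (box a b) x"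
    have wi: "integrable (lebesgue_on U) ?w"
      by (rule lebesgue_on_integrable_mult_indicator[OF v _ Ul]) simp
    have "AE x in lebesgue_on U. ?w x = 0"
    proof (rule AE_zero_of_box_integrals[OF Ul wi])
      fix c d :: 'a
      obtain c' d' where cd: "box a b \<inter> box c d = box c' d'"
        by (rule that[OF box_Int_box])
      have e: "(\<lambda>x. ?w x * indicator (box c d) x) = (\<lambda>x. v x * indicator (box c' d') x)"
        unfolding cd[symmetric] by (rule ext) (simp add: indicator_def)
      show "lebint U (\<lambda>x. ?w x * indicator (box c d) x) = 0"
      proof (cases "box c' d' = {}")
        case True
        then show ?thesis unfolding e by simp
      next
        case False
        have "cbox c' d' = closure (box c' d')" using closure_box[OF False] by simp
        also have "\<dots> \<subseteq> closure (box a b)" using cd by (intro closure_mono) blast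
        also have "\<dots> \<subseteq> cbox a b" by (rule closure_minimal[OF box_subset_cbox closed_cbox])
        finally show ?thesis unfolding e using KU z by blast
      qed
    qed
    \<comment> \<open>The truncation uses the open box, so the boundary of the closed one is
      discarded as a null set.\<close>
    moreover have "AE x in lebesgue_on U. x \<notin> cbox a b - box a b"
    proof -
      have "cbox a b - box a b \<in> null_sets lebesgue"
        using negligible_frontier_interval negligible_iff_null_sets by blast
      then have "AE x in lebesgue. x \<notin> cbox a b - box a b" by (rule AE_not_in)
      then show ?thesis using Ul by (subst AE_restrict_space_iff) auto
    qed
    ultimately show ?thesis
      by eventually_elim (auto simp: ab indicator_def split: if_splits)
  qed
  then have "AE x in lebesgue_on U. \<forall>K\<in>D. x \<in> K \<longrightarrow> v x = 0"
    by (subst AE_ball_countable[OF D(1)]) blast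
  moreover have "AE x in lebesgue_on U. x \<in> U" by (rule AE_I2) simp
  ultimately show ?thesis
    by eventually_elim (use D(4) in blast)
qed

section \<open>Test functions approximating boxes\<close>

definition bump :: "real^2 \<Rightarrow> real^2 \<Rightarrow> nat \<Rightarrow> real^2 \<Rightarrow> complex" where
  "bump c d n x = (\<Prod>i\<in>UNIV. complex_of_real (cutoff (c $ i) (d $ i) n (x $ i)))"

lemma smooth_bump: "smooth (bump c d n)"
  unfolding bump_def[abs_def] by (intro smooth_prod smooth_of_coord smoothR_cutoff)

lemma bump_bound: "cmod (bump c d n x) \<le> 1"
  unfolding bump_def using cutoff_bounds
  by (auto simp: prod_norm[symmetric] intro!: prod_le_1)

lemma bump_outside: "x \<notin> box c d \<Longrightarrow> bump c d n x = 0"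
  proof -
  assume "x \<notin> box c d"
  then obtain i where "x $ i \<notin> {c $ i<..<d $ i}" unfolding mem_box_cart by auto
  then have "cutoff (c $ i) (d $ i) n (x $ i) = 0" by (rule cutoff_outside)
  then show ?thesis unfolding bump_def by (intro prod_zero) auto
qed

lemma bump_tendsto: "(\<lambda>n. bump c d n x) \<longlonglongrightarrow> indicator (box c d) x"
proof -
  have "(\<lambda>n. bump c d n x) \<longlonglongrightarrow> (\<Prod>i\<in>UNIV. complex_of_real (indicator {c $ i<..<d $ i} (x $ i)))"
    unfolding bump_def by (intro tendsto_prod tendsto_of_real cutoff_tendsto)
  also have "(\<Prod>i\<in>UNIV. complex_of_real (indicator {c $ i<..<d $ i} (x $ i))) = indicator (box c d) x"
    by (auto simp: UNIV_2 mem_box_cart indicator_def forall_2)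
  finally show ?thesis .
qed

lemma bump_test_function: "cbox c d \<subseteq> U \<Longrightarrow> bump c d n \<in> test_functions U"
proof -
  assume U: "cbox c d \<subseteq> U"
  have "{x. bump c d n x \<noteq> 0} \<subseteq> cbox c d" using bump_outside box_subset_cbox by blast
  then have s: "closure {x. bump c d n x \<noteq> 0} \<subseteq> cbox c d" by (rule closure_minimal[OF _ closed_cbox])
  then have "compact (closure {x. bump c d n x \<noteq> 0})"
    by (metis bounded_subset bounded_cbox closed_closure compact_eq_bounded_closed)
  then show ?thesis using s U smooth_bump by (auto simp: test_functions_def)
qed

lemma box_integral_limit:
  fixes v :: "real^2 \<Rightarrow> complex"
  assumes v: "integrable (lebesgue_on U) v"
  shows "(\<lambda>n. lebint U (\<lambda>x. v x * bump c d n x)) \<longlonglongrightarrow> lebint U (\<lambda>x. v x * indicator (box c d) x)"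
proof (rule integral_dominated_convergence[where w="\<lambda>x. cmod (v x)"])
  have vm[measurable]: "v \<in> borel_measurable (lebesgue_on U)" using v by auto
  have b[measurable]: "bump c d n \<in> borel_measurable (lebesgue_on U)" for n
    by (rule continuous_imp_lebesgue_on_measurable[OF smooth_continuous[OF smooth_bump]])
  show "(\<lambda>x. v x * bump c d n x) \<in> borel_measurable (lebesgue_on U)" for n by measurable
  have "(indicator (box c d) :: real^2 \<Rightarrow> complex) \<in> borel_measurable lebesgue" by (rule borel_measurable_indicator) simp
  then have [measurable]: "(indicator (box c d) :: real^2 \<Rightarrow> complex) \<in> borel_measurable (lebesgue_on U)" by (rule measurable_restrict_space1)
  show "(\<lambda>x. v x * indicator (box c d) x) \<in> borel_measurable (lebesgue_on U)" by measurable
  show "integrable (lebesgue_on U) (\<lambda>x. cmod (v x))" using v by (rule integrable_norm)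
  show "AE x in lebesgue_on U. (\<lambda>n. v x * bump c d n x) \<longlonglongrightarrow> v x * indicator (box c d) x"
    by (rule AE_I2) (intro tendsto_mult tendsto_const bump_tendsto)
  show "AE x in lebesgue_on U. norm (v x * bump c d n x) \<le> cmod (v x)" for n
    by (rule AE_I2) (simp add: norm_mult mult_left_le bump_bound)
qed

text \<open>Bumps are test functions and converge boundedly to indicators of boxes, which reduces
  the claim to box integrals.\<close>

lemma AE_zero_of_test_functions:
  assumes U: "open U" and v: "integrable (lebesgue_on U) v"
    and z: "\<And>\<phi>. \<phi> \<in> test_functions U \<Longrightarrow> lebint U (\<lambda>x. v x * \<phi> x) = 0"
  shows "AE x in lebesgue_on U. v x = 0"
proof (rule AE_zero_of_interior_box_integrals[OF U v])
  fix c d :: "real^2" assume "cbox c d \<subseteq> U"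
  then have e: "\<And>n. lebint U (\<lambda>x. v x * bump c d n x) = 0"
    by (intro z bump_test_function)
  then show "lebint U (\<lambda>x. v x * indicator (box c d) x) = 0"
    using box_integral_limit[OF v, of c d] unfolding e LIMSEQ_const_iff by simp
qed

lemma lmeasurable_open_bounded: "open U \<Longrightarrow> bounded U \<Longrightarrow> U \<in> lmeasurable"
  by (rule lmeasurable_open)

lemma test_function_L2:
  assumes "open U" "bounded U" "\<phi> \<in> test_functions U"
  shows "\<phi> \<in> L2 U" "pderiv_at i \<phi> \<in> L2 U"
  using assms lmeasurable_open_bounded[OF assms(1,2)]
  by (auto intro!: L2_continuous smooth_continuous smooth_pderiv simp: test_functions_def)

text \<open>\<open>wpderiv\<close> is a Hilbert choice; this uniqueness is what links it to a
  concretely known derivative.\<close>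

lemma weak_pderiv_unique:
  assumes U: "open U" "bounded U" and v: "v \<in> L2 U" "w \<in> L2 U"
    and w: "is_weak_pderiv U i u v" "is_weak_pderiv U i u w"
  shows "AE x in lebesgue_on U. v x = w x"
proof -
  note Um = lmeasurable_open_bounded[OF U]
  have "AE x in lebesgue_on U. v x - w x = 0"
  proof (rule AE_zero_of_test_functions[OF U(1)])
    show "integrable (lebesgue_on U) (\<lambda>x. v x - w x)" by (rule L2_integrable[OF Um L2_diff[OF v]])
    fix \<phi> assume \<phi>: "\<phi> \<in> test_functions U"
    note p = test_function_L2[OF U \<phi>]
    have "lebint U (\<lambda>x. v x * \<phi> x) = lebint U (\<lambda>x. w x * \<phi> x)"
      using bspec[OF w(1)[unfolded is_weak_pderiv_def] \<phi>] bspec[OF w(2)[unfolded is_weak_pderiv_def] \<phi>] by simp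
    then have "lebint U (\<lambda>x. v x * \<phi> x - w x * \<phi> x) = 0"
      using Bochner_Integration.integral_diff[OF L2_mult_integrable[OF v(1) p(1)] L2_mult_integrable[OF v(2) p(1)]] by simp
    then show "lebint U (\<lambda>x. (v x - w x) * \<phi> x) = 0" by (simp only: left_diff_distrib)
  qed
  then show ?thesis by simp
qed

lemma weak_pderiv_AE_cong:
  assumes U: "open U" "bounded U" and u: "u \<in> L2 U" "v \<in> L2 U" and ae: "AE x in lebesgue_on U. u x = v x"
    and w: "is_weak_pderiv U i v w"
  shows "is_weak_pderiv U i u w"
  unfolding is_weak_pderiv_def
proof
  fix \<phi> assume \<phi>: "\<phi> \<in> test_functions U"
  note p = test_function_L2[OF U \<phi>]
  note [measurable] = L2_measurable[OF u(1)] L2_measurable[OF u(2)] L2_measurable[OF p(2)]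
  have "lebint U (\<lambda>x. u x * pderiv_at i \<phi> x) = lebint U (\<lambda>x. v x * pderiv_at i \<phi> x)"
    by (rule integral_cong_AE) (use ae in auto)
  then show "lebint U (\<lambda>x. u x * pderiv_at i \<phi> x) = - lebint U (\<lambda>x. w x * \<phi> x)"
    using bspec[OF w[unfolded is_weak_pderiv_def] \<phi>] by simp
qed

lemma wpderiv_props:
  assumes "u \<in> H1 U"
  shows "wpderiv U i u \<in> L2 U" "is_weak_pderiv U i u (wpderiv U i u)"
proof -
  have "\<exists>v. v \<in> L2 U \<and> is_weak_pderiv U i u v" using assms unfolding H1_def by blast
  then have "wpderiv U i u \<in> L2 U \<and> is_weak_pderiv U i u (wpderiv U i u)"
    unfolding wpderiv_def by (rule someI_ex)
  then show "wpderiv U i u \<in> L2 U" "is_weak_pderiv U i u (wpderiv U i u)" by auto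
qed

lemma H1_L2: "u \<in> H1 U \<Longrightarrow> u \<in> L2 U"
  by (simp add: H1_def)

section \<open>Polar coordinates\<close>


lemma polar_nth [simp]: "polar r \<theta> $ 1 = r * cos \<theta>" "polar r \<theta> $ 2 = r * sin \<theta>"
  by (simp_all add: polar_def)

lemma norm_polar_sq: "(norm (polar r \<theta>))\<^sup>2 = r\<^sup>2"
proof -
  have "(norm (polar r \<theta>))\<^sup>2 = r\<^sup>2 * ((cos \<theta>)\<^sup>2 + (sin \<theta>)\<^sup>2)"
    unfolding norm_sq_coords polar_nth by (simp only: power_mult_distrib distrib_left)
  then show ?thesis by simp
qed

lemma norm_polar: "norm (polar r \<theta>) = \<bar>r\<bar>"
proof -
  have "sqrt ((norm (polar r \<theta>))\<^sup>2) = sqrt (r\<^sup>2)" by (simp only: norm_polar_sq)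
  then show ?thesis by simp
qed

definition polar_map :: "real \<times> real \<Rightarrow> real^2" where
  "polar_map = (\<lambda>(s, \<theta>). polar (sqrt s) \<theta>)"

definition polar_rect :: "real \<Rightarrow> (real \<times> real) set" where
  "polar_rect \<rho> = {0<..<\<rho>\<^sup>2} \<times> {0<..<2*pi}"

lemma continuous_on_polar: "continuous_on UNIV (\<lambda>(r, \<theta>). polar r \<theta>)"
proof (rule continuous_on_componentwise[THEN iffD2], rule ballI)
  fix b :: "real^2" assume "b \<in> Basis"
  then obtain i where b: "b = axis i 1" by (auto simp: Basis_vec_def)
  have "(\<lambda>x. (case x of (r, \<theta>) \<Rightarrow> polar r \<theta>) \<bullet> b) = (\<lambda>x. (case x of (r, \<theta>) \<Rightarrow> polar r \<theta>) $ i)"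
    unfolding b by (simp add: inner_axis)
  moreover have "continuous_on UNIV (\<lambda>x::real\<times>real. (case x of (r, \<theta>) \<Rightarrow> polar r \<theta>) $ i)"
  proof -
    have "continuous_on UNIV (\<lambda>x::real\<times>real. fst x * cos (snd x))" "continuous_on UNIV (\<lambda>x::real\<times>real. fst x * sin (snd x))"
      by (intro continuous_intros)+
    then show ?thesis using exhaust_2[of i] by (auto simp: case_prod_unfold)
  qed
  ultimately show "continuous_on UNIV (\<lambda>x. (case x of (r, \<theta>) \<Rightarrow> polar r \<theta>) \<bullet> b)" by (simp only:)
qed

lemma continuous_on_polar_compose:
  assumes "continuous_on S f" "continuous_on S g"
  shows "continuous_on S (\<lambda>x. polar (f x) (g x))"
  using continuous_on_compose2[OF continuous_on_polar continuous_on_Pair[OF assms]] by auto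

lemma continuous_on_polar_map: "continuous_on UNIV polar_map"
  unfolding polar_map_def case_prod_unfold
  by (intro continuous_on_polar_compose continuous_intros)

lemma polar_map_measurable[measurable]: "polar_map \<in> borel_measurable borel"
  by (rule borel_measurable_continuous_onI[OF continuous_on_polar_map])

text \<open>In the coordinates \<open>(s, \<theta>)\<close> with \<open>s = r\<^sup>2\<close> the Jacobian of the polar map is the constant \<open>1/2\<close>.\<close>

lemma polar_map_measure_vec:
  fixes A :: "(real^2) set" and \<rho> :: real
  defines "S \<equiv> {y::real^2. 0 < y $ 1 \<and> y $ 1 < \<rho>\<^sup>2 \<and> 0 < y $ 2 \<and> y $ 2 < 2 * pi \<and> polar (sqrt (y $ 1)) (y $ 2) \<in> A}"
  assumes A: "A \<in> sets borel" and \<rho>: "\<rho> > 0"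
  shows "S \<in> sets borel" "emeasure lborel S = 2 * emeasure lborel (A \<inter> ball 0 \<rho>)"
proof -
  let ?P = "\<lambda>y::real^2. polar (sqrt (y $ 1)) (y $ 2)"
  have Pc: "continuous_on UNIV ?P" by (intro continuous_on_polar_compose continuous_intros)
  have Pm: "?P -` A \<in> sets borel"
    using measurable_sets[OF borel_measurable_continuous_onI[OF Pc] A] by simp
  have Seq: "S = ?P -` A \<inter> box 0 (vector [\<rho>\<^sup>2, 2*pi])"
    by (auto simp: S_def mem_box_cart forall_2)
  show Sb: "S \<in> sets borel" unfolding Seq using Pm by auto
  have Slm: "S \<in> lmeasurable"
    by (rule bounded_set_imp_lmeasurable) (use Sb in \<open>auto simp: Seq intro: bounded_subset[OF bounded_box]\<close>)
  \<comment> \<open>The change of variables is carried out on \<open>real^2\<close>, where images of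
    sets under differentiable injections are measured by the determinant. In the coordinates
    \<open>(s, theta)\<close> the determinant of \<open>?D\<close> is
    \<open>(cos^2 + sin^2) / 2\<close>.\<close>
  let ?D = "\<lambda>y h::real^2. vector [h $ 1 * cos (y $ 2) / (2 * sqrt (y $ 1)) - sqrt (y $ 1) * sin (y $ 2) * h $ 2,
      h $ 1 * sin (y $ 2) / (2 * sqrt (y $ 1)) + sqrt (y $ 1) * cos (y $ 2) * h $ 2] :: real^2"
  have der: "(?P has_derivative ?D y) (at y within S)" if y: "y \<in> S" for y
  proof (rule has_derivative_componentwise_within[THEN iffD2], rule ballI)
    fix b :: "real^2" assume "b \<in> Basis"
    then obtain i where b: "b = axis i 1" by (auto simp: Basis_vec_def)
    have y1: "y $ 1 > 0" using y by (simp add: S_def)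
    have n: "((\<lambda>y::real^2. y $ j) has_derivative (\<lambda>h. h $ j)) (at y within S)" for j
      by (intro bounded_linear_imp_has_derivative bounded_linear_vec_nth)
    have s: "((\<lambda>y::real^2. sqrt (y $ 1)) has_derivative (\<lambda>h. h $ 1 * (inverse (sqrt (y $ 1)) / 2))) (at y within S)"
    proof (rule has_derivative_compose[OF n[of 1]])
      show "(sqrt has_derivative (\<lambda>h. h * (inverse (sqrt (y $ 1)) / 2))) (at (y $ 1))"
        by (rule has_derivative_eq_rhs[OF DERIV_real_sqrt[OF y1, unfolded has_field_derivative_def]]) (simp add: fun_eq_iff)
    qed
    have "((\<lambda>y::real^2. sqrt (y $ 1) * cos (y $ 2)) has_derivative (\<lambda>h. ?D y h $ 1)) (at y within S)"
      by (rule has_derivative_eq_rhs, rule has_derivative_mult[OF s has_derivative_cos[OF n]])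
        (simp add: fun_eq_iff field_simps)
    moreover have "((\<lambda>y::real^2. sqrt (y $ 1) * sin (y $ 2)) has_derivative (\<lambda>h. ?D y h $ 2)) (at y within S)"
      by (rule has_derivative_eq_rhs, rule has_derivative_mult[OF s has_derivative_sin[OF n]])
        (simp add: fun_eq_iff field_simps)
    ultimately show "((\<lambda>y. ?P y \<bullet> b) has_derivative (\<lambda>h. ?D y h \<bullet> b)) (at y within S)"
      using exhaust_2[of i] by (auto simp: b inner_axis)
  qed
  have det: "\<bar>det (matrix (?D y))\<bar> = 1/2" if y: "y \<in> S" for y
  proof -
    have y1: "sqrt (y $ 1) \<noteq> 0" using y by (simp add: S_def)
    have "det (matrix (?D y)) = ((cos (y $ 2))\<^sup>2 + (sin (y $ 2))\<^sup>2) / 2"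
      unfolding det_2 matrix_def using y1 by (simp add: axis_def field_simps power2_eq_square)
    then show ?thesis by simp
  qed
  have inj: "inj_on ?P S"
  proof (rule inj_onI)
    fix x y assume xy: "x \<in> S" "y \<in> S" "?P x = ?P y"
    have "(norm (?P x))\<^sup>2 = (norm (?P y))\<^sup>2" using xy by simp
    then have e1: "x $ 1 = y $ 1" using xy(1,2) unfolding norm_polar_sq by (simp add: S_def)
    have "sqrt (x $ 1) * cos (x $ 2) = sqrt (x $ 1) * cos (y $ 2)" "sqrt (x $ 1) * sin (x $ 2) = sqrt (x $ 1) * sin (y $ 2)"
      using arg_cong[OF xy(3), of "\<lambda>v. v $ 1"] arg_cong[OF xy(3), of "\<lambda>v. v $ 2"] e1 by auto
    then have "cos (x $ 2) = cos (y $ 2)" "sin (x $ 2) = sin (y $ 2)"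
      using xy(1) by (auto simp: S_def)
    then have "sin (x $ 2) = sin (y $ 2) \<and> cos (x $ 2) = cos (y $ 2)" by simp
    then obtain n :: int where n: "x $ 2 = y $ 2 + 2 * pi * of_int n"
      unfolding sin_cos_eq_iff by auto
    \<comment> \<open>Both angles lie in an open interval of length \<open>2 pi\<close>, so the
      multiple of \<open>2 pi\<close> between them is zero.\<close>
    have "\<bar>x $ 2 - y $ 2\<bar> < 2 * pi" using xy(1,2) by (auto simp: S_def)
    then have "2 * pi * \<bar>of_int n\<bar> < 2 * pi * 1" unfolding n by (simp add: abs_mult)
    then have "\<bar>real_of_int n\<bar> < 1" by (subst (asm) mult_less_cancel_left_pos) auto
    then have "n = 0" by linarith
    then show "x = y" using n e1 by (simp add: vec_eq_iff forall_2)
  qed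
  have hi: "((\<lambda>y. \<bar>det (matrix (?D y))\<bar>) has_integral (measure lebesgue S / 2)) S"
  proof -
    have "((\<lambda>y. 1::real) has_integral measure lebesgue S) S" using has_integral_measure_lborel
      by (metis Slm lmeasure_integral integrable_integral lmeasurable_iff_integrable_on)
    from has_integral_mult_right[OF this, of "1/2"]
    have "((\<lambda>y. 1/2) has_integral (measure lebesgue S / 2)) S" by simp
    then show ?thesis by (rule has_integral_eq[rotated]) (simp add: det)
  qed
  from has_measure_differentiable_image[OF _ der inj, of "measure lebesgue S / 2"] hi Slm
  have im: "?P ` S \<in> lmeasurable" "measure lebesgue (?P ` S) = measure lebesgue S / 2" by auto
  \<comment> \<open>The rectangle omits the angle \<open>0\<close>, so the image misses part of the
    line \<open>x_2 = 0\<close>; removing the whole line costs only a null set.\<close>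
  define Z where "Z = {x::real^2. axis 2 1 \<bullet> x = 0}"
  have Zn: "negligible Z" unfolding Z_def by (rule negligible_hyperplane) simp
  have sub: "?P ` S \<subseteq> A \<inter> ball 0 \<rho>"
  proof
    fix x assume "x \<in> ?P ` S"
    then obtain y where y: "y \<in> S" "x = ?P y" by blast
    have "sqrt (y $ 1) < sqrt (\<rho>\<^sup>2)" using y by (intro real_sqrt_less_mono) (simp add: S_def)
    then have "norm x < \<rho>" using y \<rho> by (simp add: norm_polar S_def)
    then show "x \<in> A \<inter> ball 0 \<rho>" using y by (simp add: S_def)
  qed
  have sup: "A \<inter> ball 0 \<rho> - Z \<subseteq> ?P ` S"
  proof
    fix x assume x: "x \<in> A \<inter> ball 0 \<rho> - Z"
    then have x2: "x $ 2 \<noteq> 0" by (simp add: Z_def inner_axis inner_commute)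
    let ?s = "(norm x)\<^sup>2"
    have xn: "norm x > 0" using x2 by auto
    have "(x $ 1 / norm x)\<^sup>2 + (x $ 2 / norm x)\<^sup>2 = 1"
      unfolding power_divide add_divide_distrib[symmetric] norm_sq_coords[symmetric] using xn by simp
    from sincos_total_2pi[OF this] obtain t where t: "0 \<le> t" "t < 2 * pi" "x $ 1 / norm x = cos t" "x $ 2 / norm x = sin t"
      by blast
    have t0: "t \<noteq> 0" using t(4) x2 xn by auto
    have "?P (vector [?s, t]) = x"
    proof -
      have "norm x * cos t = x $ 1" "norm x * sin t = x $ 2"
        unfolding t(3,4)[symmetric] using xn by simp_all
      then show ?thesis by (simp add: vec_eq_iff forall_2)
    qed
    moreover have "vector [?s, t] \<in> S"
    proof -
      have "?s < \<rho>\<^sup>2" using x by (intro power_strict_mono) auto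
      then show ?thesis using t t0 xn x calculation by (auto simp: S_def)
    qed
    ultimately show "x \<in> ?P ` S" by (intro rev_image_eqI[of "vector [?s, t]"]) (auto simp only:)
  qed
  have Am: "A \<inter> ball 0 \<rho> \<in> lmeasurable"
    using A by (intro bounded_set_imp_lmeasurable) (auto intro: bounded_subset[OF bounded_ball])
  have "measure lebesgue (?P ` S) = measure lebesgue (A \<inter> ball 0 \<rho>)"
  proof (rule measure_negligible_symdiff)
    show "negligible (A \<inter> ball 0 \<rho> - ?P ` S \<union> (?P ` S - A \<inter> ball 0 \<rho>))"
      by (rule negligible_subset[OF Zn]) (use sub sup in blast)
  qed (use Am in auto)
  then have m: "measure lebesgue S = 2 * measure lebesgue (A \<inter> ball 0 \<rho>)" using im by simp
  have "emeasure lborel S = emeasure lebesgue S" using Sb by simp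
  also have "\<dots> = ennreal (measure lebesgue S)" using Slm by (simp add: emeasure_eq_measure2)
  also have "\<dots> = 2 * ennreal (measure lebesgue (A \<inter> ball 0 \<rho>))" unfolding m by (simp add: ennreal_mult)
  also have "\<dots> = 2 * emeasure lebesgue (A \<inter> ball 0 \<rho>)" using Am by (simp add: emeasure_eq_measure2)
  also have "\<dots> = 2 * emeasure lborel (A \<inter> ball 0 \<rho>)" using A by simp
  finally show "emeasure lborel S = 2 * emeasure lborel (A \<inter> ball 0 \<rho>)" .
qed

text \<open>The change of variables lives on \<open>real^2\<close>, Fubini's theorem on pairs. The
  two Lebesgue measures correspond because both give boxes the product of the side lengths.\<close>

lemma distr_lborel_vector2: "distr lborel borel (\<lambda>(s, \<theta>). vector [s, \<theta>] :: real^2) = lborel"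
proof (rule lborel_eqI[symmetric])
  let ?J = "\<lambda>(s::real, \<theta>::real). vector [s, \<theta>] :: real^2"
  have "?J = (\<lambda>x. fst x *\<^sub>R axis 1 1 + snd x *\<^sub>R axis 2 1)"
    by (auto simp: fun_eq_iff vec_eq_iff forall_2 axis_def)
  then have "continuous_on UNIV ?J" by (auto intro!: continuous_intros)
  then have Jm: "?J \<in> borel_measurable lborel"
    using borel_measurable_continuous_onI by auto
  fix l u :: "real^2" assume lu: "\<And>b. b \<in> Basis \<Longrightarrow> l \<bullet> b \<le> u \<bullet> b"
  have c: "l $ i \<le> u $ i" for i using lu[of "axis i 1"] by (simp add: inner_axis axis_in_Basis_iff)
  have "emeasure (distr lborel borel ?J) (box l u) = emeasure lborel (?J -` box l u \<inter> space lborel)"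
    by (rule emeasure_distr[OF Jm]) simp
  also have "?J -` box l u \<inter> space lborel = box (l $ 1, l $ 2) (u $ 1, u $ 2)"
    by (auto simp: mem_box_cart forall_2 mem_box Basis_prod_def)
  also have "emeasure lborel \<dots> = ennreal (\<Prod>b\<in>Basis. ((u $ 1, u $ 2) - (l $ 1, l $ 2)) \<bullet> b)"
    by (rule emeasure_lborel_box) (use c in \<open>auto simp: Basis_prod_def\<close>)
  also have "(\<Prod>b\<in>Basis. ((u $ 1, u $ 2) - (l $ 1, l $ 2)) \<bullet> b) = (u $ 1 - l $ 1) * (u $ 2 - l $ 2)"
  proof -
    have B: "(Basis :: (real \<times> real) set) = {(1, 0), (0, 1)}" by (auto simp: Basis_prod_def)
    show ?thesis unfolding B by simp
  qed
  also have "\<dots> = (\<Prod>b\<in>Basis. (u - l) \<bullet> b)"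
  proof -
    have B: "(Basis :: (real^2) set) = {axis 1 1, axis 2 1}" by (auto simp: Basis_vec_def UNIV_2)
    show ?thesis unfolding B by (subst prod.insert) (auto simp: inner_axis axis_eq_axis)
  qed
  finally show "emeasure (distr lborel borel ?J) (box l u) = ennreal (\<Prod>b\<in>Basis. (u - l) \<bullet> b)" .
qed simp

lemma polar_rect_borel [measurable]: "polar_rect \<rho> \<in> sets borel"
  unfolding polar_rect_def by (intro borel_open open_Times) auto

text \<open>As an identity of measures, the polar formula serves both for integrals and for null
  sets. The factor \<open>2\<close> is the inverse of the Jacobian.\<close>

lemma distr_polar_map:
  assumes \<rho>: "\<rho> > 0"
  shows "distr (density lborel (indicator (polar_rect \<rho>))) borel polar_map = density lborel (\<lambda>x. 2 * indicator (ball 0 \<rho>) x)"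
proof (rule measure_eqI)
  fix A assume "A \<in> sets (distr (density lborel (indicator (polar_rect \<rho>))) borel polar_map)"
  then have A[measurable]: "A \<in> sets borel" by simp
  let ?J = "\<lambda>(s::real, \<theta>::real). vector [s, \<theta>] :: real^2"
  let ?S = "{y::real^2. 0 < y $ 1 \<and> y $ 1 < \<rho>\<^sup>2 \<and> 0 < y $ 2 \<and> y $ 2 < 2 * pi \<and> polar (sqrt (y $ 1)) (y $ 2) \<in> A}"
  have "?J = (\<lambda>x. fst x *\<^sub>R axis 1 1 + snd x *\<^sub>R axis 2 1)"
    by (auto simp: fun_eq_iff vec_eq_iff forall_2 axis_def)
  then have "continuous_on UNIV ?J" by (auto intro!: continuous_intros)
  then have Jm: "?J \<in> borel_measurable lborel"
    using borel_measurable_continuous_onI by auto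
  have pA: "polar_map -` A \<in> sets borel" using measurable_sets[OF polar_map_measurable A] by simp
  have "emeasure (distr (density lborel (indicator (polar_rect \<rho>))) borel polar_map) A
      = emeasure (density lborel (indicator (polar_rect \<rho>))) (polar_map -` A)"
    by (subst emeasure_distr) auto
  also have "\<dots> = (\<integral>\<^sup>+y. indicator (polar_rect \<rho>) y * indicator (polar_map -` A) y \<partial>lborel)"
    by (rule emeasure_density) (use pA in auto)
  also have "\<dots> = (\<integral>\<^sup>+y. indicator (polar_rect \<rho> \<inter> polar_map -` A) y \<partial>lborel)"
    by (simp only: indicator_inter_arith)
  also have "\<dots> = emeasure lborel (polar_rect \<rho> \<inter> polar_map -` A)"
    by (rule nn_integral_indicator) (use pA in auto)
  also have "polar_rect \<rho> \<inter> polar_map -` A = ?J -` ?S \<inter> space lborel"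
    by (auto simp: polar_rect_def polar_map_def)
  also have "emeasure lborel \<dots> = emeasure (distr lborel borel ?J) ?S"
    by (rule emeasure_distr[symmetric, OF Jm polar_map_measure_vec(1)[OF A \<rho>]])
  also have "\<dots> = 2 * emeasure lborel (A \<inter> ball 0 \<rho>)"
    unfolding distr_lborel_vector2 by (rule polar_map_measure_vec(2)[OF A \<rho>])
  also have "\<dots> = emeasure (density lborel (\<lambda>x. 2 * indicator (ball 0 \<rho>) x)) A"
  proof -
    have "emeasure (density lborel (\<lambda>x. 2 * indicator (ball 0 \<rho>) x)) A = (\<integral>\<^sup>+x. 2 * indicator (A \<inter> ball 0 \<rho>) x \<partial>lborel)"
      by (subst emeasure_density) (auto intro!: nn_integral_cong simp: indicator_def)
    also have "\<dots> = 2 * emeasure lborel (A \<inter> ball 0 \<rho>)"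
    proof (subst nn_integral_cmult)
      have AB: "A \<inter> ball 0 \<rho> \<in> sets lborel" using A by simp
      then show "indicator (A \<inter> ball 0 \<rho>) \<in> borel_measurable lborel" by (rule borel_measurable_indicator)
      show "2 * (\<integral>\<^sup>+x. indicator (A \<inter> ball 0 \<rho>) x \<partial>lborel) = 2 * emeasure lborel (A \<inter> ball 0 \<rho>)"
        using nn_integral_indicator[OF AB] by simp
    qed
    finally show ?thesis by simp
  qed
  finally show "emeasure (distr (density lborel (indicator (polar_rect \<rho>))) borel polar_map) A = emeasure (density lborel (\<lambda>x. 2 * indicator (ball 0 \<rho>) x)) A" .
qed simp

lemma AE_polar:
  assumes \<rho>: "\<rho> > 0" and ae: "AE x in lebesgue_on (ball 0 \<rho>). Q x"
  shows "AE y in lborel. y \<in> polar_rect \<rho> \<longrightarrow> Q (polar_map y)"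
proof -
  have "AE x in lebesgue. x \<in> ball 0 \<rho> \<longrightarrow> Q x"
    using ae by (subst (asm) AE_restrict_space_iff) auto
  then have "AE x in lborel. x \<in> ball 0 \<rho> \<longrightarrow> Q x" by (simp add: AE_completion_iff)
  then have "AE x in density lborel (\<lambda>x. 2 * indicator (ball 0 \<rho>) x). Q x"
    by (subst AE_density) (auto elim!: eventually_mono simp: indicator_def split: if_splits)
  then have "AE x in distr (density lborel (indicator (polar_rect \<rho>))) borel polar_map. Q x"
    by (simp only: distr_polar_map[OF \<rho>])
  then have "AE y in density lborel (indicator (polar_rect \<rho>)). Q (polar_map y)"
    by (rule AE_distrD[rotated]) simp
  then show ?thesis
    by (subst (asm) AE_density) (auto elim!: eventually_mono simp: indicator_def split: if_splits)
qed

lemma polar_integral: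
  fixes f :: "real^2 \<Rightarrow> complex"
  assumes \<rho>: "\<rho> > 0" and f[measurable]: "f \<in> borel_measurable borel" and i: "integrable (lebesgue_on (ball 0 \<rho>)) f"
  shows "integrable lborel (\<lambda>y. indicator (polar_rect \<rho>) y *\<^sub>R f (polar_map y))"
    "lebint (ball 0 \<rho>) f = (1/2) * lborint (\<lambda>y. indicator (polar_rect \<rho>) y *\<^sub>R f (polar_map y))"
proof -
  have bm[measurable]: "ball (0::real^2) \<rho> \<in> sets borel" by simp
  have fb[measurable]: "(\<lambda>x. indicator (ball 0 \<rho>) x *\<^sub>R f x) \<in> borel_measurable borel"
    by (intro borel_measurable_scaleR borel_measurable_indicator f bm)
  have "integrable lebesgue (\<lambda>x. indicator (ball 0 \<rho>) x *\<^sub>R f x)"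
    using i by (subst (asm) integrable_restrict_space) auto
  then have ib: "integrable lborel (\<lambda>x. indicator (ball 0 \<rho>) x *\<^sub>R f x)"
    by (subst (asm) integrable_completion) auto
  let ?D = "density lborel (\<lambda>x::real^2. ennreal (2 * indicator (ball 0 \<rho>) x))"
  have D: "density lborel (\<lambda>x::real^2. 2 * indicator (ball 0 \<rho>) x) = ?D"
    by (intro density_cong) (auto simp: indicator_def)
  have R: "density lborel (indicator (polar_rect \<rho>)) = density lborel (\<lambda>y. ennreal (indicator (polar_rect \<rho>) y))"
    by (intro density_cong) (auto simp: indicator_def)
  have "integrable lborel (\<lambda>x. (2 * indicator (ball 0 \<rho>) x) *\<^sub>R f x)"
    using integrable_scaleR_right[OF ib, of 2] by simp
  then have iD: "integrable ?D f" by (subst integrable_density) auto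
  have eD: "integral\<^sup>L ?D f = 2 * lborint (\<lambda>x. indicator (ball 0 \<rho>) x *\<^sub>R f x)"
  proof -
    have "integral\<^sup>L ?D f = lborint (\<lambda>x. (2 * indicator (ball 0 \<rho>) x) *\<^sub>R f x)"
      by (rule integral_density) auto
    also have "(\<lambda>x. (2 * indicator (ball 0 \<rho>) x) *\<^sub>R f x) = (\<lambda>x. 2 * (indicator (ball 0 \<rho>) x *\<^sub>R f x))"
      by (auto simp: indicator_def scaleR_conv_of_real)
    finally show ?thesis by (simp only: integral_mult_right_zero)
  qed
  have iR: "integrable (density lborel (\<lambda>y. ennreal (indicator (polar_rect \<rho>) y))) (\<lambda>y. f (polar_map y))"
    using iD unfolding D[symmetric] distr_polar_map[OF \<rho>, symmetric] R[symmetric]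
    by (subst (asm) integrable_distr_eq) auto
  then show "integrable lborel (\<lambda>y. indicator (polar_rect \<rho>) y *\<^sub>R f (polar_map y))"
    by (subst (asm) integrable_density) auto
  have "integral\<^sup>L ?D f = integral\<^sup>L (density lborel (\<lambda>y. ennreal (indicator (polar_rect \<rho>) y))) (\<lambda>y. f (polar_map y))"
    unfolding D[symmetric] distr_polar_map[OF \<rho>, symmetric] R[symmetric]
    by (rule integral_distr) auto
  also have "\<dots> = lborint (\<lambda>y. indicator (polar_rect \<rho>) y *\<^sub>R f (polar_map y))"
    by (rule integral_density) auto
  finally have m1: "2 * lborint (\<lambda>x. indicator (ball 0 \<rho>) x *\<^sub>R f x) = lborint (\<lambda>y. indicator (polar_rect \<rho>) y *\<^sub>R f (polar_map y))"
    unfolding eD .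
  have m2: "lebint (ball 0 \<rho>) f = integral\<^sup>L lebesgue (\<lambda>x. indicator (ball 0 \<rho>) x *\<^sub>R f x)"
    by (rule integral_restrict_space) auto
  have m3: "\<dots> = lborint (\<lambda>x. indicator (ball 0 \<rho>) x *\<^sub>R f x)"
    by (rule integral_completion) auto
  show "lebint (ball 0 \<rho>) f = (1/2) * lborint (\<lambda>y. indicator (polar_rect \<rho>) y *\<^sub>R f (polar_map y))"
    unfolding m2 m3 m1[symmetric] by simp
qed

section \<open>The divergence theorem on discs\<close>


lemma integrable_lebesgue_on_subset:
  fixes f :: "'a::euclidean_space \<Rightarrow> 'b::euclidean_space"
  assumes "integrable (lebesgue_on T) f" "S \<subseteq> T" "S \<in> sets lebesgue" "T \<in> sets lebesgue"
  shows "integrable (lebesgue_on S) f"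
proof -
  have "set_integrable lebesgue T f"
    unfolding set_integrable_def using assms by (subst (asm) integrable_restrict_space) auto
  then have "set_integrable lebesgue S f" by (rule set_integrable_subset) (use assms in auto)
  then show ?thesis
    unfolding set_integrable_def using assms by (subst integrable_restrict_space) auto
qed

lemma integrable_lebesgue_on_open_interval:
  fixes f :: "real \<Rightarrow> complex"
  assumes "continuous_on {a..b} f"
  shows "integrable (lebesgue_on {a<..<b}) f"
  by (rule integrable_lebesgue_on_subset[OF continuous_imp_integrable_real[OF assms]]) auto

lemma lebesgue_on_open_interval_integral:
  fixes f :: "real \<Rightarrow> complex"
  assumes "continuous_on {a..b} f"
  shows "lebint {a<..<b} f = integral {a..b} f"
  using lebesgue_integral_eq_integral[OF integrable_lebesgue_on_open_interval[OF assms]]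
  by (simp add: integral_open_interval_real)

lemma lborel_open_interval_integral:
  fixes f :: "real \<Rightarrow> complex"
  assumes "continuous_on {a..b} f"
  shows "lborint (\<lambda>x. indicator {a<..<b} x *\<^sub>R f x) = integral {a..b} f"
proof -
  have "set_integrable lborel {a<..<b} f"
    by (rule set_integrable_subset[OF borel_integrable_atLeastAtMost'[OF assms]]) auto
  from set_borel_integral_eq_integral(2)[OF this] show ?thesis
    by (simp add: set_lebesgue_integral_def integral_open_interval_real)
qed

lemma continuous_integrable_ball:
  fixes f :: "real^2 \<Rightarrow> complex"
  assumes "continuous_on UNIV f" "S \<in> lmeasurable" "bounded S"
  shows "integrable (lebesgue_on S) f"
  by (rule L2_integrable[OF assms(2) L2_continuous[OF assms(2,3,1)]])

lemma polar_iterated_integral: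
  fixes f :: "real^2 \<Rightarrow> complex"
  assumes \<rho>: "\<rho> > 0" and f: "continuous_on UNIV f"
  shows "lebint (ball 0 \<rho>) f
    = (1/2) * integral {0..\<rho>\<^sup>2} (\<lambda>s. integral {0..2*pi} (\<lambda>\<theta>. f (polar (sqrt s) \<theta>)))"
proof -
  have fm: "f \<in> borel_measurable borel" by (rule borel_measurable_continuous_onI[OF f])
  have fi: "integrable (lebesgue_on (ball 0 \<rho>)) f" by (rule continuous_integrable_ball[OF f]) auto
  note P = polar_integral[OF \<rho> fm fi]
  let ?g = "\<lambda>y. indicator (polar_rect \<rho>) y *\<^sub>R f (polar_map y)"
  define H where "H s = integral {0..2*pi} (\<lambda>\<theta>. f (polar (sqrt s) \<theta>))" for s
  have fc: "continuous_on UNIV (\<lambda>(s, \<theta>). f (polar (sqrt s) \<theta>))"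
    unfolding case_prod_unfold
    by (rule continuous_on_compose2[OF f continuous_on_polar_compose]) (auto intro!: continuous_intros)
  have inner: "lborint (\<lambda>\<theta>. ?g (s, \<theta>)) = indicator {0<..<\<rho>\<^sup>2} s *\<^sub>R H s" for s
  proof -
    have "(\<lambda>\<theta>. ?g (s, \<theta>)) = (\<lambda>\<theta>. indicator {0<..<\<rho>\<^sup>2} s *\<^sub>R (indicator {0<..<2*pi} \<theta> *\<^sub>R f (polar (sqrt s) \<theta>)))"
      by (rule ext) (auto simp: polar_rect_def polar_map_def indicator_def)
    then have "lborint (\<lambda>\<theta>. ?g (s, \<theta>)) = indicator {0<..<\<rho>\<^sup>2} s *\<^sub>R lborint (\<lambda>\<theta>. indicator {0<..<2*pi} \<theta> *\<^sub>R f (polar (sqrt s) \<theta>))"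
      by (simp only: integral_scaleR_right)
    also have "lborint (\<lambda>\<theta>. indicator {0<..<2*pi} \<theta> *\<^sub>R f (polar (sqrt s) \<theta>)) = H s"
      unfolding H_def
      by (rule lborel_open_interval_integral)
        (rule continuous_on_compose2[OF f continuous_on_polar_compose], auto intro!: continuous_intros)
    finally show ?thesis .
  qed
  have Hc: "continuous_on {0..\<rho>\<^sup>2} H"
    unfolding H_def cbox_interval[symmetric]
    by (rule integral_continuous_on_param) (rule continuous_on_subset[OF fc], simp)
  have "lborint ?g = lborint (\<lambda>s. lborint (\<lambda>\<theta>. ?g (s, \<theta>)))"
    using lborel_pair.integral_fst'[of ?g] P(1) by (simp only: lborel_prod)
  also have "\<dots> = lborint (\<lambda>s. indicator {0<..<\<rho>\<^sup>2} s *\<^sub>R H s)" unfolding inner ..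
  also have "\<dots> = integral {0..\<rho>\<^sup>2} H" by (rule lborel_open_interval_integral[OF Hc])
  finally show ?thesis unfolding P(2) H_def by simp
qed

lemma has_derivative_pderiv:
  assumes "f differentiable (at x)"
  shows "(f has_derivative (\<lambda>h. of_real (h $ 1) * pderiv_at 1 f x + of_real (h $ 2) * pderiv_at 2 f x)) (at x)"
proof -
  let ?D = "frechet_derivative f (at x)"
  have D: "(f has_derivative ?D) (at x)" using assms frechet_derivative_works by blast
  interpret linear ?D by (rule has_derivative_linear[OF D])
  have "?D h = of_real (h $ 1) * pderiv_at 1 f x + of_real (h $ 2) * pderiv_at 2 f x" for h
  proof -
    have "h = h $ 1 *\<^sub>R axis 1 1 + h $ 2 *\<^sub>R axis 2 1"
      by (simp add: vec_eq_iff forall_2 axis_def)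
    then have "?D h = ?D (h $ 1 *\<^sub>R axis 1 1 + h $ 2 *\<^sub>R axis 2 1)" by (rule arg_cong)
    also have "\<dots> = h $ 1 *\<^sub>R ?D (axis 1 1) + h $ 2 *\<^sub>R ?D (axis 2 1)" by (simp only: add scale)
    finally show ?thesis by (simp only: pderiv_at_def scaleR_conv_of_real)
  qed
  then have "?D = (\<lambda>h. of_real (h $ 1) * pderiv_at 1 f x + of_real (h $ 2) * pderiv_at 2 f x)" by (rule ext)
  then show ?thesis using D by (simp only:)
qed

lemma polar_linear_comb: "polar r \<theta> = (r * cos \<theta>) *\<^sub>R axis 1 1 + (r * sin \<theta>) *\<^sub>R axis 2 1"
  by (simp add: vec_eq_iff forall_2 axis_def)

lemma has_vector_derivative_polar_radial:
  assumes "smooth f"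
  shows "((\<lambda>r. f (polar r \<theta>)) has_vector_derivative
    (of_real (cos \<theta>) * pderiv_at 1 f (polar r \<theta>) + of_real (sin \<theta>) * pderiv_at 2 f (polar r \<theta>))) (at r within S)"
proof -
  have p: "((\<lambda>r. polar r \<theta>) has_derivative (\<lambda>h. h *\<^sub>R polar 1 \<theta>)) (at r within S)"
    unfolding polar_linear_comb by (auto intro!: derivative_eq_intros simp: algebra_simps)
  from has_derivative_compose[OF p has_derivative_pderiv[OF smooth_differentiable[OF assms]]]
  show ?thesis unfolding has_vector_derivative_def
    by (rule has_derivative_eq_rhs) (simp add: fun_eq_iff scaleR_conv_of_real[where 'a=complex] algebra_simps)
qed

lemma has_vector_derivative_polar_angular:
  assumes "smooth f"
  shows "((\<lambda>\<theta>. f (polar r \<theta>)) has_vector_derivative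
    (of_real (- r * sin \<theta>) * pderiv_at 1 f (polar r \<theta>) + of_real (r * cos \<theta>) * pderiv_at 2 f (polar r \<theta>))) (at \<theta> within S)"
proof -
  have p: "((\<lambda>\<theta>. polar r \<theta>) has_derivative (\<lambda>h. h *\<^sub>R vector [- r * sin \<theta>, r * cos \<theta>])) (at \<theta> within S)"
    unfolding polar_linear_comb
    by (rule has_derivative_eq_rhs) (auto intro!: derivative_eq_intros simp: fun_eq_iff vec_eq_iff forall_2 axis_def)
  from has_derivative_compose[OF p has_derivative_pderiv[OF smooth_differentiable[OF assms]]]
  show ?thesis unfolding has_vector_derivative_def
    by (rule has_derivative_eq_rhs) (simp add: fun_eq_iff scaleR_conv_of_real[where 'a=complex] algebra_simps)
qed

lemma continuous_on_smooth_polar: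
  assumes "smooth f" "continuous_on S g" "continuous_on S h"
  shows "continuous_on S (\<lambda>x. f (polar (g x) (h x)))"
  by (rule continuous_on_compose2[OF smooth_continuous[OF assms(1)] continuous_on_polar_compose[OF assms(2,3)]]) simp

text \<open>\<open>\<nu>\<close> is the \<open>i\<close>-th component of the exterior unit normal
  and \<open>\<tau>\<close> an antiderivative of it; \<open>rel\<close> says that \<open>r\<close>
  times the \<open>i\<close>-th partial derivative is \<open>\<nu> r d/dr - \<tau> d/dtheta\<close>.
  Differentiating the flux \<open>K r\<close> through the circle of radius \<open>r\<close> and
  integrating by parts over a period of the angle gives \<open>K' = r H\<close>, with
  \<open>H\<close> the angular integral of the partial derivative.\<close>

lemma disc_divergence_aux:
  fixes \<nu> \<tau> :: "real \<Rightarrow> real" and i :: 2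
  assumes G: "smooth G" and \<rho>: "\<rho> > 0"
    and cont: "continuous_on UNIV \<nu>"
    and \<tau>: "\<And>\<theta>. (\<tau> has_real_derivative \<nu> \<theta>) (at \<theta>)" and per: "\<tau> (2 * pi) = \<tau> 0"
    and rel: "\<And>\<theta> a b :: complex. of_real (\<nu> \<theta>) * (of_real (cos \<theta>) * a + of_real (sin \<theta>) * b)
       - of_real (\<tau> \<theta>) * (of_real (- sin \<theta>) * a + of_real (cos \<theta>) * b) = (if i = 1 then a else b)"
  shows "lebint (ball 0 \<rho>) (pderiv_at i G)
    = of_real \<rho> * integral {0..2*pi} (\<lambda>\<theta>. G (polar \<rho> \<theta>) * of_real (\<nu> \<theta>))"
proof -
  note c = continuous_on_smooth_polar[OF G] continuous_on_smooth_polar[OF smooth_pderiv[OF G]]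
    continuous_on_compose2[OF cont]
  define K where "K r = integral (cbox 0 (2*pi)) (\<lambda>\<theta>. of_real r * of_real (\<nu> \<theta>) * G (polar r \<theta>))" for r
  define k' where "k' r \<theta> = of_real (\<nu> \<theta>) * G (polar r \<theta>) + of_real (r * \<nu> \<theta>) *
      (of_real (cos \<theta>) * pderiv_at 1 G (polar r \<theta>) + of_real (sin \<theta>) * pderiv_at 2 G (polar r \<theta>))" for r \<theta>
  define H where "H r = integral (cbox 0 (2*pi)) (\<lambda>\<theta>. pderiv_at i G (polar r \<theta>))" for r
  have Kd: "(K has_vector_derivative integral (cbox 0 (2*pi)) (k' r)) (at r)" for r
    unfolding K_def
  proof (rule leibniz_rule_vector_derivative[of UNIV, simplified])
    show "((\<lambda>r. of_real r * of_real (\<nu> \<theta>) * G (polar r \<theta>)) has_vector_derivative k' r \<theta>) (at r)" for r \<theta>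
    proof -
      have a: "((\<lambda>r. complex_of_real r * of_real (\<nu> \<theta>)) has_vector_derivative of_real (\<nu> \<theta>)) (at r)"
        by (auto intro!: derivative_eq_intros)
      show ?thesis
        using has_vector_derivative_mult[OF a has_vector_derivative_polar_radial[OF G, of \<theta> r UNIV]]
        unfolding k'_def by (simp add: algebra_simps)
    qed
    show "(\<lambda>\<theta>. of_real r * of_real (\<nu> \<theta>) * G (polar r \<theta>)) integrable_on cbox 0 (2*pi)" for r
      by (rule integrable_continuous) (intro continuous_intros c; auto)
    show "continuous_on (UNIV \<times> cbox 0 (2*pi)) (\<lambda>(r, \<theta>). k' r \<theta>)"
      unfolding k'_def case_prod_unfold by (intro continuous_intros c; auto)
  qed
  have k'H: "integral (cbox 0 (2*pi)) (k' r) = of_real r * H r" for r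
  proof -
    \<comment> \<open>The angular derivative of \<open>\<tau>\<close> times \<open>G\<close>, whose
      integral over a period vanishes because both factors take equal values at \<open>0\<close> and
      \<open>2 pi\<close>.\<close>
    define w where "w \<theta> = of_real (\<nu> \<theta>) * G (polar r \<theta>) + of_real (\<tau> \<theta>) *
       (of_real (- r * sin \<theta>) * pderiv_at 1 G (polar r \<theta>) + of_real (r * cos \<theta>) * pderiv_at 2 G (polar r \<theta>))" for \<theta>
    have wd: "((\<lambda>\<theta>. of_real (\<tau> \<theta>) * G (polar r \<theta>)) has_vector_derivative w \<theta>) (at \<theta> within {0..2*pi})" for \<theta>
    proof -
      have a: "((\<lambda>\<theta>. complex_of_real (\<tau> \<theta>)) has_vector_derivative of_real (\<nu> \<theta>)) (at \<theta> within {0..2*pi})"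
        using \<tau>[of \<theta>] by (intro has_vector_derivative_of_real) (auto simp: has_real_derivative_iff_has_vector_derivative intro: has_vector_derivative_at_within)
      show ?thesis
        using has_vector_derivative_mult[OF a has_vector_derivative_polar_angular[OF G]]
        unfolding w_def by (simp add: algebra_simps)
    qed
    have "(w has_integral (of_real (\<tau> (2*pi)) * G (polar r (2*pi)) - of_real (\<tau> 0) * G (polar r 0))) {0..2*pi}"
      by (rule fundamental_theorem_of_calculus[OF _ wd]) simp
    moreover have "polar r (2*pi) = polar r 0" by (simp add: polar_def)
    ultimately have w0: "(w has_integral 0) (cbox 0 (2*pi))" using per by simp
    have "k' r \<theta> = w \<theta> + of_real r * pderiv_at i G (polar r \<theta>)" for \<theta>
    proof -
      have i: "pderiv_at i G (polar r \<theta>) = (if i = 1 then pderiv_at 1 G (polar r \<theta>) else pderiv_at 2 G (polar r \<theta>))"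
        using exhaust_2[of i] by auto
      show ?thesis unfolding i rel[symmetric, of "pderiv_at 1 G (polar r \<theta>)" "pderiv_at 2 G (polar r \<theta>)" \<theta>] k'_def w_def
        by (simp add: algebra_simps)
    qed
    then have e: "k' r = (\<lambda>\<theta>. w \<theta> + of_real r * pderiv_at i G (polar r \<theta>))" by (rule ext)
    have "((\<lambda>\<theta>. pderiv_at i G (polar r \<theta>)) has_integral H r) (cbox 0 (2*pi))"
      unfolding H_def by (intro integrable_integral integrable_continuous c; auto intro!: continuous_intros)
    from has_integral_add[OF w0 has_integral_mult_right[OF this, of "of_real r"]]
    show ?thesis unfolding e by (simp add: integral_unique)
  qed
  have Kd': "(K has_vector_derivative of_real r * H r) (at r)" for r
    using Kd[of r] unfolding k'H .
  have Kc: "continuous_on UNIV K"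
    using Kd' by (auto intro!: continuous_at_imp_continuous_on has_vector_derivative_continuous)
  \<comment> \<open>In the variable \<open>s = r^2\<close> the factor \<open>r\<close> in
    \<open>K'\<close> cancels. The square root is not differentiable at \<open>0\<close>, so the
    fundamental theorem is used in the version for interior derivatives.\<close>
  have "((\<lambda>s. H (sqrt s) / 2) has_integral (K (sqrt (\<rho>\<^sup>2)) - K (sqrt 0))) {0..\<rho>\<^sup>2}"
  proof (rule fundamental_theorem_of_calculus_interior)
    show "continuous_on {0..\<rho>\<^sup>2} (\<lambda>s. K (sqrt s))"
      by (rule continuous_on_compose2[OF Kc]) (auto intro!: continuous_intros)
    fix s assume s: "s \<in> {0<..<\<rho>\<^sup>2}"
    have "(sqrt has_vector_derivative inverse (sqrt s) / 2) (at s)"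
      using DERIV_real_sqrt[of s] s by (simp add: has_real_derivative_iff_has_vector_derivative)
    from vector_diff_chain_at[OF this Kd']
    have "((\<lambda>s. K (sqrt s)) has_vector_derivative (inverse (sqrt s) / 2) *\<^sub>R (of_real (sqrt s) * H (sqrt s))) (at s)"
      by (simp add: o_def)
    moreover have "(inverse (sqrt s) / 2) *\<^sub>R (of_real (sqrt s) * H (sqrt s)) = H (sqrt s) / 2"
      using s by (simp add: scaleR_conv_of_real)
    ultimately show "((\<lambda>s. K (sqrt s)) has_vector_derivative H (sqrt s) / 2) (at s)" by (simp only:)
  qed simp
  moreover have "K (sqrt 0) = 0" by (simp add: K_def)
  moreover have "sqrt (\<rho>\<^sup>2) = \<rho>" using \<rho> by simp
  ultimately have "((\<lambda>s. H (sqrt s) / 2) has_integral K \<rho>) {0..\<rho>\<^sup>2}" by simp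
  then have "integral {0..\<rho>\<^sup>2} (\<lambda>s. H (sqrt s) / 2) = K \<rho>" by (rule integral_unique)
  moreover have "integral {0..\<rho>\<^sup>2} (\<lambda>s. H (sqrt s) / 2) = (1/2) * integral {0..\<rho>\<^sup>2} (\<lambda>s. H (sqrt s))"
    by simp
  moreover have "K \<rho> = of_real \<rho> * integral {0..2*pi} (\<lambda>\<theta>. G (polar \<rho> \<theta>) * of_real (\<nu> \<theta>))"
  proof -
    have "K \<rho> = integral {0..2*pi} (\<lambda>\<theta>. of_real \<rho> * (G (polar \<rho> \<theta>) * of_real (\<nu> \<theta>)))"
      unfolding K_def by (simp add: mult_ac)
    then show ?thesis by simp
  qed
  ultimately show ?thesis
    unfolding polar_iterated_integral[OF \<rho> smooth_continuous[OF smooth_pderiv[OF G]]] H_def by simp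
qed

text \<open>The circle integral, in arc length, of \<open>t F\<close> times the \<open>i\<close>-th
  component of the radial unit vector. Trace and test function have separate slots, since a trace is
  only square integrable while \<open>F\<close> is smooth.\<close>

definition circle_pairing :: "real \<Rightarrow> 2 \<Rightarrow> (real^2 \<Rightarrow> complex) \<Rightarrow> (real^2 \<Rightarrow> complex) \<Rightarrow> complex" where
  "circle_pairing \<rho> i t F = of_real \<rho> *
     lebint {0<..<2*pi} (\<lambda>\<theta>. t (polar \<rho> \<theta>) * (F (polar \<rho> \<theta>) * of_real (polar 1 \<theta> $ i)))"

lemma continuous_on_polar_nth: "continuous_on S (\<lambda>\<theta>. polar r \<theta> $ i)"
proof -
  have "continuous_on S (\<lambda>\<theta>. r * cos \<theta>)" "continuous_on S (\<lambda>\<theta>. r * sin \<theta>)"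
    by (intro continuous_intros)+
  then show ?thesis using exhaust_2[of i] by (elim disjE) (simp_all only: polar_nth)
qed

lemma disc_divergence:
  assumes G: "smooth G" and \<rho>: "\<rho> > 0"
  shows "lebint (ball 0 \<rho>) (pderiv_at i G) = circle_pairing \<rho> i (\<lambda>_. 1) G"
proof -
  have "lebint (ball 0 \<rho>) (pderiv_at i G)
    = of_real \<rho> * integral {0..2*pi} (\<lambda>\<theta>. G (polar \<rho> \<theta>) * of_real (polar 1 \<theta> $ i))"
  proof -
    have sc: "complex_of_real (cos \<theta>) * of_real (cos \<theta>) + of_real (sin \<theta>) * of_real (sin \<theta>) = 1" for \<theta>
      using sin_cos_squared_add2[of \<theta>] unfolding power2_eq_square
      by (simp only: of_real_mult[symmetric] of_real_add[symmetric]) simp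
    consider "i = 1" | "i = 2" using exhaust_2 by blast
    then show ?thesis
    proof cases
      case 1
      have "lebint (ball 0 \<rho>) (pderiv_at i G) = of_real \<rho> * integral {0..2*pi} (\<lambda>\<theta>. G (polar \<rho> \<theta>) * of_real (cos \<theta>))"
      proof (rule disc_divergence_aux[OF G \<rho>, where \<tau> = sin])
        fix \<theta> and a b :: complex
        have "complex_of_real (cos \<theta>) * (of_real (cos \<theta>) * a + of_real (sin \<theta>) * b) - of_real (sin \<theta>) * (of_real (- sin \<theta>) * a + of_real (cos \<theta>) * b)
          = (of_real (cos \<theta>) * of_real (cos \<theta>) + of_real (sin \<theta>) * of_real (sin \<theta>)) * a"
          by (simp add: algebra_simps)
        then show "complex_of_real (cos \<theta>) * (of_real (cos \<theta>) * a + of_real (sin \<theta>) * b) - of_real (sin \<theta>) * (of_real (- sin \<theta>) * a + of_real (cos \<theta>) * b)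
          = (if i = 1 then a else b)" using 1 sc by simp
      qed (auto intro!: continuous_intros derivative_eq_intros)
      then show ?thesis using 1 by simp
    next
      case 2
      have "lebint (ball 0 \<rho>) (pderiv_at i G) = of_real \<rho> * integral {0..2*pi} (\<lambda>\<theta>. G (polar \<rho> \<theta>) * of_real (sin \<theta>))"
      proof (rule disc_divergence_aux[OF G \<rho>, where \<tau> = "\<lambda>\<theta>. - cos \<theta>"])
        fix \<theta> and a b :: complex
        have "complex_of_real (sin \<theta>) * (of_real (cos \<theta>) * a + of_real (sin \<theta>) * b) - of_real (- cos \<theta>) * (of_real (- sin \<theta>) * a + of_real (cos \<theta>) * b)
          = (of_real (cos \<theta>) * of_real (cos \<theta>) + of_real (sin \<theta>) * of_real (sin \<theta>)) * b"
          by (simp add: algebra_simps)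
        then show "complex_of_real (sin \<theta>) * (of_real (cos \<theta>) * a + of_real (sin \<theta>) * b) - of_real (- cos \<theta>) * (of_real (- sin \<theta>) * a + of_real (cos \<theta>) * b)
          = (if i = 1 then a else b)" using 2 sc by simp
      qed (auto intro!: continuous_intros derivative_eq_intros)
      then show ?thesis using 2 by simp
    qed
  qed
  moreover have "lebint {0<..<2*pi} (\<lambda>\<theta>. G (polar \<rho> \<theta>) * of_real (polar 1 \<theta> $ i))
      = integral {0..2*pi} (\<lambda>\<theta>. G (polar \<rho> \<theta>) * of_real (polar 1 \<theta> $ i))"
  proof (rule lebesgue_on_open_interval_integral)
    show "continuous_on {0..2*pi} (\<lambda>\<theta>. G (polar \<rho> \<theta>) * of_real (polar 1 \<theta> $ i))"
      by (intro continuous_on_mult continuous_on_of_real continuous_on_polar_nth continuous_on_smooth_polar[OF G]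
          continuous_on_const continuous_on_id)
  qed
  ultimately show ?thesis by (simp add: circle_pairing_def)
qed

section \<open>Green's formula with traces\<close>


lemma test_function_outside:
  assumes "\<phi> \<in> test_functions U" "x \<notin> U"
  shows "\<phi> x = 0" "pderiv_at i \<phi> x = 0"
proof -
  let ?C = "closure {x. \<phi> x \<noteq> 0}"
  have x: "x \<in> - ?C" and s: "smooth \<phi>" using assms by (auto simp: test_functions_def)
  have z: "\<phi> y = 0" if "y \<in> - ?C" for y using that closure_subset[of "{x. \<phi> x \<noteq> 0}"] by blast
  show "\<phi> x = 0" by (rule z[OF x])
  have "pderiv_at i (\<lambda>_. 0) x = pderiv_at i \<phi> x"
    by (rule pderiv_at_cong_open[OF open_Compl[OF closed_closure] x z smooth_differentiable[OF s]])
  then show "pderiv_at i \<phi> x = 0" by (simp add: pderiv_at_const)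
qed

lemma integral_lebesgue_on_subset:
  fixes f :: "'a::euclidean_space \<Rightarrow> complex"
  assumes "U \<subseteq> B" "U \<in> sets lebesgue" "B \<in> sets lebesgue" "\<And>x. x \<in> B - U \<Longrightarrow> f x = 0"
  shows "lebint B f = lebint U f"
proof -
  have "lebint B f = lebint B (\<lambda>x. if x \<in> U then f x else 0)"
    by (rule Bochner_Integration.integral_cong) (use assms(4) in auto)
  also have "\<dots> = lebint U f" by (rule integral_restrict[OF assms(1,2,3)])
  finally show ?thesis .
qed

text \<open>The product with a test function vanishes on the boundary of a large disc around
  \<open>U\<close>, so the divergence theorem on discs serves every bounded open
  \<open>U\<close>.\<close>

lemma smooth_weak_pderiv:
  assumes U: "open U" "bounded U" and V: "smooth V"
  shows "is_weak_pderiv U i V (pderiv_at i V)"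
  unfolding is_weak_pderiv_def
proof
  fix \<phi> assume \<phi>: "\<phi> \<in> test_functions U"
  note Um = lmeasurable_open_bounded[OF U]
  have s: "smooth \<phi>" using \<phi> by (simp add: test_functions_def)
  obtain \<rho> where \<rho>: "\<rho> > 0" "U \<subseteq> ball 0 \<rho>" using bounded_subset_ballD[OF U(2), of 0] by blast
  let ?F = "\<lambda>x. V x * \<phi> x"
  have dF: "pderiv_at i ?F x = V x * pderiv_at i \<phi> x + pderiv_at i V x * \<phi> x" for x
    by (rule pderiv_at_mult[OF smooth_differentiable[OF V] smooth_differentiable[OF s]])
  have out: "\<phi> (polar \<rho> \<theta>) = 0" for \<theta>
  proof (rule test_function_outside(1)[OF \<phi>])
    have "polar \<rho> \<theta> \<notin> ball 0 \<rho>" using \<rho> by (simp add: norm_polar)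
    then show "polar \<rho> \<theta> \<notin> U" using \<rho> by blast
  qed
  have "lebint (ball 0 \<rho>) (pderiv_at i ?F) = 0"
    unfolding disc_divergence[OF smooth_mult[OF V s] \<rho>(1)] circle_pairing_def out by simp
  moreover have "lebint (ball 0 \<rho>) (pderiv_at i ?F) = lebint U (pderiv_at i ?F)"
    by (rule integral_lebesgue_on_subset[OF \<rho>(2)])
      (use Um test_function_outside[OF \<phi>] in \<open>auto simp: dF\<close>)
  moreover have "lebint U (pderiv_at i ?F)
     = lebint U (\<lambda>x. V x * pderiv_at i \<phi> x) + lebint U (\<lambda>x. pderiv_at i V x * \<phi> x)"
    unfolding dF
    by (intro Bochner_Integration.integral_add L2_mult_integrable test_function_L2[OF U \<phi>] L2_continuous[OF Um U(2)]
        smooth_continuous smooth_pderiv V)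
  ultimately show "lebint U (\<lambda>x. V x * pderiv_at i \<phi> x) = - lebint U (\<lambda>x. pderiv_at i V x * \<phi> x)"
    by (simp add: eq_neg_iff_add_eq_0)
qed

context
  fixes U :: "(real^2) set"
  assumes U: "open U" "bounded U"
begin

lemma smooth_L2: "smooth V \<Longrightarrow> V \<in> L2 U"
  by (rule L2_continuous[OF lmeasurable_open_bounded[OF U] U(2) smooth_continuous])

text \<open>Agreement almost everywhere is the right hypothesis: the weak first derivatives of
  \<open>u\<close> are known only almost everywhere, and the lemma is applied to them once more for
  the second order.\<close>

lemma AE_smooth_H1:
  assumes V: "smooth V" and ae: "AE x in lebesgue_on U. V x = u x"
  shows "u \<in> H1 U" "AE x in lebesgue_on U. pderiv_at i V x = wpderiv U i u x"
proof -
  have Ul: "U \<in> sets lebesgue" using U by simp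
  have u: "u \<in> L2 U" by (rule L2_AE_cong[OF Ul smooth_L2[OF V] ae])
  have w: "is_weak_pderiv U i u (pderiv_at i V)" for i
    by (rule weak_pderiv_AE_cong[OF U u smooth_L2[OF V] _ smooth_weak_pderiv[OF U V]]) (use ae in auto)
  show H: "u \<in> H1 U" unfolding H1_def using u w smooth_L2[OF smooth_pderiv[OF V]] by blast
  show "AE x in lebesgue_on U. pderiv_at i V x = wpderiv U i u x"
    by (rule weak_pderiv_unique[OF U smooth_L2[OF smooth_pderiv[OF V]] wpderiv_props(1)[OF H] w wpderiv_props(2)[OF H]])
qed

lemma AE_smooth_H2:
  assumes "smooth V" "AE x in lebesgue_on U. V x = u x"
  shows "u \<in> H2 U"
  using AE_smooth_H1[OF assms] AE_smooth_H1(1)[OF smooth_pderiv[OF assms(1)]] unfolding H2_def by blast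

lemma AE_smooth_weak_laplacian:
  assumes "smooth V" "AE x in lebesgue_on U. V x = u x"
  shows "AE x in lebesgue_on U. (\<Sum>i\<in>UNIV. pderiv_at i (pderiv_at i V) x) = weak_laplacian U u x"
proof -
  have a: "AE x in lebesgue_on U. pderiv_at i (pderiv_at i V) x = wpderiv U i (wpderiv U i u) x" for i
    by (rule AE_smooth_H1(2)[OF smooth_pderiv[OF assms(1)] AE_smooth_H1(2)[OF assms]])
  show ?thesis
    using a[of 1] a[of 2] by eventually_elim (simp add: weak_laplacian_def UNIV_2)
qed

lemma L2_circle:
  assumes "smooth V" shows "(\<lambda>\<theta>. V (polar \<rho> \<theta>)) \<in> L2 {0<..<2*pi}"
  by (rule L2_continuous[OF _ _ continuous_on_smooth_polar[OF assms]]) (auto intro!: continuous_intros)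

text \<open>The constant sequence \<open>V\<close> serves as the approximating sequence.\<close>

lemma AE_smooth_has_trace:
  assumes V: "smooth V" and ae: "AE x in lebesgue_on U. V x = u x" and t: "\<And>\<theta>. t (polar \<rho> \<theta>) = V (polar \<rho> \<theta>)"
  shows "has_trace U \<rho> u t"
proof -
  have Ul: "U \<in> sets lebesgue" using U by simp
  have "L2_tendsto U (\<lambda>_. V) u"
    by (rule L2_tendsto_AE_cong[OF Ul L2_tendsto_const[OF smooth_L2[OF V]] AE_I2 ae]) simp
  moreover have "L2_tendsto U (\<lambda>_. pderiv_at i V) (wpderiv U i u)" for i
    by (rule L2_tendsto_AE_cong[OF Ul L2_tendsto_const[OF smooth_L2[OF smooth_pderiv[OF V]]] AE_I2 AE_smooth_H1(2)[OF V ae]]) simp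
  moreover have "L2_tendsto {0<..<2*pi} (\<lambda>k \<theta>. V (polar \<rho> \<theta>)) (\<lambda>\<theta>. t (polar \<rho> \<theta>))"
    unfolding t by (rule L2_tendsto_const[OF L2_circle[OF V]])
  ultimately show ?thesis unfolding has_trace_def using AE_smooth_H1(1)[OF V ae] V
    by (intro conjI exI[of _ "\<lambda>_. V"]) auto
qed

end

lemma circle_pairing_L2:
  assumes t: "(\<lambda>\<theta>. t (polar \<rho> \<theta>)) \<in> L2 {0<..<2*pi}" and F: "smooth F"
  shows "integrable (lebesgue_on {0<..<2*pi}) (\<lambda>\<theta>. t (polar \<rho> \<theta>) * (F (polar \<rho> \<theta>) * of_real (polar 1 \<theta> $ i)))"
    and "(\<lambda>\<theta>. F (polar \<rho> \<theta>) * of_real (polar 1 \<theta> $ i)) \<in> L2 {0<..<2*pi}"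
proof -
  show c: "(\<lambda>\<theta>. F (polar \<rho> \<theta>) * of_real (polar 1 \<theta> $ i)) \<in> L2 {0<..<2*pi}"
    by (rule L2_continuous) (auto intro!: continuous_on_mult continuous_on_of_real continuous_on_polar_nth
        continuous_on_smooth_polar[OF F] continuous_on_const continuous_on_id)
  show "integrable (lebesgue_on {0<..<2*pi}) (\<lambda>\<theta>. t (polar \<rho> \<theta>) * (F (polar \<rho> \<theta>) * of_real (polar 1 \<theta> $ i)))"
    by (rule L2_mult_integrable[OF t c])
qed

text \<open>Bounded open sets whose boundary is a finite union of circles around the origin, in the form
  of the divergence theorem: \<open>e \<rho>\<close> is the sign of the exterior normal relative to the radial direction.\<close>

locale circular_domain =
  fixes U :: "(real^2) set" and C :: "real set" and e :: "real \<Rightarrow> complex"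
  assumes U: "open U" "bounded U" and C: "finite C" "\<And>\<rho>. \<rho> \<in> C \<Longrightarrow> \<rho> > 0"
    and divergence: "\<And>G i. smooth G \<Longrightarrow>
      lebint U (pderiv_at i G) = (\<Sum>\<rho>\<in>C. e \<rho> * circle_pairing \<rho> i (\<lambda>_. 1) G)"
begin

lemmas Um = lmeasurable_open_bounded[OF U]

text \<open>The defect in integration by parts, that is, the boundary term. It is additive in
  \<open>F\<close>, so it can be split over the circles.\<close>

definition by_parts :: "2 \<Rightarrow> (real^2 \<Rightarrow> complex) \<Rightarrow> (real^2 \<Rightarrow> complex) \<Rightarrow> complex" where
  "by_parts i u F = lebint U (\<lambda>x. wpderiv U i u x * F x)
     + lebint U (\<lambda>x. u x * pderiv_at i F x)"

text \<open>The divergence theorem is applied to the smooth products of \<open>F\<close> with the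
  approximating functions. Since \<open>F\<close> vanishes on the other circles, only convergence on
  the circle of radius \<open>\<rho>\<close> matters.\<close>

lemma by_parts_trace:
  assumes tr: "has_trace U \<rho> u t" and \<rho>: "\<rho> \<in> C" and F: "smooth F"
    and z: "\<And>\<rho>' \<theta>. \<rho>' \<in> C \<Longrightarrow> \<rho>' \<noteq> \<rho> \<Longrightarrow> F (polar \<rho>' \<theta>) = 0"
  shows "by_parts i u F = e \<rho> * circle_pairing \<rho> i t F"
proof -
  obtain \<phi> where \<phi>: "\<And>k. smooth (\<phi> k)" "L2_tendsto U \<phi> u" "\<And>i. L2_tendsto U (\<lambda>k. pderiv_at i (\<phi> k)) (wpderiv U i u)"
    "L2_tendsto {0<..<2*pi} (\<lambda>k \<theta>. \<phi> k (polar \<rho> \<theta>)) (\<lambda>\<theta>. t (polar \<rho> \<theta>))"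
    using tr unfolding has_trace_def by blast
  have tL: "(\<lambda>\<theta>. t (polar \<rho> \<theta>)) \<in> L2 {0<..<2*pi}" using \<phi>(4) by (simp add: L2_tendsto_def)
  have FL: "F \<in> L2 U" "pderiv_at i F \<in> L2 U"
    by (rule smooth_L2[OF U F], rule smooth_L2[OF U smooth_pderiv[OF F]])
  have eq: "lebint U (\<lambda>x. pderiv_at i (\<phi> k) x * F x) + lebint U (\<lambda>x. \<phi> k x * pderiv_at i F x)
     = e \<rho> * circle_pairing \<rho> i (\<phi> k) F" for k
  proof -
    have d: "pderiv_at i (\<lambda>x. \<phi> k x * F x) x = \<phi> k x * pderiv_at i F x + pderiv_at i (\<phi> k) x * F x" for x
      by (rule pderiv_at_mult[OF smooth_differentiable[OF \<phi>(1)] smooth_differentiable[OF F]])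
    have "lebint U (\<lambda>x. \<phi> k x * pderiv_at i F x) + lebint U (\<lambda>x. pderiv_at i (\<phi> k) x * F x)
        = lebint U (pderiv_at i (\<lambda>x. \<phi> k x * F x))"
      unfolding d
      by (rule Bochner_Integration.integral_add[symmetric])
        (intro L2_mult_integrable FL smooth_L2[OF U] \<phi> smooth_pderiv)+
    also have "\<dots> = (\<Sum>\<rho>'\<in>C. e \<rho>' * circle_pairing \<rho>' i (\<lambda>_. 1) (\<lambda>x. \<phi> k x * F x))"
      by (rule divergence[OF smooth_mult[OF \<phi>(1) F]])
    also have "\<dots> = (\<Sum>\<rho>'\<in>C. if \<rho>' = \<rho> then e \<rho> * circle_pairing \<rho> i (\<phi> k) F else 0)"
      by (rule sum.cong) (auto simp: circle_pairing_def z mult.assoc)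
    also have "\<dots> = e \<rho> * circle_pairing \<rho> i (\<phi> k) F" using C(1) \<rho> by simp
    finally show ?thesis by (simp add: add.commute)
  qed
  have l1: "(\<lambda>k. lebint U (\<lambda>x. pderiv_at i (\<phi> k) x * F x) + lebint U (\<lambda>x. \<phi> k x * pderiv_at i F x))
      \<longlonglongrightarrow> by_parts i u F"
    unfolding by_parts_def
    by (intro tendsto_add L2_tendsto_pairing[OF \<phi>(3) FL(1)] L2_tendsto_pairing[OF \<phi>(2) FL(2)])
  have l2: "(\<lambda>k. e \<rho> * circle_pairing \<rho> i (\<phi> k) F) \<longlonglongrightarrow> e \<rho> * circle_pairing \<rho> i t F"
    unfolding circle_pairing_def
    by (intro tendsto_mult tendsto_const L2_tendsto_pairing[OF \<phi>(4) circle_pairing_L2(2)[OF tL F]])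
  show ?thesis using l1 l2 unfolding eq by (rule LIMSEQ_unique)
qed

lemma by_parts_add:
  assumes u: "u \<in> H1 U" and F: "smooth F" "smooth G"
  shows "by_parts i u (\<lambda>x. F x + G x) = by_parts i u F + by_parts i u G"
proof -
  note L = smooth_L2[OF U F(1)] smooth_L2[OF U F(2)] smooth_L2[OF U smooth_pderiv[OF F(1)]] smooth_L2[OF U smooth_pderiv[OF F(2)]]
    wpderiv_props(1)[OF u] H1_L2[OF u]
  have d: "pderiv_at i (\<lambda>x. F x + G x) x = pderiv_at i F x + pderiv_at i G x" for x
    by (rule pderiv_at_add[OF smooth_differentiable[OF F(1)] smooth_differentiable[OF F(2)]])
  have "lebint U (\<lambda>x. wpderiv U i u x * F x + wpderiv U i u x * G x)
    = lebint U (\<lambda>x. wpderiv U i u x * F x) + lebint U (\<lambda>x. wpderiv U i u x * G x)"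
    by (rule Bochner_Integration.integral_add) (rule L2_mult_integrable; rule L)+
  moreover have "lebint U (\<lambda>x. u x * pderiv_at i F x + u x * pderiv_at i G x)
    = lebint U (\<lambda>x. u x * pderiv_at i F x) + lebint U (\<lambda>x. u x * pderiv_at i G x)"
    by (rule Bochner_Integration.integral_add) (rule L2_mult_integrable; rule L)+
  ultimately show ?thesis unfolding by_parts_def d distrib_left by simp
qed

lemma by_parts_zero: "by_parts i u (\<lambda>x. 0) = 0"
  by (simp add: by_parts_def pderiv_at_const)

lemma by_parts_sum:
  assumes u: "u \<in> H1 U" and F: "\<And>j. j \<in> I \<Longrightarrow> smooth (F j)"
  shows "by_parts i u (\<lambda>x. \<Sum>j\<in>I. F j x) = (\<Sum>j\<in>I. by_parts i u (F j))"
  using F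
proof (induction I rule: infinite_finite_induct)
  case (insert j I)
  then show ?case using by_parts_add[OF u, of "F j" "\<lambda>x. \<Sum>j\<in>I. F j x"] by (simp add: smooth_sum)
qed (simp_all add: by_parts_zero)

text \<open>The Lagrange polynomial in \<open>|x|^2\<close> that singles out one of the
  circles.\<close>

definition select_circle :: "real \<Rightarrow> real^2 \<Rightarrow> complex" where
  "select_circle \<rho> x = (\<Prod>\<rho>'\<in>C - {\<rho>}. (of_real ((norm x)\<^sup>2) - of_real (\<rho>'\<^sup>2)) * of_real (inverse (\<rho>\<^sup>2 - \<rho>'\<^sup>2)))"

lemma smooth_select_circle: "smooth (select_circle \<rho>)"
  unfolding select_circle_def[abs_def]
  by (intro smooth_prod smooth_mult smooth_diff smooth_const smooth_norm_sq)

lemma select_circle_polar: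
  assumes "\<rho> \<in> C" "\<rho>' \<in> C"
  shows "select_circle \<rho> (polar \<rho>' \<theta>) = (if \<rho>' = \<rho> then 1 else 0)"
proof (cases "\<rho>' = \<rho>")
  case True
  have "\<rho>\<^sup>2 - r\<^sup>2 \<noteq> 0" if "r \<in> C - {\<rho>}" for r
    using that C(2)[of r] C(2)[OF assms(1)] power2_eq_iff_nonneg[of \<rho> r] by auto
  then have "(of_real (\<rho>\<^sup>2) - of_real (r\<^sup>2)) * of_real (inverse (\<rho>\<^sup>2 - r\<^sup>2)) = (1::complex)" if "r \<in> C - {\<rho>}" for r
    using that by (simp only: of_real_diff[symmetric] of_real_mult[symmetric]) simp
  then show ?thesis unfolding select_circle_def norm_polar_sq True by simp
next
  case False
  then have "\<rho>' \<in> C - {\<rho>}" using assms by simp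
  then show ?thesis unfolding select_circle_def norm_polar_sq using C(1) False by (auto intro!: prod_zero)
qed

text \<open>A trace is tested against a function vanishing on the other circles, since each circle comes with
  its own approximating sequence.\<close>

lemma by_parts_traces:
  assumes C': "C' \<subseteq> C" "C' \<noteq> {}" and tr: "\<And>\<rho>. \<rho> \<in> C' \<Longrightarrow> has_trace U \<rho> u (t \<rho>)" and F: "smooth F"
    and z: "\<And>\<rho> \<theta>. \<rho> \<in> C - C' \<Longrightarrow> F (polar \<rho> \<theta>) = 0"
  shows "by_parts i u F = (\<Sum>\<rho>\<in>C'. e \<rho> * circle_pairing \<rho> i (t \<rho>) F)"
proof -
  obtain \<rho>0 where \<rho>0: "\<rho>0 \<in> C'" using C' by blast
  have u: "u \<in> H1 U" using tr[OF \<rho>0] by (simp add: has_trace_def)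
  let ?F = "\<lambda>\<rho> x. F x * select_circle \<rho> x"
  let ?S = "\<lambda>x. \<Sum>\<rho>\<in>C'. ?F \<rho> x"
  have sF: "smooth (?F \<rho>)" for \<rho> by (rule smooth_mult[OF F smooth_select_circle])
  have sS: "smooth ?S" by (intro smooth_sum sF)
  let ?Z = "\<lambda>x. F x - ?S x"
  have s0: "smooth ?Z" by (rule smooth_diff[OF F sS])
  have f: "finite C'" using C'(1) C(1) by (rule finite_subset)
  have z0: "?Z (polar \<rho> \<theta>) = 0" if \<rho>: "\<rho> \<in> C" for \<rho> \<theta>
  proof -
    have "?S (polar \<rho> \<theta>) = (\<Sum>\<rho>'\<in>C'. if \<rho>' = \<rho> then F (polar \<rho> \<theta>) else 0)"
      by (rule sum.cong) (use C' \<rho> in \<open>auto simp: select_circle_polar\<close>)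
    then show ?thesis using f z[of \<rho> \<theta>] \<rho> by auto
  qed
  \<comment> \<open>The remainder vanishes on every circle; any one available trace, here that on
    \<open>\<rho>0\<close>, shows that its boundary term is zero.\<close>
  have "by_parts i u ?Z = e \<rho>0 * circle_pairing \<rho>0 i (t \<rho>0) ?Z"
    by (rule by_parts_trace[OF tr[OF \<rho>0] _ s0]) (use C' \<rho>0 z0 in auto)
  also have "\<dots> = 0" using C' \<rho>0 z0 by (auto simp: circle_pairing_def)
  finally have b0: "by_parts i u ?Z = 0" .
  have b1: "by_parts i u (?F \<rho>) = e \<rho> * circle_pairing \<rho> i (t \<rho>) F" if \<rho>: "\<rho> \<in> C'" for \<rho>
  proof -
    have "by_parts i u (?F \<rho>) = e \<rho> * circle_pairing \<rho> i (t \<rho>) (?F \<rho>)"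
      by (rule by_parts_trace[OF tr[OF \<rho>] _ sF]) (use C' \<rho> in \<open>auto simp: select_circle_polar\<close>)
    also have "circle_pairing \<rho> i (t \<rho>) (?F \<rho>) = circle_pairing \<rho> i (t \<rho>) F"
      using C' \<rho> by (auto simp: circle_pairing_def select_circle_polar)
    finally show ?thesis .
  qed
  have "by_parts i u F = by_parts i u (\<lambda>x. ?Z x + ?S x)" by simp
  also have "\<dots> = by_parts i u ?Z + by_parts i u ?S" by (rule by_parts_add[OF u s0 sS])
  also have "by_parts i u ?S = (\<Sum>\<rho>\<in>C'. by_parts i u (?F \<rho>))" by (rule by_parts_sum[OF u sF])
  also have "\<dots> = (\<Sum>\<rho>\<in>C'. e \<rho> * circle_pairing \<rho> i (t \<rho>) F)" by (rule sum.cong[OF refl b1])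
  finally show ?thesis using b0 by simp
qed

text \<open>\<open>C'\<close> may leave out circles on which \<open>v\<close> vanishes. This is the
  situation at \<open>|x| = R\<close>, where the domain of the operator prescribes the trace of
  \<open>u\<close> but provides none for its derivatives.\<close>

lemma green:
  assumes C': "C' \<subseteq> C" "C' \<noteq> {}" and u: "u \<in> H2 U"
    and t: "\<And>\<rho>. \<rho> \<in> C \<Longrightarrow> has_trace U \<rho> u (t \<rho>)"
    and T: "\<And>\<rho> i. \<rho> \<in> C' \<Longrightarrow> has_trace U \<rho> (wpderiv U i u) (T \<rho> i)"
    and v: "smooth v" and z: "\<And>\<rho> \<theta>. \<rho> \<in> C - C' \<Longrightarrow> v (polar \<rho> \<theta>) = 0"
  shows "lebint U (\<lambda>x. weak_laplacian U u x * v x)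
      - lebint U (\<lambda>x. u x * (\<Sum>i\<in>UNIV. pderiv_at i (pderiv_at i v) x))
    = (\<Sum>i\<in>UNIV. (\<Sum>\<rho>\<in>C'. e \<rho> * circle_pairing \<rho> i (T \<rho> i) v) - (\<Sum>\<rho>\<in>C. e \<rho> * circle_pairing \<rho> i (t \<rho>) (pderiv_at i v)))"
proof -
  have u1: "u \<in> H1 U" and u2: "wpderiv U i u \<in> H1 U" for i using u by (auto simp: H2_def)
  note vL = smooth_L2[OF U v] smooth_L2[OF U smooth_pderiv[OF smooth_pderiv[OF v]]]
  let ?A = "\<lambda>i. lebint U (\<lambda>x. wpderiv U i (wpderiv U i u) x * v x)"
  let ?B = "\<lambda>i. lebint U (\<lambda>x. u x * pderiv_at i (pderiv_at i v) x)"
  have Cne: "C \<noteq> {}" using C' by blast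
  have ab: "?A i - ?B i = (\<Sum>\<rho>\<in>C'. e \<rho> * circle_pairing \<rho> i (T \<rho> i) v) - (\<Sum>\<rho>\<in>C. e \<rho> * circle_pairing \<rho> i (t \<rho>) (pderiv_at i v))" for i
  proof -
    have "by_parts i (wpderiv U i u) v = (\<Sum>\<rho>\<in>C'. e \<rho> * circle_pairing \<rho> i (T \<rho> i) v)"
      by (rule by_parts_traces[OF C' T v z])
    moreover have "by_parts i u (pderiv_at i v) = (\<Sum>\<rho>\<in>C. e \<rho> * circle_pairing \<rho> i (t \<rho>) (pderiv_at i v))"
      by (rule by_parts_traces[OF order_refl Cne t smooth_pderiv[OF v]]) auto
    moreover have "?A i - ?B i = by_parts i (wpderiv U i u) v - by_parts i u (pderiv_at i v)"
      by (simp add: by_parts_def)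
    ultimately show ?thesis by (simp only:)
  qed
  have A: "lebint U (\<lambda>x. weak_laplacian U u x * v x) = (\<Sum>i\<in>UNIV. ?A i)"
    unfolding weak_laplacian_def sum_distrib_right
    by (rule Bochner_Integration.integral_sum) (rule L2_mult_integrable[OF wpderiv_props(1)[OF u2] vL(1)])
  have B: "lebint U (\<lambda>x. u x * (\<Sum>i\<in>UNIV. pderiv_at i (pderiv_at i v) x)) = (\<Sum>i\<in>UNIV. ?B i)"
    unfolding sum_distrib_left
    by (rule Bochner_Integration.integral_sum) (rule L2_mult_integrable[OF H1_L2[OF u1] vL(2)])
  show ?thesis unfolding A B sum_subtractf[symmetric] by (rule sum.cong[OF refl ab])
qed

end

section \<open>Piecewise smooth functions and symmetry\<close>


definition glue :: "real \<Rightarrow> real \<Rightarrow> (real^2 \<Rightarrow> complex) \<Rightarrow> (real^2 \<Rightarrow> complex) \<Rightarrow> real^2 \<Rightarrow> complex" where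
  "glue ri re v1 v2 x = (if x \<in> Omega_minus ri re then v1 x else v2 x)"

definition lap :: "(real^2 \<Rightarrow> complex) \<Rightarrow> real^2 \<Rightarrow> complex" where
  "lap v x = (\<Sum>i\<in>UNIV. pderiv_at i (pderiv_at i v) x)"

definition radial_deriv :: "(real^2 \<Rightarrow> complex) \<Rightarrow> real^2 \<Rightarrow> complex" where
  "radial_deriv v x = (\<Sum>i\<in>UNIV. of_real (sgn x $ i) * pderiv_at i v x)"

text \<open>Both pieces are smooth on the whole plane, so that traces are restrictions. The radial
  derivatives are opposite because the normal derivatives coincide when each is taken with its own
  exterior normal, and these normals are opposite.\<close>

definition piecewise_smooth :: "real \<Rightarrow> real \<Rightarrow> real \<Rightarrow> (real^2 \<Rightarrow> complex) \<Rightarrow> (real^2 \<Rightarrow> complex) \<Rightarrow> bool" where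
  "piecewise_smooth ri re R v1 v2 \<longleftrightarrow> smooth v1 \<and> smooth v2 \<and>
     (\<forall>x. norm x = ri \<or> norm x = re \<longrightarrow> v1 x = v2 x \<and> radial_deriv v1 x = - radial_deriv v2 x) \<and>
     (\<forall>x. norm x = R \<longrightarrow> v2 x = 0)"

lemma glue_in: "x \<in> Omega_minus ri re \<Longrightarrow> glue ri re v1 v2 x = v1 x"
  and glue_out: "x \<notin> Omega_minus ri re \<Longrightarrow> glue ri re v1 v2 x = v2 x"
  by (simp_all add: glue_def)

lemma lap_sum:
  assumes "\<And>i. i \<in> I \<Longrightarrow> smooth (f i)"
  shows "lap (\<lambda>x. \<Sum>i\<in>I. a i * f i x) x = (\<Sum>i\<in>I. a i * lap (f i) x)"
proof -
  have d: "pderiv_at j (\<lambda>x. a i * g x) x = a i * pderiv_at j g x" if "smooth g" for j i x and g :: "real^2 \<Rightarrow> complex"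
    using pderiv_at_mult[OF smooth_differentiable[OF smooth_const[of "a i"]] smooth_differentiable[OF that]]
    by (simp add: pderiv_at_const)
  have e: "pderiv_at j (\<lambda>x. \<Sum>i\<in>I. a i * g i x) x = (\<Sum>i\<in>I. a i * pderiv_at j (g i) x)"
    if "\<And>i. i \<in> I \<Longrightarrow> smooth (g i)" for j x and g :: "_ \<Rightarrow> real^2 \<Rightarrow> complex"
  proof -
    have "pderiv_at j (\<lambda>x. \<Sum>i\<in>I. a i * g i x) x = (\<Sum>i\<in>I. pderiv_at j (\<lambda>x. a i * g i x) x)"
      by (rule pderiv_at_sum) (rule smooth_mult[OF smooth_const that])
    then show ?thesis using d that by simp
  qed
  have "pderiv_at j (pderiv_at j (\<lambda>x. \<Sum>i\<in>I. a i * f i x)) x = (\<Sum>i\<in>I. a i * pderiv_at j (pderiv_at j (f i)) x)" for j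
  proof -
    have "pderiv_at j (\<lambda>x. \<Sum>i\<in>I. a i * f i x) = (\<lambda>x. \<Sum>i\<in>I. a i * pderiv_at j (f i) x)"
      by (rule ext) (rule e[OF assms])
    then show ?thesis using e[of "\<lambda>i. pderiv_at j (f i)"] smooth_pderiv assms by simp
  qed
  then show ?thesis unfolding lap_def by (simp add: sum_distrib_left sum.swap[of _ UNIV])
qed

lemma radial_deriv_sum:
  assumes "\<And>i. i \<in> I \<Longrightarrow> smooth (f i)"
  shows "radial_deriv (\<lambda>x. \<Sum>i\<in>I. a i * f i x) x = (\<Sum>i\<in>I. a i * radial_deriv (f i) x)"
proof -
  have "pderiv_at j (\<lambda>x. \<Sum>i\<in>I. a i * f i x) x = (\<Sum>i\<in>I. a i * pderiv_at j (f i) x)" for j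
  proof -
    have "pderiv_at j (\<lambda>x. \<Sum>i\<in>I. a i * f i x) x = (\<Sum>i\<in>I. pderiv_at j (\<lambda>x. a i * f i x) x)"
      by (rule pderiv_at_sum) (rule smooth_mult[OF smooth_const assms])
    also have "\<dots> = (\<Sum>i\<in>I. a i * pderiv_at j (f i) x)"
      using assms by (intro sum.cong refl)
        (simp add: pderiv_at_mult[OF smooth_differentiable[OF smooth_const] smooth_differentiable] pderiv_at_const)
    finally show ?thesis .
  qed
  then show ?thesis unfolding radial_deriv_def
    by (simp add: sum_distrib_left sum.swap[of _ UNIV] mult.left_commute)
qed

lemma piecewise_smooth_sum:
  assumes "\<And>i. i \<in> I \<Longrightarrow> piecewise_smooth ri re R (f i) (g i)"
  shows "piecewise_smooth ri re R (\<lambda>x. \<Sum>i\<in>I. a i * f i x) (\<lambda>x. \<Sum>i\<in>I. a i * g i x)"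
proof -
  have s: "smooth (f i)" "smooth (g i)" if "i \<in> I" for i using assms[OF that] by (auto simp: piecewise_smooth_def)
  show ?thesis
    unfolding piecewise_smooth_def
  proof (intro conjI allI impI)
    show "smooth (\<lambda>x. \<Sum>i\<in>I. a i * f i x)" "smooth (\<lambda>x. \<Sum>i\<in>I. a i * g i x)"
      by (intro smooth_sum smooth_mult smooth_const s; assumption)+
    fix x :: "real^2"
    { assume x: "norm x = ri \<or> norm x = re"
      show "(\<Sum>i\<in>I. a i * f i x) = (\<Sum>i\<in>I. a i * g i x)"
        by (rule sum.cong) (use assms x in \<open>auto simp: piecewise_smooth_def\<close>)
      have "(\<Sum>i\<in>I. a i * radial_deriv (f i) x) = (\<Sum>i\<in>I. - (a i * radial_deriv (g i) x))"
        by (rule sum.cong) (use assms x in \<open>auto simp: piecewise_smooth_def\<close>)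
      then show "radial_deriv (\<lambda>x. \<Sum>i\<in>I. a i * f i x) x = - radial_deriv (\<lambda>x. \<Sum>i\<in>I. a i * g i x) x"
        by (simp add: radial_deriv_sum[OF s(1)] radial_deriv_sum[OF s(2)] sum_negf) }
    assume "norm x = R"
    then show "(\<Sum>i\<in>I. a i * g i x) = 0"
      by (intro sum.neutral) (use assms in \<open>auto simp: piecewise_smooth_def\<close>)
  qed
qed

locale annuli =
  fixes ri re R :: real
  assumes ri: "0 < ri" and re: "ri < re" and R: "re < R"
begin

abbreviation "Om \<equiv> Omega_minus ri re"
abbreviation "Op \<equiv> Omega_plus ri re R"

lemma closure_Om: "closure Om = {x. ri \<le> norm x \<and> norm x \<le> re}"
proof
  have "closed {x::real^2. ri \<le> norm x \<and> norm x \<le> re}"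
    by (intro closed_Collect_conj closed_Collect_le continuous_intros)
  then show "closure Om \<subseteq> {x. ri \<le> norm x \<and> norm x \<le> re}"
    by (intro closure_minimal) (auto simp: Omega_minus_def)
  show "{x. ri \<le> norm x \<and> norm x \<le> re} \<subseteq> closure Om"
  proof
    fix x :: "real^2" assume "x \<in> {x. ri \<le> norm x \<and> norm x \<le> re}"
    then have x: "ri \<le> norm x" "norm x \<le> re" by auto
    have n: "norm x > 0" using x ri by linarith
    define m where "m = (ri + re) / 2"
    have m: "ri < m" "m < re" using re by (auto simp: m_def)
    \<comment> \<open>Points on the ray of \<open>x\<close>, moved towards the middle radius
      \<open>m\<close>, lie in the open annulus and tend to \<open>x\<close>.\<close>
    define y where "y k = ((norm x + (m - norm x) / real (k + 2)) / norm x) *\<^sub>R x" for k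
    have "y k \<in> Om" for k
    proof -
      have ny: "norm (y k) = norm x + (m - norm x) / real (k + 2)"
      proof -
        have "(m - norm x) / real (k + 2) \<ge> - norm x"
        proof -
          have "norm x / real (k + 2) \<le> norm x" using n by (simp add: field_simps)
          moreover have "m / real (k + 2) \<ge> 0" using m ri by simp
          ultimately show ?thesis by (simp add: diff_divide_distrib)
        qed
        then have "norm x + (m - norm x) / real (k + 2) \<ge> 0" by linarith
        then show ?thesis using n by (simp add: y_def)
      qed
      let ?t = "1 / real (k + 2)"
      have t: "0 < ?t" "?t < 1" by (auto simp: field_simps)
      have e: "norm (y k) = (1 - ?t) * norm x + ?t * m" unfolding ny by (simp add: algebra_simps diff_divide_distrib)
      have "(1 - ?t) * ri \<le> (1 - ?t) * norm x" "?t * ri < ?t * m"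
        using t x m by (auto intro: mult_left_mono simp only: mult_less_cancel_left_pos)
      then have "(1 - ?t) * ri + ?t * ri < (1 - ?t) * norm x + ?t * m" by (rule add_le_less_mono)
      moreover have "(1 - ?t) * norm x \<le> (1 - ?t) * re" "?t * m < ?t * re"
        using t x m by (auto intro: mult_left_mono simp only: mult_less_cancel_left_pos)
      then have "(1 - ?t) * norm x + ?t * m < (1 - ?t) * re + ?t * re" by (rule add_le_less_mono)
      ultimately show ?thesis unfolding Omega_minus_def mem_Collect_eq e by (simp add: algebra_simps)
    qed
    moreover have "y \<longlonglongrightarrow> x"
    proof -
      have "(\<lambda>k. 1 / real (k + 2)) \<longlonglongrightarrow> 0" by (rule LIMSEQ_ignore_initial_segment[OF lim_1_over_n])
      then have "(\<lambda>k. (m - norm x) * (1 / real (k + 2))) \<longlonglongrightarrow> (m - norm x) * 0" by (rule tendsto_mult[OF tendsto_const])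
      then have "(\<lambda>k. (m - norm x) / real (k + 2)) \<longlonglongrightarrow> 0" by simp
      then have "y \<longlonglongrightarrow> ((norm x + 0) / norm x) *\<^sub>R x"
        unfolding y_def by (intro tendsto_intros) (use n in auto)
      then show ?thesis using n by simp
    qed
    ultimately show "x \<in> closure Om" unfolding closure_sequential by blast
  qed
qed

lemma Op_eq: "Op = {x. norm x < ri} \<union> {x. re < norm x \<and> norm x < R}"
  unfolding Omega_plus_def closure_Om using re R by auto

lemma Om_open: "open Om" and Om_bounded: "bounded Om"
proof -
  show "open Om" unfolding Omega_minus_def by (intro open_Collect_conj open_Collect_less continuous_intros)
  show "bounded Om" by (rule bounded_subset[OF bounded_ball[of 0 re]]) (auto simp: Omega_minus_def)
qed

lemma Op_open: "open Op" and Op_bounded: "bounded Op"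
proof -
  show "open Op" unfolding Omega_plus_def by (intro open_Diff open_ball closed_closure)
  show "bounded Op" by (rule bounded_subset[OF bounded_ball[of 0 R]]) (auto simp: Omega_plus_def)
qed

lemma Om_Op_disjoint: "x \<in> Om \<Longrightarrow> x \<notin> Op"
  unfolding Op_eq Omega_minus_def using re by auto

lemma glue_Op: "x \<in> Op \<Longrightarrow> glue ri re v1 v2 x = v2 x"
  by (rule glue_out) (use Om_Op_disjoint in blast)

lemma circles_null: "{x::real^2. norm x = ri \<or> norm x = re} \<in> null_sets lebesgue"
proof -
  have "negligible (sphere (0::real^2) ri \<union> sphere 0 re)" by (intro negligible_Un negligible_sphere)
  moreover have "sphere (0::real^2) ri \<union> sphere 0 re = {x::real^2. norm x = ri \<or> norm x = re}" by (auto simp: sphere_def)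
  ultimately show ?thesis by (simp add: negligible_iff_null_sets)
qed

lemma AE_ball_cases:
  assumes "AE x in lebesgue_on Om. P x" "AE x in lebesgue_on Op. P x"
  shows "AE x in lebesgue_on (ball 0 R). P x"
proof -
  have "AE x in lebesgue. x \<in> Om \<longrightarrow> P x" using assms(1) Om_open by (subst (asm) AE_restrict_space_iff) auto
  moreover have "AE x in lebesgue. x \<in> Op \<longrightarrow> P x" using assms(2) Op_open by (subst (asm) AE_restrict_space_iff) auto
  moreover have "AE x in lebesgue. x \<notin> {x::real^2. norm x = ri \<or> norm x = re}" by (rule AE_not_in[OF circles_null])
  ultimately have "AE x in lebesgue. x \<in> ball 0 R \<longrightarrow> P x"
    by eventually_elim (auto simp: Op_eq Omega_minus_def)
  then show ?thesis by (subst AE_restrict_space_iff) auto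
qed

lemma Om_subset: "Om \<subseteq> ball 0 R" and Op_subset: "Op \<subseteq> ball 0 R"
  using re R by (auto simp: Omega_minus_def Omega_plus_def)

text \<open>Up to null sets the indicator of an annular region is a signed sum of indicators of
  discs; this is how the divergence theorem is inherited from discs.\<close>

lemma integral_ball_indicator_combination:
  fixes f :: "real^2 \<Rightarrow> complex"
  assumes U: "U \<in> lmeasurable" "bounded U" and f: "continuous_on UNIV f" and fin: "finite J"
    and ae: "AE x in lebesgue. indicator U x = (\<Sum>\<rho>\<in>J. c \<rho> * indicator (ball 0 \<rho>) x :: real)"
  shows "lebint U f = (\<Sum>\<rho>\<in>J. of_real (c \<rho>) * lebint (ball 0 \<rho>) f)"
proof -
  have i: "integrable lebesgue (\<lambda>x. indicator S x *\<^sub>R f x)" if "S \<in> lmeasurable" "bounded S" for S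
    using continuous_integrable_ball[OF f that] that by (subst (asm) integrable_restrict_space) auto
  have r: "lebint S f = integral\<^sup>L lebesgue (\<lambda>x. indicator S x *\<^sub>R f x)" if "S \<in> lmeasurable" for S
    by (rule integral_restrict_space) (use that in auto)
  have "integral\<^sup>L lebesgue (\<lambda>x. indicator U x *\<^sub>R f x) = integral\<^sup>L lebesgue (\<lambda>x. \<Sum>\<rho>\<in>J. c \<rho> *\<^sub>R (indicator (ball 0 \<rho>) x *\<^sub>R f x))"
  proof (rule integral_cong_AE)
    show "(\<lambda>x. indicator U x *\<^sub>R f x) \<in> borel_measurable lebesgue"
      by (rule borel_measurable_integrable[OF i[OF U]])
    show "(\<lambda>x. \<Sum>\<rho>\<in>J. c \<rho> *\<^sub>R (indicator (ball 0 \<rho>) x *\<^sub>R f x)) \<in> borel_measurable lebesgue"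
      by (rule borel_measurable_integrable) (intro Bochner_Integration.integrable_sum integrable_scaleR_right i lmeasurable_ball bounded_ball)
    show "AE x in lebesgue. indicator U x *\<^sub>R f x = (\<Sum>\<rho>\<in>J. c \<rho> *\<^sub>R (indicator (ball 0 \<rho>) x *\<^sub>R f x))"
      using ae by eventually_elim (simp add: scaleR_sum_left)
  qed
  also have "\<dots> = (\<Sum>\<rho>\<in>J. integral\<^sup>L lebesgue (\<lambda>x. c \<rho> *\<^sub>R (indicator (ball 0 \<rho>) x *\<^sub>R f x)))"
    by (rule Bochner_Integration.integral_sum) (intro integrable_scaleR_right i lmeasurable_ball bounded_ball)
  also have "\<dots> = (\<Sum>\<rho>\<in>J. of_real (c \<rho>) * lebint (ball 0 \<rho>) f)"
    by (rule sum.cong[OF refl]) (simp only: integral_scaleR_right r[OF lmeasurable_ball], simp add: scaleR_conv_of_real)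
  finally show ?thesis unfolding r[OF U(1)] .
qed

text \<open>These signs have two roles: direction of the exterior normal, and coefficient of the
  disc in the indicator of the region.\<close>

definition sign_minus :: "real \<Rightarrow> real" where "sign_minus \<rho> = (if \<rho> = ri then - 1 else 1)"
definition sign_plus :: "real \<Rightarrow> real" where "sign_plus \<rho> = (if \<rho> = re then - 1 else 1)"

sublocale minus: circular_domain Om "{ri, re}" "\<lambda>\<rho>. of_real (sign_minus \<rho>)"
proof
  fix G :: "real^2 \<Rightarrow> complex" and i assume G: "smooth G"
  have "lebint Om (pderiv_at i G) = (\<Sum>\<rho>\<in>{ri, re}. of_real (sign_minus \<rho>) * lebint (ball 0 \<rho>) (pderiv_at i G))"
  proof (rule integral_ball_indicator_combination[OF lmeasurable_open_bounded[OF Om_open Om_bounded] Om_bounded smooth_continuous[OF smooth_pderiv[OF G]]])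
    show "AE x in lebesgue. indicator Om x = (\<Sum>\<rho>\<in>{ri, re}. sign_minus \<rho> * indicator (ball 0 \<rho>) x :: real)"
      using AE_not_in[OF circles_null]
      by eventually_elim (use re in \<open>auto simp: sign_minus_def Omega_minus_def indicator_def\<close>)
  qed simp
  then show "lebint Om (pderiv_at i G) = (\<Sum>\<rho>\<in>{ri, re}. of_real (sign_minus \<rho>) * circle_pairing \<rho> i (\<lambda>_. 1) G)"
    using ri re by (simp add: disc_divergence[OF G])
qed (use Om_open Om_bounded ri re in auto)

sublocale plus: circular_domain Op "{ri, re, R}" "\<lambda>\<rho>. of_real (sign_plus \<rho>)"
proof
  fix G :: "real^2 \<Rightarrow> complex" and i assume G: "smooth G"
  have "lebint Op (pderiv_at i G) = (\<Sum>\<rho>\<in>{ri, re, R}. of_real (sign_plus \<rho>) * lebint (ball 0 \<rho>) (pderiv_at i G))"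
  proof (rule integral_ball_indicator_combination[OF lmeasurable_open_bounded[OF Op_open Op_bounded] Op_bounded smooth_continuous[OF smooth_pderiv[OF G]]])
    show "AE x in lebesgue. indicator Op x = (\<Sum>\<rho>\<in>{ri, re, R}. sign_plus \<rho> * indicator (ball 0 \<rho>) x :: real)"
      using AE_not_in[OF circles_null]
      by eventually_elim (use re R in \<open>auto simp: sign_plus_def Op_eq indicator_def\<close>)
  qed simp
  then show "lebint Op (pderiv_at i G) = (\<Sum>\<rho>\<in>{ri, re, R}. of_real (sign_plus \<rho>) * circle_pairing \<rho> i (\<lambda>_. 1) G)"
    using ri re R by (simp add: disc_divergence[OF G])
qed (use Op_open Op_bounded ri re R in auto)

lemma glue_AE:
  "AE x in lebesgue_on Om. v1 x = glue ri re v1 v2 x" "AE x in lebesgue_on Op. v2 x = glue ri re v1 v2 x"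
  by (rule AE_I2, use Om_Op_disjoint in \<open>auto simp: glue_def\<close>)+

lemma sgn_polar: "r > 0 \<Longrightarrow> sgn (polar r \<theta>) = polar 1 \<theta>"
  by (simp add: sgn_div_norm norm_polar vec_eq_iff forall_2)

lemma radial_deriv_polar:
  "r > 0 \<Longrightarrow> radial_deriv v (polar r \<theta>) = (\<Sum>i\<in>UNIV. of_real (polar 1 \<theta> $ i) * pderiv_at i v (polar r \<theta>))"
  by (simp add: radial_deriv_def sgn_polar)

lemma glue_L2:
  assumes s: "smooth v1" "smooth v2"
  shows "glue ri re v1 v2 \<in> L2 (ball 0 R)"
proof -
  have "v1 \<in> L2 (ball 0 R)" "v2 \<in> L2 (ball 0 R)" by (rule smooth_L2[OF open_ball bounded_ball s(1)], rule smooth_L2[OF open_ball bounded_ball s(2)])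
  moreover have ind: "(indicator S :: real^2 \<Rightarrow> complex) \<in> borel_measurable (lebesgue_on (ball 0 R))" if "S \<in> sets lebesgue" for S
    by (rule measurable_restrict_space1[OF borel_measurable_indicator[OF that]])
  moreover have b: "cmod (indicator S x) \<le> 1" for S and x :: "real^2" by (simp add: indicator_def)
  moreover have "Om \<in> sets lebesgue" "- Om \<in> sets lebesgue" using Om_open by (auto simp: Compl_in_sets_lebesgue)
  ultimately have "(\<lambda>x. v1 x * indicator Om x + v2 x * indicator (- Om) x) \<in> L2 (ball 0 R)"
    by (intro L2_add L2_bounded_mult[OF _ ind b])
  moreover have "(\<lambda>x. v1 x * indicator Om x + v2 x * indicator (- Om) x) = glue ri re v1 v2"
    by (rule ext) (auto simp: glue_def indicator_def)
  ultimately show ?thesis by simp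
qed

lemma piecewise_smooth_D1:
  assumes v: "piecewise_smooth ri re R v1 v2"
  shows "glue ri re v1 v2 \<in> D1 ri re R"
proof -
  let ?v = "glue ri re v1 v2"
  note m = glue_AE(1)[of v1 v2] and p = glue_AE(2)[of v2 v1]
  have s: "smooth v1" "smooth v2" using v by (auto simp: piecewise_smooth_def)
  have tm: "x \<in> {ri, re} \<Longrightarrow> norm y = x \<Longrightarrow> v1 y = v2 y \<and> radial_deriv v1 y = - radial_deriv v2 y" for x y
    using v by (auto simp: piecewise_smooth_def)
  have "?v \<in> L2 (ball 0 R)" by (rule glue_L2[OF s])
  moreover have "?v \<in> H2 Om" by (rule AE_smooth_H2[OF Om_open Om_bounded s(1) m])
  moreover have "?v \<in> H2 Op" by (rule AE_smooth_H2[OF Op_open Op_bounded s(2) p])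
  moreover have "\<exists>t. has_trace Om \<rho> ?v t \<and> has_trace Op \<rho> ?v t" if \<rho>: "\<rho> \<in> {ri, re}" for \<rho>
  proof (intro exI[of _ v1] conjI)
    show "has_trace Om \<rho> ?v v1" by (rule AE_smooth_has_trace[OF Om_open Om_bounded s(1) m]) simp
    show "has_trace Op \<rho> ?v v1"
      by (rule AE_smooth_has_trace[OF Op_open Op_bounded s(2) p]) (use tm[OF \<rho>] \<rho> ri re in \<open>auto simp: norm_polar\<close>)
  qed
  moreover have "\<exists>s. has_normal_trace Om \<rho> (N_minus re) ?v s \<and> has_normal_trace Op \<rho> (N_plus re) ?v s" if \<rho>: "\<rho> \<in> {ri, re}" for \<rho>
  proof -
    \<comment> \<open>\<open>has_normal_trace\<close> forms \<open>s\<close> on the whole plane and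
      both sides must share it, while the fluxes match only on the circle. Cutting the derivatives
      off there makes the two functions equal everywhere without changing the traces.\<close>
    define T where "T w i x = (if norm x = \<rho> then pderiv_at i w x else 0)" for w :: "real^2 \<Rightarrow> complex" and i x
    have \<rho>0: "\<bar>\<rho>\<bar> = \<rho>" using \<rho> ri re by auto
    have "has_trace Om \<rho> (wpderiv Om i ?v) (T v1 i)" for i
      by (rule AE_smooth_has_trace[OF Om_open Om_bounded smooth_pderiv[OF s(1)] AE_smooth_H1(2)[OF Om_open Om_bounded s(1) m]])
        (simp add: T_def norm_polar \<rho>0)
    then have a: "has_normal_trace Om \<rho> (N_minus re) ?v (\<lambda>x. \<Sum>i\<in>UNIV. of_real (N_minus re x $ i) * T v1 i x)"
      unfolding has_normal_trace_def by blast
    have "has_trace Op \<rho> (wpderiv Op i ?v) (T v2 i)" for i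
      by (rule AE_smooth_has_trace[OF Op_open Op_bounded smooth_pderiv[OF s(2)] AE_smooth_H1(2)[OF Op_open Op_bounded s(2) p]])
        (simp add: T_def norm_polar \<rho>0)
    then have b: "has_normal_trace Op \<rho> (N_plus re) ?v (\<lambda>x. \<Sum>i\<in>UNIV. of_real (N_plus re x $ i) * T v2 i x)"
      unfolding has_normal_trace_def by blast
    have "(\<Sum>i\<in>UNIV. of_real (N_minus re x $ i) * T v1 i x) = (\<Sum>i\<in>UNIV. of_real (N_plus re x $ i) * T v2 i x)" for x
    proof (cases "norm x = \<rho>")
      case True
      have "radial_deriv v1 x = - radial_deriv v2 x" using tm[OF \<rho> True] by simp
      moreover have "(\<Sum>i\<in>UNIV. of_real (N_minus re x $ i) * T v1 i x) = (if norm x = re then radial_deriv v1 x else - radial_deriv v1 x)"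
        using True by (simp add: N_minus_def T_def radial_deriv_def UNIV_2)
      moreover have "(\<Sum>i\<in>UNIV. of_real (N_plus re x $ i) * T v2 i x) = (if norm x = re then - radial_deriv v2 x else radial_deriv v2 x)"
        using True by (simp add: N_plus_def N_minus_def T_def radial_deriv_def UNIV_2)
      ultimately show ?thesis by simp
    qed (simp add: T_def)
    then have "(\<lambda>x. \<Sum>i\<in>UNIV. of_real (N_minus re x $ i) * T v1 i x) = (\<lambda>x. \<Sum>i\<in>UNIV. of_real (N_plus re x $ i) * T v2 i x)"
      by (rule ext)
    then show ?thesis using a b by auto
  qed
  moreover have "has_trace Op R ?v (\<lambda>_. 0)"
    by (rule AE_smooth_has_trace[OF Op_open Op_bounded s(2) p])
      (use v ri re R in \<open>auto simp: piecewise_smooth_def norm_polar\<close>)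
  ultimately show ?thesis unfolding D1_def by blast
qed

lemma L1_glue_AE:
  assumes v: "piecewise_smooth ri re R v1 v2"
  shows "AE x in lebesgue_on (ball 0 R). glue ri re (\<lambda>x. - lap v1 x) (lap v2) x = L1 ri re R (glue ri re v1 v2) x"
proof (rule AE_ball_cases)
  have s: "smooth v1" "smooth v2" using v by (auto simp: piecewise_smooth_def)
  have "AE x in lebesgue_on Om. x \<in> Om" by (rule AE_I2) simp
  with AE_smooth_weak_laplacian[OF Om_open Om_bounded s(1) glue_AE(1)[of v1 v2]]
  show "AE x in lebesgue_on Om. glue ri re (\<lambda>x. - lap v1 x) (lap v2) x = L1 ri re R (glue ri re v1 v2) x"
    by eventually_elim (simp add: glue_in L1_def lap_def)
  have "AE x in lebesgue_on Op. x \<in> Op" by (rule AE_I2) simp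
  with AE_smooth_weak_laplacian[OF Op_open Op_bounded s(2) glue_AE(2)[of v2 v1]]
  show "AE x in lebesgue_on Op. glue ri re (\<lambda>x. - lap v1 x) (lap v2) x = L1 ri re R (glue ri re v1 v2) x"
    by eventually_elim (use Om_Op_disjoint in \<open>auto simp: glue_out L1_def lap_def\<close>)
qed

text \<open>The components are summed under one integral, so that pointwise identities between
  normal derivatives can be used.\<close>

lemma circle_pairing_sum:
  assumes T: "\<And>i. (\<lambda>\<theta>. T i (polar \<rho> \<theta>)) \<in> L2 {0<..<2*pi}" and v: "\<And>i. smooth (v i)"
  shows "(\<Sum>i\<in>UNIV. circle_pairing \<rho> i (T i) (v i)) = of_real \<rho> *
    lebint {0<..<2*pi} (\<lambda>\<theta>. \<Sum>i\<in>UNIV. T i (polar \<rho> \<theta>) * (v i (polar \<rho> \<theta>) * of_real (polar 1 \<theta> $ i)))"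
  unfolding circle_pairing_def sum_distrib_left[symmetric]
  by (subst Bochner_Integration.integral_sum) (auto intro: circle_pairing_L2(1)[OF T v])

lemma has_trace_L2_circle: "has_trace U \<rho> u t \<Longrightarrow> (\<lambda>\<theta>. t (polar \<rho> \<theta>)) \<in> L2 {0<..<2*pi}"
  by (auto simp: has_trace_def L2_tendsto_def)

lemma integral_ball_split:
  fixes f :: "real^2 \<Rightarrow> complex"
  assumes f: "integrable (lebesgue_on (ball 0 R)) f"
  shows "lebint (ball 0 R) f = lebint Om f + lebint Op f"
proof -
  have sets: "Om \<in> sets lebesgue" "Op \<in> sets lebesgue" "ball (0::real^2) R \<in> sets lebesgue" using Om_open Op_open by auto
  have r: "lebint S f = integral\<^sup>L lebesgue (\<lambda>x. indicator S x *\<^sub>R f x)"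
    and i: "integrable lebesgue (\<lambda>x. indicator S x *\<^sub>R f x)" if "S \<subseteq> ball 0 R" "S \<in> sets lebesgue" for S
    using integral_restrict_space[of S lebesgue f] integrable_lebesgue_on_subset[OF f that sets(3)] that
      integrable_restrict_space[of S lebesgue f] by auto
  note B = i[OF order_refl sets(3)] and M = i[OF Om_subset sets(1)] and P = i[OF Op_subset sets(2)]
  have "integral\<^sup>L lebesgue (\<lambda>x. indicator (ball 0 R) x *\<^sub>R f x) = integral\<^sup>L lebesgue (\<lambda>x. indicator Om x *\<^sub>R f x + indicator Op x *\<^sub>R f x)"
  proof (rule integral_cong_AE[OF borel_measurable_integrable[OF B] borel_measurable_integrable[OF Bochner_Integration.integrable_add[OF M P]]])
    show "AE x in lebesgue. indicator (ball 0 R) x *\<^sub>R f x = indicator Om x *\<^sub>R f x + indicator Op x *\<^sub>R f x"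
      using AE_not_in[OF circles_null]
      by eventually_elim (use re R in \<open>auto simp: Op_eq Omega_minus_def indicator_def\<close>)
  qed
  then show ?thesis unfolding r[OF order_refl sets(3)] r[OF Om_subset sets(1)] r[OF Op_subset sets(2)]
    by (simp only: Bochner_Integration.integral_add[OF M P])
qed

text \<open>Normal derivatives taken with the respective exterior normals coincide, so Green's
  formula on the two domains produces equal interface terms, and the sign change of the operator
  makes them cancel. On the outer circle both functions have zero trace.\<close>

lemma L1_symmetric:
  assumes w: "w \<in> D1 ri re R" "L1 ri re R w \<in> L2 (ball 0 R)" and v: "piecewise_smooth ri re R v1 v2"
  shows "lebint (ball 0 R) (\<lambda>x. L1 ri re R w x * glue ri re v1 v2 x)
    = lebint (ball 0 R) (\<lambda>x. w x * glue ri re (\<lambda>x. - lap v1 x) (lap v2) x)"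
proof -
  have s: "smooth v1" "smooth v2" using v by (auto simp: piecewise_smooth_def)
  have sl: "smooth (lap v)" if "smooth v" for v
    unfolding lap_def[abs_def] by (intro smooth_sum smooth_pderiv that)
  have wL: "w \<in> L2 (ball 0 R)" and wH: "w \<in> H2 Om" "w \<in> H2 Op" and tR: "has_trace Op R w (\<lambda>_. 0)"
    using w(1) by (auto simp: D1_def)
  have "\<forall>\<rho>\<in>{ri, re}. \<exists>t. has_trace Om \<rho> w t \<and> has_trace Op \<rho> w t"
    using w(1) by (auto simp: D1_def)
  from bchoice[OF this] obtain t where t0: "\<forall>\<rho>\<in>{ri, re}. has_trace Om \<rho> w (t \<rho>) \<and> has_trace Op \<rho> w (t \<rho>)"
    by (rule exE)
  have t: "has_trace Om \<rho> w (t \<rho>)" "has_trace Op \<rho> w (t \<rho>)" if "\<rho> \<in> {ri, re}" for \<rho>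
    using bspec[OF t0 that] by blast+
  have "\<forall>\<rho>\<in>{ri, re}. \<exists>T1 T2. (\<forall>i. has_trace Om \<rho> (wpderiv Om i w) (T1 i)) \<and> (\<forall>i. has_trace Op \<rho> (wpderiv Op i w) (T2 i))
      \<and> (\<forall>x. (\<Sum>i\<in>UNIV. of_real (N_minus re x $ i) * T1 i x) = (\<Sum>i\<in>UNIV. of_real (N_plus re x $ i) * T2 i x))"
  proof
    fix \<rho> assume "\<rho> \<in> {ri, re}"
    then obtain s where s: "has_normal_trace Om \<rho> (N_minus re) w s" "has_normal_trace Op \<rho> (N_plus re) w s"
      using w(1) unfolding D1_def by blast
    obtain T1 where T1: "\<forall>i. has_trace Om \<rho> (wpderiv Om i w) (T1 i)" "s = (\<lambda>x. \<Sum>i\<in>UNIV. of_real (N_minus re x $ i) * T1 i x)"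
      using s(1) unfolding has_normal_trace_def by blast
    obtain T2 where T2: "\<forall>i. has_trace Op \<rho> (wpderiv Op i w) (T2 i)" "s = (\<lambda>x. \<Sum>i\<in>UNIV. of_real (N_plus re x $ i) * T2 i x)"
      using s(2) unfolding has_normal_trace_def by blast
    show "\<exists>T1 T2. (\<forall>i. has_trace Om \<rho> (wpderiv Om i w) (T1 i)) \<and> (\<forall>i. has_trace Op \<rho> (wpderiv Op i w) (T2 i))
      \<and> (\<forall>x. (\<Sum>i\<in>UNIV. of_real (N_minus re x $ i) * T1 i x) = (\<Sum>i\<in>UNIV. of_real (N_plus re x $ i) * T2 i x))"
      by (intro exI[of _ T1] exI[of _ T2] conjI T1(1) T2(1) allI)
        (use fun_cong[OF T1(2)] fun_cong[OF T2(2)] in simp)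
  qed
  from bchoice[OF this] obtain T1 where "\<forall>\<rho>\<in>{ri, re}. \<exists>T2. (\<forall>i. has_trace Om \<rho> (wpderiv Om i w) (T1 \<rho> i)) \<and> (\<forall>i. has_trace Op \<rho> (wpderiv Op i w) (T2 i))
      \<and> (\<forall>x. (\<Sum>i\<in>UNIV. of_real (N_minus re x $ i) * T1 \<rho> i x) = (\<Sum>i\<in>UNIV. of_real (N_plus re x $ i) * T2 i x))"
    by (rule exE)
  from bchoice[OF this] obtain T2 where T: "\<forall>\<rho>\<in>{ri, re}. (\<forall>i. has_trace Om \<rho> (wpderiv Om i w) (T1 \<rho> i)) \<and> (\<forall>i. has_trace Op \<rho> (wpderiv Op i w) (T2 \<rho> i))
      \<and> (\<forall>x. (\<Sum>i\<in>UNIV. of_real (N_minus re x $ i) * T1 \<rho> i x) = (\<Sum>i\<in>UNIV. of_real (N_plus re x $ i) * T2 \<rho> i x))"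
    by (rule exE)
  have T1: "has_trace Om \<rho> (wpderiv Om i w) (T1 \<rho> i)" and T2: "has_trace Op \<rho> (wpderiv Op i w) (T2 \<rho> i)"
    and TT: "(\<Sum>i\<in>UNIV. of_real (N_minus re x $ i) * T1 \<rho> i x) = (\<Sum>i\<in>UNIV. of_real (N_plus re x $ i) * T2 \<rho> i x)"
    if "\<rho> \<in> {ri, re}" for \<rho> i x
    using bspec[OF T that] by blast+
  \<comment> \<open>Adds the zero trace at \<open>R\<close> to the interface traces, so that one
    family covers all circles of the outer domain.\<close>
  define t' where "t' \<rho> = (if \<rho> = R then (\<lambda>_. 0) else t \<rho>)" for \<rho>
  have t': "has_trace Op \<rho> w (t' \<rho>)" if "\<rho> \<in> {ri, re, R}" for \<rho>
    using that tR t(2) by (auto simp: t'_def)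
  have t'eq: "t' \<rho> = t \<rho>" if "\<rho> \<in> {ri, re}" for \<rho> using that re R by (auto simp: t'_def)
  let ?c = "\<lambda>\<rho>. complex_of_real (sign_minus \<rho>)" and ?d = "\<lambda>\<rho>. complex_of_real (sign_plus \<rho>)"
  have dc: "?d \<rho> = - ?c \<rho>" if "\<rho> \<in> {ri, re}" for \<rho> using that re by (auto simp: sign_minus_def sign_plus_def)
  have g1: "lebint Om (\<lambda>x. weak_laplacian Om w x * v1 x) - lebint Om (\<lambda>x. w x * lap v1 x)
    = (\<Sum>i\<in>UNIV. (\<Sum>\<rho>\<in>{ri, re}. ?c \<rho> * circle_pairing \<rho> i (T1 \<rho> i) v1) - (\<Sum>\<rho>\<in>{ri, re}. ?c \<rho> * circle_pairing \<rho> i (t \<rho>) (pderiv_at i v1)))"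
    unfolding lap_def by (rule minus.green[OF _ _ wH(1) t(1) T1 s(1)]) auto
  have g2: "lebint Op (\<lambda>x. weak_laplacian Op w x * v2 x) - lebint Op (\<lambda>x. w x * lap v2 x)
    = (\<Sum>i\<in>UNIV. (\<Sum>\<rho>\<in>{ri, re}. ?d \<rho> * circle_pairing \<rho> i (T2 \<rho> i) v2) - (\<Sum>\<rho>\<in>{ri, re, R}. ?d \<rho> * circle_pairing \<rho> i (t' \<rho>) (pderiv_at i v2)))"
    unfolding lap_def
  proof (rule plus.green[OF _ _ wH(2) t' T2 s(2)])
    show "v2 (polar \<rho> \<theta>) = 0" if "\<rho> \<in> {ri, re, R} - {ri, re}" for \<rho> \<theta>
      using that v ri re R by (auto simp: piecewise_smooth_def norm_polar)
  qed auto
  have z: "circle_pairing R i (t' R) F = 0" for i F by (simp add: circle_pairing_def t'_def)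
  \<comment> \<open>Interface terms with the normal derivative of \<open>w\<close>: equal by the
    flux condition in the domain and by continuity of the test function.\<close>
  have A: "(\<Sum>i\<in>UNIV. ?c \<rho> * circle_pairing \<rho> i (T1 \<rho> i) v1) = (\<Sum>i\<in>UNIV. ?d \<rho> * circle_pairing \<rho> i (T2 \<rho> i) v2)"
    if \<rho>: "\<rho> \<in> {ri, re}" for \<rho>
  proof -
    have \<rho>0: "\<rho> > 0" using \<rho> ri re by auto
    have e: "?c \<rho> * (\<Sum>i\<in>UNIV. T1 \<rho> i (polar \<rho> \<theta>) * (v1 (polar \<rho> \<theta>) * of_real (polar 1 \<theta> $ i)))
        = ?d \<rho> * (\<Sum>i\<in>UNIV. T2 \<rho> i (polar \<rho> \<theta>) * (v2 (polar \<rho> \<theta>) * of_real (polar 1 \<theta> $ i)))" for \<theta>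
    proof -
      let ?x = "polar \<rho> \<theta>"
      have N: "N_minus re ?x = sign_minus \<rho> *\<^sub>R polar 1 \<theta>"
        using \<rho> re \<rho>0 by (auto simp: N_minus_def sign_minus_def norm_polar sgn_polar)
      have vv: "v1 ?x = v2 ?x" using v \<rho> \<rho>0 by (auto simp: piecewise_smooth_def norm_polar)
      have "?c \<rho> * (\<Sum>i\<in>UNIV. T1 \<rho> i ?x * (v1 ?x * of_real (polar 1 \<theta> $ i))) = (\<Sum>i\<in>UNIV. of_real (N_minus re ?x $ i) * T1 \<rho> i ?x) * v1 ?x"
        unfolding N by (simp add: UNIV_2 algebra_simps)
      moreover have "?d \<rho> * (\<Sum>i\<in>UNIV. T2 \<rho> i ?x * (v2 ?x * of_real (polar 1 \<theta> $ i))) = (\<Sum>i\<in>UNIV. of_real (N_plus re ?x $ i) * T2 \<rho> i ?x) * v2 ?x"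
        unfolding N_plus_def N dc[OF \<rho>] by (simp add: UNIV_2 algebra_simps)
      ultimately show ?thesis using TT[OF \<rho>] vv by simp
    qed
    have "(\<Sum>i\<in>UNIV. ?c \<rho> * circle_pairing \<rho> i (T1 \<rho> i) v1) = of_real \<rho> * lebint {0<..<2*pi}
        (\<lambda>\<theta>. ?c \<rho> * (\<Sum>i\<in>UNIV. T1 \<rho> i (polar \<rho> \<theta>) * (v1 (polar \<rho> \<theta>) * of_real (polar 1 \<theta> $ i))))"
      unfolding sum_distrib_left[symmetric] circle_pairing_sum[OF has_trace_L2_circle[OF T1[OF \<rho>]] s(1)] by simp
    moreover have "(\<Sum>i\<in>UNIV. ?d \<rho> * circle_pairing \<rho> i (T2 \<rho> i) v2) = of_real \<rho> * lebint {0<..<2*pi}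
        (\<lambda>\<theta>. ?d \<rho> * (\<Sum>i\<in>UNIV. T2 \<rho> i (polar \<rho> \<theta>) * (v2 (polar \<rho> \<theta>) * of_real (polar 1 \<theta> $ i))))"
      unfolding sum_distrib_left[symmetric] circle_pairing_sum[OF has_trace_L2_circle[OF T2[OF \<rho>]] s(2)] by simp
    ultimately show ?thesis unfolding e by (simp only:)
  qed
  \<comment> \<open>Interface terms with the normal derivative of the test function: here the trace
    of \<open>w\<close> is common, and opposite radial derivatives meet opposite signs.\<close>
  have B: "(\<Sum>i\<in>UNIV. ?c \<rho> * circle_pairing \<rho> i (t \<rho>) (pderiv_at i v1)) = (\<Sum>i\<in>UNIV. ?d \<rho> * circle_pairing \<rho> i (t \<rho>) (pderiv_at i v2))"
    if \<rho>: "\<rho> \<in> {ri, re}" for \<rho>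
  proof -
    have \<rho>0: "\<rho> > 0" using \<rho> ri re by auto
    have e: "?c \<rho> * (\<Sum>i\<in>UNIV. t \<rho> (polar \<rho> \<theta>) * (pderiv_at i v1 (polar \<rho> \<theta>) * of_real (polar 1 \<theta> $ i)))
        = ?d \<rho> * (\<Sum>i\<in>UNIV. t \<rho> (polar \<rho> \<theta>) * (pderiv_at i v2 (polar \<rho> \<theta>) * of_real (polar 1 \<theta> $ i)))" for \<theta>
    proof -
      have r: "radial_deriv v1 (polar \<rho> \<theta>) = - radial_deriv v2 (polar \<rho> \<theta>)"
        using v \<rho> \<rho>0 by (auto simp: piecewise_smooth_def norm_polar)
      have "(\<Sum>i\<in>UNIV. t \<rho> (polar \<rho> \<theta>) * (pderiv_at i u (polar \<rho> \<theta>) * of_real (polar 1 \<theta> $ i))) = t \<rho> (polar \<rho> \<theta>) * radial_deriv u (polar \<rho> \<theta>)" for u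
        unfolding radial_deriv_polar[OF \<rho>0] by (simp only: sum_distrib_left mult_ac)
      then show ?thesis by (simp add: r dc[OF \<rho>])
    qed
    note sp = smooth_pderiv[OF s(1)] smooth_pderiv[OF s(2)]
    have "(\<Sum>i\<in>UNIV. ?c \<rho> * circle_pairing \<rho> i (t \<rho>) (pderiv_at i v1)) = of_real \<rho> * lebint {0<..<2*pi}
        (\<lambda>\<theta>. ?c \<rho> * (\<Sum>i\<in>UNIV. t \<rho> (polar \<rho> \<theta>) * (pderiv_at i v1 (polar \<rho> \<theta>) * of_real (polar 1 \<theta> $ i))))"
      unfolding sum_distrib_left[symmetric] circle_pairing_sum[where T="\<lambda>_. t \<rho>" and v="\<lambda>i. pderiv_at i v1", OF has_trace_L2_circle[OF t(1)[OF \<rho>]] sp(1)] by simp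
    moreover have "(\<Sum>i\<in>UNIV. ?d \<rho> * circle_pairing \<rho> i (t \<rho>) (pderiv_at i v2)) = of_real \<rho> * lebint {0<..<2*pi}
        (\<lambda>\<theta>. ?d \<rho> * (\<Sum>i\<in>UNIV. t \<rho> (polar \<rho> \<theta>) * (pderiv_at i v2 (polar \<rho> \<theta>) * of_real (polar 1 \<theta> $ i))))"
      unfolding sum_distrib_left[symmetric] circle_pairing_sum[where T="\<lambda>_. t \<rho>" and v="\<lambda>i. pderiv_at i v2", OF has_trace_L2_circle[OF t(1)[OF \<rho>]] sp(2)] by simp
    ultimately show ?thesis unfolding e by (simp only:)
  qed
  have neq: "ri \<noteq> re" "re \<noteq> R" "ri \<noteq> R" using re R by auto
  have key: "lebint Om (\<lambda>x. weak_laplacian Om w x * v1 x) - lebint Om (\<lambda>x. w x * lap v1 x)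
    = lebint Op (\<lambda>x. weak_laplacian Op w x * v2 x) - lebint Op (\<lambda>x. w x * lap v2 x)"
    using A[of ri] A[of re] B[of ri] B[of re] neq unfolding g1 g2 by (simp add: z t'eq sum_subtractf sum.distrib)
  note L = glue_L2[OF s] glue_L2[of "\<lambda>x. - lap v1 x" "lap v2", OF smooth_uminus[OF sl[OF s(1)]] sl[OF s(2)]]
  have "lebint (ball 0 R) (\<lambda>x. L1 ri re R w x * glue ri re v1 v2 x)
    = lebint Om (\<lambda>x. L1 ri re R w x * glue ri re v1 v2 x) + lebint Op (\<lambda>x. L1 ri re R w x * glue ri re v1 v2 x)"
    by (rule integral_ball_split[OF L2_mult_integrable[OF w(2) L(1)]])
  also have "lebint Om (\<lambda>x. L1 ri re R w x * glue ri re v1 v2 x) = lebint Om (\<lambda>x. - (weak_laplacian Om w x * v1 x))"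
    by (rule Bochner_Integration.integral_cong) (auto simp: L1_def glue_in)
  also have "\<dots> = - lebint Om (\<lambda>x. weak_laplacian Om w x * v1 x)" by (rule Bochner_Integration.integral_minus)
  also have "lebint Op (\<lambda>x. L1 ri re R w x * glue ri re v1 v2 x) = lebint Op (\<lambda>x. weak_laplacian Op w x * v2 x)"
    by (rule Bochner_Integration.integral_cong) (use Om_Op_disjoint in \<open>auto simp: L1_def glue_out\<close>)
  finally have l: "lebint (ball 0 R) (\<lambda>x. L1 ri re R w x * glue ri re v1 v2 x)
    = - lebint Om (\<lambda>x. weak_laplacian Om w x * v1 x) + lebint Op (\<lambda>x. weak_laplacian Op w x * v2 x)" .
  let ?g = "glue ri re (\<lambda>x. - lap v1 x) (lap v2)"
  have "lebint (ball 0 R) (\<lambda>x. w x * ?g x)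
    = lebint Om (\<lambda>x. w x * ?g x) + lebint Op (\<lambda>x. w x * ?g x)"
    by (rule integral_ball_split[OF L2_mult_integrable[OF wL L(2)]])
  also have "lebint Om (\<lambda>x. w x * ?g x) = lebint Om (\<lambda>x. - (w x * lap v1 x))"
    by (rule Bochner_Integration.integral_cong) (auto simp: glue_in)
  also have "\<dots> = - lebint Om (\<lambda>x. w x * lap v1 x)" by (rule Bochner_Integration.integral_minus)
  also have "lebint Op (\<lambda>x. w x * ?g x) = lebint Op (\<lambda>x. w x * lap v2 x)"
    by (rule Bochner_Integration.integral_cong) (auto simp: glue_Op)
  finally have r: "lebint (ball 0 R) (\<lambda>x. w x * ?g x)
    = - lebint Om (\<lambda>x. w x * lap v1 x) + lebint Op (\<lambda>x. w x * lap v2 x)" .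
  show ?thesis unfolding l r using key by (simp add: algebra_simps)
qed

lemma smooth_lap: "smooth v \<Longrightarrow> smooth (lap v)"
  unfolding lap_def[abs_def] by (intro smooth_sum smooth_pderiv)

lemma L1_closure_symmetric:
  assumes uf: "(u, f) \<in> L1_closure ri re R" and v: "piecewise_smooth ri re R v1 v2"
  shows "lebint (ball 0 R) (\<lambda>x. f x * glue ri re v1 v2 x)
    = lebint (ball 0 R) (\<lambda>x. u x * glue ri re (\<lambda>x. - lap v1 x) (lap v2) x)"
proof -
  obtain w where w: "\<And>k. w k \<in> D1 ri re R" "L2_tendsto (ball 0 R) w u" "L2_tendsto (ball 0 R) (\<lambda>k. L1 ri re R (w k)) f"
    using uf unfolding L1_closure_def by blast
  have s: "smooth v1" "smooth v2" using v by (auto simp: piecewise_smooth_def)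
  have "L1 ri re R (w k) \<in> L2 (ball 0 R)" for k using w(3) by (simp add: L2_tendsto_def)
  note e = L1_symmetric[OF w(1) this v]
  have "(\<lambda>k. lebint (ball 0 R) (\<lambda>x. L1 ri re R (w k) x * glue ri re v1 v2 x))
     \<longlonglongrightarrow> lebint (ball 0 R) (\<lambda>x. f x * glue ri re v1 v2 x)"
    by (rule L2_tendsto_pairing[OF w(3) glue_L2[OF s]])
  moreover have "(\<lambda>k. lebint (ball 0 R) (\<lambda>x. w k x * glue ri re (\<lambda>x. - lap v1 x) (lap v2) x))
     \<longlonglongrightarrow> lebint (ball 0 R) (\<lambda>x. u x * glue ri re (\<lambda>x. - lap v1 x) (lap v2) x)"
    by (rule L2_tendsto_pairing[OF w(2) glue_L2[OF smooth_uminus[OF smooth_lap[OF s(1)]] smooth_lap[OF s(2)]]])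
  ultimately show ?thesis unfolding e by (rule LIMSEQ_unique)
qed

lemma piecewise_smooth_limit_in_closure:
  assumes v: "\<And>k. piecewise_smooth ri re R (v1 k) (v2 k)"
    and u: "L2_tendsto (ball 0 R) (\<lambda>k. glue ri re (v1 k) (v2 k)) u"
    and f: "L2_tendsto (ball 0 R) (\<lambda>k. glue ri re (\<lambda>x. - lap (v1 k) x) (lap (v2 k))) f"
  shows "(u, f) \<in> L1_closure ri re R"
proof -
  have "L2_tendsto (ball 0 R) (\<lambda>k. L1 ri re R (glue ri re (v1 k) (v2 k))) f"
    by (rule L2_tendsto_AE_cong[OF _ f L1_glue_AE[OF v] AE_I2]) auto
  then show ?thesis unfolding L1_closure_def using u piecewise_smooth_D1[OF v]
    by (auto intro!: exI[of _ "\<lambda>k. glue ri re (v1 k) (v2 k)"])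
qed

text \<open>A diagonal choice: the \<open>k\<close>-th element is taken in the domain with both
  errors below \<open>1 / (k + 1)\<close>.\<close>

lemma L1_closure_closed:
  assumes XY: "\<And>k::nat. (X k, Y k) \<in> L1_closure ri re R"
    and X: "L2_tendsto (ball 0 R) X u" and Y: "L2_tendsto (ball 0 R) Y f"
  shows "(u, f) \<in> L1_closure ri re R"
proof -
  let ?B = "ball 0 R :: (real^2) set"
  have "\<exists>w. w \<in> D1 ri re R \<and> w \<in> L2 ?B \<and> L1 ri re R w \<in> L2 ?B \<and> L2_norm ?B (\<lambda>x. w x - X k x) < 1 / real (Suc k)
      \<and> L2_norm ?B (\<lambda>x. L1 ri re R w x - Y k x) < 1 / real (Suc k)" for k
  proof -
    obtain w where w: "\<And>k. w k \<in> D1 ri re R" "L2_tendsto ?B w (X k)" "L2_tendsto ?B (\<lambda>k. L1 ri re R (w k)) (Y k)"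
      using XY[of k] unfolding L1_closure_def by blast
    have p: "1 / real (Suc k) > 0" by simp
    have "\<forall>\<^sub>F j in sequentially. L2_norm ?B (\<lambda>x. w j x - X k x) < 1 / real (Suc k)"
      "\<forall>\<^sub>F j in sequentially. L2_norm ?B (\<lambda>x. L1 ri re R (w j) x - Y k x) < 1 / real (Suc k)"
      using w(2,3) p unfolding L2_tendsto_def by (auto intro: order_tendstoD(2))
    then have "\<forall>\<^sub>F j in sequentially. L2_norm ?B (\<lambda>x. w j x - X k x) < 1 / real (Suc k) \<and> L2_norm ?B (\<lambda>x. L1 ri re R (w j) x - Y k x) < 1 / real (Suc k)"
      by (rule eventually_conj)
    then obtain j where "L2_norm ?B (\<lambda>x. w j x - X k x) < 1 / real (Suc k) \<and> L2_norm ?B (\<lambda>x. L1 ri re R (w j) x - Y k x) < 1 / real (Suc k)"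
      using eventually_happens'[OF sequentially_bot] by blast
    then show ?thesis using w by (intro exI[of _ "w j"]) (auto simp: L2_tendsto_def)
  qed
  from choice[OF allI[OF this]] obtain w where w0: "\<forall>k. w k \<in> D1 ri re R \<and> w k \<in> L2 ?B \<and> L1 ri re R (w k) \<in> L2 ?B
      \<and> L2_norm ?B (\<lambda>x. w k x - X k x) < 1 / real (Suc k) \<and> L2_norm ?B (\<lambda>x. L1 ri re R (w k) x - Y k x) < 1 / real (Suc k)"
    by (rule exE)
  have w: "\<And>k. w k \<in> D1 ri re R" "\<And>k. w k \<in> L2 ?B" "\<And>k. L1 ri re R (w k) \<in> L2 ?B"
    "\<And>k. L2_norm ?B (\<lambda>x. w k x - X k x) < 1 / real (Suc k)" "\<And>k. L2_norm ?B (\<lambda>x. L1 ri re R (w k) x - Y k x) < 1 / real (Suc k)"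
    using w0 by blast+
  have gen: "L2_tendsto ?B W z" if W: "\<And>k. W k \<in> L2 ?B" "\<And>k. L2_norm ?B (\<lambda>x. W k x - Z k x) < 1 / real (Suc k)" and Z: "L2_tendsto ?B Z z" for W Z z
  proof -
    have zL: "z \<in> L2 ?B" "\<And>k. Z k \<in> L2 ?B" and zl: "(\<lambda>k. L2_norm ?B (\<lambda>x. Z k x - z x)) \<longlonglongrightarrow> 0"
      using Z by (auto simp: L2_tendsto_def)
    have b: "norm (L2_norm ?B (\<lambda>x. W k x - z x)) \<le> 1 / real (Suc k) + L2_norm ?B (\<lambda>x. Z k x - z x)" for k
      using L2_norm_triangle3[OF W(1)[of k] zL(2)[of k] zL(1)] W(2)[of k] L2_norm_nonneg[of ?B "\<lambda>x. W k x - z x"] by simp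
    have "(\<lambda>k. 1 / real (Suc k) + L2_norm ?B (\<lambda>x. Z k x - z x)) \<longlonglongrightarrow> 0 + 0"
      by (rule tendsto_add[OF LIMSEQ_Suc[OF lim_1_over_n] zl])
    then have "(\<lambda>k. 1 / real (Suc k) + L2_norm ?B (\<lambda>x. Z k x - z x)) \<longlonglongrightarrow> 0" by simp
    then have "(\<lambda>k. L2_norm ?B (\<lambda>x. W k x - z x)) \<longlonglongrightarrow> 0"
      by (rule Lim_null_comparison[rotated]) (rule always_eventually, rule allI, rule b)
    then show ?thesis using W zL by (simp add: L2_tendsto_def)
  qed
  show ?thesis unfolding L1_closure_def
    using w(1) gen[OF w(2,4) X] gen[of "\<lambda>k. L1 ri re R (w k)", OF w(3,5) Y] by (auto intro!: exI[of _ w])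
qed

end

section \<open>Functions of fixed angular momentum\<close>


text \<open>This is \<open>r^|m| e^(i m theta)\<close>, written as a power of
  \<open>x_1 + i x_2\<close> or of its conjugate: a harmonic polynomial, hence smooth at the origin
  for either sign of \<open>m\<close>.\<close>

definition zmode :: "int \<Rightarrow> real^2 \<Rightarrow> complex" where
  "zmode m x = (of_real (x $ 1) + (if m \<ge> 0 then \<i> else - \<i>) * of_real (x $ 2)) ^ nat \<bar>m\<bar>"

definition radial_mode :: "(real \<Rightarrow> real) \<Rightarrow> int \<Rightarrow> real^2 \<Rightarrow> complex" where
  "radial_mode G m x = of_real (G ((norm x)\<^sup>2)) * zmode m x"

lemma smooth_zmode: "smooth (zmode m)"
  unfolding zmode_def[abs_def] by (intro smooth_power smooth_add smooth_mult smooth_const smooth_coord)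

lemma smooth_radial_mode: "smoothR {-1<..} G \<Longrightarrow> smooth (radial_mode G m)"
  unfolding radial_mode_def[abs_def] by (intro smooth_mult smooth_radial smooth_zmode)

lemma zmode_polar: "zmode m (polar r \<theta>) = of_real (r ^ nat \<bar>m\<bar>) * exp (\<i> * of_int m * of_real \<theta>)"
proof -
  define q where "q = (if m \<ge> 0 then \<theta> else - \<theta>)"
  have "of_real (r * cos \<theta>) + (if m \<ge> 0 then \<i> else - \<i>) * of_real (r * sin \<theta>) = of_real r * cis q"
    by (simp add: complex_eq_iff q_def)
  then have "zmode m (polar r \<theta>) = (of_real r * cis q) ^ nat \<bar>m\<bar>" by (simp add: zmode_def)
  also have "\<dots> = of_real (r ^ nat \<bar>m\<bar>) * cis (real (nat \<bar>m\<bar>) * q)"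
    by (simp add: power_mult_distrib Complex.DeMoivre)
  also have "real (nat \<bar>m\<bar>) * q = of_int m * \<theta>" by (simp add: q_def)
  also have "cis (of_int m * \<theta>) = exp (\<i> * of_int m * of_real \<theta>)" by (simp add: cis_conv_exp mult_ac)
  finally show ?thesis .
qed

lemma norm_zmode: "cmod (zmode m x) = norm x ^ nat \<bar>m\<bar>"
proof -
  have "(cmod (of_real (x $ 1) + (if m \<ge> 0 then \<i> else - \<i>) * of_real (x $ 2)))\<^sup>2 = (norm x)\<^sup>2"
    unfolding cmod_power2 norm_sq_coords by simp
  then have "cmod (of_real (x $ 1) + (if m \<ge> 0 then \<i> else - \<i>) * of_real (x $ 2)) = norm x"
    by (rule power2_eq_imp_eq) auto
  then show ?thesis by (simp add: zmode_def norm_power)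
qed

definition zderiv :: "int \<Rightarrow> 2 \<Rightarrow> real^2 \<Rightarrow> complex" where
  "zderiv m j x = of_nat (nat \<bar>m\<bar>) * (of_real (x $ 1) + (if m \<ge> 0 then \<i> else - \<i>) * of_real (x $ 2)) ^ (nat \<bar>m\<bar> - 1)
     * (if j = 1 then 1 else if m \<ge> 0 then \<i> else - \<i>)"

lemma pderiv_at_power_linear:
  fixes \<kappa> :: complex
  shows "pderiv_at j (\<lambda>x. (of_real (x $ 1) + \<kappa> * of_real (x $ 2)) ^ n) x
    = of_nat n * (of_real (x $ 1) + \<kappa> * of_real (x $ 2)) ^ (n - 1) * (if j = 1 then 1 else \<kappa>)"
proof -
  have "((\<lambda>x. complex_of_real (x $ 1) + \<kappa> * of_real (x $ 2)) has_derivative (\<lambda>h. of_real (h $ 1) + \<kappa> * of_real (h $ 2))) (at x)"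
    by (intro has_derivative_add has_derivative_mult_right has_derivative_coord)
  from has_derivative_power[OF this, of n] have
    "((\<lambda>x. (complex_of_real (x $ 1) + \<kappa> * of_real (x $ 2)) ^ n) has_derivative
      (\<lambda>h. of_nat n * (of_real (h $ 1) + \<kappa> * of_real (h $ 2)) * (of_real (x $ 1) + \<kappa> * of_real (x $ 2)) ^ (n - 1))) (at x)" .
  from pderiv_at_eq[OF this, of j] show ?thesis
    using exhaust_2[of j] by (auto simp: axis_def)
qed

lemma pderiv_at_zmode: "pderiv_at j (zmode m) x = zderiv m j x"
  unfolding zmode_def[abs_def] zderiv_def by (rule pderiv_at_power_linear)

lemma smooth_zderiv: "smooth (zderiv m j)"
proof -
  have "zderiv m j = pderiv_at j (zmode m)" by (rule ext) (rule pderiv_at_zmode[symmetric])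
  then show ?thesis using smooth_pderiv[OF smooth_zmode] by simp
qed

text \<open>Euler's identity for a homogeneous polynomial of degree \<open>|m|\<close>.\<close>

lemma zderiv_euler: "of_real (x $ 1) * zderiv m 1 x + of_real (x $ 2) * zderiv m 2 x = of_nat (nat \<bar>m\<bar>) * zmode m x"
proof (cases "nat \<bar>m\<bar>")
  case (Suc n)
  let ?z = "complex_of_real (x $ 1) + (if m \<ge> 0 then \<i> else - \<i>) * of_real (x $ 2)"
  have "of_real (x $ 1) * zderiv m 1 x + of_real (x $ 2) * zderiv m 2 x = of_nat (Suc n) * ?z ^ n * ?z"
    unfolding zderiv_def Suc by (simp add: algebra_simps)
  then show ?thesis unfolding zmode_def Suc by simp
qed (simp add: zderiv_def)

text \<open>The two second derivatives differ by the factor \<open>i^2\<close>.\<close>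

lemma zderiv_harmonic: "pderiv_at 1 (zderiv m 1) x + pderiv_at 2 (zderiv m 2) x = 0"
proof -
  let ?k = "if m \<ge> 0 then \<i> else - \<i>"
  let ?z = "\<lambda>x::real^2. complex_of_real (x $ 1) + ?k * of_real (x $ 2)"
  have s: "smooth (\<lambda>x. ?z x ^ n)" for n by (intro smooth_power smooth_add smooth_mult smooth_const smooth_coord)
  have z: "zderiv m j = (\<lambda>x. (of_nat (nat \<bar>m\<bar>) * (if j = 1 then 1 else ?k)) * ?z x ^ (nat \<bar>m\<bar> - 1))" for j
    by (rule ext) (simp add: zderiv_def mult_ac)
  have "pderiv_at j (zderiv m j) x = (of_nat (nat \<bar>m\<bar>) * (if j = 1 then 1 else ?k)) *
      (of_nat (nat \<bar>m\<bar> - 1) * ?z x ^ (nat \<bar>m\<bar> - 1 - 1) * (if j = 1 then 1 else ?k))" for j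
    unfolding z pderiv_at_mult[OF smooth_differentiable[OF smooth_const] smooth_differentiable[OF s]] pderiv_at_const pderiv_at_power_linear
    by simp
  then show ?thesis by (simp add: algebra_simps)
qed

lemma pderiv_at_radial:
  assumes "(G has_real_derivative G') (at ((norm x)\<^sup>2))"
  shows "pderiv_at j (\<lambda>x::real^2. complex_of_real (G ((norm x)\<^sup>2))) x = of_real (2 * x $ j * G')"
    "(\<lambda>x::real^2. complex_of_real (G ((norm x)\<^sup>2))) differentiable (at x)"
proof -
  have q: "((\<lambda>x::real^2. (norm x)\<^sup>2) has_derivative (\<lambda>h. 2 * (x \<bullet> h))) (at x)"
    unfolding power2_norm_eq_inner by (auto intro!: derivative_eq_intros simp: inner_commute)
  have "(G has_derivative (\<lambda>h. G' * h)) (at ((norm x)\<^sup>2))" using assms by (simp add: has_field_derivative_def)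
  from has_derivative_of_real[OF has_derivative_compose[OF q this]]
  have d: "((\<lambda>x::real^2. complex_of_real (G ((norm x)\<^sup>2))) has_derivative (\<lambda>h. of_real (G' * (2 * (x \<bullet> h))))) (at x)" .
  show "pderiv_at j (\<lambda>x::real^2. complex_of_real (G ((norm x)\<^sup>2))) x = of_real (2 * x $ j * G')"
    unfolding pderiv_at_eq[OF d] by (simp add: inner_axis)
  show "(\<lambda>x::real^2. complex_of_real (G ((norm x)\<^sup>2))) differentiable (at x)" using d differentiable_def by blast
qed

lemma smoothR_deriv: "smoothR S G \<Longrightarrow> smoothR S (deriv G)"
  unfolding smoothR_def by (metis CkR.simps(2))

lemma smoothR_DERIV: "smoothR S G \<Longrightarrow> s \<in> S \<Longrightarrow> (G has_real_derivative deriv G s) (at s)"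
  unfolding smoothR_def using CkR_DERIV by blast

lemma norm_sq_gt: "(norm (x::real^2))\<^sup>2 \<in> {-1<..}"
  by (auto intro: less_le_trans[of _ 0])

lemma pderiv_at_radial_mode:
  assumes G: "smoothR {-1<..} G"
  shows "pderiv_at j (radial_mode G m) x = of_real (2 * x $ j) * radial_mode (deriv G) m x + of_real (G ((norm x)\<^sup>2)) * zderiv m j x"
proof -
  note r = pderiv_at_radial[OF smoothR_DERIV[OF G norm_sq_gt]]
  show ?thesis
    unfolding radial_mode_def[abs_def]
    unfolding pderiv_at_mult[OF r(2) smooth_differentiable[OF smooth_zmode]] r(1) pderiv_at_zmode
    by (simp add: algebra_simps)
qed

text \<open>Harmonicity of \<open>z^m\<close> removes the term with \<open>G\<close> itself, and
  Euler's identity turns the mixed term into a multiple of \<open>G'\<close>. What remains is an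
  ordinary differential operator in \<open>s\<close>.\<close>

lemma lap_radial_mode:
  assumes G: "smoothR {-1<..} G"
  shows "lap (radial_mode G m) x = of_real (4 * ((norm x)\<^sup>2 * deriv (deriv G) ((norm x)\<^sup>2) + real (nat \<bar>m\<bar> + 1) * deriv G ((norm x)\<^sup>2))) * zmode m x"
proof -
  note G' = smoothR_deriv[OF G]
  let ?A = "radial_mode (deriv G) m" and ?s = "(norm x)\<^sup>2"
  note r = pderiv_at_radial[OF smoothR_DERIV[OF G norm_sq_gt]]
  have c: "smooth (\<lambda>x. complex_of_real (2 * x $ j))" for j
    using smooth_mult[OF smooth_const[of 2] smooth_coord[of j]] by simp
  have pc: "pderiv_at j (\<lambda>x. complex_of_real (2 * x $ j)) x = 2" for j
    using pderiv_at_mult[OF smooth_differentiable[OF smooth_const[of 2]] smooth_differentiable[OF smooth_coord[of j]], of j x]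
    by (simp add: pderiv_at_const pderiv_at_coord)
  note sA = smooth_radial_mode[OF G', of m]
  have "pderiv_at j (pderiv_at j (radial_mode G m)) x
    = 2 * ?A x + of_real (2 * x $ j) * (of_real (2 * x $ j) * radial_mode (deriv (deriv G)) m x + of_real (deriv G ?s) * zderiv m j x)
      + of_real (2 * x $ j * deriv G ?s) * zderiv m j x + of_real (G ?s) * pderiv_at j (zderiv m j) x" for j
  proof -
    have e: "pderiv_at j (radial_mode G m) = (\<lambda>x. of_real (2 * x $ j) * ?A x + of_real (G ((norm x)\<^sup>2)) * zderiv m j x)"
      by (rule ext) (rule pderiv_at_radial_mode[OF G])
    have d1: "(\<lambda>x. of_real (2 * x $ j) * ?A x) differentiable (at x)"
      by (rule smooth_differentiable[OF smooth_mult[OF c sA]])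
    have d2: "(\<lambda>x. of_real (G ((norm x)\<^sup>2)) * zderiv m j x) differentiable (at x)"
      by (rule smooth_differentiable[OF smooth_mult[OF smooth_radial[OF G] smooth_zderiv]])
    show ?thesis
      unfolding e pderiv_at_add[OF d1 d2] pderiv_at_mult[OF smooth_differentiable[OF c] smooth_differentiable[OF sA]]
        pderiv_at_mult[OF r(2) smooth_differentiable[OF smooth_zderiv]] r(1) pc pderiv_at_radial_mode[OF G']
      by (simp add: algebra_simps)
  qed
  then have l: "lap (radial_mode G m) x = 4 * ?A x
     + of_real (4 * ((x $ 1)\<^sup>2 + (x $ 2)\<^sup>2)) * radial_mode (deriv (deriv G)) m x
     + of_real (4 * deriv G ?s) * (of_real (x $ 1) * zderiv m 1 x + of_real (x $ 2) * zderiv m 2 x)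
     + of_real (G ?s) * (pderiv_at 1 (zderiv m 1) x + pderiv_at 2 (zderiv m 2) x)"
    unfolding lap_def by (simp add: UNIV_2 algebra_simps power2_eq_square)
  define N where "N = nat \<bar>m\<bar>"
  show ?thesis unfolding l zderiv_euler zderiv_harmonic norm_sq_coords[symmetric]
    unfolding radial_mode_def N_def[symmetric] by (simp add: algebra_simps)
qed

text \<open>After multiplication by \<open>|x|\<close> this is Euler's identity again. The
  expression \<open>2 s G' + M G\<close> is the flux that enters the transmission
  conditions.\<close>

lemma radial_deriv_radial_mode:
  assumes G: "smoothR {-1<..} G" and r: "norm x > 0"
  shows "radial_deriv (radial_mode G m) x
    = of_real ((2 * (norm x)\<^sup>2 * deriv G ((norm x)\<^sup>2) + real (nat \<bar>m\<bar>) * G ((norm x)\<^sup>2)) / norm x) * zmode m x"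
proof -
  let ?s = "(norm x)\<^sup>2"
  have "of_real (norm x) * radial_deriv (radial_mode G m) x = (\<Sum>j\<in>UNIV. of_real (x $ j) * pderiv_at j (radial_mode G m) x)"
    unfolding radial_deriv_def sum_distrib_left
    by (rule sum.cong[OF refl]) (use r in \<open>simp add: sgn_div_norm field_simps\<close>)
  also have "\<dots> = of_real (2 * ((x $ 1)\<^sup>2 + (x $ 2)\<^sup>2)) * radial_mode (deriv G) m x
      + of_real (G ?s) * (of_real (x $ 1) * zderiv m 1 x + of_real (x $ 2) * zderiv m 2 x)"
    unfolding pderiv_at_radial_mode[OF G] by (simp add: UNIV_2 algebra_simps power2_eq_square)
  also have "\<dots> = of_real (2 * ?s * deriv G ?s + real (nat \<bar>m\<bar>) * G ?s) * zmode m x"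
    unfolding zderiv_euler norm_sq_coords[symmetric] radial_mode_def by (simp add: algebra_simps del: of_nat_nat)
  finally show ?thesis using r by (simp add: field_simps)
qed

section \<open>The transmission problem for one mode\<close>


text \<open>Besides the constants, the second solution of \<open>s G'' + (M + 1) G' = 0\<close>,
  normalised to have derivative \<open>s^(-M-1)\<close>; the logarithm covers
  \<open>M = 0\<close>.\<close>

definition E_fun :: "nat \<Rightarrow> real \<Rightarrow> real" where
  "E_fun M s = (if M = 0 then ln s else - (s powr (- real M)) / real M)"

definition e_fun :: "nat \<Rightarrow> real \<Rightarrow> real" where
  "e_fun M s = s powr (- (real M + 1))"

lemma E_fun_DERIV: "s > 0 \<Longrightarrow> (E_fun M has_real_derivative e_fun M s) (at s)"
proof (cases "M = 0")
  case True
  assume "s > 0"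
  then show ?thesis using DERIV_ln[of s] True
    by (simp add: E_fun_def[abs_def] e_fun_def powr_minus)
next
  case False
  assume s: "s > 0"
  have "((\<lambda>s. - (s powr (- real M)) / real M) has_real_derivative e_fun M s) (at s)"
    using s False by (auto intro!: derivative_eq_intros simp: e_fun_def)
  then show ?thesis using False by (simp add: E_fun_def[abs_def])
qed

lemma e_fun_DERIV: "s > 0 \<Longrightarrow> (e_fun M has_real_derivative - (real M + 1) * e_fun M s / s) (at s)"
proof -
  assume s: "s > 0"
  define r where "r = - (real M + 1)"
  have "((\<lambda>z. z powr r) has_real_derivative r * s powr (r - 1)) (at s)" by (rule has_real_derivative_powr[OF s])
  moreover have "s powr (r - 1) = s powr r / s" using s by (simp add: powr_diff)
  ultimately show ?thesis unfolding e_fun_def[abs_def] r_def[symmetric] by simp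
qed

lemma smoothR_e_fun: "smoothR {0<..} (e_fun M)"
  unfolding e_fun_def[abs_def] by (rule smoothR_powr)

lemma smoothR_E_fun: "smoothR {0<..} (E_fun M)"
  by (rule smoothR_antiderivative[OF _ E_fun_DERIV smoothR_e_fun]) auto

lemma e_fun_mult: "s > 0 \<Longrightarrow> s * e_fun M s * s ^ M = 1"
proof -
  assume s: "s > 0"
  have "s * e_fun M s * s ^ M = s powr 1 * s powr (- (real M + 1)) * s powr (real M)"
    using s by (simp add: e_fun_def powr_realpow)
  also have "\<dots> = s powr (1 + - (real M + 1) + real M)" by (simp only: powr_add)
  finally show ?thesis using s by simp
qed

text \<open>With the factor \<open>M\<close> the logarithmic case fits in, both sides then being
  \<open>0\<close>.\<close>

lemma E_fun_diff: "s > 0 \<Longrightarrow> t > 0 \<Longrightarrow> real M * (E_fun M s - E_fun M t) = 1 / t ^ M - 1 / s ^ M"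
  by (cases "M = 0") (auto simp: E_fun_def powr_minus powr_realpow field_simps)

lemma E_fun_mono: "0 < s \<Longrightarrow> s \<le> t \<Longrightarrow> E_fun M s \<le> E_fun M t"
proof (rule DERIV_nonneg_imp_nondecreasing[of s t])
  fix x assume "0 < s" "s \<le> x"
  then show "\<exists>y. (E_fun M has_real_derivative y) (at x) \<and> y \<ge> 0"
    using E_fun_DERIV[of x M] by (intro exI[of _ "e_fun M x"]) (auto simp: e_fun_def)
qed simp

text \<open>Arithmetic for the transition zones of the blending functions, each of which occupies
  the middle third of an interval.\<close>

lemma thirds:
  fixes a b s :: real
  shows "s < a + (b - a) / 3 \<Longrightarrow> 3 * (s - a) \<le> 1 * (b - a)"
    "s > a + 2 / 3 * (b - a) \<Longrightarrow> 2 * (b - a) \<le> 3 * (s - a)"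
    "a < b \<Longrightarrow> s \<le> a \<Longrightarrow> s < a + (b - a) / 3"
    "a < b \<Longrightarrow> b \<le> s \<Longrightarrow> s > a + 2 / 3 * (b - a)"
    "0 < a \<Longrightarrow> a \<le> s \<Longrightarrow> 2 / 3 * a < s"
  by (simp_all add: field_simps)

lemma greaterThan_cover: "0 < (a::real) \<Longrightarrow> {-1<..} \<subseteq> {..<a} \<union> {0<..}"
  by (auto intro: le_less_trans)

context annuli
begin

text \<open>For the angular momentum \<open>m\<close> and \<open>M = \<bar>m\<bar>\<close>, the harmonic functions \<open>G(\<bar>x\<bar>\<^sup>2) z\<^sup>m\<close> have
  \<open>G = \<alpha> + \<beta> E\<close>.  The coefficients below on the three regions (core, annulus, exterior, numbered 0, 1, 2)
  describe the two solutions of the transmission problem that are regular at the origin (\<open>hphi\<close>) and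
  vanish for \<open>\<bar>x\<bar> = R\<close> (\<open>hpsi\<close>).\<close>

definition psi_re :: "nat \<Rightarrow> real" where
  "psi_re M = E_fun M (R\<^sup>2) - E_fun M (re\<^sup>2)"
text \<open>Obtained by solving the flux condition at \<open>re\<close> for the coefficient of
  \<open>E\<close>, given the coefficient \<open>-1\<close> outside. \<open>slope_core\<close>
  solves the condition at \<open>ri\<close> in the same way.\<close>

definition slope_annulus :: "nat \<Rightarrow> real" where
  "slope_annulus M = 1 - real M * (re\<^sup>2) ^ M * psi_re M"
definition psi_ri :: "nat \<Rightarrow> real" where
  "psi_ri M = psi_re M + slope_annulus M * (E_fun M (ri\<^sup>2) - E_fun M (re\<^sup>2))"
definition slope_core :: "nat \<Rightarrow> real" where
  "slope_core M = - slope_annulus M - real M * (ri\<^sup>2) ^ M * psi_ri M"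

text \<open>\<open>phi\<close> is normalised to be \<open>1\<close> in the exterior; its
  coefficients in the other regions are then forced by the transmission conditions.\<close>

definition al :: "nat \<Rightarrow> nat \<Rightarrow> real" where
  "al M j = (if j = 0 then (re\<^sup>2) ^ M / (ri\<^sup>2) ^ M else if j = 1 then 1 + real M * (re\<^sup>2) ^ M * E_fun M (re\<^sup>2) else 1)"
definition be :: "nat \<Rightarrow> nat \<Rightarrow> real" where
  "be M j = (if j = 1 then - real M * (re\<^sup>2) ^ M else 0)"
definition ga :: "nat \<Rightarrow> nat \<Rightarrow> real" where
  "ga M j = (if j = 0 then psi_ri M - slope_core M * E_fun M (ri\<^sup>2)
     else if j = 1 then psi_re M - slope_annulus M * E_fun M (re\<^sup>2) else E_fun M (R\<^sup>2))"
definition de :: "nat \<Rightarrow> nat \<Rightarrow> real" where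
  "de M j = (if j = 0 then slope_core M else if j = 1 then slope_annulus M else - 1)"

definition hphi :: "nat \<Rightarrow> nat \<Rightarrow> real \<Rightarrow> real" where "hphi M j s = al M j + be M j * E_fun M s"
definition hpsi :: "nat \<Rightarrow> nat \<Rightarrow> real \<Rightarrow> real" where "hpsi M j s = ga M j + de M j * E_fun M s"
definition region :: "real \<Rightarrow> nat" where "region s = (if s < ri\<^sup>2 then 0 else if s < re\<^sup>2 then 1 else 2)"
definition phi :: "nat \<Rightarrow> real \<Rightarrow> real" where "phi M s = hphi M (region s) s"
definition psi :: "nat \<Rightarrow> real \<Rightarrow> real" where "psi M s = hpsi M (region s) s"
text \<open>The sign of the Laplacian in the operator, region by region.\<close>

definition eps :: "nat \<Rightarrow> real" where "eps j = (if j = 1 then - 1 else 1)"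

lemma sq_pos: "0 < ri\<^sup>2" "ri\<^sup>2 < re\<^sup>2" "re\<^sup>2 < R\<^sup>2" "0 < re\<^sup>2" "0 < R\<^sup>2"
  using ri re R by (auto intro!: power_strict_mono)

text \<open>The reversed flux at \<open>re\<close> turns the growing function \<open>z^m\<close> of
  the exterior into a decaying one in the annulus, so \<open>phi\<close> grows inwards up to
  \<open>(re / ri)^(2M)\<close>. This amplification is the origin of the exponential weight.\<close>

lemma hphi_annulus:
  assumes "s > 0" shows "hphi M 1 s = (re\<^sup>2) ^ M / s ^ M"
proof -
  have b: "(re\<^sup>2) ^ M \<noteq> 0" using sq_pos by simp
  have "hphi M 1 s = 1 - (re\<^sup>2) ^ M * (real M * (E_fun M s - E_fun M (re\<^sup>2)))"
    by (simp add: hphi_def al_def be_def algebra_simps)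
  also have "\<dots> = 1 - (re\<^sup>2) ^ M * (1 / (re\<^sup>2) ^ M - 1 / s ^ M)"
    by (simp only: E_fun_diff[OF assms sq_pos(4)])
  also have "\<dots> = (re\<^sup>2) ^ M / s ^ M" using b by (simp add: right_diff_distrib)
  finally show ?thesis .
qed

lemma wronskian_annulus: "be M 1 * ga M 1 - de M 1 * al M 1 = - 1"
  by (simp add: be_def ga_def de_def al_def slope_annulus_def algebra_simps)

text \<open>A profile \<open>G\<close> with coefficient \<open>b\<close> at \<open>E\<close> has
  \<open>2 s G' + M G = 2 b s^(-M) + M G\<close>. For two profiles with equal values, opposite
  fluxes therefore mean that the two coefficients add up to \<open>- M s^M G\<close>.\<close>

lemma transmission_ri:
  "hphi M 0 (ri\<^sup>2) = hphi M 1 (ri\<^sup>2)" "hpsi M 0 (ri\<^sup>2) = hpsi M 1 (ri\<^sup>2)"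
  "be M 0 + be M 1 = - real M * (ri\<^sup>2) ^ M * hphi M 1 (ri\<^sup>2)"
  "de M 0 + de M 1 = - real M * (ri\<^sup>2) ^ M * hpsi M 1 (ri\<^sup>2)"
proof -
  show "hphi M 0 (ri\<^sup>2) = hphi M 1 (ri\<^sup>2)"
    unfolding hphi_annulus[OF sq_pos(1)] by (simp add: hphi_def al_def be_def)
  have p: "hpsi M 1 (ri\<^sup>2) = psi_ri M" by (simp add: hpsi_def ga_def de_def psi_ri_def algebra_simps)
  show "hpsi M 0 (ri\<^sup>2) = hpsi M 1 (ri\<^sup>2)" unfolding p by (simp add: hpsi_def ga_def de_def)
  show "be M 0 + be M 1 = - real M * (ri\<^sup>2) ^ M * hphi M 1 (ri\<^sup>2)"
    unfolding hphi_annulus[OF sq_pos(1)] using ri by (simp add: be_def)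
  show "de M 0 + de M 1 = - real M * (ri\<^sup>2) ^ M * hpsi M 1 (ri\<^sup>2)"
    unfolding p by (simp add: de_def slope_core_def)
qed

lemma transmission_re:
  "hphi M 2 (re\<^sup>2) = hphi M 1 (re\<^sup>2)" "hpsi M 2 (re\<^sup>2) = hpsi M 1 (re\<^sup>2)"
  "be M 2 + be M 1 = - real M * (re\<^sup>2) ^ M * hphi M 1 (re\<^sup>2)"
  "de M 2 + de M 1 = - real M * (re\<^sup>2) ^ M * hpsi M 1 (re\<^sup>2)"
proof -
  have h: "hphi M 1 (re\<^sup>2) = 1" unfolding hphi_annulus[OF sq_pos(4)] using sq_pos by simp
  have p: "hpsi M 1 (re\<^sup>2) = psi_re M" by (simp add: hpsi_def ga_def de_def)
  show "hphi M 2 (re\<^sup>2) = hphi M 1 (re\<^sup>2)" unfolding h by (simp add: hphi_def al_def be_def)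
  show "hpsi M 2 (re\<^sup>2) = hpsi M 1 (re\<^sup>2)" unfolding p by (simp add: hpsi_def ga_def de_def psi_re_def)
  show "be M 2 + be M 1 = - real M * (re\<^sup>2) ^ M * hphi M 1 (re\<^sup>2)" unfolding h by (simp add: be_def)
  show "de M 2 + de M 1 = - real M * (re\<^sup>2) ^ M * hpsi M 1 (re\<^sup>2)"
    unfolding p by (simp add: de_def slope_annulus_def)
qed

text \<open>The Wronskian of \<open>phi\<close> and \<open>psi\<close> up to the factor
  \<open>e_fun\<close>. At a crossing values persist and fluxes change sign, so it changes sign as
  well; in the exterior it is \<open>1\<close> by normalisation. The sign \<open>eps\<close> later
  cancels that of the operator.\<close>

lemma wronskian: "j \<le> 2 \<Longrightarrow> be M j * ga M j - de M j * al M j = eps j"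
proof -
  assume "j \<le> 2"
  then consider "j = 0" | "j = 1" | "j = 2" by linarith
  then show ?thesis
  proof cases
    case 1
    have "(ri\<^sup>2) ^ M \<noteq> 0" using sq_pos by simp
    then have "(re\<^sup>2) ^ M / (ri\<^sup>2) ^ M * (real M * (ri\<^sup>2) ^ M * psi_ri M) = real M * (re\<^sup>2) ^ M * psi_ri M"
      by simp
    then have "be M 0 * ga M 0 - de M 0 * al M 0 = slope_annulus M * hphi M 1 (ri\<^sup>2) - be M 1 * hpsi M 1 (ri\<^sup>2)"
      unfolding transmission_ri(2)[symmetric] hphi_annulus[OF sq_pos(1)]
      by (simp add: be_def de_def al_def slope_core_def hpsi_def ga_def algebra_simps)
    also have "\<dots> = - (be M 1 * ga M 1 - de M 1 * al M 1)"
      by (simp add: hphi_def hpsi_def de_def algebra_simps)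
    finally have "be M 0 * ga M 0 - de M 0 * al M 0 = 1" using wronskian_annulus[of M] by linarith
    then show ?thesis using 1 by (simp add: eps_def)
  next
    case 2 then show ?thesis using wronskian_annulus by (simp add: eps_def)
  next
    case 3 then show ?thesis by (simp add: be_def ga_def de_def al_def eps_def)
  qed
qed

lemma hpsi_R: "hpsi M 2 (R\<^sup>2) = 0" by (simp add: hpsi_def ga_def de_def)

lemma smoothR_hphi: "smoothR {0<..} (hphi M j)"
  unfolding hphi_def[abs_def] by (intro smoothR_add smoothR_mult smoothR_const smoothR_E_fun) auto
lemma smoothR_hpsi: "smoothR {0<..} (hpsi M j)"
  unfolding hpsi_def[abs_def] by (intro smoothR_add smoothR_mult smoothR_const smoothR_E_fun) auto

definition region_set :: "nat \<Rightarrow> real set" where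
  "region_set j = (if j = 0 then {0<..<ri\<^sup>2} else if j = 1 then {ri\<^sup>2<..<re\<^sup>2} else {re\<^sup>2<..})"

lemma region_set_open: "open (region_set j)" by (simp add: region_set_def)
lemma region_set_region: "s \<in> region_set j \<Longrightarrow> j \<le> 2 \<Longrightarrow> region s = j" "s \<in> region_set j \<Longrightarrow> s > 0"
proof -
  show "s \<in> region_set j \<Longrightarrow> j \<le> 2 \<Longrightarrow> region s = j"
    using sq_pos by (auto simp: region_set_def region_def split: if_splits)
  show "s \<in> region_set j \<Longrightarrow> s > 0"
    by (auto simp only: region_set_def greaterThanLessThan_iff greaterThan_iff split: if_splits
        intro: less_trans[OF sq_pos(1)] less_trans[OF sq_pos(4)])
qed

text \<open>Variation of constants with \<open>phi\<close> and \<open>psi\<close>. The factor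
  \<open>1/4\<close> comes from the Laplacian in the variable \<open>s\<close>, and
  \<open>t^M\<close> is the reciprocal of \<open>t * e_fun M t\<close>.\<close>

definition Sol :: "nat \<Rightarrow> (real \<Rightarrow> real) \<Rightarrow> real \<Rightarrow> real" where
  "Sol M \<sigma> s = - (1/4) * (phi M s * integral {s..R\<^sup>2} (\<lambda>t. psi M t * (\<sigma> t * t ^ M))
     + psi M s * integral {0..s} (\<lambda>t. phi M t * (\<sigma> t * t ^ M)))"

text \<open>A source vanishing near the origin, the interface and the outer circle makes the
  solution homogeneous there, so that its pieces continue smoothly across the circles.\<close>

definition admissible :: "(real \<Rightarrow> real) \<Rightarrow> bool" where
  "admissible \<sigma> \<longleftrightarrow> smoothR UNIV \<sigma> \<and> (\<exists>d>0. \<forall>s. s < d \<or> \<bar>s - ri\<^sup>2\<bar> < d \<or> \<bar>s - re\<^sup>2\<bar> < d \<or> s > R\<^sup>2 - d \<longrightarrow> \<sigma> s = 0)"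

end

section \<open>Solving one mode for an admissible source\<close>

locale annuli_source = annuli +
  fixes M :: nat and \<sigma> :: "real \<Rightarrow> real" and d :: real
  assumes \<sigma>: "smoothR UNIV \<sigma>" and d: "d > 0"
    and \<sigma>0: "\<And>s. s < d \<or> \<bar>s - ri\<^sup>2\<bar> < d \<or> \<bar>s - re\<^sup>2\<bar> < d \<or> s > R\<^sup>2 - d \<Longrightarrow> \<sigma> s = 0"
begin

lemma smoothR_power: "open S \<Longrightarrow> smoothR S (\<lambda>t. t ^ n)"
proof (induction n)
  case (Suc n)
  then show ?case using smoothR_mult[OF Suc.prems smoothR_id[OF Suc.prems] Suc.IH] by simp
qed (simp add: smoothR_const)

lemma smoothR_weighted: "smoothR UNIV (\<lambda>t. \<sigma> t * t ^ M)"
  by (intro smoothR_mult \<sigma> smoothR_power open_UNIV)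

text \<open>The region index jumps only at points near which \<open>\<sigma>\<close> vanishes
  identically; the regions and those neighbourhoods form an open cover of the line.\<close>

lemma smoothR_piecewise:
  assumes f: "\<And>j. smoothR {0<..} (f j)"
  shows "smoothR UNIV (\<lambda>t. f (region t) t * (\<sigma> t * t ^ M))"
proof -
  let ?h = "\<lambda>t. f (region t) t * (\<sigma> t * t ^ M)"
  have z: "smoothR S ?h" if "open S" "\<And>s. s \<in> S \<Longrightarrow> \<sigma> s = 0" for S
    by (rule smoothR_cong[OF that(1) _ smoothR_const[OF that(1), of 0]]) (simp add: that(2))
  have r: "smoothR (region_set j) ?h" if "j \<le> 2" for j
  proof (rule smoothR_cong[OF region_set_open])
    show "smoothR (region_set j) (\<lambda>t. f j t * (\<sigma> t * t ^ M))"
      by (rule smoothR_subset[OF smoothR_mult[OF _ f smoothR_subset[OF smoothR_weighted]]])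
        (use region_set_region(2) in auto)
    show "f j x * (\<sigma> x * x ^ M) = ?h x" if "x \<in> region_set j" for x
      using region_set_region(1)[OF that \<open>j \<le> 2\<close>] by simp
  qed
  have "smoothR ({..<d} \<union> (region_set 0 \<union> ({ri\<^sup>2 - d<..<ri\<^sup>2 + d} \<union> (region_set 1 \<union> ({re\<^sup>2 - d<..<re\<^sup>2 + d} \<union> region_set 2))))) ?h"
    by (intro smoothR_Un z r open_Un region_set_open) (auto intro!: \<sigma>0)
  moreover have "{..<d} \<union> (region_set 0 \<union> ({ri\<^sup>2 - d<..<ri\<^sup>2 + d} \<union> (region_set 1 \<union> ({re\<^sup>2 - d<..<re\<^sup>2 + d} \<union> region_set 2)))) = UNIV"
  proof -
    have "s \<in> {..<d} \<union> (region_set 0 \<union> ({ri\<^sup>2 - d<..<ri\<^sup>2 + d} \<union> (region_set 1 \<union> ({re\<^sup>2 - d<..<re\<^sup>2 + d} \<union> region_set 2))))" for s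
      using d by (simp add: region_set_def) linarith
    then show ?thesis by blast
  qed
  ultimately show ?thesis by simp
qed

definition kP :: "real \<Rightarrow> real" where "kP t = psi M t * (\<sigma> t * t ^ M)"
definition kQ :: "real \<Rightarrow> real" where "kQ t = phi M t * (\<sigma> t * t ^ M)"

lemma smoothR_kP: "smoothR UNIV kP" and smoothR_kQ: "smoothR UNIV kQ"
  unfolding kP_def[abs_def] kQ_def[abs_def] phi_def psi_def
  by (rule smoothR_piecewise[OF smoothR_hpsi], rule smoothR_piecewise[OF smoothR_hphi])

lemma smoothR_continuous: "smoothR S f \<Longrightarrow> continuous_on S f"
  unfolding smoothR_def by (metis CkR.simps(1))

text \<open>The base point \<open>-1\<close> gives a two-sided derivative at
  \<open>s = 0\<close>.\<close>

lemma antiderivative_DERIV: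
  assumes k: "smoothR UNIV k" and s: "s > -1"
  shows "((\<lambda>s. integral {-1..s} k) has_real_derivative k s) (at s)"
proof -
  have "((\<lambda>s. integral {-1..s} k) has_real_derivative k s) (at s within {-1..s+1})"
    by (rule integral_has_real_derivative) (use s in \<open>auto intro: continuous_on_subset[OF smoothR_continuous[OF k]]\<close>)
  moreover have "at s within {-1..s+1} = at s" using s by (intro at_within_Icc_at) auto
  ultimately show ?thesis by (simp only:)
qed

text \<open>A difference of integrals from a common base point, so that \<open>P\<close> stays
  smooth beyond \<open>R^2\<close>. Up to there it is \<open>- 1/4\<close> times the integral from
  \<open>s\<close> to \<open>R^2\<close>.\<close>

definition P :: "real \<Rightarrow> real" where "P s = (1/4) * (integral {-1..s} kP - integral {-1..R\<^sup>2} kP)"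
definition Q :: "real \<Rightarrow> real" where "Q s = - (1/4) * integral {-1..s} kQ"

lemma P_DERIV: "s > -1 \<Longrightarrow> (P has_real_derivative (1/4) * kP s) (at s)"
  unfolding P_def[abs_def] by (auto intro!: derivative_eq_intros antiderivative_DERIV[OF smoothR_kP])

lemma Q_DERIV: "s > -1 \<Longrightarrow> (Q has_real_derivative - (1/4) * kQ s) (at s)"
  unfolding Q_def[abs_def] by (auto intro!: derivative_eq_intros antiderivative_DERIV[OF smoothR_kQ])

lemma smoothR_P: "smoothR {-1<..} P"
  by (rule smoothR_antiderivative[OF open_greaterThan P_DERIV])
    (simp, intro smoothR_mult smoothR_const smoothR_subset[OF smoothR_kP], simp_all)

lemma smoothR_Q: "smoothR {-1<..} Q"
  by (rule smoothR_antiderivative[OF open_greaterThan Q_DERIV])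
    (simp, intro smoothR_mult smoothR_const smoothR_subset[OF smoothR_kQ], simp_all)

lemma Q_zero: "s < d \<Longrightarrow> Q s = 0"
proof -
  assume "s < d"
  then have "integral {-1..s} kQ = integral {-1..s} (\<lambda>_. 0)"
    by (intro Henstock_Kurzweil_Integration.integral_cong) (simp add: kQ_def \<sigma>0)
  then show ?thesis by (simp add: Q_def)
qed

lemma k_integrable: "smoothR UNIV k \<Longrightarrow> k integrable_on {x..y::real}"
  by (rule integrable_continuous_real) (rule continuous_on_subset[OF smoothR_continuous], auto)

lemma P_eq: "-1 \<le> s \<Longrightarrow> s \<le> R\<^sup>2 \<Longrightarrow> P s = - (1/4) * integral {s..R\<^sup>2} kP"
  using Henstock_Kurzweil_Integration.integral_combine[of "-1" s "R\<^sup>2" kP] k_integrable[OF smoothR_kP] by (simp add: P_def)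

lemma Q_eq: "0 \<le> s \<Longrightarrow> Q s = - (1/4) * integral {0..s} kQ"
  using Henstock_Kurzweil_Integration.integral_combine[of "-1" 0 s kQ] k_integrable[OF smoothR_kQ] Q_zero[OF d] by (simp add: Q_def)

text \<open>The solution with the formulas of region \<open>j\<close> used for all \<open>s\<close>,
  which continues that piece beyond its region. \<open>Dr\<close> is its derivative inside the
  region and wherever \<open>\<sigma>\<close> vanishes.\<close>

definition Gr :: "nat \<Rightarrow> real \<Rightarrow> real" where "Gr j s = hphi M j s * P s + hpsi M j s * Q s"
definition Dr :: "nat \<Rightarrow> real \<Rightarrow> real" where "Dr j s = (be M j * P s + de M j * Q s) * e_fun M s"

lemma smoothR_Gr: "smoothR {0<..} (Gr j)"
  unfolding Gr_def[abs_def]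
  by (intro smoothR_add smoothR_mult smoothR_hphi smoothR_hpsi smoothR_subset[OF smoothR_P] smoothR_subset[OF smoothR_Q]) auto

text \<open>Near the origin \<open>Q\<close> vanishes and \<open>hphi M 0\<close> is constant, so
  the singular function \<open>E\<close> drops out: this is regularity at the origin.\<close>

lemma smoothR_Gr0: "smoothR {-1<..} (Gr 0)"
proof -
  have "smoothR {-1<..<d} (Gr 0)"
  proof (rule smoothR_cong)
    show "smoothR {-1<..<d} (\<lambda>s. al M 0 * P s)"
      by (intro smoothR_mult smoothR_const smoothR_subset[OF smoothR_P]) auto
    show "al M 0 * P s = Gr 0 s" if "s \<in> {-1<..<d}" for s
      using that Q_zero by (simp add: Gr_def hphi_def be_def)
  qed simp
  then have "smoothR ({-1<..<d} \<union> {0<..}) (Gr 0)" by (intro smoothR_Un smoothR_Gr) auto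
  moreover have "{-1<..<d} \<union> {0<..} = {-1<..}" using d by auto
  ultimately show ?thesis by simp
qed

text \<open>The terms with \<open>P'\<close> and \<open>Q'\<close> cancel, as in any variation of
  constants: inside the region both are \<open>phi psi\<close> times the same source term.\<close>

lemma Gr_DERIV:
  assumes s: "s > 0" and j: "region s = j \<or> \<sigma> s = 0"
  shows "(Gr j has_real_derivative Dr j s) (at s)"
proof -
  have s1: "s > -1" using s by simp
  have z: "hphi M j s * kP s = hpsi M j s * kQ s" using j by (auto simp: kP_def kQ_def phi_def psi_def)
  have ph: "(hphi M j has_real_derivative be M j * e_fun M s) (at s)"
    unfolding hphi_def[abs_def] using s by (auto intro!: derivative_eq_intros E_fun_DERIV)
  have ps: "(hpsi M j has_real_derivative de M j * e_fun M s) (at s)"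
    unfolding hpsi_def[abs_def] using s by (auto intro!: derivative_eq_intros E_fun_DERIV)
  have "(Gr j has_real_derivative (be M j * e_fun M s * P s + (1/4) * kP s * hphi M j s) + (de M j * e_fun M s * Q s + - (1/4) * kQ s * hpsi M j s)) (at s)"
    unfolding Gr_def[abs_def] by (rule DERIV_add[OF DERIV_mult[OF ph P_DERIV[OF s1]] DERIV_mult[OF ps Q_DERIV[OF s1]]])
  moreover have "(be M j * e_fun M s * P s + (1/4) * kP s * hphi M j s) + (de M j * e_fun M s * Q s + - (1/4) * kQ s * hpsi M j s) = Dr j s"
    using z by (simp add: Dr_def algebra_simps)
  ultimately show ?thesis by (simp only:)
qed

text \<open>Differentiating \<open>Dr\<close> leaves the Wronskian times the source, that is,
  \<open>eps j\<close> times \<open>\<sigma>\<close>. \<open>H\<close> is any function equal to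
  \<open>Gr j\<close> near \<open>s\<close>, because the globally smooth pieces have this form only
  locally.\<close>

lemma Gr_second_order:
  assumes s: "s \<in> region_set j" "j \<le> 2" and T: "open T" "s \<in> T" "\<And>t. t \<in> T \<Longrightarrow> H t = Gr j t"
  shows "4 * (s * deriv (deriv H) s + (real M + 1) * deriv H s) = eps j * \<sigma> s"
proof -
  have s0: "s > 0" by (rule region_set_region(2)[OF s(1)])
  have D1: "deriv H t = Dr j t" if "t \<in> T \<inter> region_set j" for t
  proof -
    have "deriv H t = deriv (Gr j) t" by (rule deriv_cong_open[OF T(1) _ T(3)]) (use that in auto)
    also have "\<dots> = Dr j t"
      by (rule DERIV_imp_deriv[OF Gr_DERIV]) (use that region_set_region s(2) in auto)
    finally show ?thesis .
  qed
  have D2: "(Dr j has_real_derivative (be M j * ((1/4) * kP s) + de M j * (- (1/4) * kQ s)) * e_fun M s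
      + (- (real M + 1) * e_fun M s / s) * (be M j * P s + de M j * Q s)) (at s)"
    unfolding Dr_def[abs_def]
    by (rule DERIV_mult[OF DERIV_add[OF DERIV_cmult[OF P_DERIV] DERIV_cmult[OF Q_DERIV]] e_fun_DERIV]) (use s0 in auto)
  have "deriv (deriv H) s = deriv (Dr j) s"
    by (rule deriv_cong_open[of "T \<inter> region_set j"]) (use T s D1 region_set_open in auto)
  also have "\<dots> = (be M j * ((1/4) * kP s) + de M j * (- (1/4) * kQ s)) * e_fun M s
      + (- (real M + 1) * e_fun M s / s) * (be M j * P s + de M j * Q s)"
    by (rule DERIV_imp_deriv[OF D2])
  finally have dd: "deriv (deriv H) s = (be M j * ((1/4) * kP s) + de M j * (- (1/4) * kQ s)) * e_fun M s
      + (- (real M + 1) * e_fun M s / s) * (be M j * P s + de M j * Q s)" .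
  have d1: "deriv H s = Dr j s" by (rule D1) (use T s in auto)
  have rg: "region s = j" by (rule region_set_region(1)[OF s])
  have "4 * (s * deriv (deriv H) s + (real M + 1) * deriv H s)
     = (s * e_fun M s * s ^ M) * \<sigma> s * (be M j * hpsi M j s - de M j * hphi M j s)"
    unfolding dd d1 Dr_def kP_def kQ_def phi_def psi_def rg using s0 by (simp add: field_simps)
  also have "\<dots> = \<sigma> s * (be M j * hpsi M j s - de M j * hphi M j s)"
    unfolding e_fun_mult[OF s0] by simp
  also have "be M j * hpsi M j s - de M j * hphi M j s = eps j"
    unfolding wronskian[OF s(2), of M, symmetric] hphi_def hpsi_def by (simp add: algebra_simps)
  finally show ?thesis by (simp add: mult.commute)
qed

text \<open>The factor is \<open>0\<close> up to \<open>ri^2 / 3\<close> and \<open>1\<close> from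
  \<open>2 ri^2 / 3\<close> on: it removes the singularity at the origin without touching the
  annulus.\<close>

definition Gin :: "real \<Rightarrow> real" where "Gin s = smooth_step (3 / ri\<^sup>2 * s + - 1) * Gr 1 s"
definition st :: "real \<Rightarrow> real" where
  "st s = smooth_step (3 / (re\<^sup>2 - ri\<^sup>2) * s + (- 3 * ri\<^sup>2 / (re\<^sup>2 - ri\<^sup>2) - 1))"
text \<open>One smooth function must serve both core and exterior. The two formulas are blended in
  the middle third of the annulus, where \<open>glue\<close> never evaluates this piece.\<close>

definition Gout :: "real \<Rightarrow> real" where "Gout s = (1 - st s) * Gr 0 s + st s * Gr 2 s"

lemma smoothR_step_affine: "smoothR S (\<lambda>s. smooth_step (p * s + q))"
  using smoothR_smooth_step CkR_affine CkR_subset unfolding smoothR_def by blast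

lemma Gin_eq: "s > 2 / 3 * ri\<^sup>2 \<Longrightarrow> Gin s = Gr 1 s"
proof -
  assume s: "s > 2 / 3 * ri\<^sup>2"
  have "3 / ri\<^sup>2 * s + - 1 \<ge> 1" using s sq_pos(1) by (simp add: field_simps)
  then show ?thesis by (simp add: Gin_def smooth_step_1)
qed

lemma st_0: "s < ri\<^sup>2 + (re\<^sup>2 - ri\<^sup>2) / 3 \<Longrightarrow> st s = 0"
proof -
  assume s: "s < ri\<^sup>2 + (re\<^sup>2 - ri\<^sup>2) / 3"
  have p: "re\<^sup>2 - ri\<^sup>2 > 0" using sq_pos by simp
  have e: "3 / (re\<^sup>2 - ri\<^sup>2) * s + (- 3 * ri\<^sup>2 / (re\<^sup>2 - ri\<^sup>2) - 1) = 3 * (s - ri\<^sup>2) / (re\<^sup>2 - ri\<^sup>2) - 1"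
    by (simp add: diff_divide_distrib right_diff_distrib)
  have "3 * (s - ri\<^sup>2) / (re\<^sup>2 - ri\<^sup>2) \<le> 1"
  proof -
    have "3 * (s - ri\<^sup>2) \<le> 1 * (re\<^sup>2 - ri\<^sup>2)" by (rule thirds(1)[OF s])
    then show ?thesis by (simp only: pos_divide_le_eq[OF p])
  qed
  then show ?thesis unfolding st_def e by (intro smooth_step_0) simp
qed

lemma st_1: "s > ri\<^sup>2 + 2 / 3 * (re\<^sup>2 - ri\<^sup>2) \<Longrightarrow> st s = 1"
proof -
  assume s: "s > ri\<^sup>2 + 2 / 3 * (re\<^sup>2 - ri\<^sup>2)"
  have p: "re\<^sup>2 - ri\<^sup>2 > 0" using sq_pos by simp
  have e: "3 / (re\<^sup>2 - ri\<^sup>2) * s + (- 3 * ri\<^sup>2 / (re\<^sup>2 - ri\<^sup>2) - 1) = 3 * (s - ri\<^sup>2) / (re\<^sup>2 - ri\<^sup>2) - 1"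
    by (simp add: diff_divide_distrib right_diff_distrib)
  have "3 * (s - ri\<^sup>2) / (re\<^sup>2 - ri\<^sup>2) \<ge> 2"
  proof -
    have "2 * (re\<^sup>2 - ri\<^sup>2) \<le> 3 * (s - ri\<^sup>2)" by (rule thirds(2)[OF s])
    then show ?thesis by (simp only: pos_le_divide_eq[OF p])
  qed
  then show ?thesis unfolding st_def e by (intro smooth_step_1) simp
qed

lemma Gout_eq0: "s < ri\<^sup>2 + (re\<^sup>2 - ri\<^sup>2) / 3 \<Longrightarrow> Gout s = Gr 0 s" by (simp add: Gout_def st_0)
lemma Gout_eq2: "s > ri\<^sup>2 + 2 / 3 * (re\<^sup>2 - ri\<^sup>2) \<Longrightarrow> Gout s = Gr 2 s" by (simp add: Gout_def st_1)

lemma smoothR_Gin: "smoothR {-1<..} Gin"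
proof -
  have "smoothR {..<ri\<^sup>2 / 3} Gin"
  proof (rule smoothR_cong[OF _ _ smoothR_const[of _ 0]])
    fix s assume "s \<in> {..<ri\<^sup>2 / 3}"
    then have "3 / ri\<^sup>2 * s + - 1 \<le> 0" using sq_pos(1) by (simp add: field_simps)
    then show "0 = Gin s" by (simp add: Gin_def smooth_step_0)
  qed auto
  moreover have "smoothR {0<..} Gin"
    unfolding Gin_def[abs_def] by (intro smoothR_mult smoothR_step_affine smoothR_Gr) auto
  ultimately have "smoothR ({..<ri\<^sup>2 / 3} \<union> {0<..}) Gin" by (intro smoothR_Un) auto
  then show ?thesis by (rule smoothR_subset) (rule greaterThan_cover, rule divide_pos_pos[OF sq_pos(1)], simp)
qed

lemma smoothR_Gout: "smoothR {-1<..} Gout"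
proof -
  have st: "smoothR S st" for S unfolding st_def[abs_def] by (rule smoothR_step_affine)
  have "smoothR {..<ri\<^sup>2} (\<lambda>s. st s * Gr 2 s)"
  proof (rule smoothR_cong[OF _ _ smoothR_const[of _ 0]])
    fix s assume "s \<in> {..<ri\<^sup>2}"
    then have "s \<le> ri\<^sup>2" by simp
    then have "st s = 0" by (intro st_0 thirds(3)[OF sq_pos(2)])
    then show "0 = st s * Gr 2 s" by simp
  qed auto
  moreover have "smoothR {0<..} (\<lambda>s. st s * Gr 2 s)" by (intro smoothR_mult st smoothR_Gr) auto
  ultimately have "smoothR ({..<ri\<^sup>2} \<union> {0<..}) (\<lambda>s. st s * Gr 2 s)" by (intro smoothR_Un) auto
  then have a: "smoothR {-1<..} (\<lambda>s. st s * Gr 2 s)" by (rule smoothR_subset[OF _ greaterThan_cover[OF sq_pos(1)]])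
  have "smoothR {-1<..} (\<lambda>s. (1 - st s) * Gr 0 s)"
    by (intro smoothR_mult smoothR_diff smoothR_const st smoothR_Gr0) auto
  from smoothR_add[OF open_greaterThan this a] show ?thesis unfolding Gout_def[abs_def] .
qed

text \<open>The conditions on \<open>hphi\<close> and \<open>hpsi\<close> pass to their combination
  with coefficients \<open>P\<close> and \<open>Q\<close>, which are common to both sides of the
  circle.\<close>

lemma transmission_aux:
  assumes s: "s > 0" and e1: "hphi M j s = hphi M 1 s" "hpsi M j s = hpsi M 1 s"
    and e2: "be M j + be M 1 = - real M * s ^ M * hphi M 1 s" "de M j + de M 1 = - real M * s ^ M * hpsi M 1 s"
  shows "Gr j s = Gr 1 s" "s * (Dr j s + Dr 1 s) = - real M * Gr 1 s"
proof -
  show "Gr j s = Gr 1 s" unfolding Gr_def e1 ..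
  have "s * (Dr j s + Dr 1 s) = s * e_fun M s * ((be M j + be M 1) * P s + (de M j + de M 1) * Q s)"
    by (simp add: Dr_def algebra_simps)
  also have "\<dots> = - real M * (s * e_fun M s * s ^ M) * (hphi M 1 s * P s + hpsi M 1 s * Q s)"
    unfolding e2 by (simp add: algebra_simps)
  finally show "s * (Dr j s + Dr 1 s) = - real M * Gr 1 s" unfolding e_fun_mult[OF s] Gr_def by simp
qed

lemma solution:
  assumes M: "M = nat \<bar>m\<bar>"
  shows "piecewise_smooth ri re R (radial_mode Gin m) (radial_mode Gout m)"
    and "\<And>x. x \<in> Om \<union> Op \<Longrightarrow> x \<noteq> 0 \<Longrightarrow> glue ri re (radial_mode Gin m) (radial_mode Gout m) x = radial_mode (Sol M \<sigma>) m x"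
    and "\<And>x. x \<in> Om \<union> Op \<Longrightarrow> x \<noteq> 0 \<Longrightarrow> glue ri re (\<lambda>x. - lap (radial_mode Gin m) x) (lap (radial_mode Gout m)) x = radial_mode \<sigma> m x"
proof -
  let ?T1 = "{2 / 3 * ri\<^sup>2<..}" and ?T0 = "{..<ri\<^sup>2 + (re\<^sup>2 - ri\<^sup>2) / 3}" and ?T2 = "{ri\<^sup>2 + 2 / 3 * (re\<^sup>2 - ri\<^sup>2)<..}"
  have za: "\<sigma> (ri\<^sup>2) = 0" "\<sigma> (re\<^sup>2) = 0" using d by (auto intro!: \<sigma>0)
  have in1: "ri\<^sup>2 \<in> ?T1" "re\<^sup>2 \<in> ?T1" "ri\<^sup>2 \<in> ?T0" "re\<^sup>2 \<in> ?T2" "R\<^sup>2 \<in> ?T2"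
    by (simp_all only: greaterThan_iff lessThan_iff thirds(3)[OF sq_pos(2) order_refl] thirds(4)[OF sq_pos(2) order_refl]
      thirds(4)[OF sq_pos(2) less_imp_le[OF sq_pos(3)]] thirds(5)[OF sq_pos(1) order_refl] thirds(5)[OF sq_pos(1) less_imp_le[OF sq_pos(2)]])
  have dGin: "deriv Gin s = Dr 1 s" if "s \<in> ?T1" "s > 0" "\<sigma> s = 0" for s
    using deriv_cong_open[of ?T1 s Gin "Gr 1"] that Gin_eq DERIV_imp_deriv[OF Gr_DERIV[of s 1]] by simp
  have dH0: "deriv Gout s = Dr 0 s" if "s \<in> ?T0" "s > 0" "\<sigma> s = 0" for s
    using deriv_cong_open[of ?T0 s Gout "Gr 0"] that Gout_eq0 DERIV_imp_deriv[OF Gr_DERIV[of s 0]] by simp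
  have dGout: "deriv Gout s = Dr 2 s" if "s \<in> ?T2" "s > 0" "\<sigma> s = 0" for s
    using deriv_cong_open[of ?T2 s Gout "Gr 2"] that Gout_eq2 DERIV_imp_deriv[OF Gr_DERIV[of s 2]] by simp
  \<comment> \<open>Near the circles both pieces are unmodified continuations \<open>Gr\<close>, and
    the source vanishes, so values and derivatives there come from
    \<open>transmission_aux\<close>.\<close>
  have tr: "Gin s = Gout s \<and> s * deriv Gin s + s * deriv Gout s = - real M * Gin s" if "s = ri\<^sup>2 \<or> s = re\<^sup>2" for s
    using that
  proof
    assume s: "s = ri\<^sup>2"
    have e: "Gin (ri\<^sup>2) = Gr 1 (ri\<^sup>2)" "Gout (ri\<^sup>2) = Gr 0 (ri\<^sup>2)"
      by (rule Gin_eq[OF in1(1)[unfolded greaterThan_iff]], rule Gout_eq0[OF in1(3)[unfolded lessThan_iff]])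
    have f: "deriv Gin (ri\<^sup>2) = Dr 1 (ri\<^sup>2)" "deriv Gout (ri\<^sup>2) = Dr 0 (ri\<^sup>2)"
      by (rule dGin[OF in1(1) sq_pos(1) za(1)], rule dH0[OF in1(3) sq_pos(1) za(1)])
    show ?thesis unfolding s e f using transmission_aux[OF sq_pos(1) transmission_ri] by (simp add: algebra_simps)
  next
    assume s: "s = re\<^sup>2"
    have e: "Gin (re\<^sup>2) = Gr 1 (re\<^sup>2)" "Gout (re\<^sup>2) = Gr 2 (re\<^sup>2)"
      by (rule Gin_eq[OF in1(2)[unfolded greaterThan_iff]], rule Gout_eq2[OF in1(4)[unfolded greaterThan_iff]])
    have f: "deriv Gin (re\<^sup>2) = Dr 1 (re\<^sup>2)" "deriv Gout (re\<^sup>2) = Dr 2 (re\<^sup>2)"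
      by (rule dGin[OF in1(2) sq_pos(4) za(2)], rule dGout[OF in1(4) sq_pos(4) za(2)])
    show ?thesis unfolding s e f using transmission_aux[OF sq_pos(4) transmission_re] by (simp add: algebra_simps)
  qed
  show "piecewise_smooth ri re R (radial_mode Gin m) (radial_mode Gout m)"
    unfolding piecewise_smooth_def
  proof (intro conjI allI impI)
    show "smooth (radial_mode Gin m)" "smooth (radial_mode Gout m)"
      by (rule smooth_radial_mode[OF smoothR_Gin], rule smooth_radial_mode[OF smoothR_Gout])
    fix x :: "real^2"
    { assume x: "norm x = ri \<or> norm x = re"
      let ?s = "(norm x)\<^sup>2"
      have t: "Gin ?s = Gout ?s" "?s * deriv Gin ?s + ?s * deriv Gout ?s = - real M * Gin ?s" using tr[of ?s] x by auto
      have n: "norm x > 0" using x ri re by auto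
      show "radial_mode Gin m x = radial_mode Gout m x" by (simp add: radial_mode_def t)
      \<comment> \<open>The relation between the derivatives, doubled, says that the two fluxes are
        opposite.\<close>
      have "2 * ?s * deriv Gin ?s + real M * Gin ?s = - (2 * ?s * deriv Gout ?s + real M * Gout ?s)"
        using t by (simp add: algebra_simps)
      then show "radial_deriv (radial_mode Gin m) x = - radial_deriv (radial_mode Gout m) x"
        unfolding radial_deriv_radial_mode[OF smoothR_Gin n] radial_deriv_radial_mode[OF smoothR_Gout n] M[symmetric]
        by (simp only: minus_divide_left[symmetric] of_real_minus mult_minus_left) }
    assume "norm x = R"
    moreover have "Gout (R\<^sup>2) = 0" using Gout_eq2[of "R\<^sup>2"] in1 by (simp add: Gr_def hpsi_R P_def)
    ultimately show "radial_mode Gout m x = 0" by (simp add: radial_mode_def)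
  qed
  fix x assume x: "x \<in> Om \<union> Op" "x \<noteq> 0"
  let ?s = "(norm x)\<^sup>2"
  have s0: "?s > 0" and sR: "?s < R\<^sup>2" using x Om_subset Op_subset R ri re by (auto intro!: power_strict_mono)
  have SolGr: "Sol M \<sigma> ?s = Gr (region ?s) ?s"
    using P_eq[of ?s] Q_eq[of ?s] s0 sR by (simp add: Sol_def Gr_def phi_def psi_def kP_def[abs_def] kQ_def[abs_def] add_divide_distrib)
  show "glue ri re (radial_mode Gin m) (radial_mode Gout m) x = radial_mode (Sol M \<sigma>) m x"
   and "glue ri re (\<lambda>x. - lap (radial_mode Gin m) x) (lap (radial_mode Gout m)) x = radial_mode \<sigma> m x"
  proof -
    consider "x \<in> Om" | "norm x < ri" | "re < norm x" using x(1) by (auto simp: Op_eq)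
    then have "glue ri re (radial_mode Gin m) (radial_mode Gout m) x = radial_mode (Sol M \<sigma>) m x \<and>
      glue ri re (\<lambda>x. - lap (radial_mode Gin m) x) (lap (radial_mode Gout m)) x = radial_mode \<sigma> m x"
    proof cases
      case 1
      then have s: "?s \<in> region_set 1" using ri by (auto simp: region_set_def Omega_minus_def intro!: power_strict_mono)
      have "ri\<^sup>2 < ?s" using s by (simp add: region_set_def)
      then have T: "?s \<in> ?T1" unfolding greaterThan_iff by (intro thirds(5)[OF sq_pos(1)] less_imp_le)
      have "4 * (?s * deriv (deriv Gin) ?s + (real M + 1) * deriv Gin ?s) = eps 1 * \<sigma> ?s"
        by (rule Gr_second_order[OF s _ open_greaterThan T]) (simp, simp only: greaterThan_iff Gin_eq)
      then have "lap (radial_mode Gin m) x = - radial_mode \<sigma> m x"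
        unfolding lap_radial_mode[OF smoothR_Gin] M[symmetric] radial_mode_def by (simp add: eps_def add.commute)
      moreover have "Gin ?s = Sol M \<sigma> ?s" using Gin_eq[of ?s] T SolGr region_set_region(1)[OF s] by simp
      ultimately show ?thesis using 1 by (simp add: glue_in radial_mode_def)
    next
      case 2
      then have o: "x \<notin> Om" by (simp add: Omega_minus_def)
      have s: "?s \<in> region_set 0" using 2 s0 by (auto simp: region_set_def intro!: power_strict_mono)
      have "?s < ri\<^sup>2" using s by (simp add: region_set_def)
      then have T: "?s \<in> ?T0" unfolding lessThan_iff by (intro thirds(3)[OF sq_pos(2)] less_imp_le)
      have "4 * (?s * deriv (deriv Gout) ?s + (real M + 1) * deriv Gout ?s) = eps 0 * \<sigma> ?s"
        by (rule Gr_second_order[OF s _ open_lessThan T]) (simp, simp only: lessThan_iff Gout_eq0)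
      then have "lap (radial_mode Gout m) x = radial_mode \<sigma> m x"
        unfolding lap_radial_mode[OF smoothR_Gout] M[symmetric] radial_mode_def by (simp add: eps_def add.commute)
      moreover have "Gout ?s = Sol M \<sigma> ?s" using Gout_eq0[of ?s] T SolGr region_set_region(1)[OF s] by simp
      ultimately show ?thesis using o by (simp add: glue_out radial_mode_def)
    next
      case 3
      then have o: "x \<notin> Om" by (simp add: Omega_minus_def)
      have s: "?s \<in> region_set 2" using 3 ri re by (auto simp: region_set_def intro!: power_strict_mono)
      have "re\<^sup>2 < ?s" using s by (simp add: region_set_def)
      then have T: "?s \<in> ?T2" unfolding greaterThan_iff by (intro thirds(4)[OF sq_pos(2)] less_imp_le)
      have "4 * (?s * deriv (deriv Gout) ?s + (real M + 1) * deriv Gout ?s) = eps 2 * \<sigma> ?s"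
        by (rule Gr_second_order[OF s _ open_greaterThan T]) (simp, simp only: greaterThan_iff Gout_eq2)
      then have "lap (radial_mode Gout m) x = radial_mode \<sigma> m x"
        unfolding lap_radial_mode[OF smoothR_Gout] M[symmetric] radial_mode_def by (simp add: eps_def add.commute)
      moreover have "Gout ?s = Sol M \<sigma> ?s" using Gout_eq2[of ?s] T SolGr region_set_region(1)[OF s] by simp
      ultimately show ?thesis using o by (simp add: glue_out radial_mode_def)
    qed
    then show "glue ri re (radial_mode Gin m) (radial_mode Gout m) x = radial_mode (Sol M \<sigma>) m x"
      and "glue ri re (\<lambda>x. - lap (radial_mode Gin m) x) (lap (radial_mode Gout m)) x = radial_mode \<sigma> m x" by auto
  qed
qed

end

lemma (in annuli) mode_solution:
  assumes "admissible \<sigma>"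
  obtains v1 v2 where "piecewise_smooth ri re R v1 v2"
    and "\<And>x. x \<in> Om \<union> Op \<Longrightarrow> x \<noteq> 0 \<Longrightarrow> glue ri re v1 v2 x = radial_mode (Sol (nat \<bar>m\<bar>) \<sigma>) m x"
    and "\<And>x. x \<in> Om \<union> Op \<Longrightarrow> x \<noteq> 0 \<Longrightarrow> glue ri re (\<lambda>x. - lap v1 x) (lap v2) x = radial_mode \<sigma> m x"
proof -
  obtain d where "d > 0" and z: "\<forall>s. s < d \<or> \<bar>s - ri\<^sup>2\<bar> < d \<or> \<bar>s - re\<^sup>2\<bar> < d \<or> s > R\<^sup>2 - d \<longrightarrow> \<sigma> s = 0"
    using assms unfolding admissible_def by blast
  then interpret annuli_source ri re R "nat \<bar>m\<bar>" \<sigma> d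
    using assms by unfold_locales (auto simp: admissible_def)
  show ?thesis by (rule that[OF solution[OF refl]])
qed

section \<open>Totality of the modes and injectivity\<close>


lemma borel_representative:
  fixes f :: "'a::euclidean_space \<Rightarrow> complex"
  assumes "S \<in> sets lebesgue" "f \<in> borel_measurable (lebesgue_on S)"
  obtains g where "g \<in> borel_measurable borel" "AE x in lebesgue_on S. f x = g x"
proof -
  have *: "\<exists>g'\<in>borel_measurable lborel. AE x in lborel. indicator S x * r x = g' x"
    if "r \<in> borel_measurable (lebesgue_on S)" for r :: "'a \<Rightarrow> real"
    by (rule completion_ex_borel_measurable_real)
      (use that assms(1) in \<open>simp add: borel_measurable_restrict_space_iff mult.commute\<close>)
  have "(\<lambda>x. Re (f x)) \<in> borel_measurable (lebesgue_on S)" "(\<lambda>x. Im (f x)) \<in> borel_measurable (lebesgue_on S)"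
    using assms(2) by auto
  then obtain p q where p: "p \<in> borel_measurable lborel" "AE x in lborel. indicator S x * Re (f x) = p x"
    and q: "q \<in> borel_measurable lborel" "AE x in lborel. indicator S x * Im (f x) = q x"
    using *[of "\<lambda>x. Re (f x)"] *[of "\<lambda>x. Im (f x)"] by blast
  have [measurable]: "p \<in> borel_measurable borel" "q \<in> borel_measurable borel" using p(1) q(1) by auto
  show thesis
  proof
    show "(\<lambda>x. of_real (p x) + \<i> * of_real (q x)) \<in> borel_measurable borel" by measurable
    have "AE x in lborel. x \<in> S \<longrightarrow> f x = of_real (p x) + \<i> * of_real (q x)"
      using p(2) q(2) by eventually_elim (auto simp: complex_eq_iff)
    then have "AE x in lebesgue. x \<in> S \<longrightarrow> f x = of_real (p x) + \<i> * of_real (q x)" by (rule AE_completion)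
    then show "AE x in lebesgue_on S. f x = of_real (p x) + \<i> * of_real (q x)"
      using assms(1) by (subst AE_restrict_space_iff) auto
  qed
qed

text \<open>A null set of angles becomes a null cylinder in the plane of parameters. This allows
  \<open>h\<close> to be replaced by a Borel representative.\<close>

lemma AE_lborel_snd:
  assumes "AE y in lborel. P (y::real)"
  shows "AE p in lborel. P (snd (p :: real \<times> real))"
proof -
  from AE_E[OF assms] obtain N where "{y \<in> space lborel. \<not> P y} \<subseteq> N" "emeasure lborel N = 0" "N \<in> sets lborel" .
  then have N: "N \<in> null_sets lborel" "{y. \<not> P y} \<subseteq> N" by (auto simp: null_sets_def)
  have "AE y in lborel. y \<notin> N" by (rule AE_not_in[OF N(1)])
  then have "AE x in lborel. AE y in lborel. snd (x::real, y) \<notin> N" by simp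
  then have "AE p in lborel \<Otimes>\<^sub>M lborel. snd (p :: real \<times> real) \<notin> N"
  proof (rule lborel_pair.AE_pair_measure[rotated])
    have "{p \<in> space (lborel \<Otimes>\<^sub>M lborel). snd (p :: real \<times> real) \<notin> N} = snd -` (- N) \<inter> space (lborel \<Otimes>\<^sub>M lborel)" by auto
    also have "\<dots> \<in> sets (lborel \<Otimes>\<^sub>M lborel)"
      by (rule measurable_sets[OF measurable_snd]) (use N(1) in auto)
    finally show "{p \<in> space (lborel \<Otimes>\<^sub>M lborel). snd (p :: real \<times> real) \<notin> N} \<in> sets (lborel \<Otimes>\<^sub>M lborel)" .
  qed
  then have "AE p in lborel. snd (p :: real \<times> real) \<notin> N" by (simp only: lborel_prod)
  then show ?thesis by eventually_elim (use N(2) in blast)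
qed

text \<open>A Borel representative enters because Fubini's theorem and the image measure are stated
  for \<open>lborel\<close>; the factorisation of \<open>w\<close> is therefore assumed only at
  almost every point of the parameter rectangle.\<close>

lemma polar_product_integral:
  fixes w :: "real^2 \<Rightarrow> complex" and A B :: "real \<Rightarrow> complex"
  assumes R: "R > 0" and w: "integrable (lebesgue_on (ball 0 R)) w"
    and A: "A \<in> borel_measurable borel" and B: "B \<in> borel_measurable borel"
    and ae: "AE y in lborel. y \<in> polar_rect R \<longrightarrow> w (polar_map y) = A (fst y) * B (snd y)"
  shows "lebint (ball 0 R) w = (1/2) * lborint (\<lambda>s. indicator {0<..<R\<^sup>2} s *\<^sub>R A s)
    * lborint (\<lambda>\<theta>. indicator {0<..<2*pi} \<theta> *\<^sub>R B \<theta>)"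
proof -
  obtain v where v[measurable]: "v \<in> borel_measurable borel" and wv: "AE x in lebesgue_on (ball 0 R). w x = v x"
    by (rule borel_representative[of "ball 0 R" w]) (use w in auto)
  have vm: "v \<in> borel_measurable (lebesgue_on (ball 0 R))"
    by (rule lebesgue_on_measurable_AE_cong[OF _ borel_measurable_integrable[OF w] wv]) simp
  have vi: "integrable (lebesgue_on (ball 0 R)) v" by (rule integrable_cong_AE_imp[OF w vm]) (use wv in auto)
  let ?f = "\<lambda>y. indicator (polar_rect R) y *\<^sub>R v (polar_map y)"
  let ?g = "\<lambda>y. (indicator {0<..<R\<^sup>2} (fst y) *\<^sub>R A (fst y)) * (indicator {0<..<2*pi} (snd y) *\<^sub>R B (snd y))"
  note P = polar_integral[OF R v vi]
  have fm: "fst \<in> borel_measurable (borel :: (real \<times> real) measure)" and sm: "snd \<in> borel_measurable (borel :: (real \<times> real) measure)"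
    by (auto intro!: borel_measurable_continuous_onI continuous_intros)
  have i1: "(\<lambda>y. indicat_real {0<..<R\<^sup>2} (fst y)) \<in> borel_measurable (borel :: (real \<times> real) measure)"
    by (rule measurable_compose[OF fm borel_measurable_indicator]) simp
  have i2: "(\<lambda>y. indicat_real {0<..<2*pi} (snd y)) \<in> borel_measurable (borel :: (real \<times> real) measure)"
    by (rule measurable_compose[OF sm borel_measurable_indicator]) simp
  have gm: "?g \<in> borel_measurable borel"
    by (rule borel_measurable_times[OF borel_measurable_scaleR[OF i1 measurable_compose[OF fm A]]
          borel_measurable_scaleR[OF i2 measurable_compose[OF sm B]]])
  have fg: "AE y in lborel. ?f y = ?g y"
    using ae AE_polar[OF R wv] by eventually_elim (auto simp: polar_rect_def indicator_def)
  have gi: "integrable lborel ?g"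
    by (rule integrable_cong_AE_imp[OF P(1)]) (use gm fg in auto)
  have "lebint (ball 0 R) w = lebint (ball 0 R) v"
    by (rule integral_cong_AE[OF borel_measurable_integrable[OF w] vm wv])
  also have "\<dots> = (1/2) * lborint ?f" by (rule P(2))
  also have "lborint ?f = lborint ?g"
    by (rule integral_cong_AE) (use borel_measurable_integrable[OF P(1)] gm fg in auto)
  also have "\<dots> = lborint (\<lambda>s. lborint (\<lambda>\<theta>. ?g (s, \<theta>)))"
    using lborel_pair.integral_fst'[of ?g] gi by (simp only: lborel_prod)
  also have "\<dots> = lborint (\<lambda>s. (indicator {0<..<R\<^sup>2} s *\<^sub>R A s) * lborint (\<lambda>\<theta>. indicator {0<..<2*pi} \<theta> *\<^sub>R B \<theta>))"
    by (simp only: fst_conv snd_conv integral_mult_right_zero)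
  also have "\<dots> = lborint (\<lambda>s. indicator {0<..<R\<^sup>2} s *\<^sub>R A s) * lborint (\<lambda>\<theta>. indicator {0<..<2*pi} \<theta> *\<^sub>R B \<theta>)"
    by (rule integral_mult_left_zero)
  finally show ?thesis by (simp only: mult.assoc)
qed

lemma integral_exp_int:
  "lborint (\<lambda>\<theta>. indicator {0<..<2*pi} \<theta> *\<^sub>R exp (\<i> * of_int k * of_real \<theta>)) = (if k = 0 then of_real (2 * pi) else 0)"
proof -
  have "lborint (\<lambda>\<theta>. indicator {0<..<2*pi} \<theta> *\<^sub>R exp (\<i> * of_int k * of_real \<theta>)) = integral {0..2*pi} (\<lambda>\<theta>. exp (\<i> * of_int k * of_real \<theta>))"
    by (rule lborel_open_interval_integral) (intro continuous_intros)
  also have "\<dots> = (if k = 0 then of_real (2 * pi) else 0)"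
  proof (cases "k = 0")
    case True then show ?thesis by (simp add: scaleR_conv_of_real)
  next
    case False
    let ?c = "\<i> * of_int k"
    have "((\<lambda>\<theta>. exp (?c * of_real \<theta>)) has_integral (exp (?c * of_real (2*pi)) / ?c - exp (?c * of_real 0) / ?c)) {0..2*pi}"
    proof (rule fundamental_theorem_of_calculus)
      fix x :: real
      have "((\<lambda>z. exp (?c * z) / ?c) has_field_derivative exp (?c * of_real x)) (at (of_real x))"
        using False by (auto intro!: derivative_eq_intros)
      from has_vector_derivative_real_field[OF this]
      show "((\<lambda>\<theta>. exp (?c * of_real \<theta>) / ?c) has_vector_derivative exp (?c * of_real x)) (at x within {0..2*pi})"
        by (rule has_vector_derivative_at_within)
    qed simp
    moreover have "exp (?c * of_real (2*pi)) = 1"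
      using exp_integer_2pi[of "of_int k"] by (simp add: mult_ac)
    ultimately show ?thesis using False by (simp add: integral_unique)
  qed
  finally show ?thesis .
qed

lemma radial_mode_polar_map:
  assumes "s > 0"
  shows "radial_mode F m (polar_map (s, \<theta>)) = of_real (F s * sqrt s ^ nat \<bar>m\<bar>) * exp (\<i> * of_int m * of_real \<theta>)"
  using assms by (simp add: radial_mode_def polar_map_def norm_polar_sq zmode_polar)

lemma radial_mode_measurable:
  assumes [measurable]: "F \<in> borel_measurable borel"
  shows "radial_mode F m \<in> borel_measurable borel" "radial_mode F m \<in> borel_measurable (lebesgue_on S)"
proof -
  have [measurable]: "zmode m \<in> borel_measurable borel"
    by (rule borel_measurable_continuous_onI[OF smooth_continuous[OF smooth_zmode]])
  show b: "radial_mode F m \<in> borel_measurable borel" unfolding radial_mode_def[abs_def] by measurable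
  show "radial_mode F m \<in> borel_measurable (lebesgue_on S)"
    by (rule measurable_restrict_space1[OF measurable_completion]) (use b in simp)
qed

lemma radial_mode_bound:
  assumes "\<And>s. \<lbrakk>0 \<le> s; s < R\<^sup>2\<rbrakk> \<Longrightarrow> \<bar>F s\<bar> \<le> B" "x \<in> ball 0 R"
  shows "cmod (radial_mode F m x) \<le> B * R ^ nat \<bar>m\<bar>"
proof -
  have x: "norm x < R" using assms(2) by simp
  have s: "(norm x)\<^sup>2 < R\<^sup>2" using x by (intro power_strict_mono) auto
  have "B \<ge> 0" using assms(1)[OF _ s] by fastforce
  then show ?thesis unfolding radial_mode_def norm_mult norm_zmode
    using assms(1)[OF _ s] x by (intro mult_mono power_mono) auto
qed

lemma radial_mode_L2:
  assumes F: "F \<in> borel_measurable borel" and b: "\<And>s. \<lbrakk>0 \<le> s; s < R\<^sup>2\<rbrakk> \<Longrightarrow> \<bar>F s\<bar> \<le> B"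
  shows "radial_mode F m \<in> L2 (ball 0 R)"
  by (rule L2_bounded[OF _ radial_mode_measurable(2)[OF F] radial_mode_bound[OF b]]) auto

text \<open>Different angular momenta are orthogonal already on every circle. For equal ones, each
  mode contributes a factor \<open>sqrt s ^ |m|\<close>.\<close>

lemma radial_mode_inner:
  assumes R: "R > 0" and F: "F \<in> borel_measurable borel" "radial_mode F m \<in> L2 (ball 0 R)"
    and G: "G \<in> borel_measurable borel" "radial_mode G n \<in> L2 (ball 0 R)"
  shows "L2_inner (ball 0 R) (radial_mode F m) (radial_mode G n)
    = (if m = n then of_real (pi * lborint (\<lambda>s. indicator {0<..<R\<^sup>2} s * (F s * G s * s ^ nat \<bar>m\<bar>))) else 0)"
proof -
  note [measurable] = F(1) G(1)
  let ?A = "\<lambda>s. complex_of_real (F s * sqrt s ^ nat \<bar>m\<bar> * (G s * sqrt s ^ nat \<bar>n\<bar>))"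
  let ?B = "\<lambda>\<theta>. exp (\<i> * of_int (m - n) * complex_of_real \<theta>)"
  have Bm: "?B \<in> borel_measurable borel" by (intro borel_measurable_continuous_onI continuous_intros)
  have "AE y in lborel. y \<in> polar_rect R \<longrightarrow> radial_mode F m (polar_map y) * cnj (radial_mode G n (polar_map y)) = ?A (fst y) * ?B (snd y)"
  proof (rule AE_I2, rule impI)
    fix y assume "y \<in> polar_rect R"
    then obtain s \<theta> where y: "y = (s, \<theta>)" "s > 0" by (auto simp: polar_rect_def)
    have e: "exp (\<i> * of_int m * complex_of_real \<theta>) * exp (- \<i> * of_int n * complex_of_real \<theta>) = ?B \<theta>"
      by (simp add: exp_add[symmetric] algebra_simps)
    have c: "cnj (exp (\<i> * of_int n * complex_of_real \<theta>)) = exp (- \<i> * of_int n * complex_of_real \<theta>)"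
      by (simp add: exp_cnj)
    show "radial_mode F m (polar_map y) * cnj (radial_mode G n (polar_map y)) = ?A (fst y) * ?B (snd y)"
      unfolding y(1) radial_mode_polar_map[OF y(2)] fst_conv snd_conv complex_cnj_mult complex_cnj_complex_of_real c e[symmetric]
      by (simp only: of_real_mult mult_ac)
  qed
  from polar_product_integral[OF R L2_inner_integrable[OF F(2) G(2)] _ Bm this]
  have i: "L2_inner (ball 0 R) (radial_mode F m) (radial_mode G n) = (1/2) * lborint (\<lambda>s. indicator {0<..<R\<^sup>2} s *\<^sub>R ?A s)
     * (if m - n = 0 then of_real (2 * pi) else 0)"
    unfolding L2_inner_def integral_exp_int by simp
  show ?thesis
  proof (cases "m = n")
    case True
    have e: "(\<lambda>s. indicator {0<..<R\<^sup>2} s *\<^sub>R ?A s) = (\<lambda>s. complex_of_real (indicator {0<..<R\<^sup>2} s * (F s * G s * s ^ nat \<bar>m\<bar>)))"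
    proof (rule ext)
      fix s :: real
      show "indicator {0<..<R\<^sup>2} s *\<^sub>R ?A s = complex_of_real (indicator {0<..<R\<^sup>2} s * (F s * G s * s ^ nat \<bar>m\<bar>))"
      proof (cases "s > 0")
        case s: True
        have "sqrt s ^ nat \<bar>m\<bar> * sqrt s ^ nat \<bar>m\<bar> = s ^ nat \<bar>m\<bar>"
          using s by (simp add: power_mult_distrib[symmetric])
        then have "F s * sqrt s ^ nat \<bar>m\<bar> * (G s * sqrt s ^ nat \<bar>n\<bar>) = F s * G s * s ^ nat \<bar>m\<bar>"
          using True by (simp add: mult_ac)
        then show ?thesis by (simp only: scaleR_conv_of_real of_real_mult)
      qed (simp add: indicator_def)
    qed
    show ?thesis unfolding i e integral_complex_of_real using True by simp
  qed (simp add: i)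
qed

lemma radial_mode_norm:
  assumes R: "R > 0" and F: "F \<in> borel_measurable borel" "radial_mode F m \<in> L2 (ball 0 R)"
  shows "(L2_norm (ball 0 R) (radial_mode F m))\<^sup>2 = pi * lborint (\<lambda>s. indicator {0<..<R\<^sup>2} s * ((F s)\<^sup>2 * s ^ nat \<bar>m\<bar>))"
proof -
  have "complex_of_real ((L2_norm (ball 0 R) (radial_mode F m))\<^sup>2) = L2_inner (ball 0 R) (radial_mode F m) (radial_mode F m)"
    unfolding L2_inner_def L2_norm_sq
    by (simp only: complex_norm_square[symmetric] of_real_power[symmetric] integral_complex_of_real)
  also have "\<dots> = of_real (pi * lborint (\<lambda>s. indicator {0<..<R\<^sup>2} s * ((F s)\<^sup>2 * s ^ nat \<bar>m\<bar>)))"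
    unfolding radial_mode_inner[OF R F F] by (simp add: power2_eq_square)
  finally show ?thesis by (simp only: of_real_eq_iff)
qed

text \<open>Multiplication by \<open>z\<close> raises the angular momentum by one; against a power
  of the conjugate it leaves a factor \<open>|x|^2\<close>, which a radial profile can
  absorb.\<close>

lemma zmode_times_z: "zmode m x * zmode 1 x = (if m \<ge> 0 then 1 else of_real ((norm x)\<^sup>2)) * zmode (m + 1) x"
proof (cases "m \<ge> 0")
  case True
  then have "nat \<bar>m + 1\<bar> = Suc (nat \<bar>m\<bar>)" by simp
  then show ?thesis using True by (simp add: zmode_def)
next
  case False
  then have n: "nat \<bar>m\<bar> = Suc (nat \<bar>m + 1\<bar>)" by simp
  have z: "(complex_of_real (x $ 1) - \<i> * of_real (x $ 2)) * (of_real (x $ 1) + \<i> * of_real (x $ 2)) = of_real ((norm x)\<^sup>2)"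
    unfolding norm_sq_coords by (simp add: algebra_simps power2_eq_square complex_eq_iff)
  show ?thesis
  proof (cases "m = -1")
    case True then show ?thesis using z by (simp add: zmode_def)
  next
    case F: False
    then have neg: "\<not> m + 1 \<ge> 0" using False by linarith
    have "zmode m x * zmode 1 x = (complex_of_real (x $ 1) - \<i> * of_real (x $ 2)) ^ nat \<bar>m + 1\<bar> * ((complex_of_real (x $ 1) - \<i> * of_real (x $ 2)) * (of_real (x $ 1) + \<i> * of_real (x $ 2)))"
      using False unfolding zmode_def n by simp
    then show ?thesis unfolding z using False neg by (simp add: zmode_def)
  qed
qed

lemma zmode_cnj: "zmode (- m) x = cnj (zmode m x)"
  by (auto simp: zmode_def)

lemma zmode_times_cnj_z: "zmode m x * zmode (-1) x = (if m \<le> 0 then 1 else of_real ((norm x)\<^sup>2)) * zmode (m - 1) x"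
proof -
  have "zmode m x * zmode (-1) x = cnj (zmode (- m) x * zmode 1 x)"
    using zmode_cnj[of 1 x] zmode_cnj[of "- m" x] by simp
  also have "\<dots> = (if m \<le> 0 then 1 else of_real ((norm x)\<^sup>2)) * cnj (zmode (- m + 1) x)"
    unfolding zmode_times_z by simp
  also have "cnj (zmode (- m + 1) x) = zmode (m - 1) x" using zmode_cnj[of "- m + 1" x] by simp
  finally show ?thesis .
qed

context annuli
begin

text \<open>\<open>f\<close> may be singular at \<open>0\<close>, since \<open>\<sigma>\<close>
  vanishes near \<open>0\<close>.\<close>

lemma admissible_mult:
  assumes \<sigma>: "admissible \<sigma>" and f: "smoothR {0<..} f"
  shows "admissible (\<lambda>s. \<sigma> s * f s)"
proof -
  obtain d where d: "d > 0" "\<forall>s. s < d \<or> \<bar>s - ri\<^sup>2\<bar> < d \<or> \<bar>s - re\<^sup>2\<bar> < d \<or> s > R\<^sup>2 - d \<longrightarrow> \<sigma> s = 0"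
    and s: "smoothR UNIV \<sigma>" using \<sigma> unfolding admissible_def by blast
  have "smoothR ({..<d} \<union> {0<..}) (\<lambda>s. \<sigma> s * f s)"
  proof (rule smoothR_Un)
    show "smoothR {..<d} (\<lambda>s. \<sigma> s * f s)"
      by (rule smoothR_cong[OF open_lessThan _ smoothR_const[OF open_lessThan, of _ 0]]) (use d(2) in simp)
    show "smoothR {0<..} (\<lambda>s. \<sigma> s * f s)" by (intro smoothR_mult f smoothR_subset[OF s]) auto
  qed auto
  moreover have "{..<d} \<union> {0<..} = UNIV" using d(1) by (auto simp: not_less)
  ultimately show ?thesis unfolding admissible_def using d by (auto intro!: exI[of _ d])
qed

text \<open>The margin \<open>1 / (n + 1)\<close> of the cutoff serves as the distance in
  \<open>admissible\<close>, provided that the interval lies within one region.\<close>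

lemma admissible_cutoff:
  assumes "0 \<le> c" "e \<le> ri\<^sup>2 \<or> (ri\<^sup>2 \<le> c \<and> e \<le> re\<^sup>2) \<or> (re\<^sup>2 \<le> c \<and> e \<le> R\<^sup>2)"
  shows "admissible (cutoff c e n)"
proof -
  have p: "1 / real (Suc n) > 0" by simp
  show ?thesis unfolding admissible_def
  proof (intro conjI exI[of _ "1 / real (Suc n)"] allI impI p smoothR_cutoff)
    fix s assume s: "s < 1 / real (Suc n) \<or> \<bar>s - ri\<^sup>2\<bar> < 1 / real (Suc n) \<or> \<bar>s - re\<^sup>2\<bar> < 1 / real (Suc n) \<or> s > R\<^sup>2 - 1 / real (Suc n)"
    show "cutoff c e n s = 0"
      by (rule cutoff_eq_0) (use s assms sq_pos in \<open>linarith\<close>)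
  qed
qed

lemma radial_mode_admissible_L2:
  assumes "admissible \<sigma>" shows "radial_mode \<sigma> m \<in> L2 (ball 0 R)"
proof -
  have "smoothR UNIV \<sigma>" using assms by (simp add: admissible_def)
  then have "smooth (radial_mode \<sigma> m)" by (intro smooth_radial_mode) (rule smoothR_subset, auto)
  then show ?thesis by (rule smooth_L2[OF open_ball bounded_ball])
qed

text \<open>Multiplication by \<open>x\<^sub>1 \<plusminus> \<i> x\<^sub>2\<close> maps radial modes to radial modes, so orthogonality to all of them
  extends to their products with polynomials and, by Stone-Weierstrass, with continuous functions.\<close>

lemma radial_modes_total:
  assumes w: "w \<in> L2 (ball 0 R)"
    and z: "\<And>\<sigma> m. admissible \<sigma> \<Longrightarrow> lebint (ball 0 R) (\<lambda>x. w x * radial_mode \<sigma> m x) = 0"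
  shows "AE x in lebesgue_on (ball 0 R). w x = 0"
proof -
  let ?B = "ball 0 R :: (real^2) set"
  have Bm: "?B \<in> lmeasurable" by simp
  \<comment> \<open>The property quantifies over all profiles and momenta, so that it survives
    multiplication by \<open>z\<close> and its conjugate, which changes both.\<close>
  define T where "T F \<longleftrightarrow> continuous_on UNIV F \<and> (\<forall>\<sigma> m. admissible \<sigma> \<longrightarrow>
     lebint ?B (\<lambda>x. w x * (radial_mode \<sigma> m x * F x)) = 0)" for F :: "real^2 \<Rightarrow> complex"
  have L: "(\<lambda>x. radial_mode \<sigma> m x * F x) \<in> L2 ?B" if \<sigma>: "admissible \<sigma>" and F: "continuous_on UNIV F" for \<sigma> m F
  proof -
    have "smoothR UNIV \<sigma>" using \<sigma> by (simp add: admissible_def)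
    then have "smooth (radial_mode \<sigma> m)" by (intro smooth_radial_mode) (rule smoothR_subset, auto)
    then show ?thesis by (intro L2_continuous[OF Bm bounded_ball] continuous_on_mult smooth_continuous F)
  qed
  have T1: "T (\<lambda>_. 1)" using z by (simp add: T_def)
  have Tadd: "T (\<lambda>x. F x + G x)" if F: "T F" and G: "T G" for F G
    unfolding T_def
  proof (intro conjI allI impI)
    show "continuous_on UNIV (\<lambda>x. F x + G x)" using F G by (auto simp: T_def intro: continuous_on_add)
    fix \<sigma> m assume \<sigma>: "admissible \<sigma>"
    have "lebint ?B (\<lambda>x. w x * (radial_mode \<sigma> m x * F x) + w x * (radial_mode \<sigma> m x * G x)) = 0"
      using F G \<sigma> unfolding T_def by (subst Bochner_Integration.integral_add) (auto intro: L2_mult_integrable[OF w L])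
    then show "lebint ?B (\<lambda>x. w x * (radial_mode \<sigma> m x * (F x + G x))) = 0"
      by (simp only: distrib_left)
  qed
  have Tc: "T (\<lambda>x. c * F x)" if F: "T F" for F c
    unfolding T_def
  proof (intro conjI allI impI)
    show "continuous_on UNIV (\<lambda>x. c * F x)" using F by (auto simp: T_def intro: continuous_on_mult_left)
    fix \<sigma> m assume \<sigma>: "admissible \<sigma>"
    have "lebint ?B (\<lambda>x. c * (w x * (radial_mode \<sigma> m x * F x))) = 0"
      using F \<sigma> unfolding T_def by simp
    then show "lebint ?B (\<lambda>x. w x * (radial_mode \<sigma> m x * (c * F x))) = 0"
      by (simp only: mult_ac)
  qed
  have as: "admissible (\<lambda>s. \<sigma> s * s)" if "admissible \<sigma>" for \<sigma>
    by (rule admissible_mult[OF that smoothR_id[OF open_greaterThan]])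
  have Tz: "T (\<lambda>x. zmode j x * F x)" if F: "T F" and j: "j = 1 \<or> j = -1" for F j
    unfolding T_def
  proof (intro conjI allI impI)
    show "continuous_on UNIV (\<lambda>x. zmode j x * F x)"
      using F by (auto simp: T_def intro: continuous_on_mult smooth_continuous[OF smooth_zmode])
    fix \<sigma> m assume \<sigma>: "admissible \<sigma>"
    have "\<exists>\<sigma>' m'. admissible \<sigma>' \<and> (\<forall>x. radial_mode \<sigma> m x * zmode j x = radial_mode \<sigma>' m' x)"
      using j
    proof
      assume j: "j = 1"
      show ?thesis
      proof (intro exI[of _ "if m \<ge> 0 then \<sigma> else (\<lambda>s. \<sigma> s * s)"] exI[of _ "m + 1"] conjI allI)
        fix x show "radial_mode \<sigma> m x * zmode j x = radial_mode (if m \<ge> 0 then \<sigma> else (\<lambda>s. \<sigma> s * s)) (m + 1) x"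
          unfolding radial_mode_def j mult.assoc zmode_times_z by simp
      qed (use \<sigma> as in auto)
    next
      assume j: "j = -1"
      show ?thesis
      proof (intro exI[of _ "if m \<le> 0 then \<sigma> else (\<lambda>s. \<sigma> s * s)"] exI[of _ "m - 1"] conjI allI)
        fix x show "radial_mode \<sigma> m x * zmode j x = radial_mode (if m \<le> 0 then \<sigma> else (\<lambda>s. \<sigma> s * s)) (m - 1) x"
          unfolding radial_mode_def j mult.assoc zmode_times_cnj_z by simp
      qed (use \<sigma> as in auto)
    qed
    then obtain \<sigma>' m' where "admissible \<sigma>'" and e: "\<And>x. radial_mode \<sigma> m x * zmode j x = radial_mode \<sigma>' m' x" by blast
    then have "lebint ?B (\<lambda>x. w x * (radial_mode \<sigma>' m' x * F x)) = 0" using F by (simp add: T_def)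
    then show "lebint ?B (\<lambda>x. w x * (radial_mode \<sigma> m x * (zmode j x * F x))) = 0"
      unfolding e[symmetric] by (simp only: mult.assoc)
  qed
  have Tp: "\<forall>F. T F \<longrightarrow> T (\<lambda>x. of_real (p x) * F x)" if "real_polynomial_function p" for p :: "real^2 \<Rightarrow> real"
    using that
  proof (induction rule: real_polynomial_function.induct)
    case (linear p)
    interpret bounded_linear p by (rule linear)
    show ?case
    proof (intro allI impI)
      fix F assume F: "T F"
      let ?a = "complex_of_real (p (axis 1 1))" and ?b = "complex_of_real (p (axis 2 1))"
      \<comment> \<open>Real linear forms are combinations of \<open>z\<close> and its
        conjugate.\<close>
      have e: "complex_of_real (p x) = (?a - \<i> * ?b) / 2 * zmode 1 x + (?a + \<i> * ?b) / 2 * zmode (-1) x" for x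
      proof -
        have "x = x $ 1 *\<^sub>R axis 1 1 + x $ 2 *\<^sub>R axis 2 1" by (simp add: vec_eq_iff forall_2 axis_def)
        then have "p x = p (x $ 1 *\<^sub>R axis 1 1 + x $ 2 *\<^sub>R axis 2 1)" by (rule arg_cong)
        also have "\<dots> = x $ 1 * p (axis 1 1) + x $ 2 * p (axis 2 1)" by (simp add: add scale)
        finally have "p x = x $ 1 * p (axis 1 1) + x $ 2 * p (axis 2 1)" .
        then show ?thesis by (simp add: zmode_def complex_eq_iff algebra_simps add_divide_distrib diff_divide_distrib)
      qed
      have "T (\<lambda>x. (?a - \<i> * ?b) / 2 * (zmode 1 x * F x) + (?a + \<i> * ?b) / 2 * (zmode (-1) x * F x))"
        by (intro Tadd Tc Tz F) auto
      moreover have "(\<lambda>x. (?a - \<i> * ?b) / 2 * (zmode 1 x * F x) + (?a + \<i> * ?b) / 2 * (zmode (-1) x * F x)) = (\<lambda>x. of_real (p x) * F x)"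
        by (rule ext, subst e) (simp only: distrib_right mult.assoc)
      ultimately show "T (\<lambda>x. of_real (p x) * F x)" by (simp only:)
    qed
  next
    case (const c)
    then show ?case using Tc by simp
  next
    case (add p q)
    show ?case
    proof (intro allI impI)
      fix F assume F: "T F"
      have "T (\<lambda>x. of_real (p x) * F x + of_real (q x) * F x)" by (rule Tadd) (use add.IH F in auto)
      then show "T (\<lambda>x. of_real (p x + q x) * F x)" by (simp only: of_real_add distrib_right)
    qed
  next
    case (mult p q)
    show ?case
    proof (intro allI impI)
      fix F assume "T F"
      then have "T (\<lambda>x. of_real (p x) * (of_real (q x) * F x))" using mult.IH by blast
      then show "T (\<lambda>x. of_real (p x * q x) * F x)" by (simp only: of_real_mult mult.assoc)
    qed
  qed
  \<comment> \<open>Uniform approximation by polynomials on the closed disc. From here on only modes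
    with \<open>m = 0\<close> are used, which are functions of \<open>|x|^2\<close> alone.\<close>
  have Tcont: "lebint ?B (\<lambda>x. w x * radial_mode \<sigma> 0 x * of_real (F x)) = 0"
    if \<sigma>: "admissible \<sigma>" and F: "continuous_on UNIV F" for \<sigma> and F :: "real^2 \<Rightarrow> real"
  proof -
    have "\<exists>p. real_polynomial_function p \<and> (\<forall>x\<in>cball 0 R. \<bar>F x - p x\<bar> < 1 / real (Suc n))" for n
      by (rule Stone_Weierstrass_real_polynomial_function[of "cball 0 R" F "1 / real (Suc n)"])
        (use F in \<open>auto intro: continuous_on_subset\<close>)
    from choice[OF allI[OF this]] obtain p where p0: "\<forall>n. real_polynomial_function (p n) \<and> (\<forall>x\<in>cball 0 R. \<bar>F x - p n x\<bar> < 1 / real (Suc n))"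
      by (rule exE)
    have p: "real_polynomial_function (p n)" and pF: "x \<in> ?B \<Longrightarrow> \<bar>F x - p n x\<bar> < 1 / real (Suc n)" for n x
      using p0 by auto
    let ?v = "\<lambda>x. w x * radial_mode \<sigma> 0 x"
    have vi: "integrable (lebesgue_on ?B) ?v" by (rule L2_mult_integrable[OF w radial_mode_admissible_L2[OF \<sigma>]])
    have z0: "lebint ?B (\<lambda>x. ?v x * of_real (p n x)) = 0" for n
    proof -
      have "T (\<lambda>x. of_real (p n x) * 1)" using Tp[OF p[of n]] T1 by blast
      then have "lebint ?B (\<lambda>x. w x * (radial_mode \<sigma> 0 x * (of_real (p n x) * 1))) = 0"
        using \<sigma> unfolding T_def by blast
      then show ?thesis by (simp only: mult.assoc mult_1_right)
    qed
    have Fm: "(\<lambda>x. complex_of_real (F x)) \<in> borel_measurable (lebesgue_on ?B)"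
      by (rule continuous_imp_lebesgue_on_measurable) (intro continuous_on_of_real F)
    have pm: "(\<lambda>x. complex_of_real (p n x)) \<in> borel_measurable (lebesgue_on ?B)" for n
      by (rule continuous_imp_lebesgue_on_measurable)
        (intro continuous_on_of_real continuous_at_imp_continuous_on ballI continuous_real_polymonial_function p)
    have "(\<lambda>n. lebint ?B (\<lambda>x. ?v x * of_real (p n x))) \<longlonglongrightarrow> lebint ?B (\<lambda>x. ?v x * of_real (F x))"
    proof (rule integral_dominated_convergence[where w="\<lambda>x. cmod (?v x) * (\<bar>F x\<bar> + 1)"])
      note [measurable] = Fm pm borel_measurable_integrable[OF vi]
      show "(\<lambda>x. ?v x * of_real (F x)) \<in> borel_measurable (lebesgue_on ?B)" "(\<lambda>x. ?v x * of_real (p n x)) \<in> borel_measurable (lebesgue_on ?B)" for n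
        by measurable
      have "(\<lambda>x. radial_mode \<sigma> 0 x * complex_of_real (\<bar>F x\<bar> + 1)) \<in> L2 ?B"
        by (rule L[OF \<sigma>]) (intro continuous_intros F)
      from integrable_norm[OF L2_mult_integrable[OF w this]]
      show "integrable (lebesgue_on ?B) (\<lambda>x. cmod (?v x) * (\<bar>F x\<bar> + 1))"
        by (simp add: norm_mult mult.assoc del: of_real_add)
      show "AE x in lebesgue_on ?B. (\<lambda>n. ?v x * of_real (p n x)) \<longlonglongrightarrow> ?v x * of_real (F x)"
      proof (rule AE_I2)
        fix x assume "x \<in> space (lebesgue_on ?B)"
        then have x: "x \<in> ?B" by simp
        have "(\<lambda>n. p n x - F x) \<longlonglongrightarrow> 0"
          by (rule Lim_null_comparison[OF always_eventually LIMSEQ_Suc[OF lim_1_over_n]])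
            (use pF[OF x] in \<open>auto simp: abs_minus_commute less_imp_le\<close>)
        then have "(\<lambda>n. p n x) \<longlonglongrightarrow> F x" by (rule LIM_zero_cancel)
        then show "(\<lambda>n. ?v x * of_real (p n x)) \<longlonglongrightarrow> ?v x * of_real (F x)"
          by (intro tendsto_mult tendsto_const tendsto_of_real)
      qed
      show "AE x in lebesgue_on ?B. norm (?v x * of_real (p n x)) \<le> cmod (?v x) * (\<bar>F x\<bar> + 1)" for n
      proof (rule AE_I2)
        fix x assume "x \<in> space (lebesgue_on ?B)"
        then have x: "x \<in> ?B" by simp
        have "1 / real (Suc n) \<le> 1" by simp
        then have "\<bar>p n x\<bar> \<le> \<bar>F x\<bar> + 1" using pF[OF x, of n] by linarith
        then show "norm (?v x * of_real (p n x)) \<le> cmod (?v x) * (\<bar>F x\<bar> + 1)"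
          by (simp add: norm_mult mult_left_mono)
      qed
    qed
    then show ?thesis unfolding z0 LIMSEQ_const_iff by simp
  qed
  have wz: "AE x in lebesgue_on ?B. w x * radial_mode \<sigma> 0 x = 0" if \<sigma>: "admissible \<sigma>" for \<sigma>
  proof (rule AE_zero_of_box_integrals)
    show "?B \<in> sets lebesgue" by simp
    show vi: "integrable (lebesgue_on ?B) (\<lambda>x. w x * radial_mode \<sigma> 0 x)"
      by (rule L2_mult_integrable[OF w radial_mode_admissible_L2[OF \<sigma>]])
    fix c e :: "real^2"
    have b: "bump c e n x = of_real (\<Prod>i\<in>UNIV. cutoff (c $ i) (e $ i) n (x $ i))" for n x
      by (simp add: bump_def)
    have "lebint ?B (\<lambda>x. w x * radial_mode \<sigma> 0 x * bump c e n x) = 0" for n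
    proof -
      have "continuous_on UNIV (\<lambda>x. Re (bump c e n x))"
        by (intro continuous_on_Re smooth_continuous[OF smooth_bump])
      then have "continuous_on UNIV (\<lambda>x. \<Prod>i\<in>UNIV. cutoff (c $ i) (e $ i) n (x $ i))" by (simp only: b Re_complex_of_real)
      from Tcont[OF \<sigma> this] show ?thesis unfolding b .
    qed
    then show "lebint ?B (\<lambda>x. w x * radial_mode \<sigma> 0 x * indicator (box c e) x) = 0"
      using box_integral_limit[OF vi, of c e] by (simp add: LIMSEQ_const_iff)
  qed
  \<comment> \<open>At every point off the interface and the origin, the cutoffs of the region
    containing it tend to \<open>1\<close>, which forces \<open>w\<close> to vanish there.\<close>
  let ?rs = "{(0, ri\<^sup>2), (ri\<^sup>2, re\<^sup>2), (re\<^sup>2, R\<^sup>2)}"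
  have adm: "admissible (cutoff c e n)" if "(c, e) \<in> ?rs" for c e n
    by (rule admissible_cutoff) (use that sq_pos in auto)
  have "AE x in lebesgue_on ?B. \<forall>n. \<forall>(c, e)\<in>?rs. w x * radial_mode (cutoff c e n) 0 x = 0"
  proof (subst AE_all_countable, rule allI)
    fix n
    have "AE x in lebesgue_on ?B. w x * radial_mode (cutoff 0 (ri\<^sup>2) n) 0 x = 0"
      "AE x in lebesgue_on ?B. w x * radial_mode (cutoff (ri\<^sup>2) (re\<^sup>2) n) 0 x = 0"
      "AE x in lebesgue_on ?B. w x * radial_mode (cutoff (re\<^sup>2) (R\<^sup>2) n) 0 x = 0"
      by (rule wz[OF adm], simp)+
    then show "AE x in lebesgue_on ?B. \<forall>(c, e)\<in>?rs. w x * radial_mode (cutoff c e n) 0 x = 0"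
      by eventually_elim auto
  qed
  moreover have "AE x in lebesgue_on ?B. x \<notin> {x. norm x = ri \<or> norm x = re}"
    by (subst AE_restrict_space_iff, simp, rule eventually_mono[OF AE_not_in[OF circles_null]]) simp
  moreover have "AE x in lebesgue_on ?B. x \<noteq> 0"
  proof -
    have "AE x::real^2 in lebesgue. x \<notin> {0}" by (rule AE_not_in) (simp add: negligible_iff_null_sets[symmetric])
    from eventually_mono[OF this, of "\<lambda>x. x \<in> ?B \<longrightarrow> x \<noteq> 0"]
    show ?thesis by (subst AE_restrict_space_iff) auto
  qed
  moreover have "AE x in lebesgue_on ?B. x \<in> ?B" by (rule AE_I2) simp
  ultimately show ?thesis
  proof eventually_elim
    case (elim x)
    let ?s = "(norm x)\<^sup>2"
    have x: "norm x \<noteq> ri" "norm x \<noteq> re" "norm x > 0" "norm x < R" using elim by auto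
    have "\<exists>(c, e)\<in>?rs. ?s \<in> {c<..<e}"
    proof -
      consider "norm x < ri" | "ri < norm x" "norm x < re" | "re < norm x" using x by linarith
      then show ?thesis
        by cases (use x ri re in \<open>auto intro!: power_strict_mono\<close>)
    qed
    then obtain c e where ce: "(c, e) \<in> ?rs" "?s \<in> {c<..<e}" by blast
    show "w x = 0"
    proof (rule ccontr)
      assume w: "w x \<noteq> 0"
      have "cutoff c e n ?s = 0" for n using elim(1) ce(1) w by (auto simp: radial_mode_def zmode_def)
      then have "(\<lambda>n. 0) \<longlonglongrightarrow> (indicator {c<..<e} ?s :: real)" using cutoff_tendsto[of c e ?s] by simp
      then show False using ce(2) by (simp add: LIMSEQ_const_iff)
    qed
  qed
qed

section \<open>The closure tested against mode solutions\<close>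

lemma AE_nonzero_Om_Op:
  assumes "\<And>x. x \<in> Om \<union> Op \<Longrightarrow> x \<noteq> 0 \<Longrightarrow> P x"
  shows "AE x in lebesgue_on (ball 0 R). P x"
proof -
  have "AE x::real^2 in lebesgue. x \<notin> {0}" by (rule AE_not_in) (simp add: negligible_iff_null_sets[symmetric])
  with AE_not_in[OF circles_null] have "AE x in lebesgue. x \<in> ball 0 R \<longrightarrow> P x"
  proof eventually_elim
    case (elim x)
    show ?case
    proof
      assume "x \<in> ball 0 R"
      then have "x \<in> Om \<union> Op" using elim by (auto simp: Op_eq Omega_minus_def)
      then show "P x" using elim assms by auto
    qed
  qed
  then show ?thesis by (subst AE_restrict_space_iff) auto
qed

text \<open>\<open>Sol\<close> is almost everywhere the profile of an explicit piecewise smooth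
  solution, and Green's formula moves the operator onto it. Injectivity and the necessity of the
  condition both rest on this family of pairings.\<close>

lemma L1_closure_pairing:
  assumes uf: "(u, f) \<in> L1_closure ri re R" and \<sigma>: "admissible \<sigma>"
  shows "lebint (ball 0 R) (\<lambda>x. u x * radial_mode \<sigma> m x)
    = lebint (ball 0 R) (\<lambda>x. f x * radial_mode (Sol (nat \<bar>m\<bar>) \<sigma>) m x)"
    and "radial_mode (Sol (nat \<bar>m\<bar>) \<sigma>) m \<in> L2 (ball 0 R)"
proof -
  obtain v1 v2 where v: "piecewise_smooth ri re R v1 v2"
    and e1: "\<And>x. x \<in> Om \<union> Op \<Longrightarrow> x \<noteq> 0 \<Longrightarrow> glue ri re v1 v2 x = radial_mode (Sol (nat \<bar>m\<bar>) \<sigma>) m x"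
    and e2: "\<And>x. x \<in> Om \<union> Op \<Longrightarrow> x \<noteq> 0 \<Longrightarrow> glue ri re (\<lambda>x. - lap v1 x) (lap v2) x = radial_mode \<sigma> m x"
    using mode_solution[OF \<sigma>, of m] by blast
  have s: "smooth v1" "smooth v2" using v by (auto simp: piecewise_smooth_def)
  have B: "ball (0::real^2) R \<in> sets lebesgue" by simp
  have a1: "AE x in lebesgue_on (ball 0 R). glue ri re v1 v2 x = radial_mode (Sol (nat \<bar>m\<bar>) \<sigma>) m x"
    by (rule AE_nonzero_Om_Op) (rule e1)
  have a2: "AE x in lebesgue_on (ball 0 R). glue ri re (\<lambda>x. - lap v1 x) (lap v2) x = radial_mode \<sigma> m x"
    by (rule AE_nonzero_Om_Op) (rule e2)
  have uL: "u \<in> L2 (ball 0 R)" "f \<in> L2 (ball 0 R)" using uf unfolding L1_closure_def by (auto simp: L2_tendsto_def)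
  note g1 = glue_L2[OF s] and g2 = glue_L2[OF smooth_uminus[OF smooth_lap[OF s(1)]] smooth_lap[OF s(2)]]
  show S: "radial_mode (Sol (nat \<bar>m\<bar>) \<sigma>) m \<in> L2 (ball 0 R)" by (rule L2_AE_cong[OF B g1 a1])
  have "lebint (ball 0 R) (\<lambda>x. u x * radial_mode \<sigma> m x) = lebint (ball 0 R) (\<lambda>x. u x * glue ri re (\<lambda>x. - lap v1 x) (lap v2) x)"
    by (rule integral_cong_AE[OF borel_measurable_integrable[OF L2_mult_integrable[OF uL(1) radial_mode_admissible_L2[OF \<sigma>]]]
          borel_measurable_integrable[OF L2_mult_integrable[OF uL(1) g2]]], rule eventually_mono[OF a2], simp)
  also have "\<dots> = lebint (ball 0 R) (\<lambda>x. f x * glue ri re v1 v2 x)"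
    by (rule L1_closure_symmetric[OF uf v, symmetric])
  also have "\<dots> = lebint (ball 0 R) (\<lambda>x. f x * radial_mode (Sol (nat \<bar>m\<bar>) \<sigma>) m x)"
    by (rule integral_cong_AE[OF borel_measurable_integrable[OF L2_mult_integrable[OF uL(2) g1]]
          borel_measurable_integrable[OF L2_mult_integrable[OF uL(2) S]]], rule eventually_mono[OF a1], simp)
  finally show "lebint (ball 0 R) (\<lambda>x. u x * radial_mode \<sigma> m x)
    = lebint (ball 0 R) (\<lambda>x. f x * radial_mode (Sol (nat \<bar>m\<bar>) \<sigma>) m x)" .
qed

lemma L1_closure_injective:
  assumes "(u, f) \<in> L1_closure ri re R" "(v, f) \<in> L1_closure ri re R"
  shows "AE x in lebesgue_on (ball 0 R). u x = v x"
proof -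
  have L: "u \<in> L2 (ball 0 R)" "v \<in> L2 (ball 0 R)" using assms unfolding L1_closure_def by (auto simp: L2_tendsto_def)
  have "AE x in lebesgue_on (ball 0 R). u x - v x = 0"
  proof (rule radial_modes_total[OF L2_diff[OF L]])
    fix \<sigma> m assume \<sigma>: "admissible \<sigma>"
    have "lebint (ball 0 R) (\<lambda>x. u x * radial_mode \<sigma> m x - v x * radial_mode \<sigma> m x) = 0"
      using L1_closure_pairing(1)[OF assms(1) \<sigma>] L1_closure_pairing(1)[OF assms(2) \<sigma>]
      by (subst Bochner_Integration.integral_diff) (auto intro: L2_mult_integrable L radial_mode_admissible_L2[OF \<sigma>])
    then show "lebint (ball 0 R) (\<lambda>x. (u x - v x) * radial_mode \<sigma> m x) = 0"
      by (simp only: left_diff_distrib)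
  qed
  then show ?thesis by simp
qed

end

section \<open>Necessity of the summability condition\<close>


lemma integrable_powr_interval:
  fixes \<alpha> \<beta> p :: real
  assumes "0 < \<alpha>"
  shows "integrable lborel (\<lambda>t. indicator {\<alpha><..<\<beta>} t * t powr p)"
proof -
  have "set_integrable lborel {\<alpha>..\<beta>} (\<lambda>t. t powr p)"
    by (rule borel_integrable_atLeastAtMost') (use assms in \<open>auto intro!: continuous_intros\<close>)
  then have "set_integrable lborel {\<alpha><..<\<beta>} (\<lambda>t. t powr p)" by (rule set_integrable_subset) auto
  then show ?thesis by (simp add: set_integrable_def)
qed

text \<open>The integral concentrates at the left end on the scale \<open>1 / (1 + p)\<close>: up to
  \<open>\<gamma>\<close> the integrand loses at most the factor
  \<open>exp (\<beta> / \<alpha> - 1)\<close> against its value at \<open>\<alpha>\<close>. Explicit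
  integration would have to single out \<open>p = 1\<close>.\<close>

lemma powr_neg_lower:
  fixes \<alpha> \<beta> p :: real
  assumes "0 < \<alpha>" "\<alpha> < \<beta>" "0 \<le> p"
  shows "\<alpha> powr (- p) * (exp (- (\<beta> / \<alpha> - 1)) * (\<beta> - \<alpha>)) / (1 + p) \<le> lborint (\<lambda>t. indicator {\<alpha><..<\<beta>} t * t powr (- p))"
proof -
  define \<delta> where "\<delta> = \<beta> / \<alpha> - 1"
  define \<gamma> where "\<gamma> = \<alpha> + (\<beta> - \<alpha>) / (1 + p)"
  have \<delta>: "\<delta> > 0" using assms by (simp add: \<delta>_def)
  have g: "\<alpha> < \<gamma>" "\<gamma> \<le> \<beta>"
  proof -
    show "\<alpha> < \<gamma>" using assms by (simp add: \<gamma>_def)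
    have "(\<beta> - \<alpha>) / (1 + p) \<le> (\<beta> - \<alpha>) / 1" using assms by (intro divide_left_mono) auto
    then show "\<gamma> \<le> \<beta>" by (simp add: \<gamma>_def)
  qed
  have "\<alpha> * \<delta> = \<beta> - \<alpha>" using assms by (simp add: \<delta>_def field_simps)
  then have ge: "\<gamma> = \<alpha> * (1 + \<delta> / (1 + p))" unfolding \<gamma>_def by (simp add: distrib_left)
  have low: "\<alpha> powr (- p) * exp (- \<delta>) \<le> t powr (- p)" if t: "\<alpha> < t" "t < \<gamma>" for t
  proof -
    have x: "0 \<le> \<delta> / (1 + p)" using \<delta> assms by simp
    have "(1 + \<delta> / (1 + p)) powr p \<le> exp (\<delta> / (1 + p)) powr p"
      using x assms by (intro powr_mono2 exp_ge_add_one_self) auto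
    also have "\<dots> = exp (p * (\<delta> / (1 + p)))" by (simp add: powr_def)
    also have "\<dots> \<le> exp \<delta>"
    proof -
      have "p * \<delta> \<le> \<delta> * (1 + p)" using \<delta> by (simp add: algebra_simps)
      then have "p * (\<delta> / (1 + p)) \<le> \<delta>" using assms by (simp add: field_simps)
      then show ?thesis by simp
    qed
    finally have k: "(1 + \<delta> / (1 + p)) powr p \<le> exp \<delta>" .
    have "t powr p \<le> \<gamma> powr p" using t assms by (intro powr_mono2) auto
    also have "\<dots> = \<alpha> powr p * (1 + \<delta> / (1 + p)) powr p" unfolding ge using x assms by (intro powr_mult)
    also have "\<dots> \<le> \<alpha> powr p * exp \<delta>" using k by (intro mult_left_mono) auto
    finally have "t powr p \<le> \<alpha> powr p * exp \<delta>" .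
    moreover have "t powr p > 0" using t assms by simp
    ultimately have "inverse (\<alpha> powr p * exp \<delta>) \<le> inverse (t powr p)" by (rule le_imp_inverse_le)
    then show ?thesis by (simp add: powr_minus exp_minus)
  qed
  have int: "integrable lborel (\<lambda>t. indicator {\<alpha><..<\<beta>} t * t powr (- p))" by (rule integrable_powr_interval) (rule assms)
  have "lborint (\<lambda>t. indicator {\<alpha><..<\<gamma>} t * (\<alpha> powr (- p) * exp (- \<delta>))) \<le> lborint (\<lambda>t. indicator {\<alpha><..<\<beta>} t * t powr (- p))"
  proof (rule integral_mono[OF _ int])
    show "integrable lborel (\<lambda>t. indicator {\<alpha><..<\<gamma>} t * (\<alpha> powr (- p) * exp (- \<delta>)))"
      by (intro integrable_mult_left integrable_real_indicator) (use g in auto)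
    show "indicator {\<alpha><..<\<gamma>} t * (\<alpha> powr (- p) * exp (- \<delta>)) \<le> indicator {\<alpha><..<\<beta>} t * t powr (- p)" for t
      using low[of t] g by (auto simp: indicator_def)
  qed
  also have "lborint (\<lambda>t. indicator {\<alpha><..<\<gamma>} t * (\<alpha> powr (- p) * exp (- \<delta>))) = (\<gamma> - \<alpha>) * (\<alpha> powr (- p) * exp (- \<delta>))"
    using g by (simp add: integral_mult_left_zero)
  finally show ?thesis by (simp add: \<gamma>_def \<delta>_def mult_ac)
qed

lemma powr_neg_integral:
  fixes \<alpha> \<beta> p :: real
  assumes "0 < \<alpha>" "\<alpha> \<le> \<beta>" "p > 0"
  shows "((\<lambda>t. t powr (- p - 1)) has_integral (\<alpha> powr (- p) - \<beta> powr (- p)) / p) {\<alpha>..\<beta>}"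
proof -
  have "((\<lambda>t. t powr (- p - 1)) has_integral ((- (\<beta> powr (- p)) / p) - (- (\<alpha> powr (- p)) / p))) {\<alpha>..\<beta>}"
  proof (rule fundamental_theorem_of_calculus[OF assms(2)])
    fix t assume "t \<in> {\<alpha>..\<beta>}"
    then have t: "t > 0" using assms by auto
    have "((\<lambda>t. t powr (- p)) has_real_derivative - p * t powr (- p - 1)) (at t)"
      by (rule has_real_derivative_powr[OF t])
    from DERIV_cmult[OF this, of "- 1 / p"]
    have "((\<lambda>t. - (t powr (- p)) / p) has_real_derivative t powr (- p - 1)) (at t)" using assms by simp
    then show "((\<lambda>t. - (t powr (- p)) / p) has_vector_derivative t powr (- p - 1)) (at t within {\<alpha>..\<beta>})"
      by (simp add: has_real_derivative_iff_has_vector_derivative has_vector_derivative_at_within)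
  qed
  then show ?thesis by (simp add: diff_divide_distrib)
qed

lemma lborel_integral_le_of_has_integral:
  fixes f g :: "real \<Rightarrow> real"
  assumes f: "f \<in> borel_measurable borel" "\<And>t. 0 \<le> f t" and le: "\<And>t. t \<in> {\<alpha><..<\<beta>} \<Longrightarrow> f t \<le> g t" "\<And>t. t \<notin> {\<alpha><..<\<beta>} \<Longrightarrow> f t = 0"
    and g: "continuous_on {\<alpha>..\<beta>} g" "(g has_integral I) {\<alpha>..\<beta>}"
  shows "integrable lborel f" "lborint f \<le> I"
proof -
  have si: "set_integrable lborel {\<alpha>..\<beta>} g" by (rule borel_integrable_atLeastAtMost'[OF g(1)])
  then have si': "set_integrable lborel {\<alpha><..<\<beta>} g" by (rule set_integrable_subset) auto
  then have gi: "integrable lborel (\<lambda>t. indicator {\<alpha><..<\<beta>} t * g t)" by (simp add: set_integrable_def)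
  have b: "f t \<le> indicator {\<alpha><..<\<beta>} t * g t" for t using le[of t] by (cases "t \<in> {\<alpha><..<\<beta>}") auto
  show fi: "integrable lborel f"
    by (rule Bochner_Integration.integrable_bound[OF gi]) (use f order_trans[OF b abs_ge_self] in \<open>auto intro!: AE_I2 simp: abs_of_nonneg\<close>)
  have "lborint f \<le> lborint (\<lambda>t. indicator {\<alpha><..<\<beta>} t * g t)"
    by (rule integral_mono[OF fi gi b])
  also have "\<dots> = integral {\<alpha><..<\<beta>} g"
    using set_borel_integral_eq_integral(2)[OF si'] by (simp add: set_lebesgue_integral_def)
  also have "\<dots> = I" using g(2) by (simp add: integral_open_interval_real[symmetric] integral_unique)
  finally show "lborint f \<le> I" .
qed

text \<open>Splitting off one factor \<open>t\<close>, bounded by \<open>\<beta>\<close>, lowers the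
  exponent to \<open>- p - 1\<close> and avoids the logarithm at \<open>p = 1\<close>.\<close>

lemma powr_neg_upper:
  fixes \<alpha> \<beta> p :: real
  assumes "0 < \<alpha>" "\<alpha> < \<beta>" "p > 0"
  shows "lborint (\<lambda>t. indicator {\<alpha><..<\<beta>} t * t powr (- p)) \<le> \<beta> * \<alpha> powr (- p) / p"
proof -
  have "lborint (\<lambda>t. indicator {\<alpha><..<\<beta>} t * t powr (- p)) \<le> \<beta> * ((\<alpha> powr (- p) - \<beta> powr (- p)) / p)"
  proof (rule lborel_integral_le_of_has_integral(2)[where g="\<lambda>t. \<beta> * t powr (- p - 1)" and \<alpha>=\<alpha> and \<beta>=\<beta>])
    show "indicator {\<alpha><..<\<beta>} t * t powr (- p) \<le> \<beta> * t powr (- p - 1)" if "t \<in> {\<alpha><..<\<beta>}" for t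
    proof -
      have "t powr (- p) = t * t powr (- p - 1)" using that assms powr_add[of t 1 "- p - 1"] by simp
      also have "\<dots> \<le> \<beta> * t powr (- p - 1)" using that by (intro mult_right_mono) auto
      finally show ?thesis using that by simp
    qed
    show "continuous_on {\<alpha>..\<beta>} (\<lambda>t. \<beta> * t powr (- p - 1))" using assms by (auto intro!: continuous_intros)
    show "((\<lambda>t. \<beta> * t powr (- p - 1)) has_integral \<beta> * ((\<alpha> powr (- p) - \<beta> powr (- p)) / p)) {\<alpha>..\<beta>}"
      by (rule has_integral_mult_right[OF powr_neg_integral]) (use assms in auto)
  qed auto
  also have "\<dots> \<le> \<beta> * (\<alpha> powr (- p) / p)"
    using assms by (intro mult_left_mono divide_right_mono) auto
  finally show ?thesis by simp
qed

section \<open>Growth in \<open>M\<close> of the annulus integral and the source integral\<close>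

context annuli
begin

lemma R_gt: "R > 0" using ri re R by linarith

text \<open>Up to the factor \<open>pi\<close>, the squared norm of the mode with profile
  \<open>s^(-M)\<close> on the annulus.\<close>

definition J_int :: "nat \<Rightarrow> real" where
  "J_int M = lborint (\<lambda>t. indicator {ri\<^sup>2<..<re\<^sup>2} t * t powr (- real M))"

text \<open>Up to a constant, the pairing of \<open>psi z^m\<close> with a source
  \<open>e^(-i m theta)\<close> supported in \<open>a < r < b\<close>.\<close>

definition I_int :: "real \<Rightarrow> real \<Rightarrow> nat \<Rightarrow> real" where
  "I_int a b M = lborint (\<lambda>t. indicator {a\<^sup>2<..<b\<^sup>2} t * (hpsi M 2 t * sqrt t ^ M))"

lemma sqrt_power_powr: "t > 0 \<Longrightarrow> sqrt t ^ M = t powr (real M / 2)"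
  using powr_realpow[of "sqrt t" M] by (simp add: powr_half_sqrt[symmetric] powr_powr)

lemma hpsi_outer: "hpsi M 2 s = E_fun M (R\<^sup>2) - E_fun M s"
  by (simp add: hpsi_def ga_def de_def)

lemma hpsi_outer_eq:
  assumes "M \<ge> 1" "s > 0"
  shows "hpsi M 2 s = (1 / s ^ M - 1 / (R\<^sup>2) ^ M) / real M"
  using E_fun_diff[OF sq_pos(5) assms(2), of M] assms(1) unfolding hpsi_outer by (simp add: field_simps)

lemma hpsi_outer_nonneg: "0 < s \<Longrightarrow> s \<le> R\<^sup>2 \<Longrightarrow> 0 \<le> hpsi M 2 s"
  unfolding hpsi_outer using E_fun_mono[of s "R\<^sup>2" M] by simp

lemma hpsi_outer_le:
  assumes "M \<ge> 1" "s > 0"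
  shows "hpsi M 2 s \<le> s powr (- real M) / real M"
proof -
  have "s powr (- real M) = 1 / s ^ M" using assms(2) by (simp add: powr_minus powr_realpow divide_inverse)
  moreover have "0 \<le> 1 / (R\<^sup>2) ^ M" by simp
  ultimately show ?thesis unfolding hpsi_outer_eq[OF assms] by (intro divide_right_mono) auto
qed

lemma hpsi_measurable [measurable]: "hpsi M j \<in> borel_measurable borel" "hphi M j \<in> borel_measurable borel"
proof -
  have "E_fun M \<in> borel_measurable borel" unfolding E_fun_def[abs_def] by (cases "M = 0") auto
  then show "hpsi M j \<in> borel_measurable borel" "hphi M j \<in> borel_measurable borel"
    unfolding hpsi_def[abs_def] hphi_def[abs_def] by measurable
qed

lemma outer_integrand_le:
  assumes "M \<ge> 1" "t > 0"
  shows "hpsi M 2 t * sqrt t ^ M \<le> t powr (- (real M / 2)) / real M"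
proof -
  have "hpsi M 2 t * sqrt t ^ M \<le> t powr (- real M) / real M * t powr (real M / 2)"
    unfolding sqrt_power_powr[OF assms(2)] by (intro mult_right_mono hpsi_outer_le assms) simp
  also have "\<dots> = (t powr (- real M) * t powr (real M / 2)) / real M" by simp
  also have "t powr (- real M) * t powr (real M / 2) = t powr (- (real M / 2))"
    unfolding powr_add[symmetric] by simp
  finally show ?thesis .
qed

lemma I_int_lower:
  assumes a: "re \<le> a" "a < b" "b \<le> R"
  obtains c where "c > 0" "\<And>M. M \<ge> 1 \<Longrightarrow> c / a ^ M / (real M)\<^sup>2 \<le> I_int a b M"
proof -
  have a0: "a > 0" using a ri re by linarith
  \<comment> \<open>\<open>psi\<close> vanishes at \<open>R\<close>, and \<open>b = R\<close> is
    allowed. The midpoint stays away from \<open>R^2\<close>, which makes \<open>c0\<close>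
    positive.\<close>
  define \<beta> where "\<beta> = (a\<^sup>2 + b\<^sup>2) / 2"
  have ab: "a\<^sup>2 < b\<^sup>2" "b\<^sup>2 \<le> R\<^sup>2" using a a0 by (auto intro!: power_strict_mono power_mono)
  have \<beta>: "a\<^sup>2 < \<beta>" "\<beta> < b\<^sup>2" using ab by (auto simp: \<beta>_def)
  define c0 where "c0 = 1 - \<beta> / R\<^sup>2"
  have c0: "c0 > 0" using \<beta> ab sq_pos by (simp add: c0_def)
  have a2: "0 < a\<^sup>2" using a0 by simp
  define c1 where "c1 = exp (- (\<beta> / a\<^sup>2 - 1)) * (\<beta> - a\<^sup>2)"
  have c1: "c1 > 0" using \<beta> by (simp add: c1_def)
  show ?thesis
  proof (rule that[of "c0 * c1 / 2"])
    show "c0 * c1 / 2 > 0" using c0 c1 by simp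
    fix M :: nat assume M: "M \<ge> 1"
    have low: "c0 / real M * (indicator {a\<^sup>2<..<\<beta>} t * t powr (- (real M / 2))) \<le> indicator {a\<^sup>2<..<b\<^sup>2} t * (hpsi M 2 t * sqrt t ^ M)" for t
    proof (cases "t \<in> {a\<^sup>2<..<\<beta>}")
      case True
      then have t: "t > 0" "t < R\<^sup>2" using \<beta> ab by (meson greaterThanLessThan_iff less_trans less_le_trans a2)+
      have tM: "t ^ M > 0" using t by simp
      \<comment> \<open>As \<open>M \<ge> 1\<close>, the power is at most its base, which is bounded
        independently of \<open>M\<close>.\<close>
      have r: "(t / R\<^sup>2) ^ M \<le> \<beta> / R\<^sup>2"
      proof -
        have "t / R\<^sup>2 \<le> 1" using t sq_pos(5) by (simp only: divide_le_eq_1_pos less_imp_le)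
        then have "(t / R\<^sup>2) ^ M \<le> (t / R\<^sup>2) ^ 1" using t M by (intro power_decreasing) auto
        also have "\<dots> \<le> \<beta> / R\<^sup>2" using True by (simp add: divide_right_mono)
        finally show ?thesis .
      qed
      have "hpsi M 2 t = (1 - (t / R\<^sup>2) ^ M) / (t ^ M * real M)"
        unfolding hpsi_outer_eq[OF M t(1)] using tM t(1) by (simp add: power_divide diff_divide_distrib)
      also have "\<dots> \<ge> c0 / (t ^ M * real M)" using r tM by (intro divide_right_mono) (auto simp: c0_def)
      finally have "c0 / (t ^ M * real M) * sqrt t ^ M \<le> hpsi M 2 t * sqrt t ^ M"
        using t by (intro mult_right_mono) auto
      moreover have "c0 / (t ^ M * real M) * sqrt t ^ M = c0 / real M * t powr (- (real M / 2))"
      proof -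
        have "t powr (- (real M / 2)) = t powr (- real M) * t powr (real M / 2)"
          unfolding powr_add[symmetric] by simp
        also have "\<dots> = sqrt t ^ M / t ^ M"
          unfolding sqrt_power_powr[OF t(1)] powr_minus powr_realpow[OF t(1)] divide_inverse by (rule mult.commute)
        finally show ?thesis by simp
      qed
      ultimately show ?thesis using True \<beta> by simp
    next
      case False
      have "0 \<le> indicator {a\<^sup>2<..<b\<^sup>2} t * (hpsi M 2 t * sqrt t ^ M)"
      proof (cases "t \<in> {a\<^sup>2<..<b\<^sup>2}")
        case True
        then have "0 < t" "t \<le> R\<^sup>2" using ab by (meson greaterThanLessThan_iff less_trans less_le_trans less_imp_le a2)+
        then show ?thesis using hpsi_outer_nonneg[of t M] by simp
      qed simp
      then show ?thesis using False by simp
    qed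
    have i1: "integrable lborel (\<lambda>t. indicator {a\<^sup>2<..<\<beta>} t * t powr (- (real M / 2)))" by (rule integrable_powr_interval[OF a2])
    have i2: "integrable lborel (\<lambda>t. indicator {a\<^sup>2<..<b\<^sup>2} t * (hpsi M 2 t * sqrt t ^ M))"
    proof -
      have "set_integrable lborel {a\<^sup>2..b\<^sup>2} (\<lambda>t. hpsi M 2 t * sqrt t ^ M)"
      proof (rule borel_integrable_atLeastAtMost')
        have "continuous_on {a\<^sup>2..b\<^sup>2} (hpsi M 2)"
          using smoothR_hpsi[of M 2] a2 unfolding smoothR_def by (metis CkR.simps(1) continuous_on_subset atLeastAtMost_iff greaterThan_iff less_le_trans subsetI)
        then show "continuous_on {a\<^sup>2..b\<^sup>2} (\<lambda>t. hpsi M 2 t * sqrt t ^ M)" by (intro continuous_intros)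
      qed
      then have "set_integrable lborel {a\<^sup>2<..<b\<^sup>2} (\<lambda>t. hpsi M 2 t * sqrt t ^ M)" by (rule set_integrable_subset) auto
      then show ?thesis by (simp add: set_integrable_def)
    qed
    have pw: "(a\<^sup>2) powr (- (real M / 2)) = 1 / a ^ M"
    proof -
      have "(a\<^sup>2) powr (real M / 2) = a ^ M" using sqrt_power_powr[OF a2, of M] a0 by simp
      then show ?thesis by (simp add: powr_minus inverse_eq_divide)
    qed
    have "c0 * c1 / 2 / a ^ M / (real M)\<^sup>2 = c0 / real M * ((1 / a ^ M) * c1 / (2 * real M))"
      by (simp add: power2_eq_square)
    also have "\<dots> \<le> c0 / real M * ((1 / a ^ M) * c1 / (1 + real M / 2))"
      using c0 c1 M a0 by (intro mult_left_mono divide_left_mono mult_pos_pos) auto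
    also have "\<dots> \<le> c0 / real M * lborint (\<lambda>t. indicator {a\<^sup>2<..<\<beta>} t * t powr (- (real M / 2)))"
      using powr_neg_lower[OF a2 \<beta>(1), of "real M / 2"] c0 unfolding pw c1_def by (intro mult_left_mono) auto
    also have "\<dots> = lborint (\<lambda>t. c0 / real M * (indicator {a\<^sup>2<..<\<beta>} t * t powr (- (real M / 2))))" by simp
    also have "\<dots> \<le> I_int a b M" unfolding I_int_def
      by (rule integral_mono[OF integrable_mult_right[OF i1] i2 low])
    finally show "c0 * c1 / 2 / a ^ M / (real M)\<^sup>2 \<le> I_int a b M" .
  qed
qed

lemma J_int_lower:
  obtains c where "c > 0" "\<And>M. M \<ge> 1 \<Longrightarrow> c / (ri\<^sup>2) ^ M / real M \<le> J_int M"
proof (rule that[of "exp (- (re\<^sup>2 / ri\<^sup>2 - 1)) * (re\<^sup>2 - ri\<^sup>2) / 2"])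
  let ?c = "exp (- (re\<^sup>2 / ri\<^sup>2 - 1)) * (re\<^sup>2 - ri\<^sup>2)"
  have c: "?c > 0" using sq_pos by simp
  then show "?c / 2 > 0" by simp
  fix M :: nat assume M: "M \<ge> 1"
  have pw: "(ri\<^sup>2) powr (- real M) = 1 / (ri\<^sup>2) ^ M" using sq_pos(1) by (simp add: powr_minus powr_realpow divide_inverse)
  have "?c / 2 / (ri\<^sup>2) ^ M / real M = (1 / (ri\<^sup>2) ^ M) * ?c / (2 * real M)" by simp
  also have "\<dots> \<le> (1 / (ri\<^sup>2) ^ M) * ?c / (1 + real M)"
  proof (rule divide_left_mono)
    show "0 \<le> (1 / (ri\<^sup>2) ^ M) * ?c" by (rule mult_nonneg_nonneg[OF _ less_imp_le[OF c]]) simp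
  qed (use M in auto)
  also have "\<dots> \<le> J_int M" unfolding J_int_def using powr_neg_lower[OF sq_pos(1,2), of "real M"] unfolding pw by simp
  finally show "?c / 2 / (ri\<^sup>2) ^ M / real M \<le> J_int M" .
qed

end

locale source = annuli +
  fixes a b :: real and h :: "real \<Rightarrow> complex" and g :: "real^2 \<Rightarrow> complex"
  assumes ab: "re \<le> a" "a < b" "b \<le> R" and h: "h \<in> L2 {0<..<2*pi}" and g: "g \<in> L2 (ball 0 R)"
    and gh: "AE x in lebesgue_on (ball 0 R). \<forall>r>0. \<forall>\<theta>\<in>{0<..<2*pi}. x = polar r \<theta> \<longrightarrow>
                  g x = indicator {a<..<b} r * h \<theta>"
begin

abbreviation "c \<equiv> fourier_coeff h"
abbreviation "B \<equiv> ball 0 R :: (real^2) set"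

lemma a_pos: "a > 0" and ab_sq: "re\<^sup>2 \<le> a\<^sup>2" "a\<^sup>2 < b\<^sup>2" "b\<^sup>2 \<le> R\<^sup>2" "0 < a\<^sup>2"
  using ab ri re by (auto intro!: power_strict_mono power_mono)

text \<open>The pairing carries no conjugation, hence the index \<open>- m\<close>.\<close>

lemma fourier_coeff_lborel:
  assumes h': "h' \<in> borel_measurable borel" "AE \<theta> in lebesgue_on {0<..<2*pi}. h \<theta> = h' \<theta>"
  shows "lborint (\<lambda>\<theta>. indicator {0<..<2*pi} \<theta> *\<^sub>R (h' \<theta> * exp (\<i> * of_int m * of_real \<theta>))) = of_real (2 * pi) * c (- m)"
proof -
  let ?e = "\<lambda>\<theta>. exp (\<i> * of_int m * complex_of_real \<theta>)"
  have e: "?e \<in> borel_measurable borel" by (intro borel_measurable_continuous_onI continuous_intros)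
  have em: "?e \<in> borel_measurable (lebesgue_on {0<..<2*pi})" by (rule continuous_imp_lebesgue_on_measurable) (intro continuous_intros)
  have h'm: "h' \<in> borel_measurable (lebesgue_on {0<..<2*pi})"
    by (rule lebesgue_on_measurable_AE_cong[OF _ L2_measurable[OF h] h'(2)]) simp
  have "lborint (\<lambda>\<theta>. indicator {0<..<2*pi} \<theta> *\<^sub>R (h' \<theta> * ?e \<theta>)) = integral\<^sup>L lebesgue (\<lambda>\<theta>. indicator {0<..<2*pi} \<theta> *\<^sub>R (h' \<theta> * ?e \<theta>))"
    by (rule integral_completion[symmetric]) (use h'(1) e in \<open>simp add: borel_measurable_scaleR borel_measurable_times borel_measurable_indicator\<close>)
  also have "\<dots> = lebint {0<..<2*pi} (\<lambda>\<theta>. h' \<theta> * ?e \<theta>)"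
    by (rule integral_restrict_space[symmetric]) auto
  also have "\<dots> = lebint {0<..<2*pi} (\<lambda>\<theta>. h \<theta> * ?e \<theta>)"
  proof (rule integral_cong_AE)
    show "AE \<theta> in lebesgue_on {0<..<2*pi}. h' \<theta> * ?e \<theta> = h \<theta> * ?e \<theta>" using h'(2) by eventually_elim simp
  qed (intro borel_measurable_times h'm em L2_measurable[OF h])+
  finally show ?thesis by (simp add: fourier_coeff_def)
qed

text \<open>\<open>V\<close> has to be a mode only where \<open>g\<close> lives, so the exterior
  formula of a mode solution can be used although the solution looks different elsewhere.\<close>

lemma source_pairing:
  assumes V: "V \<in> L2 B" "\<And>x. a < norm x \<Longrightarrow> norm x < b \<Longrightarrow> V x = radial_mode F m x" and F: "F \<in> borel_measurable borel"
  shows "lebint B (\<lambda>x. g x * V x)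
    = of_real (pi * lborint (\<lambda>s. indicator {a\<^sup>2<..<b\<^sup>2} s * (F s * sqrt s ^ nat \<bar>m\<bar>))) * c (- m)"
proof -
  obtain h' where h': "h' \<in> borel_measurable borel" "AE \<theta> in lebesgue_on {0<..<2*pi}. h \<theta> = h' \<theta>"
    by (rule borel_representative[OF _ L2_measurable[OF h]]) auto
  let ?e = "\<lambda>\<theta>. exp (\<i> * of_int m * complex_of_real \<theta>)"
  let ?A = "\<lambda>s. complex_of_real (indicator {a\<^sup>2<..<b\<^sup>2} s * (F s * sqrt s ^ nat \<bar>m\<bar>))"
  let ?B = "\<lambda>\<theta>. h' \<theta> * ?e \<theta>"
  have e: "?e \<in> borel_measurable borel" by (intro borel_measurable_continuous_onI continuous_intros)
  have A: "?A \<in> borel_measurable borel" using F by measurable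
  have Bm: "?B \<in> borel_measurable borel" by (intro borel_measurable_times h' e)
  have "AE \<theta> in lebesgue. \<theta> \<in> {0<..<2*pi} \<longrightarrow> h \<theta> = h' \<theta>" using h'(2) by (subst (asm) AE_restrict_space_iff) auto
  then have "AE \<theta> in lborel. \<theta> \<in> {0<..<2*pi} \<longrightarrow> h \<theta> = h' \<theta>" by (simp add: AE_completion_iff)
  from AE_lborel_snd[OF this] AE_polar[OF R_gt gh]
  have ae: "AE y in lborel. y \<in> polar_rect R \<longrightarrow> g (polar_map y) * V (polar_map y) = ?A (fst y) * ?B (snd y)"
  proof eventually_elim
    case (elim y)
    show ?case
    proof
      assume y: "y \<in> polar_rect R"
      obtain s \<theta> where st: "y = (s, \<theta>)" by (cases y)
      have s: "0 < s" "s < R\<^sup>2" "\<theta> \<in> {0<..<2*pi}" using y by (auto simp: st polar_rect_def)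
      have gg: "g (polar_map y) = indicator {a<..<b} (sqrt s) * h' \<theta>"
        using elim y s by (auto simp: st polar_map_def)
      have lt: "a < sqrt s \<longleftrightarrow> a\<^sup>2 < s" "sqrt s < b \<longleftrightarrow> s < b\<^sup>2"
        using a_pos ab s real_less_rsqrt[of a s] real_sqrt_less_iff[of "a\<^sup>2" s] real_sqrt_less_iff[of s "b\<^sup>2"] by auto
      show "g (polar_map y) * V (polar_map y) = ?A (fst y) * ?B (snd y)"
      proof (cases "s \<in> {a\<^sup>2<..<b\<^sup>2}")
        case True
        have "norm (polar_map y) = sqrt s" using s by (simp add: st polar_map_def norm_polar)
        then have "V (polar_map y) = radial_mode F m (polar_map y)" using True lt by (intro V(2)) auto
        then show ?thesis unfolding gg using True lt s(1) by (simp add: st radial_mode_polar_map mult_ac)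
      next
        case False
        then show ?thesis unfolding gg using lt by (auto simp: st)
      qed
    qed
  qed
  have e2: "(\<lambda>s. indicator {0<..<R\<^sup>2} s *\<^sub>R ?A s) = ?A"
  proof (rule ext)
    fix s
    show "indicator {0<..<R\<^sup>2} s *\<^sub>R ?A s = ?A s"
    proof (cases "s \<in> {a\<^sup>2<..<b\<^sup>2}")
      case True
      then have "s \<in> {0<..<R\<^sup>2}" by (meson greaterThanLessThan_iff less_trans less_le_trans ab_sq)
      then show ?thesis by simp
    qed simp
  qed
  show ?thesis
    unfolding polar_product_integral[OF R_gt L2_mult_integrable[OF g V(1)] A Bm ae] e2 integral_complex_of_real fourier_coeff_lborel[OF h']
    by simp
qed

text \<open>In the annulus \<open>phi\<close> is a multiple of \<open>s^(-M)\<close>, so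
  \<open>\<sigma>\<close> is the profile that \<open>u\<close> is expected to show there. It jumps
  at the interface and is not admissible; it is reached as the limit of the admissible profiles
  \<open>s\<^sub>n\<close>.\<close>

lemma annulus_pairing:
  assumes uf: "(u, g) \<in> L1_closure ri re R"
  defines "\<sigma> \<equiv> \<lambda>m s. indicator {ri\<^sup>2<..<re\<^sup>2} s * s powr (- real (nat \<bar>m\<bar>))"
  shows "lebint B (\<lambda>x. u x * radial_mode (\<sigma> m) m x)
    = - of_real ((1/4) * (re\<^sup>2) ^ nat \<bar>m\<bar> * J_int (nat \<bar>m\<bar>) * pi * I_int a b (nat \<bar>m\<bar>)) * c (- m)"
    and "radial_mode (\<sigma> m) m \<in> L2 B"
proof -
  define M where "M = nat \<bar>m\<bar>"
  have uL: "u \<in> L2 B" using uf unfolding L1_closure_def by (auto simp: L2_tendsto_def)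
  define s\<^sub>n where "s\<^sub>n n s = cutoff (ri\<^sup>2) (re\<^sup>2) n s * s powr (- real M)" for n s
  have adm: "admissible (s\<^sub>n n)" for n
    unfolding s\<^sub>n_def[abs_def] by (rule admissible_mult[OF admissible_cutoff smoothR_powr]) auto
  define K where "K n = integral {ri\<^sup>2..re\<^sup>2} (\<lambda>t. (re\<^sup>2) ^ M * (cutoff (ri\<^sup>2) (re\<^sup>2) n t * t powr (- real M)))" for n
  have cc: "continuous_on S (cutoff p q n)" for S p q n
    using smoothR_cutoff[of p q n] unfolding smoothR_def by (metis CkR.simps(1) continuous_on_subset subset_UNIV)
  \<comment> \<open>Seen from the exterior the source lies entirely at smaller radii. So only the
    term with \<open>psi\<close> remains, and its coefficient \<open>K n\<close> does not depend on
    \<open>s\<close>.\<close>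
  have Sol: "Sol M (s\<^sub>n n) s = - (1/4) * K n * hpsi M 2 s" if s: "re\<^sup>2 < s" "s < R\<^sup>2" for n s
  proof -
    have z: "s\<^sub>n n t = 0" if "t \<notin> {ri\<^sup>2<..<re\<^sup>2}" for t by (simp add: s\<^sub>n_def cutoff_outside[OF that])
    have "integral {s..R\<^sup>2} (\<lambda>t. psi M t * (s\<^sub>n n t * t ^ M)) = integral {s..R\<^sup>2} (\<lambda>t. 0)"
      by (rule Henstock_Kurzweil_Integration.integral_cong) (use s z in auto)
    moreover have "integral {0..s} (\<lambda>t. phi M t * (s\<^sub>n n t * t ^ M)) = K n"
    proof -
      have e: "phi M t * (s\<^sub>n n t * t ^ M) = (if t \<in> {ri\<^sup>2..re\<^sup>2} then (re\<^sup>2) ^ M * (cutoff (ri\<^sup>2) (re\<^sup>2) n t * t powr (- real M)) else 0)" for t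
      proof (cases "t \<in> {ri\<^sup>2<..<re\<^sup>2}")
        case True
        have t0: "t > 0" using True by (meson greaterThanLessThan_iff less_trans sq_pos(1))
        have "phi M t = (re\<^sup>2) ^ M / t ^ M" using True hphi_annulus[OF t0] by (simp add: phi_def region_def)
        then show ?thesis using True t0 by (simp add: s\<^sub>n_def)
      next
        case False
        then have "cutoff (ri\<^sup>2) (re\<^sup>2) n t = 0" by (rule cutoff_outside)
        then show ?thesis using z[OF False] by simp
      qed
      have "integral {0..s} (\<lambda>t. phi M t * (s\<^sub>n n t * t ^ M)) = integral {0..s} (\<lambda>t. if t \<in> {ri\<^sup>2..re\<^sup>2} then (re\<^sup>2) ^ M * (cutoff (ri\<^sup>2) (re\<^sup>2) n t * t powr (- real M)) else 0)"
        unfolding e ..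
      also have "\<dots> = integral ({ri\<^sup>2..re\<^sup>2} \<inter> {0..s}) (\<lambda>t. (re\<^sup>2) ^ M * (cutoff (ri\<^sup>2) (re\<^sup>2) n t * t powr (- real M)))"
        by (rule integral_restrict_Int)
      also have "{ri\<^sup>2..re\<^sup>2} \<inter> {0..s} = {ri\<^sup>2..re\<^sup>2}" using s sq_pos by auto
      finally show ?thesis by (simp add: K_def)
    qed
    moreover have "phi M s = 1 \<and> psi M s = hpsi M 2 s"
      using s sq_pos by (simp add: phi_def psi_def region_def hphi_def al_def be_def)
    ultimately show ?thesis by (simp add: Sol_def)
  qed
  have pair: "lebint B (\<lambda>x. u x * radial_mode (s\<^sub>n n) m x) = of_real (- (1/4) * K n * pi * I_int a b M) * c (- m)" for n
  proof -
    note P = L1_closure_pairing[OF uf adm[of n], of m, folded M_def]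
    have "lebint B (\<lambda>x. g x * radial_mode (Sol M (s\<^sub>n n)) m x)
      = of_real (pi * lborint (\<lambda>s. indicator {a\<^sup>2<..<b\<^sup>2} s * ((- (1/4) * K n * hpsi M 2 s) * sqrt s ^ nat \<bar>m\<bar>))) * c (- m)"
    proof (rule source_pairing[OF P(2)])
      fix x :: "real^2" assume x: "a < norm x" "norm x < b"
      have "re\<^sup>2 < (norm x)\<^sup>2" "(norm x)\<^sup>2 < R\<^sup>2" using x ab ri re by (auto intro!: power_strict_mono)
      then show "radial_mode (Sol M (s\<^sub>n n)) m x = radial_mode (\<lambda>s. - (1/4) * K n * hpsi M 2 s) m x"
        by (simp add: radial_mode_def Sol)
    qed measurable
    also have "(\<lambda>s. indicator {a\<^sup>2<..<b\<^sup>2} s * ((- (1/4) * K n * hpsi M 2 s) * sqrt s ^ nat \<bar>m\<bar>))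
        = (\<lambda>s. (- (1/4) * K n) * (indicator {a\<^sup>2<..<b\<^sup>2} s * (hpsi M 2 s * sqrt s ^ M)))"
      by (rule ext) (simp add: M_def)
    also have "lborint \<dots> = (- (1/4) * K n) * I_int a b M"
      unfolding I_int_def by (rule integral_mult_right_zero)
    finally show ?thesis unfolding P(1) by (simp add: mult_ac)
  qed
  have Klim: "K \<longlonglongrightarrow> (re\<^sup>2) ^ M * J_int M"
  proof -
    let ?G = "\<lambda>t. (re\<^sup>2) ^ M * (indicator {ri\<^sup>2<..<re\<^sup>2} t * t powr (- real M))"
    have "(\<lambda>n. integral {ri\<^sup>2..re\<^sup>2} (\<lambda>t. (re\<^sup>2) ^ M * (cutoff (ri\<^sup>2) (re\<^sup>2) n t * t powr (- real M)))) \<longlonglongrightarrow> integral {ri\<^sup>2..re\<^sup>2} ?G"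
    proof (rule dominated_convergence(2)[where h="\<lambda>t. (re\<^sup>2) ^ M * t powr (- real M)"])
      show "(\<lambda>t. (re\<^sup>2) ^ M * (cutoff (ri\<^sup>2) (re\<^sup>2) n t * t powr (- real M))) integrable_on {ri\<^sup>2..re\<^sup>2}" for n
        by (rule integrable_continuous_real) (use sq_pos in \<open>auto intro!: continuous_intros cc\<close>)
      show "(\<lambda>t. (re\<^sup>2) ^ M * t powr (- real M)) integrable_on {ri\<^sup>2..re\<^sup>2}"
        by (rule integrable_continuous_real) (use sq_pos in \<open>auto intro!: continuous_intros\<close>)
      show "norm ((re\<^sup>2) ^ M * (cutoff (ri\<^sup>2) (re\<^sup>2) n t * t powr (- real M))) \<le> (re\<^sup>2) ^ M * t powr (- real M)" for n t
        using cutoff_bounds[of "ri\<^sup>2" "re\<^sup>2" n t] by (simp add: abs_mult mult_left_le_one_le mult_left_mono)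
      show "(\<lambda>n. (re\<^sup>2) ^ M * (cutoff (ri\<^sup>2) (re\<^sup>2) n t * t powr (- real M))) \<longlonglongrightarrow> ?G t" for t
        by (intro tendsto_mult tendsto_const cutoff_tendsto)
    qed
    also have "integral {ri\<^sup>2..re\<^sup>2} ?G = (re\<^sup>2) ^ M * J_int M"
    proof -
      have "set_integrable lborel {ri\<^sup>2..re\<^sup>2} (\<lambda>t. t powr (- real M))"
        by (rule borel_integrable_atLeastAtMost') (use sq_pos in \<open>auto intro!: continuous_intros\<close>)
      then have si: "set_integrable lborel {ri\<^sup>2<..<re\<^sup>2} (\<lambda>t. t powr (- real M))" by (rule set_integrable_subset) auto
      have "J_int M = integral {ri\<^sup>2<..<re\<^sup>2} (\<lambda>t. t powr (- real M))"
        using set_borel_integral_eq_integral(2)[OF si] by (simp add: J_int_def set_lebesgue_integral_def)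
      also have "\<dots> = integral {ri\<^sup>2<..<re\<^sup>2} (\<lambda>t. indicator {ri\<^sup>2<..<re\<^sup>2} t * t powr (- real M))"
        by (rule Henstock_Kurzweil_Integration.integral_cong) simp
      also have "\<dots> = integral {ri\<^sup>2..re\<^sup>2} (\<lambda>t. indicator {ri\<^sup>2<..<re\<^sup>2} t * t powr (- real M))"
        by (rule integral_open_interval_real[symmetric])
      finally show ?thesis by simp
    qed
    finally show ?thesis unfolding K_def[abs_def] .
  qed
  have T: "L2_tendsto B (\<lambda>n. radial_mode (s\<^sub>n n) m) (radial_mode (\<sigma> m) m)"
  proof (rule L2_tendsto_dominated)
    show "radial_mode (s\<^sub>n n) m \<in> borel_measurable (lebesgue_on B)" for n
      by (rule L2_measurable[OF radial_mode_admissible_L2[OF adm]])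
    show "radial_mode (\<sigma> m) m \<in> borel_measurable (lebesgue_on B)"
      unfolding \<sigma>_def by (rule radial_mode_measurable(2)) measurable
    have bd: "\<bar>s\<^sub>n n s\<bar> \<le> (ri\<^sup>2) powr (- real M)" for n s
    proof (cases "s \<in> {ri\<^sup>2<..<re\<^sup>2}")
      case True
      have "s powr (- real M) \<le> (ri\<^sup>2) powr (- real M)" using True sq_pos by (intro powr_mono2') auto
      then show ?thesis using cutoff_bounds[of "ri\<^sup>2" "re\<^sup>2" n s] mult_mono[of "cutoff (ri\<^sup>2) (re\<^sup>2) n s" 1 "s powr (- real M)" "(ri\<^sup>2) powr (- real M)"]
        by (simp add: s\<^sub>n_def abs_mult)
    next
      case False then show ?thesis by (simp add: s\<^sub>n_def cutoff_outside)
    qed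
    show "cmod (radial_mode (s\<^sub>n n) m x) \<le> (ri\<^sup>2) powr (- real M) * R ^ nat \<bar>m\<bar>" if "x \<in> B" for n x
      by (rule radial_mode_bound[OF bd that])
    show "(\<lambda>n. radial_mode (s\<^sub>n n) m x) \<longlonglongrightarrow> radial_mode (\<sigma> m) m x" for x
      unfolding radial_mode_def s\<^sub>n_def \<sigma>_def M_def
      by (intro tendsto_mult tendsto_of_real tendsto_const cutoff_tendsto)
  qed simp
  show "radial_mode (\<sigma> m) m \<in> L2 B" using T by (simp add: L2_tendsto_def)
  have "(\<lambda>n. lebint B (\<lambda>x. u x * radial_mode (s\<^sub>n n) m x)) \<longlonglongrightarrow> lebint B (\<lambda>x. u x * radial_mode (\<sigma> m) m x)"
    using L2_tendsto_pairing[OF T uL] by (simp only: mult.commute)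
  moreover have "(\<lambda>n. complex_of_real (- (1/4) * K n * pi * I_int a b M) * c (- m)) \<longlonglongrightarrow> of_real (- (1/4) * ((re\<^sup>2) ^ M * J_int M) * pi * I_int a b M) * c (- m)"
    by (intro tendsto_mult tendsto_of_real tendsto_const Klim)
  ultimately have "lebint B (\<lambda>x. u x * radial_mode (\<sigma> m) m x) = of_real (- (1/4) * ((re\<^sup>2) ^ M * J_int M) * pi * I_int a b M) * c (- m)"
    unfolding pair by (rule LIMSEQ_unique)
  then show "lebint B (\<lambda>x. u x * radial_mode (\<sigma> m) m x)
    = - of_real ((1/4) * (re\<^sup>2) ^ nat \<bar>m\<bar> * J_int (nat \<bar>m\<bar>) * pi * I_int a b (nat \<bar>m\<bar>)) * c (- m)"
    by (simp add: M_def)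
qed

lemma cnj_radial_mode: "cnj (radial_mode F m x) = radial_mode F (- m) x"
  by (simp add: radial_mode_def zmode_cnj)

text \<open>In Bessel's inequality for the annulus modes each term equals
  \<open>pi / 16 * re^(4M) * J * I^2 * |h_m|^2\<close>, where \<open>J\<close> and \<open>I\<close>
  are the annulus and the source integral. Their lower bounds turn it into a multiple of the term of
  the series.\<close>

lemma summability_necessary:
  assumes uf: "(u, g) \<in> L1_closure ri re R"
  shows "summability_condition ri re a h"
proof -
  have uL: "u \<in> L2 B" using uf unfolding L1_closure_def by (auto simp: L2_tendsto_def)
  let ?\<sigma> = "\<lambda>(m::int) s. indicator {ri\<^sup>2<..<re\<^sup>2} s * s powr (- real (nat \<bar>m\<bar>))"
  define e where "e m = radial_mode (?\<sigma> m) m" for m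
  note AP = annulus_pairing[OF uf]
  have eL: "e m \<in> L2 B" for m unfolding e_def by (rule AP(2))
  have \<sigma>m: "?\<sigma> m \<in> borel_measurable borel" for m by measurable
  have inner0: "L2_inner B (e m) (e n) = 0" if "m \<noteq> n" for m n
    using radial_mode_inner[OF R_gt \<sigma>m eL[unfolded e_def] \<sigma>m eL[unfolded e_def], of m n] that by (simp add: e_def)
  have norm: "(L2_norm B (e m))\<^sup>2 = pi * J_int (nat \<bar>m\<bar>)" for m
  proof -
    have "(\<lambda>s. indicator {0<..<R\<^sup>2} s * ((?\<sigma> m s)\<^sup>2 * s ^ nat \<bar>m\<bar>)) = (\<lambda>s. indicator {ri\<^sup>2<..<re\<^sup>2} s * s powr (- real (nat \<bar>m\<bar>)))"
    proof (rule ext)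
      fix s :: real
      show "indicator {0<..<R\<^sup>2} s * ((?\<sigma> m s)\<^sup>2 * s ^ nat \<bar>m\<bar>) = indicator {ri\<^sup>2<..<re\<^sup>2} s * s powr (- real (nat \<bar>m\<bar>))"
      proof (cases "s \<in> {ri\<^sup>2<..<re\<^sup>2}")
        case True
        have s: "0 < s" "s < R\<^sup>2" using True by (meson greaterThanLessThan_iff less_trans sq_pos)+
        define M where "M = nat \<bar>m\<bar>"
        have "(s powr (- real M))\<^sup>2 * s ^ M = s powr (- real M)"
          using s by (simp add: powr_minus powr_realpow power2_eq_square)
        then show ?thesis using True s unfolding M_def[symmetric] by simp
      qed simp
    qed
    then show ?thesis using radial_mode_norm[OF R_gt \<sigma>m eL[unfolded e_def], of m] by (simp add: e_def J_int_def)
  qed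
  obtain c1 where c1: "c1 > 0" "\<And>M. M \<ge> 1 \<Longrightarrow> c1 / (ri\<^sup>2) ^ M / real M \<le> J_int M" using J_int_lower by blast
  obtain c2 where c2: "c2 > 0" "\<And>M. M \<ge> 1 \<Longrightarrow> c2 / a ^ M / (real M)\<^sup>2 \<le> I_int a b M" using I_int_lower[OF ab] by blast
  \<comment> \<open>The \<open>1/16\<close> is the square of the \<open>1/4\<close> in
    \<open>Sol\<close>. Of the five powers of \<open>M\<close>, one comes from \<open>J\<close> and
    two from each factor \<open>I\<close>.\<close>
  define k where "k = pi / 16 * c1 * c2\<^sup>2"
  have k: "k > 0" using c1 c2 by (simp add: k_def)
  let ?t = "\<lambda>m::int. (cmod (c m))\<^sup>2 / \<bar>real_of_int m\<bar> ^ 5 * (re\<^sup>2 / (ri * a)) ^ (2 * nat \<bar>m\<bar>)"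
  have tm: "k * ?t m \<le> (cmod (L2_inner B u (e m)))\<^sup>2 / (L2_norm B (e m))\<^sup>2" and Jp: "L2_norm B (e m) \<noteq> 0" if m: "m \<noteq> 0" for m
  proof -
    define M where "M = nat \<bar>m\<bar>"
    have M: "M \<ge> 1" using m by (simp add: M_def)
    have J: "c1 / (ri\<^sup>2) ^ M / real M \<le> J_int M" "0 < c1 / (ri\<^sup>2) ^ M / real M" using c1 M ri by auto
    have I: "c2 / a ^ M / (real M)\<^sup>2 \<le> I_int a b M" "0 < c2 / a ^ M / (real M)\<^sup>2" using c2 M a_pos by auto
    have Jpos: "J_int M > 0" using J by linarith
    show "L2_norm B (e m) \<noteq> 0"
    proof
      assume "L2_norm B (e m) = 0"
      then show False using norm[of m] Jpos by (simp add: M_def)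
    qed
    \<comment> \<open>Conjugation changes \<open>m\<close> into \<open>- m\<close>, and the pairing
      with \<open>g\<close> changes it back, so the coefficient is \<open>c m\<close>.\<close>
    have "L2_inner B u (e m) = lebint B (\<lambda>x. u x * radial_mode (?\<sigma> (- m)) (- m) x)"
      unfolding L2_inner_def e_def cnj_radial_mode by simp
    also have "\<dots> = - of_real ((1/4) * (re\<^sup>2) ^ M * J_int M * pi * I_int a b M) * c m"
      using AP(1)[of "- m"] by (simp add: M_def)
    finally have L: "L2_inner B u (e m) = - of_real ((1/4) * (re\<^sup>2) ^ M * J_int M * pi * I_int a b M) * c m" .
    have "0 \<le> I_int a b M" using I by linarith
    then have "0 \<le> (1/4) * (re\<^sup>2) ^ M * J_int M * pi * I_int a b M" using Jpos by simp
    then have L': "cmod (L2_inner B u (e m)) = (1/4) * (re\<^sup>2) ^ M * J_int M * pi * I_int a b M * cmod (c m)"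
      unfolding L by (simp only: norm_mult norm_minus_cancel norm_of_real abs_of_nonneg)
    have aux: "((1/4) * r * J * p * I * k)\<^sup>2 / (p * J) = p / 16 * r\<^sup>2 * J * I\<^sup>2 * k\<^sup>2" if "J > 0" "p > 0" for r J p I k :: real
      using that by (simp add: power2_eq_square)
    have "(cmod (L2_inner B u (e m)))\<^sup>2 / (L2_norm B (e m))\<^sup>2 = pi / 16 * ((re\<^sup>2) ^ M)\<^sup>2 * J_int M * (I_int a b M)\<^sup>2 * (cmod (c m))\<^sup>2"
      unfolding norm M_def[symmetric] L' by (rule aux[OF Jpos pi_gt_zero])
    moreover have "k * ?t m = pi / 16 * ((re\<^sup>2) ^ M)\<^sup>2 * (c1 / (ri\<^sup>2) ^ M / real M) * (c2 / a ^ M / (real M)\<^sup>2)\<^sup>2 * (cmod (c m))\<^sup>2"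
    proof -
      have am: "\<bar>real_of_int m\<bar> = real M" by (simp add: M_def)
      have q: "(re\<^sup>2 / (ri * a)) ^ (2 * M) = ((re\<^sup>2) ^ M)\<^sup>2 / ((ri\<^sup>2) ^ M * (a ^ M)\<^sup>2)"
        by (simp add: power_divide power_mult_distrib power_mult[symmetric] mult.commute)
      show ?thesis unfolding am q M_def[symmetric] k_def using M ri a_pos
        by (simp add: power_divide power2_eq_square power_numeral_reduce mult_ac)
    qed
    moreover have "pi / 16 * ((re\<^sup>2) ^ M)\<^sup>2 * (c1 / (ri\<^sup>2) ^ M / real M) * (c2 / a ^ M / (real M)\<^sup>2)\<^sup>2 * (cmod (c m))\<^sup>2
       \<le> pi / 16 * ((re\<^sup>2) ^ M)\<^sup>2 * J_int M * (I_int a b M)\<^sup>2 * (cmod (c m))\<^sup>2"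
    proof -
      have "(c1 / (ri\<^sup>2) ^ M / real M) * (c2 / a ^ M / (real M)\<^sup>2)\<^sup>2 \<le> J_int M * (I_int a b M)\<^sup>2"
        using J I by (intro mult_mono power_mono) auto
      then have "pi / 16 * ((re\<^sup>2) ^ M)\<^sup>2 * ((c1 / (ri\<^sup>2) ^ M / real M) * (c2 / a ^ M / (real M)\<^sup>2)\<^sup>2) * (cmod (c m))\<^sup>2
         \<le> pi / 16 * ((re\<^sup>2) ^ M)\<^sup>2 * (J_int M * (I_int a b M)\<^sup>2) * (cmod (c m))\<^sup>2"
        by (intro mult_right_mono mult_left_mono) auto
      then show ?thesis by (simp only: mult.assoc)
    qed
    ultimately show "k * ?t m \<le> (cmod (L2_inner B u (e m)))\<^sup>2 / (L2_norm B (e m))\<^sup>2" by linarith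
  qed
  have "?t summable_on (UNIV - {0})"
  proof (rule nonneg_bdd_above_summable_on)
    show "bdd_above (sum ?t ` {F. F \<subseteq> UNIV - {0} \<and> finite F})"
    proof (rule bdd_aboveI2)
      fix F :: "int set" assume F: "F \<in> {F. F \<subseteq> UNIV - {0} \<and> finite F}"
      have "k * sum ?t F \<le> (\<Sum>m\<in>F. (cmod (L2_inner B u (e m)))\<^sup>2 / (L2_norm B (e m))\<^sup>2)"
        unfolding sum_distrib_left by (rule sum_mono) (use F tm in auto)
      also have "\<dots> \<le> (L2_norm B u)\<^sup>2"
        proof (rule L2_bessel)
        show "finite F" using F by simp
        show "L2_norm B (e m) \<noteq> 0" if "m \<in> F" for m using Jp[of m] F that by blast
      qed (rule eL uL inner0, assumption?)+
      finally show "sum ?t F \<le> (L2_norm B u)\<^sup>2 / k" using k by (simp add: field_simps)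
    qed
  qed (use a_pos ri in auto)
  then show ?thesis unfolding summability_condition_def .
qed

end

section \<open>Sufficiency of the summability condition\<close>


context source
begin

text \<open>The mode solutions are estimated for the sharp weight \<open>ind\<close> and its smooth approximations \<open>cutab n\<close>
  at once; since the weight is supported outside the interface, \<open>phi\<close> and \<open>psi\<close> enter the integrals
  only through their exterior formulas.\<close>

definition sub_ind :: "(real \<Rightarrow> real) \<Rightarrow> bool" where
  "sub_ind \<kappa> \<longleftrightarrow> \<kappa> \<in> borel_measurable borel \<and> (\<forall>t. 0 \<le> \<kappa> t \<and> \<kappa> t \<le> indicator {a\<^sup>2<..<b\<^sup>2} t)"

text \<open>The weight \<open>t^M\<close> of \<open>Sol\<close> times the profile
  \<open>t^(-M/2)\<close> of a pure character leaves \<open>sqrt t ^ M\<close>. In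
  \<open>inner_int\<close> the factor \<open>phi\<close> is \<open>1\<close>.\<close>

definition outer_int :: "(real \<Rightarrow> real) \<Rightarrow> nat \<Rightarrow> real \<Rightarrow> real" where
  "outer_int \<kappa> M s = lborint (\<lambda>t. if s \<le> t then \<kappa> t * (hpsi M 2 t * sqrt t ^ M) else 0)"

definition inner_int :: "(real \<Rightarrow> real) \<Rightarrow> nat \<Rightarrow> real \<Rightarrow> real" where
  "inner_int \<kappa> M s = lborint (\<lambda>t. if t \<le> s then \<kappa> t * sqrt t ^ M else 0)"

definition Sol_ind :: "(real \<Rightarrow> real) \<Rightarrow> nat \<Rightarrow> real \<Rightarrow> real" where
  "Sol_ind \<kappa> M s = - (1/4) * (phi M s * outer_int \<kappa> M s + psi M s * inner_int \<kappa> M s)"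

abbreviation "ind \<equiv> indicator {a\<^sup>2<..<b\<^sup>2} :: real \<Rightarrow> real"
abbreviation "cutab \<equiv> cutoff (a\<^sup>2) (b\<^sup>2)"
abbreviation "L M \<equiv> hpsi M 2 (re\<^sup>2)"

lemma sub_ind_ind: "sub_ind ind" by (simp add: sub_ind_def)

lemma sub_ind_cutoff: "sub_ind (cutab n)"
proof -
  have "continuous_on UNIV (cutab n)"
    using smoothR_cutoff[of "a\<^sup>2" "b\<^sup>2" n] unfolding smoothR_def by (metis CkR.simps(1))
  then have "cutab n \<in> borel_measurable borel" by (rule borel_measurable_continuous_onI)
  moreover have "cutab n t \<le> ind t" for t
    using cutoff_bounds(2)[of "a\<^sup>2" "b\<^sup>2" n t] cutoff_outside[of t "a\<^sup>2" "b\<^sup>2" n] by (cases "t \<in> {a\<^sup>2<..<b\<^sup>2}") auto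
  ultimately show ?thesis by (simp add: sub_ind_def cutoff_bounds)
qed

lemma sub_ind_D:
  assumes "sub_ind \<kappa>"
  shows "\<kappa> \<in> borel_measurable borel" "0 \<le> \<kappa> t" "\<kappa> t \<le> 1" "t \<notin> {a\<^sup>2<..<b\<^sup>2} \<Longrightarrow> \<kappa> t = 0"
proof -
  have *: "0 \<le> \<kappa> t" "\<kappa> t \<le> ind t" using assms by (auto simp: sub_ind_def)
  show "\<kappa> \<in> borel_measurable borel" using assms by (simp add: sub_ind_def)
  show "0 \<le> \<kappa> t" by (rule *)
  show "\<kappa> t \<le> 1" by (rule order_trans[OF *(2)]) (simp add: indicator_def)
  show "\<kappa> t = 0" if "t \<notin> {a\<^sup>2<..<b\<^sup>2}" using * that by simp
qed

lemma norm_le_of_nonneg: "0 \<le> x \<Longrightarrow> x \<le> y \<Longrightarrow> norm x \<le> norm (y::real)"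
  by simp

lemma ind_pos: "t \<in> {a\<^sup>2<..<b\<^sup>2} \<Longrightarrow> 0 < t \<and> re\<^sup>2 < t \<and> t < R\<^sup>2"
  by (meson greaterThanLessThan_iff le_less_trans less_le_trans less_trans ab_sq)

lemma hpsi_outer_mono: "0 < s \<Longrightarrow> s \<le> t \<Longrightarrow> hpsi M 2 t \<le> hpsi M 2 s"
  unfolding hpsi_outer using E_fun_mono[of s t M] by simp

lemma L_nonneg: "0 \<le> L M" by (rule hpsi_outer_nonneg) (use sq_pos in auto)

lemma sqrt_power_le: "t \<le> R\<^sup>2 \<Longrightarrow> 0 \<le> t \<Longrightarrow> sqrt t ^ M \<le> R ^ M"
  using real_sqrt_le_mono[of t "R\<^sup>2"] R_gt by (intro power_mono) auto

lemma integrand_bounds: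
  assumes t: "t \<in> {a\<^sup>2<..<b\<^sup>2}"
  shows "0 \<le> hpsi M 2 t * sqrt t ^ M" "hpsi M 2 t * sqrt t ^ M \<le> L M * R ^ M" "0 \<le> sqrt t ^ M" "sqrt t ^ M \<le> R ^ M"
proof -
  note p = ind_pos[OF t]
  have 1: "0 \<le> hpsi M 2 t" "hpsi M 2 t \<le> L M"
    using p hpsi_outer_nonneg[of t M] hpsi_outer_mono[of "re\<^sup>2" t M] sq_pos by auto
  show 3: "0 \<le> sqrt t ^ M" using p by simp
  show 4: "sqrt t ^ M \<le> R ^ M" using p by (intro sqrt_power_le) auto
  show "0 \<le> hpsi M 2 t * sqrt t ^ M" using 1 3 by simp
  show "hpsi M 2 t * sqrt t ^ M \<le> L M * R ^ M" using 1 3 4 by (intro mult_mono L_nonneg) auto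
qed

lemma ind_integral: "integrable lborel (\<lambda>t. ind t * k)" "lborint (\<lambda>t. ind t * k) = (b\<^sup>2 - a\<^sup>2) * k"
  using ab_sq by (auto intro!: integrable_mult_left integrable_real_indicator)

lemma ind_integral_le: "0 \<le> k \<Longrightarrow> lborint (\<lambda>t. ind t * k) \<le> R\<^sup>2 * k"
  unfolding ind_integral using ab_sq(3) zero_le_power2[of a] by (intro mult_right_mono) linarith+

lemma outer_int_integrand:
  fixes M :: nat
  assumes \<kappa>: "sub_ind \<kappa>"
  defines "f \<equiv> \<lambda>s t. if s \<le> t then \<kappa> t * (hpsi M 2 t * sqrt t ^ M) else 0"
  shows "f s \<in> borel_measurable borel" "0 \<le> f s t" "f s t \<le> ind t * (L M * R ^ M)" "integrable lborel (f s)"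
    and "f s t \<le> ind t * (hpsi M 2 t * sqrt t ^ M)"
proof -
  note [measurable] = sub_ind_D(1)[OF \<kappa>]
  show m: "f s \<in> borel_measurable borel" unfolding f_def by measurable
  have *: "0 \<le> f s t \<and> f s t \<le> ind t * (hpsi M 2 t * sqrt t ^ M) \<and> f s t \<le> ind t * (L M * R ^ M)" for t
  proof (cases "t \<in> {a\<^sup>2<..<b\<^sup>2}")
    case True
    note i = integrand_bounds[OF True, of M] and c = sub_ind_D(2,3)[OF \<kappa>, of t]
    have "\<kappa> t * (hpsi M 2 t * sqrt t ^ M) \<le> 1 * (hpsi M 2 t * sqrt t ^ M)" using i c by (intro mult_right_mono) auto
    moreover have "0 \<le> \<kappa> t * (hpsi M 2 t * sqrt t ^ M)" using i c by simp
    ultimately show ?thesis using True i by (auto simp: f_def)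
  next
    case False then show ?thesis using sub_ind_D(4)[OF \<kappa> False] by (simp add: f_def)
  qed
  show "0 \<le> f s t" "f s t \<le> ind t * (L M * R ^ M)" "f s t \<le> ind t * (hpsi M 2 t * sqrt t ^ M)" using * by auto
  show "integrable lborel (f s)"
  proof (rule Bochner_Integration.integrable_bound[OF ind_integral(1)[of "L M * R ^ M"]])
    show "AE t in lborel. norm (f s t) \<le> norm (ind t * (L M * R ^ M))" by (rule AE_I2, rule norm_le_of_nonneg) (use * in blast)+
  qed (use m in simp)
qed

lemma inner_int_integrand:
  fixes M :: nat
  assumes \<kappa>: "sub_ind \<kappa>"
  defines "f \<equiv> \<lambda>s t. if t \<le> s then \<kappa> t * sqrt t ^ M else 0"
  shows "f s \<in> borel_measurable borel" "0 \<le> f s t" "f s t \<le> ind t * R ^ M" "integrable lborel (f s)"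
    and "0 \<le> s \<Longrightarrow> f s t \<le> ind t * sqrt s ^ M"
proof -
  note [measurable] = sub_ind_D(1)[OF \<kappa>]
  show m: "f s \<in> borel_measurable borel" unfolding f_def by measurable
  have *: "0 \<le> f s t \<and> f s t \<le> ind t * R ^ M \<and> (0 \<le> s \<longrightarrow> f s t \<le> ind t * sqrt s ^ M)" for t
  proof (cases "t \<in> {a\<^sup>2<..<b\<^sup>2}")
    case True
    note i = integrand_bounds(3,4)[OF True, of M] and c = sub_ind_D(2,3)[OF \<kappa>, of t]
    have 1: "\<kappa> t * sqrt t ^ M \<le> 1 * sqrt t ^ M" using i c by (intro mult_right_mono) auto
    have 2: "0 \<le> \<kappa> t * sqrt t ^ M" using i c by simp
    have 3: "sqrt t ^ M \<le> sqrt s ^ M" if "t \<le> s" using ind_pos[OF True] that by (intro power_mono) auto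
    have 4: "0 \<le> sqrt s ^ M" if "0 \<le> s" using that by simp
    have 5: "0 \<le> R ^ M" using R_gt by simp
    show ?thesis using True i 1 2 3 4 5 by (auto simp: f_def)
  next
    case False then show ?thesis using sub_ind_D(4)[OF \<kappa> False] by (simp add: f_def)
  qed
  show "0 \<le> f s t" "f s t \<le> ind t * R ^ M" "0 \<le> s \<Longrightarrow> f s t \<le> ind t * sqrt s ^ M" using * by auto
  show "integrable lborel (f s)"
  proof (rule Bochner_Integration.integrable_bound[OF ind_integral(1)[of "R ^ M"]])
    show "AE t in lborel. norm (f s t) \<le> norm (ind t * R ^ M)" by (rule AE_I2, rule norm_le_of_nonneg) (use * in blast)+
  qed (use m in simp)
qed

text \<open>The third bound has the sharp size \<open>a^(-M) / M^2\<close> and governs core and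
  annulus. The fourth is adapted to the exterior, where the powers of \<open>s\<close> will cancel.
  The second, not uniform in \<open>M\<close>, provides integrability and majorants.\<close>

lemma outer_int_bounds:
  assumes \<kappa>: "sub_ind \<kappa>"
  shows "0 \<le> outer_int \<kappa> M s" "outer_int \<kappa> M s \<le> R\<^sup>2 * (L M * R ^ M)"
    and "M \<ge> 1 \<Longrightarrow> outer_int \<kappa> M s \<le> 2 * R\<^sup>2 / a ^ M / (real M)\<^sup>2"
    and "M \<ge> 1 \<Longrightarrow> s > 0 \<Longrightarrow> outer_int \<kappa> M s \<le> R\<^sup>2 * s powr (- (real M / 2))"
proof -
  note i = outer_int_integrand[OF \<kappa>, where s=s and M=M]
  show "0 \<le> outer_int \<kappa> M s" unfolding outer_int_def by (rule integral_nonneg_AE) (intro AE_I2 i(2))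
  have "outer_int \<kappa> M s \<le> lborint (\<lambda>t. ind t * (L M * R ^ M))"
    unfolding outer_int_def by (rule integral_mono[OF i(4) ind_integral(1) i(3)])
  also have "\<dots> \<le> R\<^sup>2 * (L M * R ^ M)" by (rule ind_integral_le) (use L_nonneg R_gt in auto)
  finally show "outer_int \<kappa> M s \<le> R\<^sup>2 * (L M * R ^ M)" .
  { assume M: "M \<ge> 1"
    have int: "integrable lborel (\<lambda>t. ind t * t powr (- (real M / 2)))" by (rule integrable_powr_interval[OF ab_sq(4)])
    have le: "(if s \<le> t then \<kappa> t * (hpsi M 2 t * sqrt t ^ M) else 0) \<le> ind t * t powr (- (real M / 2)) * (1 / real M)" for t
    proof (cases "t \<in> {a\<^sup>2<..<b\<^sup>2}")
      case True
      have "t > 0" using ind_pos[OF True] by simp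
      from outer_integrand_le[OF M this] i(5)[of t] True show ?thesis by simp
    next
      case False then show ?thesis using sub_ind_D(4)[OF \<kappa> False] by simp
    qed
    have "outer_int \<kappa> M s \<le> lborint (\<lambda>t. ind t * t powr (- (real M / 2)) * (1 / real M))"
      unfolding outer_int_def by (rule integral_mono[OF i(4) integrable_mult_left[OF int] le])
    also have "\<dots> = lborint (\<lambda>t. ind t * t powr (- (real M / 2))) * (1 / real M)" by (rule integral_mult_left_zero)
    also have "\<dots> \<le> (b\<^sup>2 * (a\<^sup>2) powr (- (real M / 2)) / (real M / 2)) * (1 / real M)"
      by (intro mult_right_mono powr_neg_upper) (use ab_sq M in auto)
    also have "(a\<^sup>2) powr (- (real M / 2)) = 1 / a ^ M"
      using sqrt_power_powr[OF ab_sq(4), of M] a_pos by (simp add: powr_minus inverse_eq_divide)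
    also have "b\<^sup>2 * (1 / a ^ M) / (real M / 2) * (1 / real M) = 2 * b\<^sup>2 / a ^ M / (real M)\<^sup>2"
      by (simp add: power2_eq_square mult_ac)
    also have "\<dots> \<le> 2 * R\<^sup>2 / a ^ M / (real M)\<^sup>2"
      using ab_sq a_pos by (intro divide_right_mono) auto
    finally show "outer_int \<kappa> M s \<le> 2 * R\<^sup>2 / a ^ M / (real M)\<^sup>2" .
    assume s: "s > 0"
    have le2: "(if s \<le> t then \<kappa> t * (hpsi M 2 t * sqrt t ^ M) else 0) \<le> ind t * s powr (- (real M / 2))" for t
    proof (cases "s \<le> t")
      case True
      have "t powr (- (real M / 2)) * (1 / real M) \<le> t powr (- (real M / 2)) * 1"
        using M by (intro mult_left_mono) auto
      also have "\<dots> \<le> s powr (- (real M / 2))" using True s by (simp add: powr_mono2')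
      finally have "ind t * (t powr (- (real M / 2)) * (1 / real M)) \<le> ind t * s powr (- (real M / 2))"
        by (intro mult_left_mono) auto
      then show ?thesis using le[of t] by simp
    qed simp
    have "outer_int \<kappa> M s \<le> lborint (\<lambda>t. ind t * s powr (- (real M / 2)))"
      unfolding outer_int_def by (rule integral_mono[OF i(4) ind_integral(1) le2])
    also have "\<dots> \<le> R\<^sup>2 * s powr (- (real M / 2))" by (rule ind_integral_le) simp
    finally show "outer_int \<kappa> M s \<le> R\<^sup>2 * s powr (- (real M / 2))" . }
qed

lemma inner_int_bounds:
  assumes \<kappa>: "sub_ind \<kappa>"
  shows "0 \<le> inner_int \<kappa> M s" "inner_int \<kappa> M s \<le> R\<^sup>2 * R ^ M" "0 \<le> s \<Longrightarrow> inner_int \<kappa> M s \<le> R\<^sup>2 * sqrt s ^ M" "s \<le> a\<^sup>2 \<Longrightarrow> inner_int \<kappa> M s = 0"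
proof -
  note i = inner_int_integrand[OF \<kappa>, where s=s and M=M]
  show "0 \<le> inner_int \<kappa> M s" unfolding inner_int_def by (rule integral_nonneg_AE) (intro AE_I2 i(2))
  have "inner_int \<kappa> M s \<le> lborint (\<lambda>t. ind t * R ^ M)"
    unfolding inner_int_def by (rule integral_mono[OF i(4) ind_integral(1) i(3)])
  also have "\<dots> \<le> R\<^sup>2 * R ^ M" by (rule ind_integral_le) (use R_gt in auto)
  finally show "inner_int \<kappa> M s \<le> R\<^sup>2 * R ^ M" .
  { assume s: "0 \<le> s"
    have "inner_int \<kappa> M s \<le> lborint (\<lambda>t. ind t * sqrt s ^ M)"
      unfolding inner_int_def by (rule integral_mono[OF i(4) ind_integral(1) i(5)[OF s]])
    also have "\<dots> \<le> R\<^sup>2 * sqrt s ^ M" by (rule ind_integral_le) (use s in auto)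
    finally show "inner_int \<kappa> M s \<le> R\<^sup>2 * sqrt s ^ M" . }
  { assume s: "s \<le> a\<^sup>2"
    have "(\<lambda>t. if t \<le> s then \<kappa> t * sqrt t ^ M else 0) = (\<lambda>t. 0)"
    proof (rule ext)
      fix t show "(if t \<le> s then \<kappa> t * sqrt t ^ M else 0) = 0" using sub_ind_D(4)[OF \<kappa>, of t] s by auto
    qed
    then show "inner_int \<kappa> M s = 0" unfolding inner_int_def by simp }
qed

lemma outer_int_tendsto: "(\<lambda>n. outer_int (cutab n) M s) \<longlonglongrightarrow> outer_int ind M s"
  unfolding outer_int_def
proof (rule integral_dominated_convergence[where w="\<lambda>t. ind t * (L M * R ^ M)"])
  note i = outer_int_integrand[OF sub_ind_ind, where s=s and M=M]
  show "(\<lambda>t. if s \<le> t then ind t * (hpsi M 2 t * sqrt t ^ M) else 0) \<in> borel_measurable lborel" using i(1) by simp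
  show "(\<lambda>t. if s \<le> t then cutab n t * (hpsi M 2 t * sqrt t ^ M) else 0) \<in> borel_measurable lborel" for n using outer_int_integrand(1)[OF sub_ind_cutoff[of n], where s=s and M=M] by simp
  show "integrable lborel (\<lambda>t. ind t * (L M * R ^ M))" by (rule ind_integral)
  show "AE t in lborel. (\<lambda>n. if s \<le> t then cutab n t * (hpsi M 2 t * sqrt t ^ M) else 0) \<longlonglongrightarrow> (if s \<le> t then ind t * (hpsi M 2 t * sqrt t ^ M) else 0)"
  proof (rule AE_I2)
    fix t
    have "(\<lambda>n. cutab n t * (hpsi M 2 t * sqrt t ^ M)) \<longlonglongrightarrow> ind t * (hpsi M 2 t * sqrt t ^ M)"
      by (rule tendsto_mult[OF cutoff_tendsto tendsto_const])
    then show "(\<lambda>n. if s \<le> t then cutab n t * (hpsi M 2 t * sqrt t ^ M) else 0) \<longlonglongrightarrow> (if s \<le> t then ind t * (hpsi M 2 t * sqrt t ^ M) else 0)"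
      by (cases "s \<le> t") auto
  qed
  show "AE t in lborel. norm (if s \<le> t then cutab n t * (hpsi M 2 t * sqrt t ^ M) else 0) \<le> ind t * (L M * R ^ M)" for n
    using outer_int_integrand(2,3)[OF sub_ind_cutoff[of n], where s=s and M=M] by (intro AE_I2) (simp only: real_norm_def abs_of_nonneg)
qed

lemma inner_int_tendsto: "(\<lambda>n. inner_int (cutab n) M s) \<longlonglongrightarrow> inner_int ind M s"
  unfolding inner_int_def
proof (rule integral_dominated_convergence[where w="\<lambda>t. ind t * R ^ M"])
  note i = inner_int_integrand[OF sub_ind_ind, where s=s and M=M]
  show "(\<lambda>t. if t \<le> s then ind t * sqrt t ^ M else 0) \<in> borel_measurable lborel" using i(1) by simp
  show "(\<lambda>t. if t \<le> s then cutab n t * sqrt t ^ M else 0) \<in> borel_measurable lborel" for n using inner_int_integrand(1)[OF sub_ind_cutoff[of n], where s=s and M=M] by simp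
  show "integrable lborel (\<lambda>t. ind t * R ^ M)" by (rule ind_integral)
  show "AE t in lborel. (\<lambda>n. if t \<le> s then cutab n t * sqrt t ^ M else 0) \<longlonglongrightarrow> (if t \<le> s then ind t * sqrt t ^ M else 0)"
  proof (rule AE_I2)
    fix t
    have "(\<lambda>n. cutab n t * sqrt t ^ M) \<longlonglongrightarrow> ind t * sqrt t ^ M"
      by (rule tendsto_mult[OF cutoff_tendsto tendsto_const])
    then show "(\<lambda>n. if t \<le> s then cutab n t * sqrt t ^ M else 0) \<longlonglongrightarrow> (if t \<le> s then ind t * sqrt t ^ M else 0)"
      by (cases "t \<le> s") auto
  qed
  show "AE t in lborel. norm (if t \<le> s then cutab n t * sqrt t ^ M else 0) \<le> ind t * R ^ M" for n
    using inner_int_integrand(2,3)[OF sub_ind_cutoff[of n], where s=s and M=M] by (intro AE_I2) (simp only: real_norm_def abs_of_nonneg)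
qed

lemma Sol_ind_tendsto: "(\<lambda>n. Sol_ind (cutab n) M s) \<longlonglongrightarrow> Sol_ind ind M s"
  unfolding Sol_ind_def by (intro tendsto_mult tendsto_add tendsto_const outer_int_tendsto inner_int_tendsto)

lemma Sol_ind_measurable:
  assumes \<kappa>: "sub_ind \<kappa>" shows "Sol_ind \<kappa> M \<in> borel_measurable borel"
proof -
  note [measurable] = sub_ind_D(1)[OF \<kappa>]
  have 1[measurable]: "outer_int \<kappa> M \<in> borel_measurable borel" "inner_int \<kappa> M \<in> borel_measurable borel"
    unfolding outer_int_def[abs_def] inner_int_def[abs_def] by measurable
  have "(\<lambda>s. if s < ri\<^sup>2 then hphi M 0 s else if s < re\<^sup>2 then hphi M 1 s else hphi M 2 s) \<in> borel_measurable borel"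
    "(\<lambda>s. if s < ri\<^sup>2 then hpsi M 0 s else if s < re\<^sup>2 then hpsi M 1 s else hpsi M 2 s) \<in> borel_measurable borel"
    by measurable
  moreover have "(\<lambda>s. if s < ri\<^sup>2 then hphi M 0 s else if s < re\<^sup>2 then hphi M 1 s else hphi M 2 s) = phi M"
    "(\<lambda>s. if s < ri\<^sup>2 then hpsi M 0 s else if s < re\<^sup>2 then hpsi M 1 s else hpsi M 2 s) = psi M"
    by (rule ext, simp add: phi_def psi_def region_def)+
  ultimately have [measurable]: "phi M \<in> borel_measurable borel" "psi M \<in> borel_measurable borel" by simp_all
  show ?thesis unfolding Sol_ind_def[abs_def] by measurable
qed

text \<open>The gauge integrals of \<open>Sol\<close> become Lebesgue integrals, for which
  measurability in \<open>s\<close> and dominated convergence are at hand.\<close>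

lemma Sol_eq_Sol_ind:
  assumes \<kappa>: "sub_ind \<kappa>" and s: "0 \<le> s" "s \<le> R\<^sup>2"
  shows "Sol M (\<lambda>t. \<kappa> t * t powr (- (real M / 2))) s = Sol_ind \<kappa> M s"
proof -
  have pw: "t powr (- (real M / 2)) * t ^ M = sqrt t ^ M" if "t > 0" for t :: real
  proof -
    have "t powr (- (real M / 2)) * t powr (real M) = t powr (real M / 2)" unfolding powr_add[symmetric] by simp
    then show ?thesis using that by (simp add: powr_realpow sqrt_power_powr)
  qed
  have e1: "(\<lambda>t. indicator {s..R\<^sup>2} t *\<^sub>R (psi M t * (\<kappa> t * t powr (- (real M / 2)) * t ^ M)))
      = (\<lambda>t. if s \<le> t then \<kappa> t * (hpsi M 2 t * sqrt t ^ M) else 0)"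
  proof (rule ext)
    fix t
    show "indicator {s..R\<^sup>2} t *\<^sub>R (psi M t * (\<kappa> t * t powr (- (real M / 2)) * t ^ M)) = (if s \<le> t then \<kappa> t * (hpsi M 2 t * sqrt t ^ M) else 0)"
    proof (cases "t \<in> {a\<^sup>2<..<b\<^sup>2}")
      case True
      note p = ind_pos[OF True]
      have "psi M t = hpsi M 2 t" using p sq_pos by (simp add: psi_def region_def)
      then show ?thesis using p by (simp add: mult.assoc pw indicator_def mult.left_commute)
    qed (simp add: sub_ind_D(4)[OF \<kappa>])
  qed
  have e2: "(\<lambda>t. indicator {0..s} t *\<^sub>R (phi M t * (\<kappa> t * t powr (- (real M / 2)) * t ^ M)))
      = (\<lambda>t. if t \<le> s then \<kappa> t * sqrt t ^ M else 0)"
  proof (rule ext)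
    fix t
    show "indicator {0..s} t *\<^sub>R (phi M t * (\<kappa> t * t powr (- (real M / 2)) * t ^ M)) = (if t \<le> s then \<kappa> t * sqrt t ^ M else 0)"
    proof (cases "t \<in> {a\<^sup>2<..<b\<^sup>2}")
      case True
      note p = ind_pos[OF True]
      have "phi M t = 1" using p sq_pos by (simp add: phi_def region_def hphi_def al_def be_def)
      then show ?thesis using p by (simp add: mult.assoc pw indicator_def)
    qed (simp add: sub_ind_D(4)[OF \<kappa>])
  qed
  have "set_integrable lborel {s..R\<^sup>2} (\<lambda>t. psi M t * (\<kappa> t * t powr (- (real M / 2)) * t ^ M))"
    unfolding set_integrable_def e1 by (rule outer_int_integrand(4)[OF \<kappa>])
  from set_borel_integral_eq_integral(2)[OF this]
  have i1: "integral {s..R\<^sup>2} (\<lambda>t. psi M t * (\<kappa> t * t powr (- (real M / 2)) * t ^ M)) = outer_int \<kappa> M s"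
    unfolding set_lebesgue_integral_def e1 outer_int_def by simp
  have "set_integrable lborel {0..s} (\<lambda>t. phi M t * (\<kappa> t * t powr (- (real M / 2)) * t ^ M))"
    unfolding set_integrable_def e2 by (rule inner_int_integrand(4)[OF \<kappa>])
  from set_borel_integral_eq_integral(2)[OF this]
  have i2: "integral {0..s} (\<lambda>t. phi M t * (\<kappa> t * t powr (- (real M / 2)) * t ^ M)) = inner_int \<kappa> M s"
    unfolding set_lebesgue_integral_def e2 inner_int_def by simp
  show ?thesis unfolding Sol_def Sol_ind_def i1 i2 ..
qed

lemma phi_core: "s \<le> ri\<^sup>2 \<Longrightarrow> phi M s = (re\<^sup>2) ^ M / (ri\<^sup>2) ^ M"
proof (cases "s = ri\<^sup>2")
  case True
  then show ?thesis using hphi_annulus[OF sq_pos(1), of M] sq_pos by (simp add: phi_def region_def)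
qed (simp add: phi_def region_def hphi_def al_def be_def)

lemma phi_annulus: "ri\<^sup>2 < s \<Longrightarrow> s < re\<^sup>2 \<Longrightarrow> phi M s = (re\<^sup>2) ^ M / s ^ M"
  using hphi_annulus[of s M] sq_pos by (simp add: phi_def region_def)

lemma phi_psi_outer: "re\<^sup>2 \<le> s \<Longrightarrow> phi M s = 1" "re\<^sup>2 \<le> s \<Longrightarrow> psi M s = hpsi M 2 s"
  using sq_pos by (simp_all add: phi_def psi_def region_def hphi_def al_def be_def)

lemma Sol_ind_inner: "sub_ind \<kappa> \<Longrightarrow> s < re\<^sup>2 \<Longrightarrow> Sol_ind \<kappa> M s = - (1/4) * (phi M s * outer_int \<kappa> M s)"
  using inner_int_bounds(4)[of \<kappa> s M] ab_sq by (simp add: Sol_ind_def)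

text \<open>For fixed \<open>M\<close> but uniform in the weight: this is the majorant for the
  passage from smooth cutoffs to the sharp weight.\<close>

lemma Sol_ind_bound:
  obtains K where "\<And>\<kappa> s. sub_ind \<kappa> \<Longrightarrow> 0 \<le> s \<Longrightarrow> s < R\<^sup>2 \<Longrightarrow> \<bar>Sol_ind \<kappa> M s\<bar> \<le> K"
proof (rule that[of "((re\<^sup>2) ^ M / (ri\<^sup>2) ^ M + 2) * (R\<^sup>2 * (L M * R ^ M))"])
  fix \<kappa> s assume \<kappa>: "sub_ind \<kappa>" and s: "0 \<le> s" "s < R\<^sup>2"
  let ?F = "(re\<^sup>2) ^ M / (ri\<^sup>2) ^ M" let ?N = "R\<^sup>2 * (L M * R ^ M)"
  have N: "0 \<le> ?N" using L_nonneg R_gt by simp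
  have F: "0 \<le> ?F" by simp
  note A = outer_int_bounds(1,2)[OF \<kappa>, of M s] and B = inner_int_bounds(1,2)[OF \<kappa>, of M s]
  have q: "\<bar>- (1/4) * z\<bar> \<le> y" if "0 \<le> z" "z \<le> y" for z y :: real using that by simp
  show "\<bar>Sol_ind \<kappa> M s\<bar> \<le> (?F + 2) * ?N"
  proof (cases "s < re\<^sup>2")
    case True
    have ph: "0 \<le> phi M s \<and> phi M s \<le> ?F"
    proof (cases "s \<le> ri\<^sup>2")
      case False
      then have "ri\<^sup>2 < s" by simp
      moreover have "(ri\<^sup>2) ^ M \<le> s ^ M" using \<open>ri\<^sup>2 < s\<close> by (intro power_mono) auto
      moreover have "0 < (ri\<^sup>2) ^ M" using sq_pos(1) by (rule zero_less_power)
      ultimately show ?thesis using s unfolding phi_annulus[OF \<open>ri\<^sup>2 < s\<close> True]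
        by (intro conjI divide_left_mono mult_pos_pos) auto
    qed (simp add: phi_core)
    have "0 \<le> phi M s * outer_int \<kappa> M s" using ph A by simp
    moreover have "phi M s * outer_int \<kappa> M s \<le> ?F * ?N" by (rule mult_mono[OF conjunct2[OF ph] A(2) F A(1)])
    moreover have "?F * ?N \<le> (?F + 2) * ?N" using N by (intro mult_right_mono) auto
    ultimately show ?thesis unfolding Sol_ind_inner[OF \<kappa> True] by (intro q) auto
  next
    case False
    then have r: "re\<^sup>2 \<le> s" by simp
    have p: "0 \<le> hpsi M 2 s" "hpsi M 2 s \<le> L M"
      using s r hpsi_outer_nonneg[OF less_le_trans[OF sq_pos(4) r], of M] hpsi_outer_mono[OF sq_pos(4) r, of M] by auto
    have "hpsi M 2 s * inner_int \<kappa> M s \<le> L M * (R\<^sup>2 * R ^ M)" using p B L_nonneg by (intro mult_mono) auto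
    then have "hpsi M 2 s * inner_int \<kappa> M s \<le> ?N" by (simp add: mult_ac)
    moreover have "0 \<le> hpsi M 2 s * inner_int \<kappa> M s" using p B by simp
    moreover have "2 * ?N \<le> (?F + 2) * ?N" using N F by (intro mult_right_mono) auto
    ultimately show ?thesis unfolding Sol_ind_def phi_psi_outer[OF r] using A by (intro q) auto
  qed
qed

text \<open>Core and annulus carry the amplification by \<open>phi\<close> against the small bound
  \<open>D\<close> for the outer integral. In the exterior the powers of \<open>s\<close> cancel,
  and the contribution is bounded independently of \<open>M\<close>.\<close>

lemma Sol_ind_sq_le:
  assumes M: "M \<ge> 1" and s: "0 < s" "s < R\<^sup>2"
  defines "D \<equiv> R\<^sup>2 / 2 / a ^ M / (real M)\<^sup>2"
  shows "(Sol_ind ind M s)\<^sup>2 * s ^ M \<le> ((re\<^sup>2) ^ M / (ri\<^sup>2) ^ M * D)\<^sup>2 * (s ^ M * indicator {0..ri\<^sup>2} s)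
    + ((re\<^sup>2) ^ M * D)\<^sup>2 * (indicator {ri\<^sup>2<..<re\<^sup>2} s * s powr (- real M)) + R ^ 4 / 4"
proof -
  have sM: "s ^ M > 0" using s by simp
  have A: "\<bar>outer_int ind M s / 4\<bar> \<le> D" using outer_int_bounds(1,3)[OF sub_ind_ind, of M s] M by (simp add: D_def)
  have D: "0 \<le> D" using A by linarith
  have sq: "x\<^sup>2 \<le> y\<^sup>2" if "\<bar>x\<bar> \<le> y" for x y :: real using that by (metis abs_ge_zero power2_abs power_mono)
  have X: "0 \<le> ((re\<^sup>2) ^ M / (ri\<^sup>2) ^ M * D)\<^sup>2 * (s ^ M * indicator {0..ri\<^sup>2} s)" using sM by simp
  have Y: "0 \<le> ((re\<^sup>2) ^ M * D)\<^sup>2 * (indicator {ri\<^sup>2<..<re\<^sup>2} s * s powr (- real M))" by simp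
  have R4: "0 \<le> R ^ 4 / 4" by simp
  consider "s \<le> ri\<^sup>2" | "ri\<^sup>2 < s" "s < re\<^sup>2" | "re\<^sup>2 \<le> s" by linarith
  then show ?thesis
  proof cases
    case 1
    have sr: "s < re\<^sup>2" using 1 sq_pos by linarith
    have "\<bar>Sol_ind ind M s\<bar> = (re\<^sup>2) ^ M / (ri\<^sup>2) ^ M * \<bar>outer_int ind M s / 4\<bar>"
      unfolding Sol_ind_inner[OF sub_ind_ind sr] phi_core[OF 1] by (simp add: abs_mult)
    also have "\<dots> \<le> (re\<^sup>2) ^ M / (ri\<^sup>2) ^ M * D" by (rule mult_left_mono[OF A]) simp
    finally have "(Sol_ind ind M s)\<^sup>2 * s ^ M \<le> ((re\<^sup>2) ^ M / (ri\<^sup>2) ^ M * D)\<^sup>2 * s ^ M"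
      using sM by (intro mult_right_mono sq) auto
    moreover have "indicator {0..ri\<^sup>2} s = (1::real)" using 1 s by simp
    ultimately show ?thesis using Y R4 by (simp only: mult_1_right)
  next
    case 2
    have "\<bar>Sol_ind ind M s\<bar> = (re\<^sup>2) ^ M / s ^ M * \<bar>outer_int ind M s / 4\<bar>"
      unfolding Sol_ind_inner[OF sub_ind_ind 2(2)] phi_annulus[OF 2] using sM by (simp add: abs_mult)
    also have "\<dots> \<le> (re\<^sup>2) ^ M / s ^ M * D" using sM by (intro mult_left_mono[OF A]) simp
    finally have "(Sol_ind ind M s)\<^sup>2 * s ^ M \<le> ((re\<^sup>2) ^ M / s ^ M * D)\<^sup>2 * s ^ M"
      using sM by (intro mult_right_mono sq) auto
    also have "\<dots> = ((re\<^sup>2) ^ M * D)\<^sup>2 * s powr (- real M)"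
      using s by (simp add: power2_eq_square powr_minus powr_realpow divide_inverse)
    finally have "(Sol_ind ind M s)\<^sup>2 * s ^ M \<le> ((re\<^sup>2) ^ M * D)\<^sup>2 * s powr (- real M)" .
    moreover have "indicator {ri\<^sup>2<..<re\<^sup>2} s = (1::real)" using 2 by simp
    ultimately show ?thesis using X R4 by (simp only: mult_1_left)
  next
    case 3
    let ?p = "s powr (- (real M / 2))"
    have p2: "hpsi M 2 s * sqrt s ^ M \<le> ?p"
    proof -
      have "?p / real M \<le> ?p / 1" using M by (intro divide_left_mono) auto
      then show ?thesis using outer_integrand_le[OF M s(1)] by simp
    qed
    have hp: "0 \<le> hpsi M 2 s" using s by (intro hpsi_outer_nonneg) auto
    have "hpsi M 2 s * inner_int ind M s \<le> hpsi M 2 s * (R\<^sup>2 * sqrt s ^ M)"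
      using inner_int_bounds(3)[OF sub_ind_ind, of s M] s hp by (intro mult_left_mono) auto
    also have "\<dots> = R\<^sup>2 * (hpsi M 2 s * sqrt s ^ M)" by simp
    also have "\<dots> \<le> R\<^sup>2 * ?p" using p2 by (intro mult_left_mono) auto
    finally have b: "hpsi M 2 s * inner_int ind M s \<le> R\<^sup>2 * ?p" .
    have b0: "0 \<le> hpsi M 2 s * inner_int ind M s" using hp inner_int_bounds(1)[OF sub_ind_ind, of M s] by simp
    have a: "0 \<le> outer_int ind M s" "outer_int ind M s \<le> R\<^sup>2 * ?p" using outer_int_bounds(1,4)[OF sub_ind_ind, of M s] M s by auto
    have "\<bar>Sol_ind ind M s\<bar> \<le> R\<^sup>2 / 2 * ?p" unfolding Sol_ind_def phi_psi_outer[OF 3] using a b b0 by simp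
    then have "(Sol_ind ind M s)\<^sup>2 * s ^ M \<le> (R\<^sup>2 / 2 * ?p)\<^sup>2 * s ^ M" using sM by (intro mult_right_mono sq) auto
    also have "\<dots> = R ^ 4 / 4"
    proof -
      have "?p\<^sup>2 * s ^ M = s powr (- (real M / 2)) * s powr (- (real M / 2)) * s powr (real M)"
        using s by (simp add: power2_eq_square powr_realpow)
      also have "\<dots> = 1" unfolding powr_add[symmetric] using s by simp
      finally have "?p\<^sup>2 * s ^ M = 1" .
      then have "(R\<^sup>2 / 2)\<^sup>2 * (?p\<^sup>2 * s ^ M) = (R\<^sup>2 / 2)\<^sup>2" by simp
      moreover have "(R\<^sup>2 / 2)\<^sup>2 = R ^ 4 / 4" by (simp add: power_divide)
      ultimately show ?thesis by (simp only: power_mult_distrib mult.assoc)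
    qed
    finally show ?thesis using X Y by linarith
  qed
qed

text \<open>Core and annulus contribute the same order: \<open>(re / ri)^(4M)\<close> times
  \<open>ri^(2M) / M\<close> in the one, \<open>re^(4M)\<close> times \<open>ri^(-2M) / M\<close> in
  the other. With \<open>D^2\<close> of order \<open>a^(-2M) / M^4\<close> this is
  \<open>q^(2M) / M^5\<close>; the summand \<open>1\<close> accounts for the exterior.\<close>

lemma Sol_ind_integral_le:
  assumes M: "M \<ge> 1" and int: "integrable lborel (\<lambda>s. indicator {0<..<R\<^sup>2} s * ((Sol_ind ind M s)\<^sup>2 * s ^ M))"
  shows "lborint (\<lambda>s. indicator {0<..<R\<^sup>2} s * ((Sol_ind ind M s)\<^sup>2 * s ^ M))
    \<le> R ^ 6 * (1 + (re\<^sup>2 / (ri * a)) ^ (2 * M) / real M ^ 5)"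
proof -
  define D where "D = R\<^sup>2 / 2 / a ^ M / (real M)\<^sup>2"
  define K0 where "K0 = ((re\<^sup>2) ^ M / (ri\<^sup>2) ^ M * D)\<^sup>2"
  define K1 where "K1 = ((re\<^sup>2) ^ M * D)\<^sup>2"
  have K: "0 \<le> K0" "0 \<le> K1" by (auto simp: K0_def K1_def)
  let ?G = "\<lambda>s. K0 * (s ^ M * indicator {0..ri\<^sup>2} s) + K1 * (indicator {ri\<^sup>2<..<re\<^sup>2} s * s powr (- real M)) + indicator {0<..<R\<^sup>2} s * (R ^ 4 / 4)"
  have i2: "integrable lborel (\<lambda>s. indicator {ri\<^sup>2<..<re\<^sup>2} s * s powr (- real M))" by (rule integrable_powr_interval[OF sq_pos(1)])
  have i3: "integrable lborel (\<lambda>s. indicator {0<..<R\<^sup>2} s * (R ^ 4 / 4))"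
    by (intro integrable_mult_left integrable_real_indicator) auto
  have i3v: "lborint (\<lambda>s. indicator {0<..<R\<^sup>2} s * (R ^ 4 / 4)) = R\<^sup>2 * (R ^ 4 / 4)"
    by (simp add: integral_mult_left_zero)
  have i1': "integrable lborel (\<lambda>s. s ^ M * indicator {0..ri\<^sup>2} s)"
  proof -
    have "set_integrable lborel {0..ri\<^sup>2} (\<lambda>s. s ^ M)"
      by (rule borel_integrable_atLeastAtMost') (intro continuous_intros)
    then show ?thesis by (simp add: set_integrable_def mult.commute)
  qed
  have i1v: "lborint (\<lambda>s. s ^ M * indicator {0..ri\<^sup>2} s) = (ri\<^sup>2) ^ Suc M / Suc M"
    using integral_power[of 0 "ri\<^sup>2" M] by simp
  have le: "indicator {0<..<R\<^sup>2} s * ((Sol_ind ind M s)\<^sup>2 * s ^ M) \<le> ?G s" for s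
  proof (cases "s \<in> {0<..<R\<^sup>2}")
    case True
    then show ?thesis using Sol_ind_sq_le[OF M, of s] unfolding K0_def K1_def D_def by simp
  next
    case False
    have "0 \<le> s ^ M * indicator {0..ri\<^sup>2} s" by (cases "s \<ge> 0") auto
    then show ?thesis using False K by simp
  qed
  have "lborint (\<lambda>s. indicator {0<..<R\<^sup>2} s * ((Sol_ind ind M s)\<^sup>2 * s ^ M)) \<le> lborint ?G"
    by (rule integral_mono[OF int _ le]) (intro Bochner_Integration.integrable_add integrable_mult_right i1' i2 i3)
  also have "\<dots> = K0 * ((ri\<^sup>2) ^ Suc M / Suc M) + K1 * lborint (\<lambda>s. indicator {ri\<^sup>2<..<re\<^sup>2} s * s powr (- real M)) + R\<^sup>2 * (R ^ 4 / 4)"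
    using i1' i2 i3 i1v i3v by (simp only: Bochner_Integration.integral_add Bochner_Integration.integrable_add integrable_mult_right integral_mult_right_zero)
  also have "\<dots> \<le> K0 * ((ri\<^sup>2) ^ M * R\<^sup>2 / real M) + K1 * (R\<^sup>2 * (1 / (ri\<^sup>2) ^ M) / real M) + R\<^sup>2 * (R ^ 4 / 4)"
  proof (intro add_mono mult_left_mono K order_refl)
    have "(ri\<^sup>2) ^ Suc M / Suc M \<le> (ri\<^sup>2) ^ Suc M / real M" using M by (intro divide_left_mono) auto
    also have "\<dots> \<le> (ri\<^sup>2) ^ M * R\<^sup>2 / real M"
      unfolding power_Suc2 using sq_pos by (intro divide_right_mono mult_left_mono) auto
    finally show "(ri\<^sup>2) ^ Suc M / Suc M \<le> (ri\<^sup>2) ^ M * R\<^sup>2 / real M" .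
    have pw: "(ri\<^sup>2) powr (- real M) = 1 / (ri\<^sup>2) ^ M" using sq_pos(1) by (simp add: powr_minus powr_realpow divide_inverse)
    have "lborint (\<lambda>s. indicator {ri\<^sup>2<..<re\<^sup>2} s * s powr (- real M)) \<le> re\<^sup>2 * (1 / (ri\<^sup>2) ^ M) / real M"
      using powr_neg_upper[OF sq_pos(1,2), of "real M"] M unfolding pw by simp
    also have "\<dots> \<le> R\<^sup>2 * (1 / (ri\<^sup>2) ^ M) / real M"
      using sq_pos by (intro divide_right_mono mult_right_mono) auto
    finally show "lborint (\<lambda>s. indicator {ri\<^sup>2<..<re\<^sup>2} s * s powr (- real M)) \<le> R\<^sup>2 * (1 / (ri\<^sup>2) ^ M) / real M" .
  qed simp
  also have "\<dots> = R ^ 6 / 2 * ((re\<^sup>2 / (ri * a)) ^ (2 * M) / real M ^ 5) + R ^ 6 / 4"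
  proof -
    have q: "(re\<^sup>2 / (ri * a)) ^ (2 * M) = ((re\<^sup>2) ^ M)\<^sup>2 / ((ri\<^sup>2) ^ M * (a ^ M)\<^sup>2)"
      by (simp add: power_divide power_mult_distrib power_mult[symmetric] mult.commute)
    define w where "w = (ri\<^sup>2) ^ M"
    define y where "y = (re\<^sup>2) ^ M"
    define z where "z = a ^ M"
    define k where "k = real M"
    have nz: "w > 0" "z > 0" "k > 0" using sq_pos a_pos M by (auto simp: w_def z_def k_def)
    have "(y / w * (R\<^sup>2 / 2 / z / k\<^sup>2))\<^sup>2 * (w * R\<^sup>2 / k) + (y * (R\<^sup>2 / 2 / z / k\<^sup>2))\<^sup>2 * (R\<^sup>2 * (1 / w) / k) + R\<^sup>2 * (R ^ 4 / 4)
      = R ^ 6 / 2 * (y\<^sup>2 / (w * z\<^sup>2) / k ^ 5) + R ^ 6 / 4"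
      using nz by (simp add: field_simps power2_eq_square power_numeral_reduce)
    then show ?thesis unfolding q K0_def K1_def D_def w_def y_def z_def k_def .
  qed
  also have "\<dots> \<le> R ^ 6 * (1 + (re\<^sup>2 / (ri * a)) ^ (2 * M) / real M ^ 5)"
  proof -
    have aux: "x / 2 * y + x / 4 \<le> x * (1 + y)" if "0 \<le> x" "0 \<le> y" for x y :: real
    proof -
      have "0 \<le> x * y" using that by simp
      then show ?thesis using that(1) by (simp add: distrib_left)
    qed
    have "0 \<le> R ^ 6" "0 \<le> (re\<^sup>2 / (ri * a)) ^ (2 * M) / real M ^ 5" using ri a_pos by auto
    then show ?thesis by (rule aux)
  qed
  finally show ?thesis .
qed

section \<open>Mode solutions and mode sources\<close>

definition V :: "int \<Rightarrow> real^2 \<Rightarrow> complex" where "V m = radial_mode (Sol_ind ind (nat \<bar>m\<bar>)) m"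
text \<open>\<open>s^(-M/2) z^m\<close> is the character \<open>e^(i m theta)\<close>, so
  \<open>c m\<close> times \<open>E m\<close> is the \<open>m\<close>-th Fourier term of
  \<open>g\<close>.\<close>

definition E :: "int \<Rightarrow> real^2 \<Rightarrow> complex" where
  "E m = radial_mode (\<lambda>s. ind s * s powr (- (real (nat \<bar>m\<bar>) / 2))) m"

lemma V_L2: "V m \<in> L2 B"
proof -
  obtain K where "\<And>\<kappa> s. sub_ind \<kappa> \<Longrightarrow> 0 \<le> s \<Longrightarrow> s < R\<^sup>2 \<Longrightarrow> \<bar>Sol_ind \<kappa> (nat \<bar>m\<bar>) s\<bar> \<le> K"
    using Sol_ind_bound[of "nat \<bar>m\<bar>"] by blast
  from this[OF sub_ind_ind] show ?thesis unfolding V_def by (rule radial_mode_L2[OF Sol_ind_measurable[OF sub_ind_ind]])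
qed

lemma sub_ind_weight_bound:
  assumes "sub_ind \<kappa>" shows "\<bar>\<kappa> s * s powr (- (real M / 2))\<bar> \<le> (a\<^sup>2) powr (- (real M / 2))"
proof (cases "s \<in> {a\<^sup>2<..<b\<^sup>2}")
  case True
  have "s powr (- (real M / 2)) \<le> (a\<^sup>2) powr (- (real M / 2))" using True ab_sq by (intro powr_mono2') auto
  then have "\<kappa> s * s powr (- (real M / 2)) \<le> 1 * (a\<^sup>2) powr (- (real M / 2))"
    using sub_ind_D(2,3)[OF assms, of s] by (intro mult_mono) auto
  then show ?thesis using sub_ind_D(2)[OF assms, of s] by simp
qed (simp add: sub_ind_D(4)[OF assms])

lemma E_L2: "E m \<in> L2 B"
  unfolding E_def by (rule radial_mode_L2[OF _ sub_ind_weight_bound[OF sub_ind_ind]]) measurable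

lemma V_orthogonal: "m \<noteq> n \<Longrightarrow> L2_inner B (V m) (V n) = 0"
  unfolding V_def using radial_mode_inner[OF R_gt Sol_ind_measurable[OF sub_ind_ind] V_L2[unfolded V_def] Sol_ind_measurable[OF sub_ind_ind] V_L2[unfolded V_def], of m n]
  by simp

lemma E_measurable: "(\<lambda>s. ind s * s powr (- (real M / 2))) \<in> borel_measurable borel" by measurable

lemma E_orthogonal: "m \<noteq> n \<Longrightarrow> L2_inner B (E m) (E n) = 0"
  unfolding E_def using radial_mode_inner[OF R_gt E_measurable E_L2[unfolded E_def] E_measurable E_L2[unfolded E_def], of m n]
  by simp

lemma powr_half_sq: "s > 0 \<Longrightarrow> (s powr (- (real M / 2)))\<^sup>2 * s ^ M = 1" "s > 0 \<Longrightarrow> s powr (- (real M / 2)) * sqrt s ^ M = 1"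
  "s > 0 \<Longrightarrow> s powr (- (real M / 2)) * s ^ M = sqrt s ^ M"
proof -
  assume s: "s > 0"
  have "s powr (- (real M / 2)) * s powr (real M / 2) = 1" unfolding powr_add[symmetric] using s by simp
  then show 2: "s powr (- (real M / 2)) * sqrt s ^ M = 1" using sqrt_power_powr[OF s] by simp
  have s2: "s ^ M = sqrt s ^ M * sqrt s ^ M" using s by (simp add: power_mult_distrib[symmetric])
  show 3: "s powr (- (real M / 2)) * s ^ M = sqrt s ^ M" unfolding s2 mult.assoc[symmetric] 2 by simp
  show "(s powr (- (real M / 2)))\<^sup>2 * s ^ M = 1" unfolding power2_eq_square mult.assoc 3 by (rule 2)
qed

lemma E_norm: "(L2_norm B (E m))\<^sup>2 = pi * (b\<^sup>2 - a\<^sup>2)"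
proof -
  have e: "(\<lambda>s. indicator {0<..<R\<^sup>2} s * ((ind s * s powr (- (real (nat \<bar>m\<bar>) / 2)))\<^sup>2 * s ^ nat \<bar>m\<bar>)) = (\<lambda>s. ind s * 1)"
  proof (rule ext)
    fix s show "indicator {0<..<R\<^sup>2} s * ((ind s * s powr (- (real (nat \<bar>m\<bar>) / 2)))\<^sup>2 * s ^ nat \<bar>m\<bar>) = ind s * 1"
      using ind_pos[of s] powr_half_sq(1)[of s "nat \<bar>m\<bar>"] by (cases "s \<in> {a\<^sup>2<..<b\<^sup>2}") auto
  qed
  show ?thesis unfolding E_def radial_mode_norm[OF R_gt E_measurable E_L2[unfolded E_def]] e ind_integral by simp
qed

lemma E_inner: "L2_inner B g (E m) = of_real (pi * (b\<^sup>2 - a\<^sup>2)) * c m"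
proof -
  have "L2_inner B g (E m) = lebint B (\<lambda>x. g x * E (- m) x)"
    unfolding L2_inner_def E_def cnj_radial_mode by simp
  also have "\<dots> = of_real (pi * lborint (\<lambda>s. ind s * ((ind s * s powr (- (real (nat \<bar>- m\<bar>) / 2))) * sqrt s ^ nat \<bar>- m\<bar>))) * c (- (- m))"
    by (rule source_pairing[OF E_L2 _ E_measurable]) (simp add: E_def)
  also have "(\<lambda>s. ind s * ((ind s * s powr (- (real (nat \<bar>- m\<bar>) / 2))) * sqrt s ^ nat \<bar>- m\<bar>)) = (\<lambda>s. ind s * 1)"
  proof (rule ext)
    fix s show "ind s * ((ind s * s powr (- (real (nat \<bar>- m\<bar>) / 2))) * sqrt s ^ nat \<bar>- m\<bar>) = ind s * 1"
      using ind_pos[of s] powr_half_sq(2)[of s "nat \<bar>m\<bar>"] by (cases "s \<in> {a\<^sup>2<..<b\<^sup>2}") auto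
  qed
  finally show ?thesis unfolding ind_integral by simp
qed

text \<open>All \<open>E m\<close> have the same norm, so this bounds the sum of the
  \<open>|h_m|^2\<close>, which pays for the summand \<open>1\<close> in
  \<open>V_norm\<close>.\<close>

lemma E_bessel: "finite I \<Longrightarrow> (\<Sum>m\<in>I. (cmod (c m))\<^sup>2 * (L2_norm B (E m))\<^sup>2) \<le> (L2_norm B g)\<^sup>2"
proof -
  assume I: "finite I"
  have k: "pi * (b\<^sup>2 - a\<^sup>2) > 0" using ab_sq by simp
  have n0: "L2_norm B (E m) \<noteq> 0" for m
  proof
    assume "L2_norm B (E m) = 0"
    then show False using E_norm[of m] k by simp
  qed
  have "(\<Sum>m\<in>I. (cmod (c m))\<^sup>2 * (L2_norm B (E m))\<^sup>2) = (\<Sum>m\<in>I. (cmod (L2_inner B g (E m)))\<^sup>2 / (L2_norm B (E m))\<^sup>2)"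
  proof (rule sum.cong[OF refl])
    fix m
    have "cmod (L2_inner B g (E m)) = pi * (b\<^sup>2 - a\<^sup>2) * cmod (c m)" unfolding E_inner norm_mult norm_of_real using k by simp
    then show "(cmod (c m))\<^sup>2 * (L2_norm B (E m))\<^sup>2 = (cmod (L2_inner B g (E m)))\<^sup>2 / (L2_norm B (E m))\<^sup>2"
      unfolding E_norm using k by (simp add: power2_eq_square)
  qed
  also have "\<dots> \<le> (L2_norm B g)\<^sup>2" by (rule L2_bessel[OF I E_L2 g E_orthogonal n0])
  finally show ?thesis .
qed

lemma V_norm:
  assumes "m \<noteq> 0"
  shows "(L2_norm B (V m))\<^sup>2 \<le> pi * R ^ 6 * (1 + (re\<^sup>2 / (ri * a)) ^ (2 * nat \<bar>m\<bar>) / \<bar>real_of_int m\<bar> ^ 5)"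
proof -
  define M where "M = nat \<bar>m\<bar>"
  have M: "M \<ge> 1" using assms by (simp add: M_def)
  have am: "\<bar>real_of_int m\<bar> = real M" by (simp add: M_def)
  obtain K where K: "\<And>\<kappa> s. sub_ind \<kappa> \<Longrightarrow> 0 \<le> s \<Longrightarrow> s < R\<^sup>2 \<Longrightarrow> \<bar>Sol_ind \<kappa> M s\<bar> \<le> K"
    using Sol_ind_bound[of M] by blast
  note [measurable] = Sol_ind_measurable[OF sub_ind_ind, of M]
  have "integrable lborel (\<lambda>s. indicator {0<..<R\<^sup>2} s * ((Sol_ind ind M s)\<^sup>2 * s ^ M))"
  proof (rule Bochner_Integration.integrable_bound)
    show "integrable lborel (\<lambda>s. indicator {0<..<R\<^sup>2} s * (K\<^sup>2 * (R\<^sup>2) ^ M))"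
      by (intro integrable_mult_left integrable_real_indicator) auto
    show "AE s in lborel. norm (indicator {0<..<R\<^sup>2} s * ((Sol_ind ind M s)\<^sup>2 * s ^ M)) \<le> norm (indicator {0<..<R\<^sup>2} s * (K\<^sup>2 * (R\<^sup>2) ^ M))"
    proof (rule AE_I2)
      fix s
      show "norm (indicator {0<..<R\<^sup>2} s * ((Sol_ind ind M s)\<^sup>2 * s ^ M)) \<le> norm (indicator {0<..<R\<^sup>2} s * (K\<^sup>2 * (R\<^sup>2) ^ M))"
      proof (cases "s \<in> {0<..<R\<^sup>2}")
        case True
        have "\<bar>Sol_ind ind M s\<bar> \<le> K" using K[OF sub_ind_ind, of s] True by simp
        then have "\<bar>Sol_ind ind M s\<bar>\<^sup>2 \<le> K\<^sup>2" by (rule power_mono) simp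
        then have "(Sol_ind ind M s)\<^sup>2 \<le> K\<^sup>2" by simp
        then have "(Sol_ind ind M s)\<^sup>2 * s ^ M \<le> K\<^sup>2 * (R\<^sup>2) ^ M"
          using True by (intro mult_mono[OF _ power_mono]) auto
        moreover have "0 \<le> (Sol_ind ind M s)\<^sup>2 * s ^ M" using True by simp
        ultimately show ?thesis using True by simp
      qed simp
    qed
  qed measurable
  from Sol_ind_integral_le[OF M this]
  have "pi * lborint (\<lambda>s. indicator {0<..<R\<^sup>2} s * ((Sol_ind ind M s)\<^sup>2 * s ^ M)) \<le> pi * (R ^ 6 * (1 + (re\<^sup>2 / (ri * a)) ^ (2 * M) / real M ^ 5))"
    by (intro mult_left_mono) auto
  then show ?thesis unfolding am M_def[symmetric] unfolding M_def V_def radial_mode_norm[OF R_gt Sol_ind_measurable[OF sub_ind_ind] V_L2[unfolded V_def]]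
    by (simp only: mult.assoc)
qed

text \<open>The linear combination is formed among smooth pairs, where the transmission conditions
  are linear, and only then do the cutoffs tend to the sharp weight.\<close>

lemma mode_sum_in_closure:
  assumes I: "finite I"
  shows "((\<lambda>x. \<Sum>m\<in>I. d m * V m x), (\<lambda>x. \<Sum>m\<in>I. d m * E m x)) \<in> L1_closure ri re R"
proof -
  let ?s = "\<lambda>n m t. cutab n t * t powr (- (real (nat \<bar>m\<bar>) / 2))"
  let ?V = "\<lambda>n m. radial_mode (Sol_ind (cutab n) (nat \<bar>m\<bar>)) m"
  have adm: "admissible (?s n m)" for n m
    by (rule admissible_mult[OF admissible_cutoff smoothR_powr]) (use ab_sq in auto)
  define P where "P n m v \<longleftrightarrow> piecewise_smooth ri re R (fst v) (snd v)
     \<and> (\<forall>x. x \<in> Om \<union> Op \<longrightarrow> x \<noteq> 0 \<longrightarrow> glue ri re (fst v) (snd v) x = ?V n m x)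
     \<and> (\<forall>x. x \<in> Om \<union> Op \<longrightarrow> x \<noteq> 0 \<longrightarrow> glue ri re (\<lambda>x. - lap (fst v) x) (lap (snd v)) x = radial_mode (?s n m) m x)" for n m v
  have "\<exists>v. P n m v" for n m
  proof -
    obtain v1 v2 where v: "piecewise_smooth ri re R v1 v2"
      and e1: "\<And>x. x \<in> Om \<union> Op \<Longrightarrow> x \<noteq> 0 \<Longrightarrow> glue ri re v1 v2 x = radial_mode (Sol (nat \<bar>m\<bar>) (?s n m)) m x"
      and e2: "\<And>x. x \<in> Om \<union> Op \<Longrightarrow> x \<noteq> 0 \<Longrightarrow> glue ri re (\<lambda>x. - lap v1 x) (lap v2) x = radial_mode (?s n m) m x"
      using mode_solution[OF adm[of n m], of m] by blast
    have "glue ri re v1 v2 x = ?V n m x" if x: "x \<in> Om \<union> Op" "x \<noteq> 0" for x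
    proof -
      have "norm x < R" using x Om_subset Op_subset by auto
      then have "(norm x)\<^sup>2 \<le> R\<^sup>2" by (intro power_mono) auto
      then have S: "Sol (nat \<bar>m\<bar>) (?s n m) ((norm x)\<^sup>2) = Sol_ind (cutab n) (nat \<bar>m\<bar>) ((norm x)\<^sup>2)"
        by (rule Sol_eq_Sol_ind[OF sub_ind_cutoff zero_le_power2])
      show ?thesis unfolding e1[OF x] radial_mode_def S ..
    qed
    then have "P n m (v1, v2)" unfolding P_def using v e2 by simp
    then show ?thesis by blast
  qed
  then have "\<forall>p. \<exists>v. P (fst p) (snd p) v" by simp
  from choice[OF this] obtain w where w0: "\<forall>p. P (fst p) (snd p) (w p)" by (rule exE)
  define v1 where "v1 n m = fst (w (n, m))" for n m
  define v2 where "v2 n m = snd (w (n, m))" for n m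
  have w: "piecewise_smooth ri re R (v1 n m) (v2 n m)"
    "\<And>x. x \<in> Om \<union> Op \<Longrightarrow> x \<noteq> 0 \<Longrightarrow> glue ri re (v1 n m) (v2 n m) x = ?V n m x"
    "\<And>x. x \<in> Om \<union> Op \<Longrightarrow> x \<noteq> 0 \<Longrightarrow> glue ri re (\<lambda>x. - lap (v1 n m) x) (lap (v2 n m)) x = radial_mode (?s n m) m x" for n m
    using w0[rule_format, of "(n, m)"] unfolding P_def v1_def v2_def by auto
  have sm: "smooth (v1 n m)" "smooth (v2 n m)" for n m using w(1)[of n m] by (auto simp: piecewise_smooth_def)
  have Bs: "B \<in> sets lebesgue" by simp
  obtain K where K: "\<And>m \<kappa> s. sub_ind \<kappa> \<Longrightarrow> 0 \<le> s \<Longrightarrow> s < R\<^sup>2 \<Longrightarrow> \<bar>Sol_ind \<kappa> (nat \<bar>m\<bar>) s\<bar> \<le> K m"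
  proof -
    have "\<exists>K. \<forall>\<kappa> s. sub_ind \<kappa> \<longrightarrow> 0 \<le> s \<longrightarrow> s < R\<^sup>2 \<longrightarrow> \<bar>Sol_ind \<kappa> (nat \<bar>m\<bar>) s\<bar> \<le> K" for m :: int
      by (rule Sol_ind_bound[of "nat \<bar>m\<bar>"]) blast
    from choice[OF allI[OF this]] obtain K where "\<forall>m::int. \<forall>\<kappa> s. sub_ind \<kappa> \<longrightarrow> 0 \<le> s \<longrightarrow> s < R\<^sup>2 \<longrightarrow> \<bar>Sol_ind \<kappa> (nat \<bar>m\<bar>) s\<bar> \<le> K m"
      by (rule exE)
    then show ?thesis by (intro that) blast
  qed
  have T1: "L2_tendsto B (\<lambda>n x. \<Sum>m\<in>I. d m * ?V n m x) (\<lambda>x. \<Sum>m\<in>I. d m * V m x)"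
  proof (rule L2_tendsto_dominated)
    show "(\<lambda>x. \<Sum>m\<in>I. d m * ?V n m x) \<in> borel_measurable (lebesgue_on B)" for n
      by (intro borel_measurable_sum borel_measurable_times borel_measurable_const radial_mode_measurable(2) Sol_ind_measurable sub_ind_cutoff)
    show "(\<lambda>x. \<Sum>m\<in>I. d m * V m x) \<in> borel_measurable (lebesgue_on B)"
      unfolding V_def by (intro borel_measurable_sum borel_measurable_times borel_measurable_const radial_mode_measurable(2) Sol_ind_measurable sub_ind_ind)
    show "cmod (\<Sum>m\<in>I. d m * ?V n m x) \<le> (\<Sum>m\<in>I. cmod (d m) * (K m * R ^ nat \<bar>m\<bar>))" if "x \<in> B" for n x
    proof (rule sum_norm_le)
      fix m
      show "cmod (d m * ?V n m x) \<le> cmod (d m) * (K m * R ^ nat \<bar>m\<bar>)"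
        unfolding norm_mult by (rule mult_left_mono[OF radial_mode_bound[OF K[OF sub_ind_cutoff] that]]) auto
    qed
    show "(\<lambda>n. \<Sum>m\<in>I. d m * ?V n m x) \<longlonglongrightarrow> (\<Sum>m\<in>I. d m * V m x)" for x
      unfolding V_def radial_mode_def by (intro tendsto_sum tendsto_mult tendsto_const tendsto_of_real Sol_ind_tendsto)
  qed simp
  have T2: "L2_tendsto B (\<lambda>n x. \<Sum>m\<in>I. d m * radial_mode (?s n m) m x) (\<lambda>x. \<Sum>m\<in>I. d m * E m x)"
  proof (rule L2_tendsto_dominated)
    show "(\<lambda>x. \<Sum>m\<in>I. d m * radial_mode (?s n m) m x) \<in> borel_measurable (lebesgue_on B)" for n
      by (intro borel_measurable_sum borel_measurable_times borel_measurable_const L2_measurable[OF radial_mode_admissible_L2[OF adm]])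
    show "(\<lambda>x. \<Sum>m\<in>I. d m * E m x) \<in> borel_measurable (lebesgue_on B)"
      by (intro borel_measurable_sum borel_measurable_times borel_measurable_const L2_measurable[OF E_L2])
    show "cmod (\<Sum>m\<in>I. d m * radial_mode (?s n m) m x) \<le> (\<Sum>m\<in>I. cmod (d m) * ((a\<^sup>2) powr (- (real (nat \<bar>m\<bar>) / 2)) * R ^ nat \<bar>m\<bar>))" if "x \<in> B" for n x
    proof (rule sum_norm_le)
      fix m
      show "cmod (d m * radial_mode (?s n m) m x) \<le> cmod (d m) * ((a\<^sup>2) powr (- (real (nat \<bar>m\<bar>) / 2)) * R ^ nat \<bar>m\<bar>)"
        unfolding norm_mult by (rule mult_left_mono[OF radial_mode_bound[OF sub_ind_weight_bound[OF sub_ind_cutoff] that]]) auto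
    qed
    show "(\<lambda>n. \<Sum>m\<in>I. d m * radial_mode (?s n m) m x) \<longlonglongrightarrow> (\<Sum>m\<in>I. d m * E m x)" for x
      unfolding E_def radial_mode_def by (intro tendsto_sum tendsto_mult tendsto_const tendsto_of_real cutoff_tendsto)
  qed simp
  have gs: "glue ri re (\<lambda>x. \<Sum>m\<in>I. d m * p m x) (\<lambda>x. \<Sum>m\<in>I. d m * q m x) x = (\<Sum>m\<in>I. d m * glue ri re (p m) (q m) x)" for p q :: "int \<Rightarrow> real^2 \<Rightarrow> complex" and x
    by (simp add: glue_def)
  show ?thesis
  proof (rule piecewise_smooth_limit_in_closure[where ?v1.0="\<lambda>n x. \<Sum>m\<in>I. d m * v1 n m x" and ?v2.0="\<lambda>n x. \<Sum>m\<in>I. d m * v2 n m x"])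
    show "piecewise_smooth ri re R (\<lambda>x. \<Sum>m\<in>I. d m * v1 n m x) (\<lambda>x. \<Sum>m\<in>I. d m * v2 n m x)" for n
      by (rule piecewise_smooth_sum) (rule w(1))
    show "L2_tendsto B (\<lambda>n. glue ri re (\<lambda>x. \<Sum>m\<in>I. d m * v1 n m x) (\<lambda>x. \<Sum>m\<in>I. d m * v2 n m x)) (\<lambda>x. \<Sum>m\<in>I. d m * V m x)"
    proof (rule L2_tendsto_AE_cong[OF Bs T1])
      show "AE x in lebesgue_on B. (\<Sum>m\<in>I. d m * ?V n m x) = glue ri re (\<lambda>x. \<Sum>m\<in>I. d m * v1 n m x) (\<lambda>x. \<Sum>m\<in>I. d m * v2 n m x) x" for n
        unfolding gs by (rule AE_nonzero_Om_Op, subst w(2)) (assumption | rule refl)+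
    qed simp
    show "L2_tendsto B (\<lambda>n. glue ri re (\<lambda>x. - lap (\<lambda>x. \<Sum>m\<in>I. d m * v1 n m x) x) (lap (\<lambda>x. \<Sum>m\<in>I. d m * v2 n m x))) (\<lambda>x. \<Sum>m\<in>I. d m * E m x)"
    proof (rule L2_tendsto_AE_cong[OF Bs T2])
      have l1: "(\<lambda>x. - lap (\<lambda>x. \<Sum>m\<in>I. d m * v1 n m x) x) = (\<lambda>x. \<Sum>m\<in>I. d m * (- lap (v1 n m) x))" for n
        by (rule ext) (simp add: lap_sum sm sum_negf)
      have l2: "lap (\<lambda>x. \<Sum>m\<in>I. d m * v2 n m x) = (\<lambda>x. \<Sum>m\<in>I. d m * lap (v2 n m) x)" for n
        by (rule ext) (simp add: lap_sum sm)
      show "AE x in lebesgue_on B. (\<Sum>m\<in>I. d m * radial_mode (?s n m) m x) = glue ri re (\<lambda>x. - lap (\<lambda>x. \<Sum>m\<in>I. d m * v1 n m x) x) (lap (\<lambda>x. \<Sum>m\<in>I. d m * v2 n m x)) x" for n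
        unfolding l1 l2 gs by (rule AE_nonzero_Om_Op, subst w(3)) (assumption | rule refl)+
    qed simp
  qed
qed

end

text \<open>The symmetric partial sums of the squared norms are increasing and bounded, hence
  Cauchy; by Pythagoras so are the partial sums of the series.\<close>

lemma L2_orthogonal_series:
  fixes e :: "int \<Rightarrow> 'a::euclidean_space \<Rightarrow> complex"
  assumes S: "S \<in> lmeasurable" and e: "\<And>m. e m \<in> L2 S" and o: "\<And>m n. m \<noteq> n \<Longrightarrow> L2_inner S (e m) (e n) = 0"
    and b: "\<And>I. finite I \<Longrightarrow> (\<Sum>m\<in>I. (cmod (d m))\<^sup>2 * (L2_norm S (e m))\<^sup>2) \<le> K"
  shows "\<exists>u. L2_tendsto S (\<lambda>k x. \<Sum>m\<in>{- int k..int k}. d m * e m x) u"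
proof (rule L2_complete[OF S])
  define J where "J k = {- int k..int k}" for k
  define t where "t m = (cmod (d m))\<^sup>2 * (L2_norm S (e m))\<^sup>2" for m
  define T where "T k = sum t (J k)" for k
  have t0: "0 \<le> t m" for m by (simp add: t_def)
  have FL: "(\<lambda>x. \<Sum>m\<in>I. d m * e m x) \<in> L2 S" for I by (intro L2_sum L2_cmult e)
  show "(\<lambda>x. \<Sum>m\<in>{- int k..int k}. d m * e m x) \<in> L2 S" for k by (rule FL)
  have "incseq T"
  proof (rule monoI)
    fix k l :: nat assume "k \<le> l"
    then show "T k \<le> T l" unfolding T_def by (intro sum_mono2) (auto simp: J_def t0)
  qed
  moreover have "T k \<le> K" for k using b[of "J k"] by (simp add: T_def t_def J_def)
  ultimately obtain l where "T \<longlonglongrightarrow> l" using incseq_convergent[of T K] by blast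
  then have C: "Cauchy T" by (rule LIMSEQ_imp_Cauchy)
  fix \<epsilon> :: real assume "\<epsilon> > 0"
  then have "\<epsilon>\<^sup>2 > 0" by simp
  from CauchyD[OF C this] obtain N where N: "\<forall>m\<ge>N. \<forall>n\<ge>N. norm (T m - T n) < \<epsilon>\<^sup>2" by blast
  have main: "L2_norm S (\<lambda>x. (\<Sum>m\<in>J k. d m * e m x) - (\<Sum>m\<in>J l. d m * e m x)) < \<epsilon>" if kl: "N \<le> l" "l \<le> k" for k l
  proof -
    have sub: "J l \<subseteq> J k" "finite (J k)" using kl by (auto simp: J_def)
    have "(\<lambda>x. (\<Sum>m\<in>J k. d m * e m x) - (\<Sum>m\<in>J l. d m * e m x)) = (\<lambda>x. \<Sum>m\<in>J k - J l. d m * e m x)"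
      using sub by (simp add: sum_diff)
    moreover have "(L2_norm S (\<lambda>x. \<Sum>m\<in>J k - J l. d m * e m x))\<^sup>2 = sum t (J k - J l)"
      unfolding t_def by (rule L2_pythagoras_sum) (use sub e o in auto)
    moreover have "sum t (J k - J l) = T k - T l" unfolding T_def using sub by (rule sum_diff[rotated])
    moreover have "T k - T l < \<epsilon>\<^sup>2" using N[rule_format, of k l] kl by simp
    ultimately have "(L2_norm S (\<lambda>x. (\<Sum>m\<in>J k. d m * e m x) - (\<Sum>m\<in>J l. d m * e m x)))\<^sup>2 < \<epsilon>\<^sup>2" by simp
    then show ?thesis using \<open>\<epsilon> > 0\<close> by (intro power2_less_imp_less[of _ \<epsilon>]) auto
  qed
  show "\<exists>N. \<forall>k\<ge>N. \<forall>l\<ge>N. L2_norm S (\<lambda>x. (\<Sum>m\<in>{- int k..int k}. d m * e m x) - (\<Sum>m\<in>{- int l..int l}. d m * e m x)) < \<epsilon>"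
  proof (intro exI[of _ N] allI impI)
    fix k l assume kl: "N \<le> k" "N \<le> l"
    show "L2_norm S (\<lambda>x. (\<Sum>m\<in>{- int k..int k}. d m * e m x) - (\<Sum>m\<in>{- int l..int l}. d m * e m x)) < \<epsilon>"
    proof (cases "l \<le> k")
      case True from main[OF kl(2) this] show ?thesis by (simp only: J_def)
    next
      case False
      then have "k \<le> l" by simp
      from main[OF kl(1) this] show ?thesis unfolding L2_norm_minus_commute[of S "\<lambda>x. \<Sum>m\<in>{- int k..int k}. d m * e m x"] by (simp only: J_def)
    qed
  qed
qed

context source
begin

text \<open>Totality of the radial modes takes the place of completeness of the characters: against
  a mode of momentum \<open>j\<close> only the term \<open>m = - j\<close> survives, and it
  reproduces the pairing with \<open>g\<close>.\<close>

lemma E_series_limit: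
  assumes G: "L2_tendsto B (\<lambda>k x. \<Sum>m\<in>{- int k..int k}. c m * E m x) G"
  shows "AE x in lebesgue_on B. G x = g x"
proof -
  have GL: "G \<in> L2 B" using G by (simp add: L2_tendsto_def)
  have "AE x in lebesgue_on B. G x - g x = 0"
  proof (rule radial_modes_total[OF L2_diff[OF GL g]])
    fix \<sigma> :: "real \<Rightarrow> real" and j :: int assume \<sigma>: "admissible \<sigma>"
    define M where "M = nat \<bar>j\<bar>"
    have rL: "radial_mode \<sigma> j \<in> L2 B" "radial_mode \<sigma> (- j) \<in> L2 B" by (rule radial_mode_admissible_L2[OF \<sigma>])+
    have \<sigma>m: "\<sigma> \<in> borel_measurable borel"
      using \<sigma> unfolding admissible_def smoothR_def by (metis CkR.simps(1) borel_measurable_continuous_onI)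
    define X where "X = pi * lborint (\<lambda>s. ind s * (\<sigma> s * sqrt s ^ M))"
    have gp: "lebint B (\<lambda>x. g x * radial_mode \<sigma> j x) = of_real X * c (- j)"
      unfolding X_def M_def by (rule source_pairing[OF rL(1) refl \<sigma>m])
    have Ep: "lebint B (\<lambda>x. E m x * radial_mode \<sigma> j x) = (if m = - j then of_real X else 0)" for m
    proof -
      have "lebint B (\<lambda>x. E m x * radial_mode \<sigma> j x) = L2_inner B (E m) (radial_mode \<sigma> (- j))"
        unfolding L2_inner_def cnj_radial_mode by simp
      also have "\<dots> = (if m = - j then of_real (pi * lborint (\<lambda>s. indicator {0<..<R\<^sup>2} s * ((ind s * s powr (- (real (nat \<bar>m\<bar>) / 2))) * \<sigma> s * s ^ nat \<bar>m\<bar>))) else 0)"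
        unfolding E_def by (rule radial_mode_inner[OF R_gt E_measurable E_L2[unfolded E_def] \<sigma>m rL(2)])
      also have "(\<lambda>s. indicator {0<..<R\<^sup>2} s * ((ind s * s powr (- (real (nat \<bar>m\<bar>) / 2))) * \<sigma> s * s ^ nat \<bar>m\<bar>)) = (\<lambda>s. ind s * (\<sigma> s * sqrt s ^ nat \<bar>m\<bar>))"
      proof (rule ext)
        fix s
        show "indicator {0<..<R\<^sup>2} s * ((ind s * s powr (- (real (nat \<bar>m\<bar>) / 2))) * \<sigma> s * s ^ nat \<bar>m\<bar>) = ind s * (\<sigma> s * sqrt s ^ nat \<bar>m\<bar>)"
        proof (cases "s \<in> {a\<^sup>2<..<b\<^sup>2}")
          case True
          note p = ind_pos[OF True]
          have "s powr (- (real (nat \<bar>m\<bar>) / 2)) * \<sigma> s * s ^ nat \<bar>m\<bar> = \<sigma> s * (s powr (- (real (nat \<bar>m\<bar>) / 2)) * s ^ nat \<bar>m\<bar>)" by (simp only: mult_ac)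
          also have "\<dots> = \<sigma> s * sqrt s ^ nat \<bar>m\<bar>" using p by (simp only: powr_half_sq(3))
          finally show ?thesis using True p by simp
        qed simp
      qed
      finally show ?thesis by (simp add: X_def M_def)
    qed
    have "(\<lambda>k. lebint B (\<lambda>x. (\<Sum>m\<in>{- int k..int k}. c m * E m x) * radial_mode \<sigma> j x)) \<longlonglongrightarrow> lebint B (\<lambda>x. G x * radial_mode \<sigma> j x)"
      by (rule L2_tendsto_pairing[OF G rL(1)])
    \<comment> \<open>Once the partial sum contains the index \<open>- j\<close>, its pairing no
      longer depends on \<open>k\<close>.\<close>
    moreover have "\<forall>\<^sub>F k in sequentially. lebint B (\<lambda>x. (\<Sum>m\<in>{- int k..int k}. c m * E m x) * radial_mode \<sigma> j x) = of_real X * c (- j)"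
      unfolding eventually_sequentially
    proof (intro exI[of _ M] allI impI)
      fix k assume k: "M \<le> k"
      have "lebint B (\<lambda>x. (\<Sum>m\<in>{- int k..int k}. c m * E m x) * radial_mode \<sigma> j x)
        = lebint B (\<lambda>x. \<Sum>m\<in>{- int k..int k}. c m * (E m x * radial_mode \<sigma> j x))"
        by (simp only: sum_distrib_right mult.assoc)
      also have "\<dots> = (\<Sum>m\<in>{- int k..int k}. lebint B (\<lambda>x. c m * (E m x * radial_mode \<sigma> j x)))"
        by (rule Bochner_Integration.integral_sum) (intro integrable_mult_right L2_mult_integrable E_L2 rL)
      also have "\<dots> = (\<Sum>m\<in>{- int k..int k}. if m = - j then c m * of_real X else 0)"
        unfolding integral_mult_right_zero Ep by (rule sum.cong) auto
      also have "\<dots> = of_real X * c (- j)" using k by (auto simp: M_def sum.delta)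
      finally show "lebint B (\<lambda>x. (\<Sum>m\<in>{- int k..int k}. c m * E m x) * radial_mode \<sigma> j x) = of_real X * c (- j)" .
    qed
    ultimately have "(\<lambda>k::nat. of_real X * c (- j)) \<longlonglongrightarrow> lebint B (\<lambda>x. G x * radial_mode \<sigma> j x)"
      by (simp only: tendsto_cong)
    then have "lebint B (\<lambda>x. G x * radial_mode \<sigma> j x) = of_real X * c (- j)"
      by (simp add: LIMSEQ_const_iff)
    then show "lebint B (\<lambda>x. (G x - g x) * radial_mode \<sigma> j x) = 0"
      unfolding left_diff_distrib
      using Bochner_Integration.integral_diff[OF L2_mult_integrable[OF GL rL(1)] L2_mult_integrable[OF g rL(1)]] gp by simp
  qed
  then show ?thesis by eventually_elim simp
qed

lemma summability_sufficient:
  assumes sc: "summability_condition ri re a h"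
  shows "\<exists>u. (u, g) \<in> L1_closure ri re R"
proof -
  have Bm: "B \<in> lmeasurable" by simp
  let ?q = "\<lambda>m::int. (re\<^sup>2 / (ri * a)) ^ (2 * nat \<bar>m\<bar>)"
  let ?t = "\<lambda>m::int. (cmod (c m))\<^sup>2 / \<bar>real_of_int m\<bar> ^ 5 * ?q m"
  have t0: "0 \<le> ?t m" for m using a_pos ri by simp
  have sm: "?t summable_on (UNIV - {0})" using sc by (simp add: summability_condition_def)
  define S where "S = infsum ?t (UNIV - {0})"
  have tS: "sum ?t I \<le> S" if "finite I" "0 \<notin> I" for I
    unfolding S_def by (rule finite_sum_le_infsum[OF sm that(1)]) (use that t0 in auto)
  define k where "k = pi * (b\<^sup>2 - a\<^sup>2)"
  have k: "k > 0" using ab_sq by (simp add: k_def)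
  have cS: "(\<Sum>m\<in>I. (cmod (c m))\<^sup>2) \<le> (L2_norm B g)\<^sup>2 / k" if "finite I" for I
  proof -
    have "(\<Sum>m\<in>I. (cmod (c m))\<^sup>2) * k \<le> (L2_norm B g)\<^sup>2"
      using E_bessel[OF that] unfolding E_norm k_def[symmetric] sum_distrib_right .
    then show ?thesis using k by (simp add: pos_le_divide_eq)
  qed
  \<comment> \<open>The term \<open>m = 0\<close> is split off: the condition does not see it, and
    it adds only one fixed summand to the bound.\<close>
  have vb: "(\<Sum>m\<in>I. (cmod (c m))\<^sup>2 * (L2_norm B (V m))\<^sup>2) \<le> (cmod (c 0))\<^sup>2 * (L2_norm B (V 0))\<^sup>2 + pi * R ^ 6 * ((L2_norm B g)\<^sup>2 / k + S)"
    if I: "finite I" for I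
  proof -
    let ?f = "\<lambda>m. (cmod (c m))\<^sup>2 * (L2_norm B (V m))\<^sup>2"
    have "sum ?f I \<le> sum ?f (insert 0 (I - {0}))" by (rule sum_mono2) (use I in auto)
    also have "\<dots> = ?f 0 + sum ?f (I - {0})" using I by (subst sum.insert) auto
    also have "sum ?f (I - {0}) \<le> (\<Sum>m\<in>I - {0}. pi * R ^ 6 * ((cmod (c m))\<^sup>2 + ?t m))"
    proof (rule sum_mono)
      fix m assume "m \<in> I - {0}"
      then have "?f m \<le> (cmod (c m))\<^sup>2 * (pi * R ^ 6 * (1 + ?q m / \<bar>real_of_int m\<bar> ^ 5))"
        by (intro mult_left_mono V_norm) auto
      also have "\<dots> = pi * R ^ 6 * ((cmod (c m))\<^sup>2 + ?t m)" by (simp add: distrib_left distrib_right mult_ac)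
      finally show "?f m \<le> pi * R ^ 6 * ((cmod (c m))\<^sup>2 + ?t m)" .
    qed
    also have "\<dots> = pi * R ^ 6 * ((\<Sum>m\<in>I - {0}. (cmod (c m))\<^sup>2) + sum ?t (I - {0}))"
      by (simp only: sum_distrib_left[symmetric] sum.distrib)
    also have "\<dots> \<le> pi * R ^ 6 * ((L2_norm B g)\<^sup>2 / k + S)"
      by (intro mult_left_mono add_mono cS tS) (use I R_gt in auto)
    finally show ?thesis by simp
  qed
  obtain u where u: "L2_tendsto B (\<lambda>k x. \<Sum>m\<in>{- int k..int k}. c m * V m x) u"
    using L2_orthogonal_series[OF Bm V_L2 V_orthogonal vb] by blast
  obtain G where G: "L2_tendsto B (\<lambda>k x. \<Sum>m\<in>{- int k..int k}. c m * E m x) G"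
    using L2_orthogonal_series[OF Bm E_L2 E_orthogonal E_bessel] by blast
  \<comment> \<open>The sources converge to some limit \<open>G\<close>, which is replaced by the
    given representative \<open>g\<close>.\<close>
  have G': "L2_tendsto B (\<lambda>k x. \<Sum>m\<in>{- int k..int k}. c m * E m x) g"
    by (rule L2_tendsto_AE_cong[OF _ G _ E_series_limit[OF G]]) auto
  have "(u, g) \<in> L1_closure ri re R"
    by (rule L1_closure_closed[OF mode_sum_in_closure u G']) simp
  then show ?thesis by blast
qed

end

section \<open>Dependence of the condition on the inner radius of the source\<close>


lemma character_L2:
  "(\<lambda>\<theta>. exp (\<i> * of_int m * complex_of_real \<theta>)) \<in> L2 {0<..<2*pi}"
  "L2_norm {0<..<2*pi} (\<lambda>\<theta>. exp (\<i> * of_int m * complex_of_real \<theta>)) = sqrt (2 * pi)"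
proof -
  have n: "cmod (exp (\<i> * of_int m * complex_of_real \<theta>)) = 1" for \<theta> by (simp add: norm_exp_eq_Re)
  show "(\<lambda>\<theta>. exp (\<i> * of_int m * complex_of_real \<theta>)) \<in> L2 {0<..<2*pi}"
    by (rule L2_continuous) (auto intro!: continuous_intros)
  show "L2_norm {0<..<2*pi} (\<lambda>\<theta>. exp (\<i> * of_int m * complex_of_real \<theta>)) = sqrt (2 * pi)"
    unfolding L2_norm_def n by (simp add: measure_restrict_space)
qed

lemma fourier_coeff_diff:
  assumes f: "f \<in> L2 {0<..<2*pi}" and g: "g \<in> L2 {0<..<2*pi}"
  shows "fourier_coeff f m - fourier_coeff g m = fourier_coeff (\<lambda>\<theta>. f \<theta> - g \<theta>) m"
proof -
  have e: "(\<lambda>\<theta>. exp (- \<i> * of_int m * complex_of_real \<theta>)) \<in> L2 {0<..<2*pi}" using character_L2(1)[of "- m"] by simp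
  show ?thesis unfolding fourier_coeff_def left_diff_distrib
    using Bochner_Integration.integral_diff[OF L2_mult_integrable[OF f e] L2_mult_integrable[OF g e]]
    by (simp add: right_diff_distrib diff_divide_distrib)
qed

text \<open>Cauchy-Schwarz gives the factor \<open>sqrt (2 pi) / (2 pi)\<close>, which is below
  \<open>1\<close>. With linearity, the bound makes each coefficient continuous in the
  \<open>L2\<close> seminorm.\<close>

lemma fourier_coeff_bound:
  assumes "f \<in> L2 {0<..<2*pi}"
  shows "cmod (fourier_coeff f m) \<le> L2_norm {0<..<2*pi} f"
proof -
  have e: "(\<lambda>\<theta>. exp (- \<i> * of_int m * complex_of_real \<theta>)) \<in> L2 {0<..<2*pi}"
    "L2_norm {0<..<2*pi} (\<lambda>\<theta>. exp (- \<i> * of_int m * complex_of_real \<theta>)) = sqrt (2 * pi)"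
    using character_L2[of "- m"] by simp_all
  have "cmod (fourier_coeff f m) = 1 / (2 * pi) * cmod (lebint {0<..<2*pi} (\<lambda>\<theta>. f \<theta> * exp (- \<i> * of_int m * of_real \<theta>)))"
    unfolding fourier_coeff_def norm_mult norm_of_real by simp
  also have "\<dots> \<le> 1 / (2 * pi) * (L2_norm {0<..<2*pi} f * sqrt (2 * pi))"
    using L2_cauchy_schwarz[OF assms e(1)] unfolding e(2) by (intro mult_left_mono) auto
  also have "\<dots> \<le> L2_norm {0<..<2*pi} f"
  proof -
    have "1 \<le> 2 * pi" using pi_gt3 by linarith
    then have "2 * pi * 1 \<le> 2 * pi * (2 * pi)" by (intro mult_left_mono) auto
    then have "sqrt (2 * pi) \<le> 2 * pi" by (intro real_le_lsqrt) (auto simp: power2_eq_square)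
    then have "L2_norm {0<..<2*pi} f * sqrt (2 * pi) \<le> L2_norm {0<..<2*pi} f * (2 * pi)"
      by (rule mult_left_mono[OF _ L2_norm_nonneg])
    then show ?thesis by (simp add: field_simps)
  qed
  finally show ?thesis .
qed

lemma fourier_coeff_character:
  "fourier_coeff (\<lambda>\<theta>. d * exp (\<i> * of_int m * complex_of_real \<theta>)) m = d"
proof -
  have "(\<lambda>\<theta>. d * exp (\<i> * of_int m * complex_of_real \<theta>) * exp (- \<i> * of_int m * of_real \<theta>)) = (\<lambda>\<theta>. d)"
    by (rule ext) (simp add: exp_add[symmetric] mult.assoc)
  then show ?thesis unfolding fourier_coeff_def
    by (simp add: measure_restrict_space scaleR_conv_of_real)
qed

lemma summable_on_int_inverse_power5: "(\<lambda>m::int. 1 / \<bar>real_of_int m\<bar> ^ 5) summable_on (UNIV - {0})"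
proof -
  have s: "(\<lambda>n::nat. 1 / real n ^ 5) summable_on {1..}"
  proof (rule summable_on_subset_banach)
    have "summable (\<lambda>n. inverse (real n ^ 5))" by (rule inverse_power_summable) simp
    then have "summable (\<lambda>n. norm (1 / real n ^ 5))" by (simp add: divide_inverse)
    then show "(\<lambda>n::nat. 1 / real n ^ 5) summable_on UNIV" by (rule norm_summable_imp_summable_on)
  qed simp
  have 1: "(\<lambda>m::int. 1 / \<bar>real_of_int m\<bar> ^ 5) summable_on int ` {1..}"
    by (subst summable_on_reindex) (use s in \<open>auto simp: o_def\<close>)
  have 2: "(\<lambda>m::int. 1 / \<bar>real_of_int m\<bar> ^ 5) summable_on (\<lambda>n. - int n) ` {1..}"
    by (subst summable_on_reindex) (use s in \<open>auto simp: o_def inj_on_def\<close>)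
  have "(\<lambda>m::int. 1 / \<bar>real_of_int m\<bar> ^ 5) summable_on (int ` {1..} \<union> (\<lambda>n. - int n) ` {1..})"
    by (rule summable_on_Un_disjoint[OF 1 2]) auto
  moreover have "int ` {1..} \<union> (\<lambda>n. - int n) ` {1..} = UNIV - {0}"
  proof (intro equalityI subsetI)
    fix m :: int assume m: "m \<in> UNIV - {0}"
    show "m \<in> int ` {1..} \<union> (\<lambda>n. - int n) ` {1..}"
    proof (cases "m > 0")
      case True
      then have "m = int (nat m)" "nat m \<in> {1..}" by auto
      then show ?thesis by blast
    next
      case False
      then have "m = - int (nat (- m))" "nat (- m) \<in> {1..}" using m by auto
      then show ?thesis by blast
    qed
  qed auto
  ultimately show ?thesis by simp
qed

text \<open>The ratio is at most \<open>1\<close> and the coefficients are bounded, so the fifth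
  power alone ensures convergence.\<close>

lemma summability_far:
  assumes "0 < ri" "0 < a" "re\<^sup>2 / ri \<le> a" and h: "h \<in> L2 {0<..<2*pi}"
  shows "summability_condition ri re a h"
  unfolding summability_condition_def
proof (rule summable_on_comparison_test[OF summable_on_cmult_right[OF summable_on_int_inverse_power5]])
  fix m :: int
  have q: "0 \<le> re\<^sup>2 / (ri * a)" "re\<^sup>2 / (ri * a) \<le> 1" using assms by (auto simp: field_simps)
  have "(cmod (fourier_coeff h m))\<^sup>2 / \<bar>real_of_int m\<bar> ^ 5 * (re\<^sup>2 / (ri * a)) ^ (2 * nat \<bar>m\<bar>)
     \<le> (L2_norm {0<..<2*pi} h)\<^sup>2 / \<bar>real_of_int m\<bar> ^ 5 * 1"
    using q by (intro mult_mono divide_right_mono power_mono fourier_coeff_bound h power_le_one) auto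
  then show "(cmod (fourier_coeff h m))\<^sup>2 / \<bar>real_of_int m\<bar> ^ 5 * (re\<^sup>2 / (ri * a)) ^ (2 * nat \<bar>m\<bar>)
     \<le> (L2_norm {0<..<2*pi} h)\<^sup>2 * (1 / \<bar>real_of_int m\<bar> ^ 5)" by simp
  show "0 \<le> (cmod (fourier_coeff h m))\<^sup>2 / \<bar>real_of_int m\<bar> ^ 5 * (re\<^sup>2 / (ri * a)) ^ (2 * nat \<bar>m\<bar>)"
    using q by simp
qed

text \<open>With \<open>y = q^(-2/5)\<close> the term is the fifth power of \<open>n y^n\<close>,
  which tends to \<open>0\<close>.\<close>

lemma power5_over_exponential_tendsto:
  assumes "1 < (q::real)"
  shows "(\<lambda>n. real n ^ 5 / q ^ (2 * n)) \<longlonglongrightarrow> 0"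
proof -
  define y where "y = q powr (- (2/5))"
  have y: "0 < y" "y < 1" using assms by (auto simp: y_def powr_less_one)
  have y5: "y ^ 5 = 1 / q\<^sup>2"
  proof -
    have "y ^ 5 = y powr 5" using y by simp
    also have "\<dots> = q powr (- 2)" by (simp add: y_def powr_powr)
    also have "\<dots> = 1 / q\<^sup>2" using assms by (simp add: powr_minus divide_inverse)
    finally show ?thesis .
  qed
  have "(\<lambda>n. real n * y ^ n) \<longlonglongrightarrow> 0" by (rule powser_times_n_limit_0) (use y in simp)
  from tendsto_power[OF this, of 5] have "(\<lambda>n. (real n * y ^ n) ^ 5) \<longlonglongrightarrow> 0" by simp
  moreover have "(real n * y ^ n) ^ 5 = real n ^ 5 / q ^ (2 * n)" for n
  proof -
    have "(real n * y ^ n) ^ 5 = real n ^ 5 * (y ^ 5) ^ n" by (simp add: power_mult_distrib power_mult[symmetric] mult.commute)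
    also have "\<dots> = real n ^ 5 / q ^ (2 * n)" unfolding y5 by (simp add: power_divide power_mult)
    finally show ?thesis .
  qed
  ultimately show ?thesis by simp
qed

lemma summability_generically_fails:
  assumes ri: "0 < ri" and a: "0 < a" and close: "a < re\<^sup>2 / ri"
  shows "holds_generically (L2_topology {0<..<2*pi}) (\<lambda>h. \<not> summability_condition ri re a h)"
proof -
  let ?S = "{0<..<2*pi}"
  define q where "q = re\<^sup>2 / (ri * a)"
  have q: "1 < q" using assms by (simp add: q_def field_simps)
  define t where "t h m = (cmod (fourier_coeff h m))\<^sup>2 / \<bar>real_of_int m\<bar> ^ 5 * q ^ (2 * nat \<bar>m\<bar>)" for h m
  \<comment> \<open>Bounding every single term instead of the sum makes closedness elementary, since
    each term is continuous in \<open>h\<close>.\<close>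
  define N where "N k = {h \<in> L2 ?S. \<forall>m. m \<noteq> 0 \<longrightarrow> t h m \<le> real k}" for k :: nat
  have t_le: "t h m \<le> r \<longleftrightarrow> (cmod (fourier_coeff h m))\<^sup>2 \<le> r * (\<bar>real_of_int m\<bar> ^ 5 / q ^ (2 * nat \<bar>m\<bar>))" if "m \<noteq> 0" for h m r
    using that q by (simp add: t_def field_simps)
  have NL: "N k \<subseteq> L2 ?S" for k by (auto simp: N_def)
  have open': "openin (L2_topology ?S) (L2 ?S - N k)" for k
    unfolding openin_L2_topology
  proof (intro conjI ballI)
    fix f assume f: "f \<in> L2 ?S - N k"
    then obtain m where m: "m \<noteq> 0" "\<not> t f m \<le> real k" and fL: "f \<in> L2 ?S" by (auto simp: N_def)
    define K where "K = real k * (\<bar>real_of_int m\<bar> ^ 5 / q ^ (2 * nat \<bar>m\<bar>))"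
    have K0: "0 \<le> K" using q by (simp add: K_def)
    have big: "sqrt K < cmod (fourier_coeff f m)"
      using m(2) unfolding t_le[OF m(1)] K_def[symmetric] by (intro real_less_lsqrt) auto
    show "\<exists>e>0. \<forall>g\<in>L2 ?S. L2_norm ?S (\<lambda>x. g x - f x) < e \<longrightarrow> g \<in> L2 ?S - N k"
    proof (intro exI[of _ "cmod (fourier_coeff f m) - sqrt K"] conjI ballI impI)
      show "0 < cmod (fourier_coeff f m) - sqrt K" using big by simp
      fix g assume gL: "g \<in> L2 ?S" and d: "L2_norm ?S (\<lambda>x. g x - f x) < cmod (fourier_coeff f m) - sqrt K"
      have "cmod (fourier_coeff g m - fourier_coeff f m) < cmod (fourier_coeff f m) - sqrt K"
        unfolding fourier_coeff_diff[OF gL fL] by (rule le_less_trans[OF fourier_coeff_bound[OF L2_diff[OF gL fL]] d])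
      moreover have "cmod (fourier_coeff f m) \<le> cmod (fourier_coeff g m) + cmod (fourier_coeff g m - fourier_coeff f m)"
        by (metis norm_minus_commute norm_triangle_sub)
      ultimately have "sqrt K < cmod (fourier_coeff g m)" by linarith
      then have "K < (cmod (fourier_coeff g m))\<^sup>2" using K0 by (metis real_sqrt_less_iff real_sqrt_abs abs_norm_cancel)
      then have "\<not> t g m \<le> real k" unfolding t_le[OF m(1)] K_def by simp
      then show "g \<in> L2 ?S - N k" using m gL by (auto simp: N_def)
    qed
  qed auto
  have closed: "(L2_topology ?S) closure_of N k = N k" for k
    by (rule closure_of_closedin) (simp add: closedin_def NL open')
  have empty: "(L2_topology ?S) interior_of N k = {}" for k
  proof (rule ccontr)
    assume "(L2_topology ?S) interior_of N k \<noteq> {}"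
    then obtain f where f: "f \<in> (L2_topology ?S) interior_of N k" by blast
    have "openin (L2_topology ?S) ((L2_topology ?S) interior_of N k)" by (rule openin_interior_of)
    from this[unfolded openin_L2_topology] f obtain e where e: "e > 0"
      and eI: "\<And>g. g \<in> L2 ?S \<Longrightarrow> L2_norm ?S (\<lambda>x. g x - f x) < e \<Longrightarrow> g \<in> (L2_topology ?S) interior_of N k" by blast
    have sub: "(L2_topology ?S) interior_of N k \<subseteq> N k" by (rule interior_of_subset)
    have fN: "f \<in> N k" and fL: "f \<in> L2 ?S" using f sub NL by auto
    \<comment> \<open>Chosen such that \<open>\<delta>\<close> times a character has norm
      \<open>e / 2\<close>.\<close>
    define \<delta> where "\<delta> = e / (2 * sqrt (2 * pi))"
    have \<delta>: "\<delta> > 0" using e by (simp add: \<delta>_def)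
    \<comment> \<open>Adding \<open>\<delta>\<close> times the \<open>n\<close>-th character moves
      the \<open>n\<close>-th coefficient by \<open>\<delta>\<close> and stays in the ball. So
      \<open>\<delta>\<close> is at most twice the largest modulus that \<open>N k\<close> allows
      for this coefficient, a bound that tends to \<open>0\<close> with growing
      \<open>n\<close>.\<close>
    have key: "\<delta>\<^sup>2 \<le> 4 * real k * (real n ^ 5 / q ^ (2 * n))" if n: "n \<ge> 1" for n
    proof -
      define \<kappa> where "\<kappa> \<theta> = of_real \<delta> * exp (\<i> * of_int (int n) * complex_of_real \<theta>)" for \<theta>
      have \<kappa>L: "\<kappa> \<in> L2 ?S" unfolding \<kappa>_def[abs_def] by (rule L2_cmult[OF character_L2(1)])
      have \<kappa>n: "L2_norm ?S \<kappa> = \<delta> * sqrt (2 * pi)"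
        unfolding \<kappa>_def[abs_def] L2_norm_cmult character_L2(2) using \<delta> by simp
      define g where "g \<theta> = f \<theta> + \<kappa> \<theta>" for \<theta>
      have gL: "g \<in> L2 ?S" unfolding g_def[abs_def] by (rule L2_add[OF fL \<kappa>L])
      have gf: "(\<lambda>x. g x - f x) = \<kappa>" by (rule ext) (simp add: g_def)
      have "g \<in> (L2_topology ?S) interior_of N k"
      proof (rule eI[OF gL])
        have "\<delta> * sqrt (2 * pi) = e / 2" by (simp add: \<delta>_def)
        then show "L2_norm ?S (\<lambda>x. g x - f x) < e" unfolding gf \<kappa>n using e by simp
      qed
      then have gN: "g \<in> N k" using sub by blast
      define K where "K = real k * (real n ^ 5 / q ^ (2 * n))"
      have K0: "0 \<le> K" using q by (simp add: K_def)
      have b: "cmod (fourier_coeff p (int n)) \<le> sqrt K" if "p \<in> N k" for p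
      proof -
        have "t p (int n) \<le> real k" using that n by (simp add: N_def)
        then have "(cmod (fourier_coeff p (int n)))\<^sup>2 \<le> K" using n t_le[of "int n" p "real k"] by (simp add: K_def)
        then show ?thesis by (rule real_le_rsqrt)
      qed
      have "fourier_coeff g (int n) - fourier_coeff f (int n) = of_real \<delta>"
        unfolding fourier_coeff_diff[OF gL fL] gf unfolding \<kappa>_def[abs_def] by (rule fourier_coeff_character)
      then have "\<delta> = cmod (fourier_coeff g (int n) - fourier_coeff f (int n))" using \<delta> by simp
      also have "\<dots> \<le> cmod (fourier_coeff g (int n)) + cmod (fourier_coeff f (int n))" by (rule norm_triangle_ineq4)
      also have "\<dots> \<le> 2 * sqrt K" using b[OF gN] b[OF fN] by simp
      finally have "\<delta>\<^sup>2 \<le> (2 * sqrt K)\<^sup>2" using \<delta> by (intro power_mono) auto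
      then show ?thesis using K0 by (simp add: power_mult_distrib K_def)
    qed
    have "(\<lambda>n. 4 * real k * (real n ^ 5 / q ^ (2 * n))) \<longlonglongrightarrow> 4 * real k * 0"
      by (intro tendsto_mult tendsto_const power5_over_exponential_tendsto q)
    then have "\<delta>\<^sup>2 \<le> 4 * real k * 0" by (rule LIMSEQ_le_const) (use key in blast)
    then show False using \<delta> by simp
  qed
  \<comment> \<open>The terms are nonnegative, so each of them is at most the sum of the
    series.\<close>
  have cover: "h \<in> (\<Union>k. N k)" if h: "h \<in> L2 ?S" and s: "summability_condition ri re a h" for h
  proof -
    have s': "t h summable_on (UNIV - {0})" using s by (simp add: summability_condition_def t_def[abs_def] q_def)
    have t0: "0 \<le> t h m" for m using q by (simp add: t_def)
    obtain k :: nat where k: "infsum (t h) (UNIV - {0}) \<le> real k" using real_arch_simple by blast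
    have "t h m \<le> real k" if "m \<noteq> 0" for m
    proof -
      have "sum (t h) {m} \<le> infsum (t h) (UNIV - {0})"
        by (rule finite_sum_le_infsum[OF s']) (use that t0 in auto)
      then show ?thesis using k by simp
    qed
    then have "h \<in> N k" using h by (simp add: N_def)
    then show ?thesis by blast
  qed
  show ?thesis unfolding holds_generically_def meager_in_def topspace_L2_topology
    by (intro conjI exI[of _ N] allI) (use NL closed empty cover in auto)
qed

theorem proposition4:
  fixes ri re R :: real
  assumes "0 < ri" and "ri < re" and "re < R"
  shows "(\<forall>u v f. (u, f) \<in> L1_closure ri re R \<and> (v, f) \<in> L1_closure ri re R \<longrightarrow>
            (AE x in lebesgue_on (ball 0 R). u x = v x)) \<and>
         (\<forall>a b. re \<le> a \<and> a < b \<and> b \<le> R \<longrightarrow>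
            (\<forall>h \<in> L2 {0<..<2*pi}. \<forall>g \<in> L2 (ball 0 R).
               (AE x in lebesgue_on (ball 0 R). \<forall>r>0. \<forall>\<theta>\<in>{0<..<2*pi}. x = polar r \<theta> \<longrightarrow>
                  g x = indicator {a<..<b} r * h \<theta>) \<longrightarrow>
               (g \<in> Range (L1_closure ri re R) \<longleftrightarrow> summability_condition ri re a h)) \<and>
            (a \<ge> re\<^sup>2 / ri \<longrightarrow> (\<forall>h \<in> L2 {0<..<2*pi}. summability_condition ri re a h)) \<and>
            (a < re\<^sup>2 / ri \<longrightarrow>
               holds_generically (L2_topology {0<..<2*pi}) (\<lambda>h. \<not> summability_condition ri re a h)))"
proof -
  interpret annuli ri re R by unfold_locales (use assms in auto)
  show ?thesis
  proof (intro conjI allI impI ballI)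
    fix u v f assume "(u, f) \<in> L1_closure ri re R \<and> (v, f) \<in> L1_closure ri re R"
    then show "AE x in lebesgue_on (ball 0 R). u x = v x" by (intro L1_closure_injective[of u f v]) auto
  next
    fix a b h g
    assume ab: "re \<le> a \<and> a < b \<and> b \<le> R" and "h \<in> L2 {0<..<2*pi}" "g \<in> L2 (ball 0 R)"
      "AE x in lebesgue_on (ball 0 R). \<forall>r>0. \<forall>\<theta>\<in>{0<..<2*pi}. x = polar r \<theta> \<longrightarrow> g x = indicator {a<..<b} r * h \<theta>"
    then interpret source ri re R a b h g by unfold_locales auto
    show "g \<in> Range (L1_closure ri re R) \<longleftrightarrow> summability_condition ri re a h"
      using summability_necessary summability_sufficient by (blast elim: RangeE)
  next
    fix a b h
    assume "re \<le> a \<and> a < b \<and> b \<le> R" "re\<^sup>2 / ri \<le> a" "h \<in> L2 {0<..<2*pi}"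
    then show "summability_condition ri re a h" using assms by (intro summability_far) auto
  next
    fix a b
    assume "re \<le> a \<and> a < b \<and> b \<le> R" "a < re\<^sup>2 / ri"
    then show "holds_generically (L2_topology {0<..<2*pi}) (\<lambda>h. \<not> summability_condition ri re a h)"
      using assms by (intro summability_generically_fails) auto
  qed
qed

end
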